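(* Let $f:\mathbb{R}^n\times[0,\infty)\to\mathbb{R}$ be an arbitrarily often differentiable function such that for every fixed $y\in\mathbb{R}^n$ the function $s\mapsto f(y,s)$ is a Bernstein function. Let $f_0,f_1$ be Bernstein functions with $$\inf_{y\in\mathbb{R}^n}f(y,s)\ge f_0(s),\qquad \sup_{y\in\mathbb{R}^n}f(y,s)\le f_1(s)\qquad\text{for all } s\in[0,\infty),$$ and assume $f_0(s)\ge \tilde c_0 s^{\rho_0}$ for all sufficiently large $s$, with some $\tilde c_0>0$, $\rho_0>0$. Let $\psi:\mathbb{R}^n\to\mathbb{R}$ be a continuous negative definite function in the class $\Lambda$ such that $\psi(\xi)\ge\tilde c_1|\xi|^{\rho_1}$ for $|\xi|$ large, with some $\tilde c_1>0$, $\rho_1>0$. Let $q\in S^{2,\psi}_\rho(\mathbb{R}^n)$ be a real-valued negative definite symbol which is elliptic and satisfies $$0<c_0\le\frac{q(x,\xi)}{\psi(\xi)}\le c_1\quad\text{for all }x,\xi\in\mathbb{R}^n,\qquad c_1\ge1,$$ and define $p(x,\xi):=f(x,q(x,\xi))$. Put $\psi_1(\xi):=c_1f_1(\psi(\xi))$ and $\psi_0(\xi):=c_0'f_0(\psi(\xi))$, where $c_0'>0$ is a constant such that $f_0(q(x,\xi))\ge c_0'f_0(\psi(\xi))$ for all $x,\xi\in\mathbb{R}^n$, and assume $\psi_0,\psi_1\in\Lambda$. Let $0<\sigma<\frac12$, $\tau_1\ge0$, $\tau_0>0$, $\lambda_0\ge0$, and suppose: (i) $(1+\psi_1)^{1/2}\in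 S^{1+\sigma,\psi_0}_\rho(\mathbb{R}^n)$, and $H^{\psi_0,m(1+\sigma)}(\mathbb{R}^n)$ is continuously embedded into $H^{\psi_1,m}(\mathbb{R}^n)$ for all $m\ge0$; (ii) $p\in S^{2+\tau_1,\psi_1}_\rho(\mathbb{R}^n)$, and $\frac{1}{p+\lambda}\in S^{-2+\tau_0,\psi_0}_\rho(\mathbb{R}^n)$ for all $\lambda\ge\lambda_0$; (iii) the form $B(u,v):=(p(x,D)u,v)_0$, $u,v\in S(\mathbb{R}^n)$, satisfies, with some $\kappa\ge0$, $|B(u,v)|\le\kappa\|u\|_{\psi_1,1}\|v\|_{\psi_1,1}$ for all $u,v\in S(\mathbb{R}^n)$, and its continuous extension to $H^{\psi_1,1}(\mathbb{R}^n)$, again denoted by $B$, satisfies, with some $\gamma>0$, $$\operatorname{Re}B(u,u)\ge\gamma\|u\|_{\psi_0,1}^2-\lambda_0\|u\|_0^2\quad\text{for all }u\in H^{\psi_1,1}(\mathbb{R}^n).$$ If $\tau_1+\tau_0+\sigma(2+\tau_1)<1$, then $-p(x,D)$ extends to a generator of a Feller semigroup on $C_\infty(\mathbb{R}^n)$; that is, there is a Feller semigroup on $C_\infty(\mathbb{R}^n)$ whose generator $(A,D(A))$ satisfies $S(\mathbb{R}^n)\subset D(A)$ and $Au=-p(x,D)u$ for all $u\in S(\mathbb{R}^n)$.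
   Context: Notation. $S(\mathbb{R}^n)$ is the Schwartz space, $S'(\mathbb{R}^n)$ the tempered distributions, $\hat u(\xi)=(2\pi)^{-n/2}\int e^{-ix\cdot\xi}u(x)\,dx$, $(\cdot,\cdot)_0$ and $\|\cdot\|_0$ are the scalar product and norm of $L^2(\mathbb{R}^n)$, and $C_\infty(\mathbb{R}^n)$ is the space of continuous functions vanishing at infinity with the sup norm. A Feller semigroup is a strongly continuous, positivity preserving contraction semigroup on $C_\infty(\mathbb{R}^n)$. A Bernstein function is a continuous $g:[0,\infty)\to[0,\infty)$, smooth on $(0,\infty)$, with $(-1)^k g^{(k)}\le0$ for all $k\ge1$. A continuous negative definite function is a continuous function on $\mathbb{R}^n$ having a Lévy–Khinchin representation $$c+id\cdot\xi+\sum_{k,l}a_{kl}\xi_k\xi_l+\int_{\mathbb{R}^n\setminus\{0\}}\Big(1-e^{-iy\cdot\xi}-\frac{iy\cdot\xi}{1+|y|^2}\Big)\nu(dy)$$ with $c\ge0$, $d\in\mathbb{R}^n$, $(a_{kl})$ real, symmetric, positive semidefinite, and $\int(1\wedge|y|^2)\nu(dy)<\infty$. A negative definite symbol is a function $q(x,\xi)$ such that $q(x,\cdot)$ is a continuous negative definite function for each $x$. Let $\rho(k)=\min(k,2)$ for $k\in\mathbb{N}_0$. The class $\Lambda$ consists of all real-valued continuous negative definite functions $\psi$ on $\mathbb{R}^n$ such that for all $\alpha\in\mathbb{N}_0^n$ there is $c_{|\alpha|}$ with $|\partial_\xi^\alpha(1+\psi(\xi))|\le c_{|\alpha|}(1+\psi(\xi))^{(2-\rho(|\alpha|))/2}$.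 For $\psi\in\Lambda$ and $m\in\mathbb{R}$, $S^{m,\psi}_\rho(\mathbb{R}^n)$ is the set of $C^\infty$-functions $q:\mathbb{R}^n\times\mathbb{R}^n\to\mathbb{C}$ such that for all $\alpha,\beta\in\mathbb{N}_0^n$ there is $c_{\alpha,\beta}\ge0$ with $|\partial_x^\beta\partial_\xi^\alpha q(x,\xi)|\le c_{\alpha,\beta}(1+\psi(\xi))^{(m-\rho(|\alpha|))/2}$ for all $x,\xi$. A real-valued symbol $q\in S^{2,\psi}_\rho(\mathbb{R}^n)$ is elliptic if there is $\delta_0>0$ with $q(x,\xi)\ge\delta_0(1+\psi(\xi))$ for all $x,\xi\in\mathbb{R}^n$. For a symbol $p$, the pseudo-differential operator is $p(x,D)u(x)=(2\pi)^{-n/2}\int_{\mathbb{R}^n}e^{ix\cdot\xi}p(x,\xi)\hat u(\xi)\,d\xi$, $u\in S(\mathbb{R}^n)$. For a real-valued continuous negative definite function $\psi$ and $s\in\mathbb{R}$, $\|u\|_{\psi,s}^2=\int_{\mathbb{R}^n}(1+\psi(\xi))^s|\hat u(\xi)|^2\,d\xi$ and $H^{\psi,s}(\mathbb{R}^n)=\{u\in S'(\mathbb{R}^n):\|u\|_{\psi,s}<\infty\}$. *)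

theory Defs
  imports "HOL-Analysis.Analysis"
begin

section \<open>Smoothness and partial derivatives\<close>

text \<open>Derivatives are taken within \<open>S\<close>, so that the notion also makes sense on sets with
  boundary such as \<open>UNIV \<times> {0..}\<close>.  It is meant for open sets and for convex sets with nonempty
  interior, where the derivative within \<open>S\<close> is unique.\<close>

primrec times_differentiable_on ::
  "nat \<Rightarrow> 'a::real_normed_vector set \<Rightarrow> ('a \<Rightarrow> 'b::real_normed_vector) \<Rightarrow> bool" where
  "times_differentiable_on 0 S f \<longleftrightarrow> continuous_on S f"
| "times_differentiable_on (Suc k) S f \<longleftrightarrow>
     (\<forall>x\<in>S. f differentiable (at x within S)) \<and>
     (\<forall>v. times_differentiable_on k S (\<lambda>x. frechet_derivative f (at x within S) v))"

definition smooth_on :: "'a::real_normed_vector set \<Rightarrow> ('a \<Rightarrow> 'b::real_normed_vector) \<Rightarrow> bool" where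
  "smooth_on S f \<longleftrightarrow> (\<forall>k. times_differentiable_on k S f)"

definition partial_deriv ::
  "'n \<Rightarrow> (real ^ 'n \<Rightarrow> 'b::real_normed_vector) \<Rightarrow> real ^ 'n::finite \<Rightarrow> 'b" where
  "partial_deriv i f x = vector_derivative (\<lambda>t. f (x + t *\<^sub>R axis i 1)) (at 0)"

text \<open>Multi-indices are functions \<open>'n \<Rightarrow> nat\<close>.  The iterated derivative is computed along an
  arbitrary enumeration of the coordinates; for smooth functions the order is immaterial.\<close>

definition coord_list :: "'n::finite list" where
  "coord_list = (SOME is. distinct is \<and> set is = UNIV)"

lemma coord_list: "distinct (coord_list :: 'n::finite list)" "set (coord_list :: 'n list) = UNIV"
proof -
  have "\<exists>is :: 'n list. distinct is \<and> set is = UNIV"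
    using finite_distinct_list[of "UNIV :: 'n set"] by auto
  from someI_ex[OF this] show "distinct (coord_list :: 'n list)" "set (coord_list :: 'n list) = UNIV"
    unfolding coord_list_def by auto
qed

definition multi_order :: "('n::finite \<Rightarrow> nat) \<Rightarrow> nat" where
  "multi_order \<alpha> = (\<Sum>i\<in>UNIV. \<alpha> i)"

definition multi_deriv ::
  "('n \<Rightarrow> nat) \<Rightarrow> (real ^ 'n \<Rightarrow> 'b::real_normed_vector) \<Rightarrow> real ^ 'n::finite \<Rightarrow> 'b" where
  "multi_deriv \<alpha> f = foldr (\<lambda>i. partial_deriv i ^^ \<alpha> i) coord_list f"


section \<open>Bernstein functions and negative definite functions\<close>

text \<open>Only the values on \<open>{0..}\<close> matter.\<close>

definition bernstein :: "(real \<Rightarrow> real) \<Rightarrow> bool" where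
  "bernstein g \<longleftrightarrow>
     continuous_on {0..} g \<and> (\<forall>s\<ge>0. 0 \<le> g s) \<and> smooth_on {0<..} g \<and>
     (\<forall>k\<ge>1. \<forall>s>0. (- 1) ^ k * (deriv ^^ k) g s \<le> 0)"

definition levy_measure :: "(real ^ 'n::finite) measure \<Rightarrow> bool" where
  "levy_measure \<nu> \<longleftrightarrow>
     sets \<nu> = sets (restrict_space borel (- {0})) \<and>
     (\<integral>\<^sup>+ y. ennreal (min 1 ((norm y)\<^sup>2)) \<partial>\<nu>) < \<infinity>"

definition negative_definite :: "(real ^ 'n::finite \<Rightarrow> complex) \<Rightarrow> bool" where
  "negative_definite \<psi> \<longleftrightarrow>
     continuous_on UNIV \<psi> \<and>
     (\<exists>(c::real) (d :: real ^ 'n) (a :: real ^ 'n ^ 'n) \<nu>.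
        0 \<le> c \<and> transpose a = a \<and> (\<forall>\<xi>. 0 \<le> \<xi> \<bullet> (a *v \<xi>)) \<and> levy_measure \<nu> \<and>
        (\<forall>\<xi>. \<psi> \<xi> =
           complex_of_real c + \<i> * complex_of_real (d \<bullet> \<xi>)
           + complex_of_real (\<Sum>k\<in>UNIV. \<Sum>l\<in>UNIV. a $ k $ l * \<xi> $ k * \<xi> $ l)
           + (\<integral>y. 1 - exp (- (\<i> * complex_of_real (y \<bullet> \<xi>)))
                   - \<i> * complex_of_real (y \<bullet> \<xi>) / complex_of_real (1 + (norm y)\<^sup>2) \<partial>\<nu>)))"

definition negative_definite_symbol ::
  "(real ^ 'n::finite \<Rightarrow> real ^ 'n \<Rightarrow> complex) \<Rightarrow> bool" where
  "negative_definite_symbol q \<longleftrightarrow> (\<forall>x. negative_definite (q x))"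


section \<open>Symbol classes\<close>

definition rho :: "nat \<Rightarrow> nat" where
  "rho k = min k 2"

definition Lambda_class :: "(real ^ 'n::finite \<Rightarrow> real) set" where
  "Lambda_class =
     {\<psi>. negative_definite (\<lambda>\<xi>. complex_of_real (\<psi> \<xi>)) \<and> smooth_on UNIV \<psi> \<and>
          (\<exists>c :: nat \<Rightarrow> real. \<forall>\<alpha> \<xi>.
             \<bar>multi_deriv \<alpha> (\<lambda>\<eta>. 1 + \<psi> \<eta>) \<xi>\<bar>
               \<le> c (multi_order \<alpha>) * (1 + \<psi> \<xi>) powr ((2 - real (rho (multi_order \<alpha>))) / 2))}"

definition symbol_class ::
  "real \<Rightarrow> (real ^ 'n::finite \<Rightarrow> real) \<Rightarrow> (real ^ 'n \<Rightarrow> real ^ 'n \<Rightarrow> complex) set" where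
  "symbol_class m \<psi> =
     {q. smooth_on UNIV (\<lambda>(x, \<xi>). q x \<xi>) \<and>
         (\<forall>\<alpha> \<beta>. \<exists>c\<ge>0. \<forall>x \<xi>.
            cmod (multi_deriv \<beta> (\<lambda>y. multi_deriv \<alpha> (q y) \<xi>) x)
              \<le> c * (1 + \<psi> \<xi>) powr ((m - real (rho (multi_order \<alpha>))) / 2))}"

definition elliptic ::
  "(real ^ 'n::finite \<Rightarrow> real) \<Rightarrow> (real ^ 'n \<Rightarrow> real ^ 'n \<Rightarrow> real) \<Rightarrow> bool" where
  "elliptic \<psi> q \<longleftrightarrow> (\<exists>\<delta>>0. \<forall>x \<xi>. \<delta> * (1 + \<psi> \<xi>) \<le> q x \<xi>)"


section \<open>Schwartz space, Fourier transform, pseudo-differential operators\<close>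

definition schwartz :: "(real ^ 'n::finite \<Rightarrow> complex) set" where
  "schwartz =
     {u. smooth_on UNIV u \<and>
         (\<forall>k \<alpha>. bdd_above (range (\<lambda>x. (1 + norm x) ^ k * cmod (multi_deriv \<alpha> u x))))}"

definition schwartz_seminorm ::
  "nat \<Rightarrow> ('n \<Rightarrow> nat) \<Rightarrow> (real ^ 'n::finite \<Rightarrow> complex) \<Rightarrow> real" where
  "schwartz_seminorm k \<alpha> u = (SUP x. (1 + norm x) ^ k * cmod (multi_deriv \<alpha> u x))"

definition fourier :: "(real ^ 'n::finite \<Rightarrow> complex) \<Rightarrow> real ^ 'n \<Rightarrow> complex" where
  "fourier u \<xi> =
     complex_of_real ((2 * pi) powr (- real CARD('n) / 2)) *
     (\<integral>x. exp (- (\<i> * complex_of_real (x \<bullet> \<xi>))) * u x \<partial>lborel)"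

definition pseudo_diff ::
  "(real ^ 'n::finite \<Rightarrow> real ^ 'n \<Rightarrow> complex) \<Rightarrow> (real ^ 'n \<Rightarrow> complex) \<Rightarrow> real ^ 'n \<Rightarrow> complex" where
  "pseudo_diff p u x =
     complex_of_real ((2 * pi) powr (- real CARD('n) / 2)) *
     (\<integral>\<xi>. exp (\<i> * complex_of_real (x \<bullet> \<xi>)) * p x \<xi> * fourier u \<xi> \<partial>lborel)"

definition L2_inner :: "(real ^ 'n::finite \<Rightarrow> complex) \<Rightarrow> (real ^ 'n \<Rightarrow> complex) \<Rightarrow> complex" where
  "L2_inner u v = (\<integral>x. u x * cnj (v x) \<partial>lborel)"

definition L2_norm :: "(real ^ 'n::finite \<Rightarrow> complex) \<Rightarrow> real" where
  "L2_norm u = sqrt (\<integral>x. (cmod (u x))\<^sup>2 \<partial>lborel)"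


section \<open>Tempered distributions\<close>

text \<open>A tempered distribution is a functional on the Schwartz space; it is extended by \<open>0\<close> to all
  functions, so that equality of distributions is equality in HOL and the tempered distributions
  are closed under pointwise differences.\<close>

type_synonym 'n functional = "(real ^ 'n \<Rightarrow> complex) \<Rightarrow> complex"

definition tempered :: "'n::finite functional set" where
  "tempered =
     {T. (\<forall>\<phi>. \<phi> \<notin> schwartz \<longrightarrow> T \<phi> = 0) \<and>
         (\<forall>\<phi>\<in>schwartz. \<forall>\<theta>\<in>schwartz. T (\<lambda>x. \<phi> x + \<theta> x) = T \<phi> + T \<theta>) \<and>
         (\<forall>a. \<forall>\<phi>\<in>schwartz. T (\<lambda>x. a * \<phi> x) = a * T \<phi>) \<and>
         (\<exists>C N. \<forall>\<phi>\<in>schwartz.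
            cmod (T \<phi>) \<le> C * (\<Sum>\<alpha> | multi_order \<alpha> \<le> N. schwartz_seminorm N \<alpha> \<phi>))}"

definition represents :: "(real ^ 'n::finite \<Rightarrow> complex) \<Rightarrow> 'n functional \<Rightarrow> bool" where
  "represents g T \<longleftrightarrow>
     g \<in> borel_measurable lborel \<and>
     (\<forall>\<phi>\<in>schwartz. integrable lborel (\<lambda>x. g x * \<phi> x) \<and> T \<phi> = (\<integral>x. g x * \<phi> x \<partial>lborel))"

definition distr_of :: "(real ^ 'n::finite \<Rightarrow> complex) \<Rightarrow> 'n functional" where
  "distr_of u \<phi> = (if \<phi> \<in> schwartz then (\<integral>x. u x * \<phi> x \<partial>lborel) else 0)"

text \<open>The function defining a regular distribution; it is unique up to null sets, and it is only
  used under integrals.\<close>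

definition density_of :: "'n::finite functional \<Rightarrow> real ^ 'n \<Rightarrow> complex" where
  "density_of T = (SOME g. represents g T)"

definition fourier_distr :: "'n::finite functional \<Rightarrow> 'n functional" where
  "fourier_distr T \<phi> = (if \<phi> \<in> schwartz then T (fourier \<phi>) else 0)"


section \<open>The spaces \<open>H\<close>\<close>

definition H_norm_sq :: "(real ^ 'n::finite \<Rightarrow> real) \<Rightarrow> real \<Rightarrow> 'n functional \<Rightarrow> ennreal" where
  "H_norm_sq \<psi> s u =
     (\<integral>\<^sup>+ \<xi>. ennreal ((1 + \<psi> \<xi>) powr s * (cmod (density_of (fourier_distr u) \<xi>))\<^sup>2) \<partial>lborel)"

definition H_norm :: "(real ^ 'n::finite \<Rightarrow> real) \<Rightarrow> real \<Rightarrow> 'n functional \<Rightarrow> real" where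
  "H_norm \<psi> s u = sqrt (enn2real (H_norm_sq \<psi> s u))"

definition H_space :: "(real ^ 'n::finite \<Rightarrow> real) \<Rightarrow> real \<Rightarrow> 'n functional set" where
  "H_space \<psi> s = {u \<in> tempered. (\<exists>g. represents g (fourier_distr u)) \<and> H_norm_sq \<psi> s u < \<infinity>}"

definition H_continuously_embedded ::
  "(real ^ 'n::finite \<Rightarrow> real) \<Rightarrow> real \<Rightarrow> (real ^ 'n \<Rightarrow> real) \<Rightarrow> real \<Rightarrow> bool" where
  "H_continuously_embedded \<psi> s \<psi>' s' \<longleftrightarrow>
     H_space \<psi> s \<subseteq> H_space \<psi>' s' \<and> (\<exists>C. \<forall>u\<in>H_space \<psi> s. H_norm \<psi>' s' u \<le> C * H_norm \<psi> s u)"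

text \<open>\<open>B\<close> is the continuous extension to \<open>H_space \<psi> s \<times> H_space \<psi> s\<close> of the form \<open>b\<close> on the
  Schwartz space; continuity in the (metrizable) norm topology is expressed by sequences.\<close>

definition continuous_form_extension ::
  "(real ^ 'n::finite \<Rightarrow> real) \<Rightarrow> real \<Rightarrow>
   ((real ^ 'n \<Rightarrow> complex) \<Rightarrow> (real ^ 'n \<Rightarrow> complex) \<Rightarrow> complex) \<Rightarrow>
   ('n functional \<Rightarrow> 'n functional \<Rightarrow> complex) \<Rightarrow> bool" where
  "continuous_form_extension \<psi> s b B \<longleftrightarrow>
     (\<forall>u\<in>schwartz. \<forall>v\<in>schwartz. B (distr_of u) (distr_of v) = b u v) \<and>
     (\<forall>U V. \<forall>u\<in>H_space \<psi> s. \<forall>v\<in>H_space \<psi> s.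
        (\<forall>k. U k \<in> H_space \<psi> s \<and> V k \<in> H_space \<psi> s) \<longrightarrow>
        (\<lambda>k. H_norm \<psi> s (\<lambda>\<phi>. U k \<phi> - u \<phi>)) \<longlonglongrightarrow> 0 \<longrightarrow>
        (\<lambda>k. H_norm \<psi> s (\<lambda>\<phi>. V k \<phi> - v \<phi>)) \<longlonglongrightarrow> 0 \<longrightarrow>
        (\<lambda>k::nat. B (U k) (V k)) \<longlonglongrightarrow> B u v)"


section \<open>Feller semigroups\<close>

text \<open>The functions are complex-valued, as they are in \<^const>\<open>schwartz\<close>.\<close>

definition C_infty :: "(real ^ 'n::finite \<Rightarrow> complex) set" where
  "C_infty = {u. continuous_on UNIV u \<and> (u \<longlongrightarrow> 0) at_infinity}"

definition sup_norm :: "(real ^ 'n::finite \<Rightarrow> complex) \<Rightarrow> real" where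
  "sup_norm u = (SUP x. cmod (u x))"

type_synonym 'n operator_family =
  "real \<Rightarrow> (real ^ 'n \<Rightarrow> complex) \<Rightarrow> (real ^ 'n \<Rightarrow> complex)"

definition feller_semigroup :: "'n::finite operator_family \<Rightarrow> bool" where
  "feller_semigroup T \<longleftrightarrow>
     (\<forall>t\<ge>0. \<forall>u\<in>C_infty. T t u \<in> C_infty) \<and>
     (\<forall>t\<ge>0. \<forall>u\<in>C_infty. \<forall>v\<in>C_infty. T t (\<lambda>x. u x + v x) = (\<lambda>x. T t u x + T t v x)) \<and>
     (\<forall>t\<ge>0. \<forall>a. \<forall>u\<in>C_infty. T t (\<lambda>x. a * u x) = (\<lambda>x. a * T t u x)) \<and>
     (\<forall>u\<in>C_infty. T 0 u = u) \<and>
     (\<forall>s\<ge>0. \<forall>t\<ge>0. \<forall>u\<in>C_infty. T (s + t) u = T s (T t u)) \<and>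
     (\<forall>u\<in>C_infty. ((\<lambda>t. sup_norm (\<lambda>x. T t u x - u x)) \<longlongrightarrow> 0) (at_right 0)) \<and>
     (\<forall>t\<ge>0. \<forall>u\<in>C_infty. (\<forall>x. u x \<in> \<real>\<^sub>\<ge>\<^sub>0) \<longrightarrow> (\<forall>x. T t u x \<in> \<real>\<^sub>\<ge>\<^sub>0)) \<and>
     (\<forall>t\<ge>0. \<forall>u\<in>C_infty. sup_norm (T t u) \<le> sup_norm u)"

definition has_generator_value ::
  "'n::finite operator_family \<Rightarrow> (real ^ 'n \<Rightarrow> complex) \<Rightarrow> (real ^ 'n \<Rightarrow> complex) \<Rightarrow> bool" where
  "has_generator_value T u w \<longleftrightarrow>
     u \<in> C_infty \<and> w \<in> C_infty \<and>
     ((\<lambda>t. sup_norm (\<lambda>x. (T t u x - u x) / complex_of_real t - w x)) \<longlongrightarrow> 0) (at_right 0)"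

definition generator_domain :: "'n::finite operator_family \<Rightarrow> (real ^ 'n \<Rightarrow> complex) set" where
  "generator_domain T = {u. \<exists>w. has_generator_value T u w}"

definition generator ::
  "'n::finite operator_family \<Rightarrow> (real ^ 'n \<Rightarrow> complex) \<Rightarrow> (real ^ 'n \<Rightarrow> complex)" where
  "generator T u = (THE w. has_generator_value T u w)"

end

theory Submission
 imports Defs "HOL-Probability.Probability" "HOL-Real_Asymp.Real_Asymp"
begin

text \<open>The Hille--Yosida theorem is applied on \<open>C\<^sub>\<infinity>\<close> to \<open>-p(x,D)\<close> with the Schwartz functions as domain.

 Dissipativity is the positive maximum principle.  By the Levy--Khinchin formula
 \<open>m = exp (- \<epsilon> q(x,\<cdot>))\<close> is a sub-Markovian Fourier multiplier, and the Taylor series of the Bernstein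
 function \<open>f(x,\<cdot>)\<close> at \<open>1/\<epsilon>\<close> expresses \<open>f (x, (1 - m)/\<epsilon>)\<close> as a power series in \<open>m\<close> whose coefficients,
 apart from the constant one, are nonpositive and whose sum at \<open>m = 1\<close> is nonnegative; finally \<open>\<epsilon> \<rightarrow> 0\<close>.

 Density of the range of \<open>\<lambda> + p(x,D)\<close> is an energy argument.  In terms of the weight \<open>L = 1 + \<psi>0\<close> the
 symbol has order \<open>(1 + \<sigma>)(2 + \<tau>1) < 3\<close>, so that conjugating the operator with powers of \<open>L(D)\<close>
 produces errors of order less than \<open>2\<close>, which the Garding inequality absorbs for large \<open>\<lambda>\<close>.
 Hence in weighted norms dominating the supremum norm the residuals
 \<open>(\<lambda> + p(x,D)) u - g\<close> become arbitrarily small.\<close>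

text \<open>\<open>symbol_class\<close> gives a limited gain for derivatives in \<xi>, so no
  asymptotic expansion of products is available and all estimates are made for forms. A form with
  double amplitude a(x, \<xi>, \<eta>) is bounded on L2 once all derivatives of a are bounded up to
  powers of 1 + |\<xi> - \<eta>| (\<open>amp_bounded\<close>). The decisive gain is that of one
  derivative, |grad L| = O(L^(1/2)): it makes L(\<eta>)^s L(\<xi>)^(-s) - 1 an amplitude of order
  L^(-1/2). Hence the number 3: for symbols of size L^(k0/2) with k0 = (1 + \<sigma>)(2 + \<tau>1)
  the conjugation error is controlled by the weight L^((k0 - 1)/2), which must stay below the weight
  L in the Garding inequality. No equation is solved: the residual is minimised up to a small error
  among Schwartz functions, and the argument never leaves that class. Positivity is not recovered
  from the limit afterwards but carried through every approximation by the half norms sup (Re (c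
  u))^+ with |c| = 1, which are contracted along with the norm.\<close>

hide_fact (open) Henstock_Kurzweil_Integration.integral_add Henstock_Kurzweil_Integration.integral_diff
  Henstock_Kurzweil_Integration.integral_nonneg Henstock_Kurzweil_Integration.integral_cong
  Henstock_Kurzweil_Integration.integral_norm_bound_integral Henstock_Kurzweil_Integration.integrable_add
  Henstock_Kurzweil_Integration.integrable_diff

abbreviation "cr \<equiv> complex_of_real"

abbreviation lebesgue_integral_lborel ::
  "('a::euclidean_space => 'b::{banach, second_countable_topology}) => 'b" (binder "\<integral>" 10) where
  "lebesgue_integral_lborel f \<equiv> integral\<^sup>L lborel f"

abbreviation ee :: "'a::real_inner => 'a => complex" where
  "ee x y \<equiv> exp (\<i> * cr (x \<bullet> y))"

abbreviation en :: "'a::real_inner => 'a => complex" where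
  "en x y \<equiv> exp (- (\<i> * cr (x \<bullet> y)))"

abbreviation L1 :: "('a::euclidean_space => 'b::{banach, second_countable_topology}) => bool" where
  "L1 f \<equiv> integrable lborel f"

section \<open>Functions with weighted bounds on all derivatives\<close>

text \<open>The direction comes first, so that \<open>dd v\<close> maps functions to functions and
  can be iterated.\<close>

definition dd :: "'a::real_normed_vector => ('a => 'b::real_normed_vector) => 'a => 'b" where
 "dd v f x = frechet_derivative f (at x) v"

lemma dd_eq: "(f has_derivative f') (at x) \<Longrightarrow> dd v f x = f' v"
 unfolding dd_def using frechet_derivative_at by metis

lemma has_derivative_dd: "f differentiable at x \<Longrightarrow> (f has_derivative (\<lambda>v. dd v f x)) (at x)"
 unfolding dd_def using frechet_derivative_works by (metis (no_types, lifting) ext)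

text \<open>One weight \<open>W\<close> bounds the derivatives of all orders: differentiation is not
  asked to improve the bound. The constants may depend on the directions; in finite dimension the
  basis directions control all others. Above order 0, continuity comes from
  differentiability.\<close>

primrec bdk :: "nat => ('a::real_normed_vector => real) => ('a => 'b::real_normed_vector) => bool" where
 "bdk 0 W f \<longleftrightarrow> continuous_on UNIV f \<and> (\<exists>C. \<forall>x. norm (f x) \<le> C * W x)"
| "bdk (Suc k) W f \<longleftrightarrow> (\<forall>x. f differentiable at x) \<and> (\<exists>C. \<forall>x. norm (f x) \<le> C * W x)
   \<and> (\<forall>v. bdk k W (dd v f))"

definition sm :: "('a::real_normed_vector => real) => ('a => 'b::real_normed_vector) => bool" where
 "sm W f \<longleftrightarrow> (\<forall>k. bdk k W f)"

lemma differentiable_imp_continuous: "(\<And>x. f differentiable at x) \<Longrightarrow> continuous_on UNIV f"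
 by (simp add: continuous_at_imp_continuous_on differentiable_imp_continuous_within)

lemma bdk_continuous: "bdk k W f \<Longrightarrow> continuous_on UNIV f"
 by (cases k) (auto intro: differentiable_imp_continuous)

lemma bdk_Suc_D: "bdk (Suc k) W f \<Longrightarrow> bdk k W f"
proof (induction k arbitrary: f)
 case 0 then show ?case by (auto intro: differentiable_imp_continuous)
next
 case (Suc k)
 have "\<forall>v. bdk k W (dd v f)" using Suc.IH Suc.prems by (meson bdk.simps(2))
 then show ?case using Suc.prems by simp
qed

lemma smD:
 assumes "sm W f"
 shows "f differentiable at x" "sm W (dd v f)" "continuous_on UNIV f"
  "\<exists>C. \<forall>x. norm (f x) \<le> C * W x"
proof -
 have *: "bdk (Suc k) W f" for k using assms unfolding sm_def by blast
 show "f differentiable at x" using *[of 0] by simp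
 show "sm W (dd v f)" using * unfolding sm_def by simp
 show "continuous_on UNIV f" using *[of 0] bdk_continuous by blast
 show "\<exists>C. \<forall>x. norm (f x) \<le> C * W x" using *[of 0] by simp
qed

lemma sm_boundE:
 assumes "sm W f" "\<And>x. 0 \<le> W x"
 obtains C where "0 < C" "\<And>x. norm (f x) \<le> C * W x"
proof -
 obtain C where C: "\<forall>x. norm (f x) \<le> C * W x" using smD(4)[OF assms(1)] by blast
 have "norm (f x) \<le> (\<bar>C\<bar> + 1) * W x" for x
  using C assms(2)[of x] by (smt (verit) mult_right_mono)
 then show ?thesis using that[of "\<bar>C\<bar> + 1"] by simp
qed

lemma smI:
 assumes "\<And>x. f differentiable at x" "\<And>x. norm (f x) \<le> C * W x" "\<And>v. sm W (dd v f)"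
 shows "sm W f"
 unfolding sm_def
proof
 fix k
 have "\<exists>C. \<forall>x. norm (f x) \<le> C * W x" using assms(2) by blast
 then have "bdk (Suc k) W f" using assms(1,3) unfolding sm_def by simp
 then show "bdk k W f" by (rule bdk_Suc_D)
qed

text \<open>Coinduction in place of formulas for iterated derivatives: \<open>X\<close> is typically
  a family, such as the constant multiples of one exponential, in which differentiation only changes
  the parameters.\<close>

lemma sm_coinduct:
 assumes "f \<in> X"
  and diff: "\<And>f x. f \<in> X \<Longrightarrow> f differentiable at x"
  and bd: "\<And>f. f \<in> X \<Longrightarrow> \<exists>C. \<forall>x. norm (f x) \<le> C * W x"
  and step: "\<And>f v. f \<in> X \<Longrightarrow> dd v f \<in> X"
 shows "sm W f"
 unfolding sm_def
proof
 fix k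
 show "bdk k W f" using assms(1)
 proof (induction k arbitrary: f)
  case 0 then show ?case using bd diff by (auto intro: differentiable_imp_continuous)
 next
  case (Suc k) then show ?case using bd diff step by auto
 qed
qed

lemma bdk_mono:
 fixes f :: "'a::real_normed_vector => 'b::real_normed_vector"
 assumes "\<And>x. 0 \<le> W x" "\<And>x. W x \<le> c * W' x"
 shows "bdk k W f \<Longrightarrow> bdk k W' f"
proof (induction k arbitrary: f)
 have *: "\<exists>C. \<forall>x. norm (f x) \<le> C * W' x" if ex: "\<exists>C. \<forall>x. norm (f x) \<le> C * W x" for f :: "'a => 'b"
 proof -
  obtain C where C: "\<And>x. norm (f x) \<le> C * W x" using ex by blast
  have "norm (f x) \<le> (\<bar>C\<bar> * c) * W' x" for x
  proof -
   have "norm (f x) \<le> \<bar>C\<bar> * W x" using C[of x] assms(1)[of x] by (smt (verit) mult_right_mono)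
   also have "\<dots> \<le> \<bar>C\<bar> * (c * W' x)" by (intro mult_left_mono assms) simp
   finally show ?thesis by (simp add: mult.assoc)
  qed
  then show ?thesis by blast
 qed
 {
  case 0 then show ?case using * by simp
 next
  case (Suc k) then show ?case using * by simp
 }
qed

lemma sm_mono: "sm W f \<Longrightarrow> (\<And>x. 0 \<le> W x) \<Longrightarrow> (\<And>x. W x \<le> c * W' x) \<Longrightarrow> sm W' f"
 unfolding sm_def using bdk_mono by blast

lemma dd_add: "f differentiable at x \<Longrightarrow> g differentiable at x \<Longrightarrow>
  dd v (\<lambda>x. f x + g x) x = dd v f x + dd v g x"
 by (rule dd_eq) (intro has_derivative_add has_derivative_dd)

lemma bdk_add:
 fixes f g :: "'a::real_normed_vector => 'b::real_normed_vector"
 shows "bdk k W f \<Longrightarrow> bdk k W g \<Longrightarrow> bdk k W (\<lambda>x. f x + g x)"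
proof (induction k arbitrary: f g)
 have *: "\<exists>C. \<forall>x. norm (f x + g x) \<le> C * W x"
  if fg: "\<exists>C. \<forall>x. norm (f x) \<le> C * W x" "\<exists>C. \<forall>x. norm (g x) \<le> C * W x"
  for f g :: "'a => 'b"
 proof -
  obtain C D where "\<And>x. norm (f x) \<le> C * W x" "\<And>x. norm (g x) \<le> D * W x" using fg by blast
  then have "norm (f x + g x) \<le> (C + D) * W x" for x
   by (metis norm_triangle_mono distrib_right)
  then show ?thesis by blast
 qed
 {
  case 0 then show ?case using * by (simp add: continuous_on_add)
 next
  case (Suc k)
  have "dd v (\<lambda>x. f x + g x) = (\<lambda>x. dd v f x + dd v g x)" for v
   using Suc.prems by (auto simp: dd_add)
  then show ?case using Suc * by simp
 }
qed

lemma sm_add: "sm W f \<Longrightarrow> sm W g \<Longrightarrow> sm W (\<lambda>x. f x + g x)"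
 unfolding sm_def using bdk_add by blast

lemma bdk_bounded_linear:
 fixes f :: "'a::real_normed_vector => 'b::real_normed_vector" and L :: "'b => 'c::real_normed_vector"
 assumes L: "bounded_linear L"
 shows "bdk k W f \<Longrightarrow> bdk k W (\<lambda>x. L (f x))"
proof (induction k arbitrary: f)
 have *: "\<exists>C. \<forall>x. norm (L (f x)) \<le> C * W x" if ex: "\<exists>C. \<forall>x. norm (f x) \<le> C * W x" for f :: "'a => 'b"
 proof -
  obtain C where C: "\<And>x. norm (f x) \<le> C * W x" using ex by blast
  obtain K where K: "0 < K" "\<And>x. norm (L x) \<le> norm x * K"
   using bounded_linear.pos_bounded[OF L] by blast
  have "norm (L (f x)) \<le> (K * C) * W x" for x
  proof -
   have "norm (L (f x)) \<le> norm (f x) * K" by (rule K)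
   also have "\<dots> \<le> (C * W x) * K" using K(1) by (intro mult_right_mono C) simp
   finally show ?thesis by (simp add: mult_ac)
  qed
  then show ?thesis by blast
 qed
 {
  case 0 then show ?case using * L
   by (auto intro!: continuous_on_compose2[OF linear_continuous_on[OF L, of UNIV]])
 next
  case (Suc k)
  have "(\<lambda>x. L (f x)) differentiable at x" for x
   using Suc.prems L by (simp add: bounded_linear_imp_differentiable differentiable_compose)
  moreover have "dd v (\<lambda>x. L (f x)) = (\<lambda>x. L (dd v f x))" for v
  proof
   fix x
   have "f differentiable at x" using Suc.prems by simp
   then show "dd v (\<lambda>x. L (f x)) x = L (dd v f x)"
    by (intro dd_eq bounded_linear.has_derivative[OF L] has_derivative_dd)
  qed
  ultimately show ?case using Suc * by simp
 }
qed

lemma sm_bounded_linear: "bounded_linear L \<Longrightarrow> sm W f \<Longrightarrow> sm W (\<lambda>x. L (f x))"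
 unfolding sm_def using bdk_bounded_linear by blast

lemma sm_cmult: "sm W f \<Longrightarrow> sm W (\<lambda>x. c * f x)" for f :: "_ => 'b::real_normed_algebra"
 by (rule sm_bounded_linear[OF bounded_linear_mult_right])

lemma sm_scaleR: "sm W f \<Longrightarrow> sm W (\<lambda>x. c *\<^sub>R f x)"
 by (rule sm_bounded_linear[OF bounded_linear_scaleR_right])

lemma sm_minus: "sm W f \<Longrightarrow> sm W (\<lambda>x. - f x)"
 using sm_scaleR[of W f "-1"] by simp

lemma sm_diff: "sm W f \<Longrightarrow> sm W g \<Longrightarrow> sm W (\<lambda>x. f x - g x)"
 using sm_add[OF _ sm_minus] by force

lemma sm_of_real: "sm W f \<Longrightarrow> sm W (\<lambda>x. cr (f x))"
 by (rule sm_bounded_linear[OF bounded_linear_of_real])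

lemma sm_cnj: "sm W f \<Longrightarrow> sm W (\<lambda>x. cnj (f x))"
 by (rule sm_bounded_linear[OF bounded_linear_cnj])

lemma dd_const [simp]: "dd v (\<lambda>x. c) = (\<lambda>x. 0)"
 by (simp add: dd_def fun_eq_iff)

lemma sm_const:
 fixes a :: "'b::real_normed_vector" and W :: "'a::real_normed_vector => real"
 shows "(\<And>x. 1 \<le> c * W x) \<Longrightarrow> sm W (\<lambda>x. a)"
proof (rule sm_coinduct[of _ "{f. \<exists>a. f = (\<lambda>x. a)}"])
 assume *: "\<And>x. 1 \<le> c * W x"
 fix f :: "'a => 'b" assume "f \<in> {f. \<exists>a. f = (\<lambda>x. a)}"
 then obtain a where f: "f = (\<lambda>x. a)" by blast
 have "norm (f x) \<le> (norm a * c) * W x" for x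
  using mult_left_mono[OF *[of x], of "norm a"] by (simp add: f mult.assoc)
 then show "\<exists>C. \<forall>x. norm (f x) \<le> C * W x" by blast
qed auto

lemma sm_sum:
 fixes f :: "'i => 'a::real_normed_vector => 'c::real_normed_vector"
 assumes "finite A" "\<And>i. i \<in> A \<Longrightarrow> sm W (f i)" "\<And>x. 0 \<le> W x"
 shows "sm W (\<lambda>x. \<Sum>i\<in>A. f i x)"
 using assms
proof (induction A rule: finite_induct)
 case empty
 have "sm W (\<lambda>x. 0 :: 'c)"
  by (rule sm_coinduct[of _ "{\<lambda>x. 0}"]) (auto intro!: exI[of _ 0] assms)
 then show ?case by simp
next
 case (insert i A) then show ?case by (simp add: sm_add)
qed

lemma dd_mult: "f differentiable at x \<Longrightarrow> g differentiable at x \<Longrightarrow>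
  dd v (\<lambda>x. f x * g x) x = f x * dd v g x + dd v f x * g x"
 for f :: "_ => 'b::real_normed_algebra"
 by (rule dd_eq) (intro has_derivative_mult has_derivative_dd)

lemma bdk_mult:
 fixes f g :: "'a::real_normed_vector => 'b::real_normed_algebra"
 shows "bdk k W1 f \<Longrightarrow> bdk k W2 g \<Longrightarrow> bdk k (\<lambda>x. W1 x * W2 x) (\<lambda>x. f x * g x)"
proof (induction k arbitrary: f g)
 have *: "\<exists>C. \<forall>x. norm (f x * g x) \<le> C * (W1 x * W2 x)"
  if fg: "\<exists>C. \<forall>x. norm (f x) \<le> C * W1 x" "\<exists>C. \<forall>x. norm (g x) \<le> C * W2 x"
  for f g :: "'a => 'b"
 proof -
  obtain C D where CD: "\<And>x. norm (f x) \<le> C * W1 x" "\<And>x. norm (g x) \<le> D * W2 x" using fg by blast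
  have "norm (f x * g x) \<le> (C * D) * (W1 x * W2 x)" for x
  proof -
   have "norm (f x * g x) \<le> norm (f x) * norm (g x)" by (rule norm_mult_ineq)
   also have "\<dots> \<le> (C * W1 x) * (D * W2 x)"
    by (intro mult_mono CD norm_ge_zero order_trans[OF norm_ge_zero CD(1)])
   finally show ?thesis by (simp add: mult_ac)
  qed
  then show ?thesis by blast
 qed
 {
  case 0 then show ?case using * by (simp add: continuous_on_mult)
 next
  case (Suc k)
  have d: "\<And>x. f differentiable at x" "\<And>x. g differentiable at x" using Suc.prems by auto
  have "dd v (\<lambda>x. f x * g x) = (\<lambda>x. f x * dd v g x + dd v f x * g x)" for v
   using d by (auto simp: dd_mult)
  moreover have "bdk k (\<lambda>x. W1 x * W2 x) (\<lambda>x. f x * dd v g x + dd v f x * g x)" for v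
   using Suc.prems bdk_Suc_D[OF Suc.prems(1)] bdk_Suc_D[OF Suc.prems(2)]
   by (intro bdk_add Suc.IH) auto
  ultimately show ?case using Suc.prems * d by simp
 }
qed

lemma sm_mult:
 fixes f g :: "_ => 'b::real_normed_algebra"
 shows "sm W1 f \<Longrightarrow> sm W2 g \<Longrightarrow> sm (\<lambda>x. W1 x * W2 x) (\<lambda>x. f x * g x)"
 unfolding sm_def using bdk_mult by blast

lemma bdk_comp:
 assumes L: "bounded_linear L"
 shows "bdk k W f \<Longrightarrow> bdk k (\<lambda>x. W (L x + c)) (\<lambda>x. f (L x + c))"
proof (induction k arbitrary: f)
 case 0
 have "continuous_on UNIV (\<lambda>x. L x + c)"
  by (intro continuous_intros linear_continuous_on L)
 then show ?case using 0 by (auto intro: continuous_on_compose2)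
next
 case (Suc k)
 have Lc: "((\<lambda>x. L x + c) has_derivative L) (at x)" for x
  by (rule derivative_eq_intros bounded_linear_imp_has_derivative[OF L] refl | simp)+
 have *: "((\<lambda>x. f (L x + c)) has_derivative (\<lambda>v. dd (L v) f (L x + c))) (at x)" for x
 proof -
  have "(f has_derivative (\<lambda>v. dd v f (L x + c))) (at (L x + c))"
   using Suc.prems by (simp add: has_derivative_dd)
  from has_derivative_compose[OF Lc this] show ?thesis .
 qed
 then have "dd v (\<lambda>x. f (L x + c)) = (\<lambda>x. dd (L v) f (L x + c))" for v
  using dd_eq[OF *] by blast
 moreover have "(\<lambda>x. f (L x + c)) differentiable at x" for x
  using * differentiable_def by blast
 ultimately show ?case using Suc by auto
qed

lemma sm_comp_affine: "bounded_linear L \<Longrightarrow> sm W f \<Longrightarrow> sm (\<lambda>x. W (L x + c)) (\<lambda>x. f (L x + c))"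
 unfolding sm_def using bdk_comp by blast

lemma sm_comp: "bounded_linear L \<Longrightarrow> sm W f \<Longrightarrow> sm (\<lambda>x. W (L x)) (\<lambda>x. f (L x))"
 using sm_comp_affine[of L W f 0] by simp

lemma dd_comp: "bounded_linear L \<Longrightarrow> f differentiable at (L x) \<Longrightarrow> dd v (\<lambda>x. f (L x)) x = dd (L v) f (L x)"
 by (rule dd_eq) (rule has_derivative_compose[OF bounded_linear_imp_has_derivative has_derivative_dd])

lemma dd_linear: "bounded_linear L \<Longrightarrow> dd v L = (\<lambda>x. L v)"
 by (rule ext, rule dd_eq) (rule bounded_linear_imp_has_derivative)

lemma sm_linear:
 assumes L: "bounded_linear L"
 shows "sm (\<lambda>x. 1 + norm x) L"
proof -
 obtain K where K: "0 < K" "\<And>x. norm (L x) \<le> norm x * K"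
  using bounded_linear.pos_bounded[OF L] by blast
 have 1: "norm (L x) \<le> K * (1 + norm x)" for x
  using K(1) K(2)[of x] by (simp add: distrib_left mult.commute)
 have 2: "L differentiable at x" for x using L by (simp add: bounded_linear_imp_differentiable)
 have 3: "sm (\<lambda>x. 1 + norm x) (dd v L)" for v
  unfolding dd_linear[OF L] by (rule sm_const[of 1]) simp
 show ?thesis by (rule smI[OF 2 1 3])
qed

lemma sm_imp_smooth_on: "sm W f \<Longrightarrow> smooth_on UNIV f"
proof -
 have "bdk k W f \<Longrightarrow> times_differentiable_on k UNIV f" for k
  by (induction k arbitrary: f) (auto simp: dd_def[abs_def])
 then show "sm W f \<Longrightarrow> smooth_on UNIV f" unfolding sm_def smooth_on_def by blast
qed

lemma smooth_on_UNIV_D: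
 assumes "smooth_on UNIV f"
 shows "f differentiable at x" "smooth_on UNIV (dd v f)" "continuous_on UNIV f"
proof -
 have *: "times_differentiable_on (Suc k) UNIV f" for k using assms unfolding smooth_on_def by blast
 show "f differentiable at x" using *[of 0] by simp
 show "smooth_on UNIV (dd v f)" using * unfolding smooth_on_def by (simp add: dd_def[abs_def])
 show "continuous_on UNIV f" using assms times_differentiable_on.simps(1) unfolding smooth_on_def by blast
qed

section \<open>Mixed partial derivatives\<close>

lemma has_vector_derivative_line:
 assumes "f differentiable at (x + s *\<^sub>R v)"
 shows "((\<lambda>t. f (x + t *\<^sub>R v)) has_vector_derivative dd v f (x + s *\<^sub>R v)) (at s)"
proof -
 have 1: "((\<lambda>t. x + t *\<^sub>R v) has_derivative (\<lambda>t. t *\<^sub>R v)) (at s)"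
  by (auto intro!: derivative_eq_intros)
 have "((\<lambda>t. f (x + t *\<^sub>R v)) has_derivative (\<lambda>t. dd (t *\<^sub>R v) f (x + s *\<^sub>R v))) (at s)"
  using has_derivative_compose[OF 1 has_derivative_dd[OF assms]] .
 moreover have "linear (\<lambda>v. dd v f (x + s *\<^sub>R v'))" if "f differentiable at (x + s *\<^sub>R v')" for v'
  using that unfolding dd_def by (simp add: linear_frechet_derivative)
 then have "dd (t *\<^sub>R v) f (x + s *\<^sub>R v) = t *\<^sub>R dd v f (x + s *\<^sub>R v)" for t
  using linear_scale[of "\<lambda>w. dd w f (x + s *\<^sub>R v)"] assms by blast
 ultimately show ?thesis by (simp add: has_vector_derivative_def)
qed

lemma has_real_derivative_line:
 fixes f :: "'a::real_normed_vector => real"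
 assumes "f differentiable at (x + s *\<^sub>R v)"
 shows "((\<lambda>t. f (x + t *\<^sub>R v)) has_real_derivative dd v f (x + s *\<^sub>R v)) (at s)"
 using has_vector_derivative_line[OF assms] by (simp add: has_real_derivative_iff_has_vector_derivative)

text \<open>The mean value theorem is applied twice: along \<open>v\<close> to the difference of two
  parallel sections of \<open>g\<close>, then along \<open>w\<close> to \<open>dd v g\<close> at the
  position found.\<close>

lemma second_difference:
 fixes g :: "'a::real_normed_vector => real"
 assumes g: "\<And>x. g differentiable at x" "\<And>x. dd v g differentiable at x" and t: "0 < t"
 obtains s r where "0 < s" "s < t" "0 < r" "r < t"
  "g (x + t *\<^sub>R v + t *\<^sub>R w) - g (x + t *\<^sub>R v) - g (x + t *\<^sub>R w) + g x
   = t * t * dd w (dd v g) (x + s *\<^sub>R v + r *\<^sub>R w)"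
proof -
 define \<phi> where "\<phi> s = g ((x + t *\<^sub>R w) + s *\<^sub>R v) - g (x + s *\<^sub>R v)" for s
 define \<phi>' where "\<phi>' s = dd v g ((x + t *\<^sub>R w) + s *\<^sub>R v) - dd v g (x + s *\<^sub>R v)" for s
 have d: "(\<phi> has_real_derivative \<phi>' s) (at s)" for s
  unfolding \<phi>_def \<phi>'_def
  by (intro DERIV_diff has_real_derivative_line g)
 obtain s where s: "0 < s" "s < t" "\<phi> t - \<phi> 0 = (t - 0) * \<phi>' s"
  using MVT2[OF t, of \<phi> \<phi>'] d by blast
 have d2: "((\<lambda>r. dd v g ((x + s *\<^sub>R v) + r *\<^sub>R w)) has_real_derivative dd w (dd v g) ((x + s *\<^sub>R v) + r *\<^sub>R w)) (at r)" for r
  by (intro has_real_derivative_line g)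
 obtain r where r: "0 < r" "r < t"
  "dd v g ((x + s *\<^sub>R v) + t *\<^sub>R w) - dd v g ((x + s *\<^sub>R v) + 0 *\<^sub>R w)
   = (t - 0) * dd w (dd v g) ((x + s *\<^sub>R v) + r *\<^sub>R w)"
  using MVT2[OF t, of "\<lambda>r. dd v g ((x + s *\<^sub>R v) + r *\<^sub>R w)"
    "\<lambda>r. dd w (dd v g) ((x + s *\<^sub>R v) + r *\<^sub>R w)"] d2 by blast
 have "\<phi>' s = t * dd w (dd v g) (x + s *\<^sub>R v + r *\<^sub>R w)"
  using r(3) by (simp add: \<phi>'_def add_ac)
 then have "g (x + t *\<^sub>R v + t *\<^sub>R w) - g (x + t *\<^sub>R v) - g (x + t *\<^sub>R w) + g x
   = t * t * dd w (dd v g) (x + s *\<^sub>R v + r *\<^sub>R w)"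
  using s(3) by (simp add: \<phi>_def algebra_simps)
 then show ?thesis using that s r by blast
qed

text \<open>Schwarz's theorem: the second difference is symmetric in \<open>v\<close> and
  \<open>w\<close>, so \<open>second_difference\<close> represents it by either mixed derivative at
  points converging to \<open>x\<close>.\<close>

lemma dd_commute_real:
 fixes g :: "'a::real_normed_vector => real"
 assumes g: "\<And>x. g differentiable at x" "\<And>x. dd v g differentiable at x" "\<And>x. dd w g differentiable at x"
  and c: "continuous_on UNIV (dd w (dd v g))" "continuous_on UNIV (dd v (dd w g))"
 shows "dd w (dd v g) x = dd v (dd w g) x"
proof -
 define t where "t n = inverse (real (Suc n))" for n
 have t0: "0 < t n" for n by (simp add: t_def)
 have tl: "t \<longlonglongrightarrow> 0" unfolding t_def by (rule LIMSEQ_inverse_real_of_nat)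
 define \<Delta> where "\<Delta> n = g (x + t n *\<^sub>R v + t n *\<^sub>R w) - g (x + t n *\<^sub>R v) - g (x + t n *\<^sub>R w) + g x" for n
 have "\<exists>s r. 0 < s \<and> s < t n \<and> 0 < r \<and> r < t n \<and> \<Delta> n = t n * t n * dd w (dd v g) (x + s *\<^sub>R v + r *\<^sub>R w)" for n
  using second_difference[OF g(1,2) t0[of n], of x w] unfolding \<Delta>_def by metis
 then obtain s r where sr: "\<And>n. 0 < s n" "\<And>n. s n < t n" "\<And>n. 0 < r n" "\<And>n. r n < t n"
  "\<And>n. \<Delta> n = t n * t n * dd w (dd v g) (x + s n *\<^sub>R v + r n *\<^sub>R w)" by metis
 have "\<exists>s r. 0 < s \<and> s < t n \<and> 0 < r \<and> r < t n \<and> \<Delta> n = t n * t n * dd v (dd w g) (x + s *\<^sub>R w + r *\<^sub>R v)" for n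
 proof -
  have "\<Delta> n = g (x + t n *\<^sub>R w + t n *\<^sub>R v) - g (x + t n *\<^sub>R w) - g (x + t n *\<^sub>R v) + g x"
   by (simp add: \<Delta>_def add_ac)
  then show ?thesis
   using second_difference[OF g(1,3) t0[of n], of x v] by metis
 qed
 then obtain s' r' where sr': "\<And>n. 0 < s' n" "\<And>n. s' n < t n" "\<And>n. 0 < r' n" "\<And>n. r' n < t n"
  "\<And>n. \<Delta> n = t n * t n * dd v (dd w g) (x + s' n *\<^sub>R w + r' n *\<^sub>R v)" by metis
 have lim0: "q \<longlonglongrightarrow> 0" if "\<And>n. 0 < q n" "\<And>n. q n < t n" for q
  by (rule tendsto_sandwich[OF _ _ tendsto_const tl]) (auto intro!: always_eventually less_imp_le that)
 have l: "(\<lambda>n. F (x + q n *\<^sub>R a + q' n *\<^sub>R b)) \<longlonglongrightarrow> F x"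
  if "continuous_on UNIV F" "q \<longlonglongrightarrow> 0" "q' \<longlonglongrightarrow> 0" for F :: "'a => real" and q q' a b
 proof -
  have "(\<lambda>n. x + q n *\<^sub>R a + q' n *\<^sub>R b) \<longlonglongrightarrow> x + 0 *\<^sub>R a + 0 *\<^sub>R b"
   by (intro tendsto_intros that)
  then show ?thesis using that(1) isCont_tendsto_compose[of x F]
   by (simp add: continuous_on_eq_continuous_at)
 qed
 have e: "dd w (dd v g) (x + s n *\<^sub>R v + r n *\<^sub>R w) = dd v (dd w g) (x + s' n *\<^sub>R w + r' n *\<^sub>R v)" for n
  using sr(5)[of n] sr'(5)[of n] t0[of n] by simp
 have "(\<lambda>n. dd w (dd v g) (x + s n *\<^sub>R v + r n *\<^sub>R w)) \<longlonglongrightarrow> dd w (dd v g) x"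
  by (intro l c lim0 sr)
 moreover have "(\<lambda>n. dd v (dd w g) (x + s' n *\<^sub>R w + r' n *\<^sub>R v)) \<longlonglongrightarrow> dd v (dd w g) x"
  by (intro l c lim0 sr')
 ultimately show ?thesis unfolding e using LIMSEQ_unique by blast
qed

text \<open>Reduction to real functions by testing against every vector \<open>e\<close>; hence the
  inner product on the codomain.\<close>

lemma dd_commute:
 fixes f :: "'a::real_normed_vector => 'b::real_inner"
 assumes "smooth_on UNIV f"
 shows "dd w (dd v f) = dd v (dd w f)"
proof
 fix x
 have d: "dd v (\<lambda>y. h y \<bullet> e) = (\<lambda>y. dd v h y \<bullet> e)" "(\<lambda>y. h y \<bullet> e) differentiable at y"
  if "smooth_on UNIV h" for h :: "'a => 'b" and e v y
 proof -
  have *: "((\<lambda>y. h y \<bullet> e) has_derivative (\<lambda>v. dd v h y \<bullet> e)) (at y)" for y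
   by (intro bounded_linear.has_derivative[OF bounded_linear_inner_left] has_derivative_dd smooth_on_UNIV_D that)
  show "dd v (\<lambda>y. h y \<bullet> e) = (\<lambda>y. dd v h y \<bullet> e)" using dd_eq[OF *] by blast
  show "(\<lambda>y. h y \<bullet> e) differentiable at y" using * differentiable_def by blast
 qed
 note sf = smooth_on_UNIV_D[OF assms]
 note sff = smooth_on_UNIV_D[OF smooth_on_UNIV_D(2)[OF assms]]
 have "dd w (dd v f) x \<bullet> e = dd v (dd w f) x \<bullet> e" for e
 proof -
  have c: "continuous_on UNIV (\<lambda>x. dd a (dd b f) x \<bullet> e)" for a b
   by (intro continuous_intros smooth_on_UNIV_D(3) sff(2))
  have "dd w (dd v (\<lambda>y. f y \<bullet> e)) x = dd v (dd w (\<lambda>y. f y \<bullet> e)) x"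
   by (rule dd_commute_real) (simp_all add: d assms sf c)
  then show ?thesis by (simp add: d assms sf)
 qed
 then show "dd w (dd v f) x = dd v (dd w f) x" using vector_eq_rdot by blast
qed

lemma smooth_on_coinduct:
 assumes "f \<in> X"
  and diff: "\<And>f x. f \<in> X \<Longrightarrow> f differentiable at x"
  and step: "\<And>f v. f \<in> X \<Longrightarrow> dd v f \<in> X"
 shows "smooth_on UNIV f"
 unfolding smooth_on_def
proof
 fix k
 show "times_differentiable_on k UNIV f" using assms(1)
 proof (induction k arbitrary: f)
  case 0 then show ?case using diff by (auto intro: differentiable_imp_continuous)
 next
  case (Suc k)
  have "times_differentiable_on k UNIV (dd v f)" for v using Suc step by blast
  then show ?case using Suc.prems diff by (simp add: dd_def[abs_def])
 qed
qed

lemma dd_comp_affine: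
 "bounded_linear L \<Longrightarrow> f differentiable at (L x + c) \<Longrightarrow> dd v (\<lambda>x. f (L x + c)) x = dd (L v) f (L x + c)"
 "bounded_linear L \<Longrightarrow> f differentiable at (L x + c) \<Longrightarrow> (\<lambda>x. f (L x + c)) differentiable at x"
proof -
 assume L: "bounded_linear L" and d: "f differentiable at (L x + c)"
 have Lc: "((\<lambda>x. L x + c) has_derivative L) (at x)"
  by (rule derivative_eq_intros bounded_linear_imp_has_derivative[OF L] refl | simp)+
 have "((\<lambda>x. f (L x + c)) has_derivative (\<lambda>v. dd (L v) f (L x + c))) (at x)"
  using has_derivative_compose[OF Lc has_derivative_dd[OF d]] .
 then show "dd v (\<lambda>x. f (L x + c)) x = dd (L v) f (L x + c)" "(\<lambda>x. f (L x + c)) differentiable at x"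
  using dd_eq differentiable_def by blast+
qed

lemma smooth_on_affine:
 assumes L: "bounded_linear L" and f: "smooth_on UNIV f"
 shows "smooth_on UNIV (\<lambda>x. f (L x + c))"
proof (rule smooth_on_coinduct[of _ "{g. \<exists>h. smooth_on UNIV h \<and> g = (\<lambda>x. h (L x + c))}"])
 fix g v assume "g \<in> {g. \<exists>h. smooth_on UNIV h \<and> g = (\<lambda>x. h (L x + c))}"
 then obtain h where h: "smooth_on UNIV h" "g = (\<lambda>x. h (L x + c))" by blast
 show "g differentiable at x" for x
  unfolding h(2) by (intro dd_comp_affine L smooth_on_UNIV_D h)
 have "dd v g = (\<lambda>x. dd (L v) h (L x + c))"
  unfolding h(2) by (rule ext, intro dd_comp_affine L smooth_on_UNIV_D h)
 then show "dd v g \<in> {g. \<exists>h. smooth_on UNIV h \<and> g = (\<lambda>x. h (L x + c))}"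
  using smooth_on_UNIV_D(2)[OF h(1)] by blast
qed (use f in blast)

definition dds :: "'a::real_normed_vector list => ('a => 'b::real_normed_vector) => 'a => 'b" where
 "dds vs f = foldr dd vs f"

lemma dds_simps [simp]: "dds [] f = f" "dds (v # vs) f = dd v (dds vs f)"
 "dds (vs @ ws) f = dds vs (dds ws f)"
 by (auto simp: dds_def)

lemma smooth_dds: "smooth_on UNIV f \<Longrightarrow> smooth_on UNIV (dds vs f)"
 by (induction vs) (auto intro: smooth_on_UNIV_D)

lemma sm_dds: "sm W f \<Longrightarrow> sm W (dds vs f)"
 by (induction vs) (auto intro: smD)

lemma dds_remove1:
 fixes f :: "'a::real_normed_vector => 'b::real_inner"
 assumes "smooth_on UNIV f"
 shows "v \<in> set vs \<Longrightarrow> dds vs f = dd v (dds (remove1 v vs) f)"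
 by (induction vs) (auto simp: dd_commute[OF smooth_dds[OF assms], of v])

lemma dds_mset:
 fixes f :: "'a::real_normed_vector => 'b::real_inner"
 assumes "smooth_on UNIV f"
 shows "mset vs = mset ws \<Longrightarrow> dds vs f = dds ws f"
proof (induction vs arbitrary: ws)
 case Nil then show ?case by simp
next
 case (Cons v vs)
 have v: "v \<in> set ws" using Cons.prems by (metis list.set_intros(1) set_mset_mset)
 then have "mset vs = mset (remove1 v ws)" using Cons.prems by (metis add_mset_remove_trivial mset.simps(2) mset_remove1)
 then have "dds vs f = dds (remove1 v ws) f" by (rule Cons.IH)
 then show ?case using dds_remove1[OF assms v] by simp
qed

lemma partial_deriv_eq_dd: "f differentiable at x \<Longrightarrow> partial_deriv i f x = dd (axis i 1) f x"
 unfolding partial_deriv_def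
 using has_vector_derivative_line[of f x 0 "axis i 1"] by (simp add: vector_derivative_at)

lemma funpow_partial_deriv:
 "smooth_on UNIV f \<Longrightarrow> (partial_deriv i ^^ k) f = dds (replicate k (axis i 1)) f"
proof (induction k)
 case (Suc k)
 have "partial_deriv i ((partial_deriv i ^^ k) f) = dd (axis i 1) ((partial_deriv i ^^ k) f)"
  unfolding Suc.IH[OF Suc.prems]
  by (rule ext, rule partial_deriv_eq_dd) (intro smooth_on_UNIV_D smooth_dds Suc.prems)
 then show ?case using Suc by simp
qed simp

text \<open>The word of coordinates along which \<open>multi_deriv\<close> differentiates. Arbitrary
  words are compared with it through their multisets, by \<open>dds_mset\<close>.\<close>

definition index_list :: "('n::finite => nat) => 'n list" where
 "index_list a = concat (map (\<lambda>i. replicate (a i) i) coord_list)"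

lemma multi_deriv_eq_dds:
 fixes f :: "real ^ 'n::finite => 'b::real_normed_vector"
 assumes "smooth_on UNIV f"
 shows "multi_deriv a f = dds (map (\<lambda>i. axis i 1) (index_list a)) f"
proof -
 have "foldr (\<lambda>i. partial_deriv i ^^ a i) is f = dds (map (\<lambda>i. axis i 1) (concat (map (\<lambda>i. replicate (a i) i) is))) f"
  for "is" :: "'n list"
 proof (induction "is")
  case (Cons i "is")
  then show ?case by (simp add: funpow_partial_deriv smooth_dds assms)
 qed simp
 then show ?thesis by (simp add: multi_deriv_def index_list_def)
qed

lemma mset_index_list:
 fixes "is" :: "'n::finite list"
 shows "mset (index_list (count (mset is))) = mset is"
proof (rule multiset_eqI)
 fix i
 have "count (mset (concat (map (\<lambda>i. replicate (a i) i) js))) i = (if i \<in> set js then a i else 0)"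
  if "distinct js" for js :: "'n list" and a
  using that by (induction js) auto
 then show "count (mset (index_list (count (mset is)))) i = count (mset is) i"
  by (simp add: index_list_def coord_list)
qed

lemma length_index_list: "length (index_list a) = multi_order a"
proof -
 have "sum_list (map a js) = (\<Sum>i\<in>set js. a i)" if "distinct js" for js :: "'a list"
  using that by (induction js) auto
 then show ?thesis by (simp add: index_list_def multi_order_def length_concat comp_def coord_list)
qed

text \<open>\<open>dd v\<close> is a combination of basis derivatives with constant coefficients, so
  bounds along basis words pass through the recursion of \<open>bdk\<close>.\<close>

lemma sm_from_Basis:
 fixes f :: "'a::euclidean_space => 'b::real_normed_vector"
 assumes f: "smooth_on UNIV f" and W: "\<And>x. 0 \<le> W x"
  and bd: "\<And>bs. set bs \<subseteq> Basis \<Longrightarrow> \<exists>C. \<forall>x. norm (dds bs f x) \<le> C * W x"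
 shows "sm W f"
 unfolding sm_def
proof
 fix k
 have "set bs \<subseteq> Basis \<Longrightarrow> bdk k W (dds bs f)" for bs
 proof (induction k arbitrary: bs)
  case 0 then show ?case using bd by (simp add: smooth_on_UNIV_D smooth_dds f)
 next
  case (Suc k)
  have 1: "dds bs f differentiable at x" for x by (intro smooth_on_UNIV_D smooth_dds f)
  have 2: "dd v (dds bs f) = (\<lambda>x. \<Sum>b\<in>Basis. (v \<bullet> b) *\<^sub>R dds (b # bs) f x)" for v
  proof
   fix x
   have lin: "linear (\<lambda>v. dd v (dds bs f) x)"
    using linear_frechet_derivative[OF 1] unfolding dd_def by simp
   have "dd v (dds bs f) x = dd (\<Sum>b\<in>Basis. (v \<bullet> b) *\<^sub>R b) (dds bs f) x" by (simp add: euclidean_representation)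
   also have "\<dots> = (\<Sum>b\<in>Basis. (v \<bullet> b) *\<^sub>R dd b (dds bs f) x)"
    by (simp add: linear_sum[OF lin] linear_scale[OF lin])
   finally show "dd v (dds bs f) x = (\<Sum>b\<in>Basis. (v \<bullet> b) *\<^sub>R dds (b # bs) f x)" by simp
  qed
  have 3: "bdk k W (\<lambda>x. \<Sum>b\<in>A. (v \<bullet> b) *\<^sub>R dds (b # bs) f x)" if "finite A" "A \<subseteq> Basis" for v A
   using that
  proof (induction A rule: finite_induct)
   case empty
   have "sm W (\<lambda>x. 0 :: 'b)"
    by (rule sm_coinduct[of _ "{\<lambda>x. 0}"]) (auto intro!: exI[of _ 0] W)
   then show ?case by (simp add: sm_def)
  next
   case (insert b A)
   have "bdk k W (dds (b # bs) f)" using insert Suc.prems by (intro Suc.IH) auto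
   then show ?case using insert
    by (simp del: dds_simps add: bdk_add bdk_bounded_linear[OF bounded_linear_scaleR_right])
  qed
  show ?case using 1 bd[OF Suc.prems] 3[OF finite_Basis] by (simp add: 2 del: dds_simps)
 qed
 from this[of "[]"] show "bdk k W f" by simp
qed

lemma sm_from_multi_deriv:
 fixes f :: "real ^ 'n::finite => 'b::real_inner"
 assumes f: "smooth_on UNIV f" and W: "\<And>x. 0 \<le> W x"
  and bd: "\<And>a. \<exists>C. \<forall>x. norm (multi_deriv a f x) \<le> C * W x"
 shows "sm W f"
proof (rule sm_from_Basis[OF f W])
 fix bs :: "(real ^ 'n) list" assume "set bs \<subseteq> Basis"
 then have "\<exists>is. bs = map (\<lambda>i. axis i 1) is"
 proof (induction bs)
  case (Cons b bs)
  then obtain "is" where "bs = map (\<lambda>i. axis i 1) is" by auto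
  moreover obtain i where "b = axis i 1" using Cons.prems by (auto simp: Basis_vec_def)
  ultimately have "b # bs = map (\<lambda>i. axis i 1) (i # is)" by simp
  then show ?case by (rule exI)
 qed simp
 then obtain "is" where "is": "bs = map (\<lambda>i. axis i 1) is" by blast
 have "dds bs f = dds (map (\<lambda>i. axis i 1) (index_list (count (mset is)))) f"
  by (rule dds_mset[OF f]) (simp add: "is" mset_index_list)
 then show "\<exists>C. \<forall>x. norm (dds bs f x) \<le> C * W x"
  using bd[of "count (mset is)"] by (simp add: multi_deriv_eq_dds f)
qed

lemma dds_slice:
 fixes Q :: "'a::real_normed_vector \<times> 'c::real_normed_vector => 'b::real_normed_vector"
 assumes "smooth_on UNIV Q"
 shows "smooth_on UNIV (\<lambda>y. Q (x, y))" "smooth_on UNIV (\<lambda>x. Q (x, y))"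
  "dds ws (\<lambda>y. Q (x, y)) y = dds (map (Pair 0) ws) Q (x, y)"
  "dds vs (\<lambda>x. Q (x, y)) x = dds (map (\<lambda>v. (v, 0)) vs) Q (x, y)"
proof -
 have L: "bounded_linear (Pair 0 :: 'c => 'a \<times> 'c)" "bounded_linear (\<lambda>v. (v, 0) :: 'a \<times> 'c)"
  by (auto intro!: bounded_linear_Pair bounded_linear_zero bounded_linear_ident)
 have 1: "smooth_on UNIV (\<lambda>y. R (x, y))" "smooth_on UNIV (\<lambda>x. R (x, y))"
  if "smooth_on UNIV R" for R :: "'a \<times> 'c => 'b" and x y
  using smooth_on_affine[OF L(1) that, of "(x, 0)"] smooth_on_affine[OF L(2) that, of "(0, y)"] by simp_all
 show "smooth_on UNIV (\<lambda>y. Q (x, y))" "smooth_on UNIV (\<lambda>x. Q (x, y))" using 1 assms by blast+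
 have 2: "dd w (\<lambda>y. R (x, y)) y = dd (0, w) R (x, y)" "dd v (\<lambda>x. R (x, y)) x = dd (v, 0) R (x, y)"
  if "smooth_on UNIV R" for R :: "'a \<times> 'c => 'b" and x y v w
  using dd_comp_affine(1)[OF L(1), of R y "(x, 0)" w] dd_comp_affine(1)[OF L(2), of R x "(0, y)" v]
   smooth_on_UNIV_D(1)[OF that] by simp_all
 show "dds ws (\<lambda>y. Q (x, y)) y = dds (map (Pair 0) ws) Q (x, y)"
 proof (induction ws arbitrary: y)
  case (Cons w ws)
  have "dds ws (\<lambda>y. Q (x, y)) = (\<lambda>y. dds (map (Pair 0) ws) Q (x, y))" using Cons.IH by blast
  then show ?case using 2(1)[OF smooth_dds[OF assms]] by simp
 qed simp
 show "dds vs (\<lambda>x. Q (x, y)) x = dds (map (\<lambda>v. (v, 0)) vs) Q (x, y)"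
 proof (induction vs arbitrary: x)
  case (Cons v vs)
  have "dds vs (\<lambda>x. Q (x, y)) = (\<lambda>x. dds (map (\<lambda>v. (v, 0)) vs) Q (x, y))" using Cons.IH by blast
  then show ?case using 2(2)[OF smooth_dds[OF assms]] by simp
 qed simp
qed

text \<open>A word in the basis of the product space is rearranged so that all \<xi>-derivatives act
  first and all x-derivatives after them, which is the order in \<open>symbol_class\<close>.\<close>

lemma sm_from_symbol:
 fixes q :: "real ^ 'n::finite => real ^ 'n => 'b::real_inner"
 assumes q: "smooth_on UNIV (\<lambda>(x, w). q x w)" and W: "\<And>w. 0 \<le> W w"
  and bd: "\<And>a \<beta>. \<exists>C. \<forall>x w. norm (multi_deriv \<beta> (\<lambda>y. multi_deriv a (q y) w) x) \<le> C * W w"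
 shows "sm (\<lambda>(x, w). W w) (\<lambda>(x, w). q x w)"
proof (rule sm_from_Basis[OF q])
 show "0 \<le> (case z of (x, w) => W w)" for z :: "(real ^ 'n) \<times> (real ^ 'n)" using W by (cases z) simp
 fix bs :: "((real ^ 'n) \<times> (real ^ 'n)) list" assume "set bs \<subseteq> Basis"
 then have "\<exists>js is. mset bs = mset (map (\<lambda>i. (axis i 1, 0)) js @ map (\<lambda>i. (0, axis i 1)) is)"
 proof (induction bs)
  case Nil then show ?case by (intro exI[of _ "[]"]) simp
 next
  case (Cons b bs)
  then obtain js "is" where *: "mset bs = mset (map (\<lambda>i. (axis i 1, 0)) js @ map (\<lambda>i. (0, axis i 1)) is)" by auto
  from Cons.prems consider i where "b = (axis i 1, 0)" | i where "b = (0, axis i 1)"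
   by (auto simp: Basis_prod_def Basis_vec_def)
  then show ?case
  proof cases
   case 1
   then have "mset (b # bs) = mset (map (\<lambda>i. (axis i 1, 0)) (i # js) @ map (\<lambda>i. (0, axis i 1)) is)"
    using * by simp
   then show ?thesis by blast
  next
   case 2
   then have "mset (b # bs) = mset (map (\<lambda>i. (axis i 1, 0)) js @ map (\<lambda>i. (0, axis i 1)) (i # is))"
    using * by simp
   then show ?thesis by blast
  qed
 qed
 then obtain js "is" where b: "mset bs = mset (map (\<lambda>i. (axis i 1, 0)) js @ map (\<lambda>i. (0, axis i 1)) is)" by blast
 let ?Q = "\<lambda>(x, w). q x w"
 let ?bs = "map (\<lambda>i. (axis i 1, 0)) (index_list (count (mset js))) @ map (\<lambda>i. (0, axis i 1)) (index_list (count (mset is)))"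
 have "dds bs ?Q = dds ?bs ?Q"
  by (rule dds_mset[OF q]) (simp only: b mset_append mset_map mset_index_list)
 moreover have "multi_deriv \<beta> (\<lambda>y. multi_deriv a (q y) w) x
   = dds (map (\<lambda>i. (axis i 1, 0)) (index_list \<beta>) @ map (\<lambda>i. (0, axis i 1)) (index_list a)) ?Q (x, w)" for a \<beta> x w
 proof -
  have s: "smooth_on UNIV (q y)" for y using dds_slice(1)[OF q, of y] by simp
  have "multi_deriv a (q y) w = dds (map (\<lambda>i. (0, axis i 1)) (index_list a)) ?Q (y, w)" for y
   using dds_slice(3)[OF q, of "map (\<lambda>i. axis i 1) (index_list a)" y w]
   by (simp add: multi_deriv_eq_dds[OF s] comp_def)
  then have 1: "(\<lambda>y. multi_deriv a (q y) w) = (\<lambda>y. dds (map (\<lambda>i. (0, axis i 1)) (index_list a)) ?Q (y, w))" by blast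
  have s2: "smooth_on UNIV (dds (map (\<lambda>i. (0, axis i 1)) (index_list a)) ?Q)" by (rule smooth_dds[OF q])
  show ?thesis
   unfolding 1 multi_deriv_eq_dds[OF dds_slice(2)[OF s2]]
   by (subst dds_slice(4)[OF s2]) (simp add: comp_def)
 qed
 ultimately show "\<exists>C. \<forall>z. norm (dds bs ?Q z) \<le> C * (case z of (x, w) => W w)"
  using bd[where \<beta> = "count (mset js)" and a = "count (mset is)"] by (simp add: split_paired_all)
qed

section \<open>Rapidly decreasing functions and oscillatory integrals\<close>

definition dec :: "nat => 'a::real_normed_vector => real" where
 "dec N x = inverse ((1 + norm x) ^ N)"

lemma dec_pos: "0 < dec N x"
 by (simp add: dec_def add_pos_nonneg)

lemma dec_nonneg [simp]: "0 \<le> dec N x"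
 using dec_pos less_imp_le by blast

lemma dec_add: "dec (M + N) x = dec M x * dec N x"
 by (simp add: dec_def power_add)

lemma dec_antimono: "M \<le> N \<Longrightarrow> dec N x \<le> dec M x"
 unfolding dec_def by (intro le_imp_inverse_le power_increasing zero_less_power) (auto simp: add_pos_nonneg)

lemma dec_0 [simp]: "dec 0 x = 1" by (simp add: dec_def)

lemma dec_uminus [simp]: "dec N (- x) = dec N x" by (simp add: dec_def)

lemma power_dec: "(1 + norm x) ^ N * dec N x = 1"
 unfolding dec_def using power_not_zero[of "1 + norm x" N]
 by (smt (verit) norm_ge_zero right_inverse)

lemma dec_mono_norm: "norm x \<le> norm y \<Longrightarrow> dec N y \<le> dec N x"
 unfolding dec_def by (intro le_imp_inverse_le power_mono zero_less_power) (auto simp: add_pos_nonneg)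

lemma dec_le_dec:
 assumes "(1 + norm x) ^ N \<le> c * (1 + norm y) ^ N"
 shows "dec N y \<le> c * dec N x"
proof -
 have p: "0 < (1 + norm x) ^ N" "0 < (1 + norm y) ^ N" by (auto intro!: zero_less_power add_pos_nonneg)
 then show ?thesis using assms unfolding dec_def by (simp add: field_simps)
qed

text \<open>Peetre's inequality, from
  \<open>1 + norm x \<le> (1 + norm y) * (1 + norm (x + y))\<close>.\<close>

lemma dec_shift: "dec N (x + y) \<le> (1 + norm y) ^ N * dec N x"
proof (rule dec_le_dec)
 have "norm x \<le> norm (x + y) + norm y" by (metis add_diff_cancel_right' norm_triangle_ineq4)
 then have "1 + norm x \<le> (1 + norm y) * (1 + norm (x + y))"
  by (simp add: algebra_simps) (smt (verit) mult_nonneg_nonneg norm_ge_zero)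
 then show "(1 + norm x) ^ N \<le> (1 + norm y) ^ N * (1 + norm (x + y)) ^ N"
  by (metis norm_ge_zero power_mono power_mult_distrib add_nonneg_nonneg zero_le_one)
qed

lemma continuous_dec: "continuous_on UNIV (dec N)"
 unfolding dec_def by (intro continuous_intros) (auto simp: add_nonneg_eq_0_iff)

lemma measurable_dec [measurable]: "dec N \<in> borel_measurable (borel :: 'a::euclidean_space measure)"
 by (rule borel_measurable_continuous_onI[OF continuous_dec])

lemma nn_integral_inverse_1_plus_square: "(\<integral>\<^sup>+x. ennreal (inverse (1 + x\<^sup>2)) \<partial>(lborel :: real measure)) = ennreal pi"
proof -
 have i: "L1 (\<lambda>x::real. inverse (1 + x\<^sup>2))"
  using integrable_inverse_1_plus_square by (simp add: set_integrable_def interval_lebesgue_integrable_def einterval_def)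
 have "(\<integral>x. inverse (1 + x\<^sup>2) \<partial>(lborel :: real measure)) = pi"
  using LBINT_inverse_1_plus_square by (simp add: interval_lebesgue_integral_def einterval_def set_lebesgue_integral_def)
 then show ?thesis by (subst nn_integral_eq_integral[OF i]) auto
qed

lemma nn_integral_prod_inverse_1_plus_square:
 "(\<integral>\<^sup>+x. ennreal (\<Prod>b\<in>Basis. inverse (1 + (x \<bullet> b)\<^sup>2)) \<partial>(lborel :: 'a::euclidean_space measure)) = ennreal (pi ^ DIM('a))"
proof -
 have "(\<integral>\<^sup>+x. ennreal (\<Prod>b\<in>Basis. inverse (1 + (x \<bullet> b)\<^sup>2)) \<partial>(lborel :: 'a measure))
   = (\<integral>\<^sup>+x. (\<Prod>b\<in>Basis. ennreal (inverse (1 + (x \<bullet> b)\<^sup>2))) \<partial>(lborel :: 'a measure))"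
  by (simp add: prod_ennreal)
 also have "\<dots> = (\<Prod>b\<in>(Basis :: 'a set). (\<integral>\<^sup>+x. ennreal (inverse (1 + x\<^sup>2)) \<partial>(lborel :: real measure)))"
  by (rule nn_integral_lborel_prod) auto
 finally show ?thesis by (simp add: nn_integral_inverse_1_plus_square ennreal_power)
qed

text \<open>Two powers of \<open>1 + norm x\<close> per dimension dominate the factors
  \<open>1 + (x \<bullet> b)\<^sup>2\<close> one by one, which leaves a product of one-dimensional
  integrals with value \<open>pi\<close>.\<close>

lemma integrable_dec: "2 * DIM('a) \<le> N \<Longrightarrow> L1 (dec N :: 'a::euclidean_space => real)"
proof -
 assume N: "2 * DIM('a) \<le> N"
 have le: "dec N x \<le> (\<Prod>b\<in>Basis. inverse (1 + (x \<bullet> b)\<^sup>2))" for x :: 'a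
 proof -
  have "dec N x \<le> dec (2 * DIM('a)) x" by (rule dec_antimono[OF N])
  also have "\<dots> = (\<Prod>b\<in>(Basis::'a set). inverse ((1 + norm x)\<^sup>2))"
   by (simp add: dec_def power_mult power_inverse)
  also have "\<dots> \<le> (\<Prod>b\<in>Basis. inverse (1 + (x \<bullet> b)\<^sup>2))"
  proof (rule prod_mono, safe)
   fix b :: 'a assume "b \<in> Basis"
   then have "\<bar>x \<bullet> b\<bar> \<le> norm x" by (rule Basis_le_norm)
   then have "(x \<bullet> b)\<^sup>2 \<le> (norm x)\<^sup>2" by (metis abs_norm_cancel power2_le_iff_abs_le norm_ge_zero)
   moreover have "(1 + norm x)\<^sup>2 = 1 + 2 * norm x + (norm x)\<^sup>2" by (simp add: power2_eq_square algebra_simps)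
   ultimately have "1 + (x \<bullet> b)\<^sup>2 \<le> (1 + norm x)\<^sup>2" using norm_ge_zero[of x] by linarith
   then show "inverse ((1 + norm x)\<^sup>2) \<le> inverse (1 + (x \<bullet> b)\<^sup>2)"
    by (intro le_imp_inverse_le) (auto simp: add_pos_nonneg)
  qed simp
  finally show ?thesis .
 qed
 have "(\<integral>\<^sup>+x. ennreal (dec N x) \<partial>(lborel :: 'a measure)) \<le> (\<integral>\<^sup>+x. ennreal (\<Prod>b\<in>Basis. inverse (1 + (x \<bullet> b)\<^sup>2)) \<partial>(lborel :: 'a measure))"
  by (intro nn_integral_mono ennreal_leI le)
 also have "\<dots> < \<infinity>" by (simp add: nn_integral_prod_inverse_1_plus_square)
 finally show ?thesis by (intro integrableI_bounded) auto
qed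

text \<open>Dominated convergence for the normalised remainder \<open>R\<close>. The bound
  \<open>g\<close> is demanded only in basis directions and on the unit ball around
  \<open>x0\<close>; the dimension \<open>D\<close> pays for general directions.\<close>

lemma has_derivative_integral_param:
 fixes F :: "'a::euclidean_space => 'b => complex"
 assumes int: "\<And>x. integrable M (F x)"
  and der: "\<And>x y. y \<in> space M \<Longrightarrow> ((\<lambda>x. F x y) has_derivative (\<lambda>v. F' v x y)) (at x)"
  and bd: "\<And>x y b. dist x x0 \<le> 1 \<Longrightarrow> y \<in> space M \<Longrightarrow> b \<in> Basis \<Longrightarrow> norm (F' b x y) \<le> g y"
  and meas: "\<And>v. F' v x0 \<in> borel_measurable M"
  and g: "integrable M g"
 shows "((\<lambda>x. \<integral>y. F x y \<partial>M) has_derivative (\<lambda>v. \<integral>y. F' v x0 y \<partial>M)) (at x0)"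
proof -
 define D where "D = real DIM('a)"
 have lin: "linear (\<lambda>v::'a. F' v x y)" if "y \<in> space M" for x y
  using has_derivative_linear[OF der[OF that]] .
 obtain b0 :: 'a where b0: "b0 \<in> Basis" using nonempty_Basis by blast
 have bd': "norm (F' v x y) \<le> D * g y * norm v" if "dist x x0 \<le> 1" "y \<in> space M" for v x y
 proof -
  have "F' v x y = F' (\<Sum>b\<in>Basis. (v \<bullet> b) *\<^sub>R b) x y" by (simp add: euclidean_representation)
  also have "\<dots> = (\<Sum>b\<in>Basis. F' ((v \<bullet> b) *\<^sub>R b) x y)"
   by (rule linear_sum[OF lin[OF that(2)]])
  also have "\<dots> = (\<Sum>b\<in>Basis. (v \<bullet> b) *\<^sub>R F' b x y)"
   by (rule sum.cong[OF refl]) (rule linear_scale[OF lin[OF that(2)]])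
  also have "norm \<dots> \<le> (\<Sum>b\<in>(Basis::'a set). norm v * g y)"
   by (intro sum_norm_le) (simp add: mult_mono bd that Basis_le_norm)
  finally show ?thesis by (simp add: D_def mult_ac)
 qed
 have int': "integrable M (F' v x0)" for v
 proof (rule Bochner_Integration.integrable_bound[of _ "\<lambda>y. D * norm v * g y"])
  show "AE y in M. norm (F' v x0 y) \<le> norm (D * norm v * g y)"
  proof (rule AE_I2)
   fix y assume y: "y \<in> space M"
   have "norm (F' v x0 y) \<le> D * g y * norm v" using bd'[of x0 y v] y by simp
   then show "norm (F' v x0 y) \<le> norm (D * norm v * g y)" by (simp add: mult_ac)
  qed
 qed (use g meas in auto)
 show ?thesis
  unfolding has_derivative_at_within
 proof (intro conjI)
  show "bounded_linear (\<lambda>v. \<integral>y. F' v x0 y \<partial>M)"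
  proof (rule linear_conv_bounded_linear[THEN iffD1], rule linearI)
   show "(\<integral>y. F' (v + w) x0 y \<partial>M) = (\<integral>y. F' v x0 y \<partial>M) + (\<integral>y. F' w x0 y \<partial>M)" for v w
    by (subst integral_add[symmetric, OF int' int'])
     (rule integral_cong, auto simp: linear_add[OF lin])
   show "(\<integral>y. F' (r *\<^sub>R v) x0 y \<partial>M) = r *\<^sub>R (\<integral>y. F' v x0 y \<partial>M)" for r v
    by (subst integral_scaleR_right[symmetric])
     (rule integral_cong, auto simp: linear_scale[OF lin])
  qed
  define R where "R x y = (F x y - F x0 y - F' (x - x0) x0 y) /\<^sub>R norm (x - x0)" for x y
  have R: "((\<integral>y. F x y \<partial>M) - (\<integral>y. F x0 y \<partial>M) - (\<integral>y. F' (x - x0) x0 y \<partial>M)) /\<^sub>R norm (x - x0) = (\<integral>y. R x y \<partial>M)" for x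
   unfolding R_def
   by (subst integral_scaleR_right) (simp add: integral_diff int int')
  have R_bd: "norm (R x y) \<le> 2 * D * g y" if x: "dist x x0 \<le> 1" "x \<noteq> x0" and y: "y \<in> space M" for x y
  proof -
   have "norm (F x y - F x0 y) \<le> (D * g y) * norm (x - x0)"
   proof (rule differentiable_bound[of "cball x0 1" "\<lambda>x. F x y" "\<lambda>x v. F' v x y"])
    fix z assume z: "z \<in> cball x0 1"
    show "((\<lambda>x. F x y) has_derivative (\<lambda>v. F' v z y)) (at z within cball x0 1)"
     using der[OF y] has_derivative_at_withinI by blast
    show "onorm (\<lambda>v. F' v z y) \<le> D * g y"
     by (rule onorm_le) (use bd'[of z y] z y in \<open>simp add: dist_commute\<close>)
   qed (use x in \<open>auto simp: dist_commute\<close>)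
   moreover have "norm (F' (x - x0) x0 y) \<le> D * g y * norm (x - x0)" using bd'[of x0 y "x - x0"] y by simp
   ultimately have "norm (F x y - F x0 y - F' (x - x0) x0 y) \<le> D * g y * norm (x - x0) + D * g y * norm (x - x0)"
    using norm_triangle_ineq4[of "F x y - F x0 y" "F' (x - x0) x0 y"] by linarith
   then have "norm (F x y - F x0 y - F' (x - x0) x0 y) \<le> 2 * D * g y * norm (x - x0)" by simp
   then show ?thesis unfolding R_def using x(2)
    by (simp add: divide_simps mult_ac)
  qed
  show "((\<lambda>x. ((\<integral>y. F x y \<partial>M) - (\<integral>y. F x0 y \<partial>M) - (\<integral>y. F' (x - x0) x0 y \<partial>M)) /\<^sub>R norm (x - x0)) \<longlongrightarrow> 0) (at x0 within UNIV)"
   unfolding R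
  proof (rule tendsto_at_iff_sequentially[THEN iffD2], intro allI impI)
   fix X :: "nat => 'a" assume X: "\<forall>i. X i \<in> UNIV - {x0}" "X \<longlonglongrightarrow> x0"
   \<comment> \<open>Domination is known only within distance 1 of \<open>x0\<close>, so an initial
     piece of the sequence is cut off.\<close>
   from X(2) obtain k where k: "\<And>n. k \<le> n \<Longrightarrow> dist (X n) x0 \<le> 1"
    unfolding lim_sequentially by (meson less_imp_le zero_less_one)
   have m: "R x \<in> borel_measurable M" for x
    unfolding R_def using int int' by (intro borel_measurable_scaleR borel_measurable_diff) auto
   have "(\<lambda>n. \<integral>y. R (X (n + k)) y \<partial>M) \<longlonglongrightarrow> (\<integral>y. 0 \<partial>M)"
   proof (rule integral_dominated_convergence[where w = "\<lambda>y. 2 * D * g y"])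
    show "AE y in M. (\<lambda>n. R (X (n + k)) y) \<longlonglongrightarrow> 0"
    proof (rule AE_I2)
     fix y assume y: "y \<in> space M"
     have "((\<lambda>x. R x y) \<longlongrightarrow> 0) (at x0 within UNIV)"
      using der[OF y, of x0] unfolding has_derivative_at_within R_def by blast
     then have "((\<lambda>x. R x y) \<circ> X) \<longlonglongrightarrow> 0" using X by (simp add: tendsto_at_iff_sequentially)
     then show "(\<lambda>n. R (X (n + k)) y) \<longlonglongrightarrow> 0" unfolding comp_def by (rule LIMSEQ_ignore_initial_segment)
    qed
    show "AE y in M. norm (R (X (n + k)) y) \<le> 2 * D * g y" for n
    proof (rule AE_I2)
     fix y assume "y \<in> space M"
     then show "norm (R (X (n + k)) y) \<le> 2 * D * g y" using k[of "n + k"] X(1) by (intro R_bd) auto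
    qed
   qed (use m g in auto)
   then have "(\<lambda>n. \<integral>y. R (X n) y \<partial>M) \<longlonglongrightarrow> 0" by (simp add: LIMSEQ_offset)
   then show "((\<lambda>x. \<integral>y. R x y \<partial>M) \<circ> X) \<longlonglongrightarrow> 0" by (simp add: comp_def)
  qed
 qed
qed

text \<open>A coordinate-free Schwartz class, because it is needed on the space of pairs of
  frequencies too. On \<open>real ^ 'n\<close> it coincides with \<open>schwartz\<close> by
  \<open>schwartz_iff\<close>.\<close>

definition sch :: "('a::real_normed_vector => complex) => bool" where
 "sch f \<longleftrightarrow> (\<forall>N. sm (dec N) f)"

lemma schD: "sch f \<Longrightarrow> sm (dec N) f" by (simp add: sch_def)

lemma sch_differentiable: "sch f \<Longrightarrow> f differentiable at x" using schD smD(1) by blast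

lemma sch_dd: "sch f \<Longrightarrow> sch (dd v f)" unfolding sch_def using smD(2) by blast

lemma sch_continuous: "sch f \<Longrightarrow> continuous_on UNIV f" using schD smD(3) by blast

lemma sch_measurable: "sch f \<Longrightarrow> f \<in> borel_measurable borel"
 using sch_continuous borel_measurable_continuous_onI by blast

lemma sch_boundE: assumes "sch f" obtains C where "0 < C" "\<And>x. norm (f x) \<le> C * dec N x"
 using sm_boundE[OF schD[OF assms]] dec_nonneg by metis

lemma sch_integrable:
 fixes f :: "'a::euclidean_space => complex"
 assumes "sch f" shows "L1 f"
proof -
 obtain C where C: "0 < C" "\<And>x. norm (f x) \<le> C * dec (2 * DIM('a)) x" using sch_boundE[OF assms] by metis
 show ?thesis
 proof (rule Bochner_Integration.integrable_bound)
  show "L1 (\<lambda>x::'a. C * dec (2 * DIM('a)) x)"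
   by (intro integrable_mult_right integrable_dec) simp
 qed (use C sch_measurable[OF assms] in auto)
qed

lemma sch_add: "sch f \<Longrightarrow> sch g \<Longrightarrow> sch (\<lambda>x. f x + g x)" unfolding sch_def by (auto intro: sm_add)
lemma sch_diff: "sch f \<Longrightarrow> sch g \<Longrightarrow> sch (\<lambda>x. f x - g x)" unfolding sch_def by (auto intro: sm_diff)
lemma sch_cmult: "sch f \<Longrightarrow> sch (\<lambda>x. c * f x)" unfolding sch_def by (auto intro: sm_cmult)
lemma sch_cnj: "sch f \<Longrightarrow> sch (\<lambda>x. cnj (f x))" unfolding sch_def by (auto intro: sm_cnj)

lemma sch_mult:
 assumes c: "sm W c" "\<And>x. 0 \<le> W x" "\<And>x. W x \<le> C * (1 + norm x) ^ k" and f: "sch f"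
 shows "sch (\<lambda>x. c x * f x)"
 unfolding sch_def
proof
 fix N
 have "sm (\<lambda>x. W x * dec (k + N) x) (\<lambda>x. c x * f x)" by (rule sm_mult[OF c(1) schD[OF f]])
 then show "sm (dec N) (\<lambda>x. c x * f x)"
 proof (rule sm_mono)
  show "0 \<le> W x * dec (k + N) x" for x using c by simp
  show "W x * dec (k + N) x \<le> C * dec N x" for x
  proof -
   have "W x * dec (k + N) x \<le> C * (1 + norm x) ^ k * dec (k + N) x" by (intro mult_right_mono c) simp
   also have "\<dots> = C * dec N x * ((1 + norm x) ^ k * dec k x)" by (simp add: dec_add mult_ac)
   finally show ?thesis by (simp add: power_dec)
  qed
 qed
qed

lemma sch_mult_1: "sm (\<lambda>x. 1) c \<Longrightarrow> sch f \<Longrightarrow> sch (\<lambda>x. c x * f x)"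
 by (rule sch_mult[of "\<lambda>_. 1" c 1 0]) auto

lemma sch_comp_affine:
 assumes L: "bounded_linear L" "\<And>x. norm x \<le> K * norm (L x)" "0 < K" and f: "sch f"
 shows "sch (\<lambda>x. f (L x + a))"
 unfolding sch_def
proof
 fix N
 have "sm (\<lambda>x. dec N (L x + a)) (\<lambda>x. f (L x + a))" by (rule sm_comp_affine[OF L(1) schD[OF f]])
 then show "sm (dec N) (\<lambda>x. f (L x + a))"
 proof (rule sm_mono)
  show "dec N (L x + a) \<le> ((1 + norm a) ^ N * (1 + K) ^ N) * dec N x" for x
  proof -
   have "1 + norm x \<le> (1 + K) * (1 + norm (L x))" using L(2)[of x] L(3)
    by (simp add: algebra_simps) (smt (verit) norm_ge_zero mult_nonneg_nonneg)
   then have "(1 + norm x) ^ N \<le> (1 + K) ^ N * (1 + norm (L x)) ^ N"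
    by (metis norm_ge_zero power_mono power_mult_distrib add_nonneg_nonneg zero_le_one)
   then have *: "dec N (L x) \<le> (1 + K) ^ N * dec N x" by (rule dec_le_dec)
   have "dec N (L x + a) \<le> (1 + norm a) ^ N * dec N (L x)" by (rule dec_shift)
   also have "\<dots> \<le> (1 + norm a) ^ N * ((1 + K) ^ N * dec N x)" by (intro mult_left_mono *) auto
   finally show ?thesis by (simp add: mult_ac)
  qed
 qed simp
qed

lemma sch_translate: "sch f \<Longrightarrow> sch (\<lambda>x. f (x + a))"
 using sch_comp_affine[of "\<lambda>x. x" 1 f a] by (simp add: bounded_linear_ident)

lemma sch_uminus: "sch f \<Longrightarrow> sch (\<lambda>x. f (- x))"
 using sch_comp_affine[of "\<lambda>x. - x" 1 f 0] by (simp add: bounded_linear_minus bounded_linear_ident)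

lemma cis_has_derivative:
 "((\<lambda>x. ee c x) has_derivative
  (\<lambda>v. \<i> * cr (c \<bullet> v) * ee c x)) (at x)"
proof -
 have 1: "((\<lambda>x. \<i> * cr (c \<bullet> x)) has_derivative (\<lambda>v. \<i> * cr (c \<bullet> v))) (at x)"
  by (intro has_derivative_mult_right has_derivative_of_real has_derivative_inner_right has_derivative_ident)
 have 2: "(exp has_derivative (\<lambda>z. ee c x * z)) (at (\<i> * cr (c \<bullet> x)))"
  using DERIV_exp unfolding has_field_derivative_def .
 show ?thesis using has_derivative_compose[OF 1 2] by (simp add: mult_ac)
qed

lemma norm_cis_real [simp]: "cmod (exp (\<i> * cr t)) = 1" "cmod (exp (- (\<i> * cr t))) = 1"
 by (auto simp: norm_exp_eq_Re)

lemma sm_cis: "sm (\<lambda>x. 1) (\<lambda>x. ee k x)"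
proof (rule sm_coinduct[of _ "{f. \<exists>c. f = (\<lambda>x. c * ee k x)}"])
 fix f :: "'a => complex" assume "f \<in> {f. \<exists>c. f = (\<lambda>x. c * ee k x)}"
 then obtain c where f: "f = (\<lambda>x. c * ee k x)" by blast
 have d: "(f has_derivative (\<lambda>v. c * (\<i> * cr (k \<bullet> v) * ee k x))) (at x)" for x
  unfolding f by (intro has_derivative_mult_right cis_has_derivative)
 show "f differentiable at x" for x using d differentiable_def by blast
 show "\<exists>C. \<forall>x. norm (f x) \<le> C * 1" by (auto simp: f norm_mult)
 show "dd v f \<in> {f. \<exists>c. f = (\<lambda>x. c * ee k x)}" for v
  using dd_eq[OF d, of v] by (auto intro!: exI[of _ "c * (\<i> * cr (k \<bullet> v))"] simp: fun_eq_iff)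
qed (auto intro: exI[of _ 1])

lemma integral_translate:
 fixes f :: "'a::euclidean_space => 'b::{banach, second_countable_topology}"
 assumes "f \<in> borel_measurable borel"
 shows "(\<integral>x. f (a + x)) = (\<integral>x. f x)"
 using integral_distr[of "(+) a" lborel borel f] assms by (simp add: lborel_distr_plus)

text \<open>The integral of the translate \<open>f (y + t *\<^sub>R v)\<close> does not depend on
  \<open>t\<close>, and its derivative at \<open>t = 0\<close> is the integral in question.\<close>

lemma integral_dd_eq_0:
 fixes f :: "'a::euclidean_space => complex"
 assumes f: "sch f"
 shows "(\<integral>x. dd v f x) = 0"
proof -
 let ?N = "2 * DIM('a)"
 obtain C where C: "0 < C" "\<And>x. norm (dd v f x) \<le> C * dec ?N x"
  using sch_boundE[OF sch_dd[OF f]] by metis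
 have der: "((\<lambda>t. f (y + t *\<^sub>R v)) has_derivative (\<lambda>s. s *\<^sub>R dd v f (y + t *\<^sub>R v))) (at t)" for t y
  using has_vector_derivative_line[of f y t v] sch_differentiable[OF f]
  by (simp add: has_vector_derivative_def)
 have "((\<lambda>t. \<integral>y. f (y + t *\<^sub>R v) \<partial>lborel) has_derivative
   (\<lambda>s. \<integral>y. s *\<^sub>R dd v f (y + 0 *\<^sub>R v) \<partial>lborel)) (at 0)"
 proof (rule has_derivative_integral_param[where F' = "\<lambda>s t y. s *\<^sub>R dd v f (y + t *\<^sub>R v)"])
  show "L1 (\<lambda>y. f (y + t *\<^sub>R v))" for t
   by (intro sch_integrable sch_translate f)
  show "norm (b *\<^sub>R dd v f (y + t *\<^sub>R v)) \<le> C * ((1 + norm v) ^ ?N * dec ?N y)"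
   if "dist t 0 \<le> 1" "b \<in> Basis" for t b :: real and y
  proof -
   have "norm (b *\<^sub>R dd v f (y + t *\<^sub>R v)) = norm (dd v f (y + t *\<^sub>R v))" using that by simp
   also have "\<dots> \<le> C * dec ?N (y + t *\<^sub>R v)" by (rule C)
   also have "dec ?N (y + t *\<^sub>R v) \<le> (1 + norm (t *\<^sub>R v)) ^ ?N * dec ?N y" by (rule dec_shift)
   also have "\<dots> \<le> (1 + norm v) ^ ?N * dec ?N y"
    using that(1) by (intro mult_right_mono power_mono) (auto simp: mult_left_le_one_le)
   finally show ?thesis using C(1) by simp
  qed
  show "(\<lambda>y. s *\<^sub>R dd v f (y + 0 *\<^sub>R v)) \<in> borel_measurable lborel" for s
   using sch_measurable[OF sch_dd[OF f]] by simp
  show "L1 (\<lambda>y::'a. C * ((1 + norm v) ^ ?N * dec ?N y))"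
   by (intro integrable_mult_right integrable_dec) simp
 qed (rule der)
 moreover have "(\<lambda>t. \<integral>y. f (y + t *\<^sub>R v) \<partial>lborel) = (\<lambda>t. \<integral>y. f y \<partial>lborel)"
 proof
  show "(\<integral>y. f (y + t *\<^sub>R v)) = (\<integral>y. f y)" for t
   using integral_translate[OF sch_measurable[OF f], of "t *\<^sub>R v"] by (simp add: add.commute)
 qed
 ultimately have "((\<lambda>t::real. \<integral>y. f y \<partial>lborel) has_derivative (\<lambda>s. \<integral>y. s *\<^sub>R dd v f y \<partial>lborel)) (at 0)" by simp
 then have "(\<lambda>s. \<integral>y. s *\<^sub>R dd v f y \<partial>lborel) = (\<lambda>s. 0)"
  using has_derivative_const has_derivative_unique by blast
 from fun_cong[OF this, of 1] show ?thesis by simp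
qed

lemma integral_by_parts:
 fixes f g :: "'a::euclidean_space => complex"
 assumes c: "sm W c" "\<And>x. 0 \<le> W x" "\<And>x. W x \<le> C * (1 + norm x) ^ k" and f: "sch f"
 shows "(\<integral>x. c x * dd v f x) = - (\<integral>x. dd v c x * f x)"
proof -
 have i: "L1 (\<lambda>x. c x * dd v f x)" "L1 (\<lambda>x. dd v c x * f x)"
  by (intro sch_integrable sch_mult[OF c] sch_mult[OF smD(2)[OF c(1)] c(2,3)] sch_dd f)+
 have "dd v (\<lambda>x. c x * f x) = (\<lambda>x. c x * dd v f x + dd v c x * f x)"
  by (rule ext, intro dd_mult smD(1)[OF c(1)] sch_differentiable f)
 then have "(\<integral>x. c x * dd v f x + dd v c x * f x) = 0"
  using integral_dd_eq_0[OF sch_mult[OF c f], of v] by simp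
 then show ?thesis using i by (simp add: add_eq_0_iff2)
qed

section \<open>Oscillatory integrals with parameters\<close>

definition osym :: "('p::real_normed_vector => real) => ('p \<times> 'z::real_normed_vector => complex) => bool" where
 "osym W c \<longleftrightarrow> (\<forall>N. sm (\<lambda>(p, z). W p * dec N z) c)"

text \<open>Parameter \<open>p\<close> and phase variable \<open>y\<close> are kept apart: for an
  operator both are the point x, whereas the Gaussian average of a double amplitude takes
  \<open>y\<close> to be the difference of two frequencies.\<close>

definition osc :: "('p \<times> 'z::euclidean_space => complex) => 'p => 'z => complex" where
 "osc c p y = (\<integral>z. ee y z * c (p, z))"

lemma osym_dd: "osym W c \<Longrightarrow> osym W (dd v c)"
 unfolding osym_def using smD(2) by blast

lemma bounded_linear_Pairs:
 "bounded_linear (\<lambda>y. (0, y))" "bounded_linear (\<lambda>x. (x, 0))"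
 by (auto intro!: bounded_linear_Pair bounded_linear_zero bounded_linear_ident)

lemma osym_slice:
 assumes "osym W c" "\<And>p. 0 \<le> W p"
 shows "sch (\<lambda>z. c (p, z))"
 unfolding sch_def
proof
 fix N
 have "sm (\<lambda>(p, z). W p * dec N z) c" using assms by (simp add: osym_def)
 from sm_comp_affine[OF bounded_linear_Pairs(1) this, of "(p, 0)"]
 have "sm (\<lambda>z. W p * dec N z) (\<lambda>z. c (p, z))" by simp
 then show "sm (dec N) (\<lambda>z. c (p, z))" by (rule sm_mono) (auto simp: assms)
qed

lemma dd_slice:
 "f differentiable at (p, z) \<Longrightarrow> dd v (\<lambda>z. f (p, z)) z = dd (0, v) f (p, z)"
 "f differentiable at (p, z) \<Longrightarrow> dd w (\<lambda>p. f (p, z)) p = dd (w, 0) f (p, z)"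
 using dd_comp_affine(1)[OF bounded_linear_Pairs(1), of f z "(p, 0)" v]
  dd_comp_affine(1)[OF bounded_linear_Pairs(2), of f p "(0, z)" w] by simp_all

lemma osc_ibp:
 assumes c: "osym W c" "\<And>p. 0 \<le> W p"
 shows "cr (y \<bullet> v) * osc c p y = \<i> * osc (dd (0, v) c) p y"
proof -
 have s: "sch (\<lambda>z. c (p, z))" by (rule osym_slice[OF c])
 have "c differentiable at x" for x using c(1) smD(1) unfolding osym_def by blast
 then have d: "dd v (\<lambda>z. c (p, z)) = (\<lambda>z. dd (0, v) c (p, z))" by (intro ext dd_slice(1)[where f = c])
 have e: "dd v (\<lambda>z. ee y z) = (\<lambda>z. \<i> * cr (y \<bullet> v) * ee y z)"
  by (rule ext, rule dd_eq, rule cis_has_derivative)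
 have "osc (dd (0, v) c) p y = (\<integral>z. ee y z * dd v (\<lambda>z. c (p, z)) z)"
  by (simp add: osc_def d)
 also have "\<dots> = - (\<integral>z. dd v (\<lambda>z. ee y z) z * c (p, z))"
  by (rule integral_by_parts[OF sm_cis _ _ s, of 1 0]) auto
 also have "\<dots> = - (\<i> * cr (y \<bullet> v) * osc c p y)"
  unfolding e osc_def by (simp add: mult.assoc)
 finally have "\<i> * osc (dd (0, v) c) p y = - (\<i> * \<i>) * (cr (y \<bullet> v) * osc c p y)"
  by (simp add: mult.assoc)
 then show ?thesis by simp
qed

text \<open>By \<open>osc_ibp\<close> a factor \<open>y \<bullet> b\<close> is traded for a
  derivative of the amplitude in \<open>z\<close>, which stays in the same class. Induction on the
  number of factors, with \<open>norm y\<close> estimated by the sum of the coordinates.\<close>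

lemma osc_decay:
 fixes c :: "'p::real_normed_vector \<times> 'z::euclidean_space => complex"
 assumes "osym W c" and W: "\<And>p. 0 \<le> W p"
 shows "\<exists>C. \<forall>p y. cmod (osc c p y) \<le> C * (W p * dec N y)"
proof -
 have "\<exists>C\<ge>0. \<forall>p y. (1 + norm y) ^ N * cmod (osc c p y) \<le> C * W p"
  using assms(1)
 proof (induction N arbitrary: c)
  case 0
  let ?N = "2 * DIM('z)"
  have 1: "sm (\<lambda>(p, z). W p * dec ?N z) c" using 0 by (simp add: osym_def)
  obtain C where C: "0 < C" "\<And>x. norm (c x) \<le> C * (\<lambda>(p, z). W p * dec ?N z) x"
   using sm_boundE[OF 1] W by (metis (no_types, lifting) case_prod_beta dec_nonneg mult_nonneg_nonneg)
  have cb: "cmod (c (p, z)) \<le> C * (W p * dec ?N z)" for p z using C(2)[of "(p, z)"] by simp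
  define D where "D = (\<integral>z. dec ?N z \<partial>(lborel :: 'z measure))"
  have D: "0 \<le> D" unfolding D_def by (rule integral_nonneg) simp
  have "cmod (osc c p y) \<le> (C * D) * W p" for p y
  proof -
   have i: "L1 (\<lambda>z. c (p, z))" by (intro sch_integrable osym_slice[OF 0 W])
   have "cmod (osc c p y) \<le> (\<integral>z. cmod (c (p, z)))"
    unfolding osc_def by (rule order_trans[OF integral_norm_bound]) (simp add: norm_mult)
   also have "\<dots> \<le> (\<integral>z. C * (W p * dec ?N z) \<partial>(lborel :: 'z measure))"
    by (intro Bochner_Integration.integral_mono integrable_norm i integrable_mult_right integrable_dec cb) simp
   also have "\<dots> = (C * D) * W p" by (simp add: D_def)
   finally show ?thesis .
  qed
  then show ?case using C(1) D by (intro exI[of _ "C * D"]) auto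
 next
  case (Suc N)
  obtain C0 where C0: "0 \<le> C0" "\<And>p y. (1 + norm y) ^ N * cmod (osc c p y) \<le> C0 * W p"
   using Suc by blast
  have "\<forall>b. \<exists>C\<ge>0. \<forall>p y. (1 + norm y) ^ N * cmod (osc (dd (0, b) c) p y) \<le> C * W p"
   using Suc osym_dd by blast
  then obtain C1 where C1: "\<And>b. 0 \<le> C1 b" "\<And>b p y. (1 + norm y) ^ N * cmod (osc (dd (0, b) c) p y) \<le> C1 b * W p"
   by metis
  have "(1 + norm y) ^ Suc N * cmod (osc c p y) \<le> (C0 + (\<Sum>b\<in>Basis. C1 b)) * W p" for p and y :: 'z
  proof -
   have b: "\<bar>y \<bullet> b\<bar> * cmod (osc c p y) = cmod (osc (dd (0, b) c) p y)" for b
    using arg_cong[OF osc_ibp[OF Suc.prems W, of y b p], of norm] by (simp add: norm_mult)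
   have "(1 + norm y) ^ Suc N * cmod (osc c p y) = (1 + norm y) ^ N * cmod (osc c p y) + norm y * ((1 + norm y) ^ N * cmod (osc c p y))"
    by (simp add: algebra_simps)
   also have "\<dots> \<le> (1 + norm y) ^ N * cmod (osc c p y) + (\<Sum>b\<in>Basis. \<bar>y \<bullet> b\<bar>) * ((1 + norm y) ^ N * cmod (osc c p y))"
    by (intro add_left_mono mult_right_mono norm_le_l1) auto
   also have "\<dots> = (1 + norm y) ^ N * cmod (osc c p y) + (\<Sum>b\<in>Basis. (1 + norm y) ^ N * cmod (osc (dd (0, b) c) p y))"
    by (simp add: sum_distrib_right sum_distrib_left b[symmetric] mult_ac)
   also have "\<dots> \<le> C0 * W p + (\<Sum>b\<in>Basis. C1 b * W p)"
    by (intro add_mono sum_mono C0 C1)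
   finally show ?thesis by (simp add: distrib_right sum_distrib_right)
  qed
  then show ?case using C0 C1 by (intro exI[of _ "C0 + (\<Sum>b\<in>Basis. C1 b)"]) (auto intro!: add_nonneg_nonneg sum_nonneg)
 qed
 then obtain C where C: "\<And>p y. (1 + norm y) ^ N * cmod (osc c p y) \<le> C * W p" by blast
 have "cmod (osc c p y) \<le> C * (W p * dec N y)" for p y
 proof -
  have "cmod (osc c p y) = (1 + norm y) ^ N * cmod (osc c p y) * dec N y"
   using power_dec[of y N] by (metis mult.commute mult.left_commute mult.right_neutral)
  also have "\<dots> \<le> C * W p * dec N y" by (intro mult_right_mono C) simp
  finally show ?thesis by (simp add: mult.assoc)
 qed
 then show ?thesis by blast
qed

lemma osym_mult_linear:
 fixes c :: "'p::real_normed_vector \<times> 'z::euclidean_space => complex"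
 assumes c: "osym W c" "\<And>p. 0 \<le> W p"
 shows "osym W (\<lambda>(p, z). cr (v \<bullet> z) * c (p, z))"
 unfolding osym_def
proof
 fix N
 have l1: "bounded_linear (\<lambda>z :: 'z. cr (v \<bullet> z))"
  by (intro bounded_linear_compose[OF bounded_linear_of_real] bounded_linear_inner_right)
 have "sm (\<lambda>x. 1 + norm (snd x)) (\<lambda>x :: 'p \<times> 'z. cr (v \<bullet> snd x))"
  using sm_comp[OF bounded_linear_snd sm_linear[OF l1]] .
 moreover have "sm (\<lambda>(p, z). W p * dec (Suc N) z) c" using c by (simp add: osym_def)
 ultimately have "sm (\<lambda>x. (1 + norm (snd x)) * (case x of (p, z) => W p * dec (Suc N) z)) (\<lambda>x. cr (v \<bullet> snd x) * c x)"
  by (rule sm_mult)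
 then have "sm (\<lambda>(p, z). W p * dec N z) (\<lambda>x. cr (v \<bullet> snd x) * c x)"
 proof (rule sm_mono)
  fix x :: "'p \<times> 'z"
  obtain p z where x: "x = (p, z)" by (cases x)
  show "0 \<le> (1 + norm (snd x)) * (case x of (p, z) => W p * dec (Suc N) z)" using c(2) by (simp add: x)
  have "(1 + norm z) * dec (Suc N) z = dec N z"
   using power_dec[of z 1] dec_add[of 1 N z] by (simp add: mult.assoc[symmetric])
  then have eq: "(1 + norm z) * (W p * dec (Suc N) z) = W p * dec N z" by (simp only: mult.left_commute)
  show "(1 + norm (snd x)) * (case x of (p, z) => W p * dec (Suc N) z) \<le> 1 * (case x of (p, z) => W p * dec N z)"
   by (simp only: x snd_conv prod.case eq mult_1_left order_refl)
 qed
 then show "sm (\<lambda>(p, z). W p * dec N z) (\<lambda>(p, z). cr (v \<bullet> z) * c (p, z))"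
  by (simp add: case_prod_beta')
qed

lemma osym_add: "osym W c \<Longrightarrow> osym W d \<Longrightarrow> osym W (\<lambda>x. c x + d x)"
 unfolding osym_def by (auto intro: sm_add)

lemma osym_cmult: "osym W c \<Longrightarrow> osym W (\<lambda>x. a * c x)"
 unfolding osym_def by (auto intro: sm_cmult)

lemma osym_differentiable: "osym W c \<Longrightarrow> c differentiable at x"
 unfolding osym_def using smD(1) by blast

text \<open>The amplitude of the derivative of the diagonal integral \<open>osc c x x\<close>: one
  term comes from the exponential, the other from the amplitude.\<close>

definition osc_dd :: "'a::euclidean_space => ('a \<times> 'a => complex) => 'a \<times> 'a => complex" where
 "osc_dd v c = (\<lambda>x. \<i> * (\<lambda>(x, z). cr (v \<bullet> z) * c (x, z)) x + dd (v, 0) c x)"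

lemma osym_osc_dd: "osym (\<lambda>_. 1) c \<Longrightarrow> osym (\<lambda>_. 1) (osc_dd v c)"
 unfolding osc_dd_def by (intro osym_add osym_cmult osym_mult_linear osym_dd) auto

lemma osc_diag_has_derivative:
 fixes c :: "'a::euclidean_space \<times> 'a => complex"
 assumes c: "osym (\<lambda>_. 1) c"
 shows "((\<lambda>x. osc c x x) has_derivative (\<lambda>v. osc (osc_dd v c) x x)) (at x)"
proof -
 let ?N = "2 * DIM('a)"
 have s: "sch (\<lambda>z. c (x, z))" if "osym (\<lambda>_. 1) c" for c :: "'a \<times> 'a => complex" and x
  using osym_slice[OF that] by simp
 have "\<forall>b. \<exists>C>0. \<forall>x. norm (osc_dd b c x) \<le> C * (case x of (p, z) => 1 * dec ?N z)"
 proof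
  fix b
  have "sm (\<lambda>(p, z). 1 * dec ?N z) (osc_dd b c)" using osym_osc_dd[OF c, of b] unfolding osym_def by blast
  from sm_boundE[OF this] show "\<exists>C>0. \<forall>x. norm (osc_dd b c x) \<le> C * (case x of (p, z) => 1 * dec ?N z)"
   by (metis (no_types, lifting) case_prod_beta dec_nonneg mult_1)
 qed
 then obtain C where C: "\<And>b. 0 < C b" "\<And>b x. norm (osc_dd b c x) \<le> C b * (case x of (p, z) => 1 * dec ?N z)"
  by metis
 show ?thesis
  unfolding osc_def
 proof (rule has_derivative_integral_param[where g = "\<lambda>z. (\<Sum>b\<in>Basis. C b) * dec ?N z"])
  show "L1 (\<lambda>z. ee x z * c (x, z))" for x
   by (intro sch_integrable sch_mult_1 sm_cis s c)
  show "((\<lambda>x. ee x z * c (x, z)) has_derivative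
    (\<lambda>v. ee x z * osc_dd v c (x, z))) (at x)" for x z
  proof -
   have "((\<lambda>x. c (x, z)) has_derivative (\<lambda>v. dd v (\<lambda>x. c (x, z)) x)) (at x)"
    using dd_comp_affine(2)[OF bounded_linear_Pairs(2), of c x "(0, z)"] osym_differentiable[OF c]
    by (intro has_derivative_dd) simp
   then have 1: "((\<lambda>x. c (x, z)) has_derivative (\<lambda>v. dd (v, 0) c (x, z))) (at x)"
    using dd_slice(2)[OF osym_differentiable[OF c]] by simp
   have 2: "((\<lambda>x. ee x z) has_derivative
    (\<lambda>v. \<i> * cr (v \<bullet> z) * ee x z)) (at x)"
    using cis_has_derivative[of z x] by (simp add: inner_commute)
   show ?thesis using has_derivative_mult[OF 2 1] by (simp add: osc_dd_def algebra_simps)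
  qed
  show "norm (ee y z * osc_dd b c (y, z)) \<le> (\<Sum>b\<in>Basis. C b) * dec ?N z"
   if "b \<in> Basis" for y z :: 'a and b
  proof -
   have "norm (ee y z * osc_dd b c (y, z)) \<le> C b * dec ?N z"
    using C(2)[of b "(y, z)"] by (simp add: norm_mult)
   also have "\<dots> \<le> (\<Sum>b\<in>Basis. C b) * dec ?N z"
    using C(1) that by (intro mult_right_mono member_le_sum) (auto simp: less_imp_le)
   finally show ?thesis .
  qed
  show "(\<lambda>z. ee x z * osc_dd v c (x, z)) \<in> borel_measurable lborel" for v
   using sch_measurable[OF sch_mult_1[OF sm_cis s[OF osym_osc_dd[OF c]]]] by simp
  show "L1 (\<lambda>z::'a. (\<Sum>b\<in>Basis. C b) * dec ?N z)"
   by (intro integrable_mult_right integrable_dec) simp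
 qed
qed

text \<open>Diagonal integrals are closed under differentiation by \<open>osc_dd\<close>, so
  coinduction reduces the claim to the decay of a single one. Applied to a symbol times a Fourier
  transform, this shows that the operator preserves the Schwartz class.\<close>

lemma sch_osc_diag:
 fixes c :: "'a::euclidean_space \<times> 'a => complex"
 assumes "osym (\<lambda>_. 1) c"
 shows "sch (\<lambda>x. osc c x x)"
 unfolding sch_def
proof
 fix N
 show "sm (dec N) (\<lambda>x. osc c x x)"
 proof (rule sm_coinduct[of _ "{f. \<exists>c. osym (\<lambda>_. 1) c \<and> f = (\<lambda>x. osc c x x)}"])
  fix f :: "'a => complex" assume "f \<in> {f. \<exists>c. osym (\<lambda>_. 1) c \<and> f = (\<lambda>x. osc c x x)}"
  then obtain c where c: "osym (\<lambda>_. 1) c" "f = (\<lambda>x. osc c x x)" by blast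
  note d = osc_diag_has_derivative[OF c(1), folded c(2)]
  show "f differentiable at x" for x using d differentiable_def by blast
  show "dd v f \<in> {f. \<exists>c. osym (\<lambda>_. 1) c \<and> f = (\<lambda>x. osc c x x)}" for v
   using dd_eq[OF d] osym_osc_dd[OF c(1)] by blast
  obtain C where "\<And>p y. cmod (osc c p y) \<le> C * (1 * dec N y)"
   using osc_decay[OF c(1)] by (metis zero_le_one)
  then show "\<exists>C. \<forall>x. norm (f x) \<le> C * dec N x" unfolding c(2) by auto
 qed (use assms in blast)
qed

lemma osym_snd:
 assumes "sch h"
 shows "osym (\<lambda>_. 1) (\<lambda>x :: 'p::real_normed_vector \<times> 'z::euclidean_space. h (snd x))"
 unfolding osym_def
proof
 fix N
 show "sm (\<lambda>(p, z). 1 * dec N z) (\<lambda>x :: 'p \<times> 'z. h (snd x))"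
  using sm_comp[OF bounded_linear_snd schD[OF assms]] by (simp add: case_prod_beta')
qed

section \<open>Fourier inversion and Plancherel's formula\<close>

definition fm :: "('a::euclidean_space => complex) => 'a => complex" where
 "fm h x = (\<integral>z. en z x * h z)"

lemma fm_eq_osc: "fm h x = osc (\<lambda>x. h (snd x)) (- x) (- x)"
 by (simp add: fm_def osc_def inner_commute)

lemma sch_fm: "sch h \<Longrightarrow> sch (fm h)"
 unfolding fm_eq_osc[abs_def] by (rule sch_uminus[OF sch_osc_diag]) (rule osym_snd)

lemma dd_fm:
 assumes "sch h"
 shows "dd v (fm h) x = fm (\<lambda>z. - \<i> * cr (v \<bullet> z) * h z) x"
proof -
 let ?c = "\<lambda>x :: 'a \<times> 'a. h (snd x)"
 have c: "osym (\<lambda>_. 1) ?c" by (rule osym_snd[OF assms])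
 have m: "((\<lambda>x :: 'a. - x) has_derivative (\<lambda>v. - v)) (at x)" by (intro derivative_intros)
 have "(fm h has_derivative (\<lambda>v. osc (osc_dd (- v) ?c) (- x) (- x))) (at x)"
  unfolding fm_eq_osc[abs_def]
  using has_derivative_compose[OF m osc_diag_has_derivative[OF c]] by (simp add: comp_def)
 then have "dd v (fm h) x = osc (osc_dd (- v) ?c) (- x) (- x)" by (rule dd_eq)
 also have "\<dots> = fm (\<lambda>z. - \<i> * cr (v \<bullet> z) * h z) x"
 proof -
  have "dd (- v, 0) ?c = (\<lambda>x. dd 0 h (snd x))"
   using dd_comp[OF bounded_linear_snd sch_differentiable[OF assms], of "(- v, 0)"] by (auto simp: fun_eq_iff)
  moreover have "dd 0 h = (\<lambda>x. 0)"
   unfolding dd_def using linear_0[OF linear_frechet_derivative[OF sch_differentiable[OF assms]]] by simp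
  ultimately show ?thesis by (simp add: osc_def fm_def osc_dd_def inner_commute[of x] mult.assoc)
 qed
 finally show ?thesis .
qed

lemma fm_dd:
 assumes "sch h"
 shows "fm (dd v h) x = \<i> * cr (v \<bullet> x) * fm h x"
proof -
 let ?c = "\<lambda>x :: 'a \<times> 'a. h (snd x)"
 have c: "osym (\<lambda>_. 1) ?c" by (rule osym_snd[OF assms])
 have "dd (0, v) ?c = (\<lambda>x. dd v h (snd x))"
  using dd_comp[OF bounded_linear_snd sch_differentiable[OF assms], of "(0, v)"] by (auto simp: fun_eq_iff)
 then have "cr ((- x) \<bullet> v) * fm h x = \<i> * fm (dd v h) x"
  using osc_ibp[OF c, of "- x" v "- x"] by (simp add: fm_eq_osc)
 then have "\<i> * (\<i> * fm (dd v h) x) = \<i> * (cr ((- x) \<bullet> v) * fm h x)" by simp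
 then have "- fm (dd v h) x = \<i> * cr ((- x) \<bullet> v) * fm h x" by (simp only: mult.assoc[symmetric] i_squared) simp
 then show ?thesis by (simp add: inner_commute)
qed

definition gauss :: "'a::euclidean_space => complex" where
 "gauss x = cr (exp (- (x \<bullet> x) / 2))"

lemma gauss_has_derivative: "(gauss has_derivative (\<lambda>v. - cr (x \<bullet> v) * gauss x)) (at x)"
proof -
 have 1: "((\<lambda>x. - (x \<bullet> x) / 2) has_derivative (\<lambda>v. - (x \<bullet> v))) (at x)"
  by (auto intro!: derivative_eq_intros simp: inner_commute)
 have 2: "(exp has_derivative (\<lambda>z. exp (- (x \<bullet> x) / 2) * z)) (at (- (x \<bullet> x) / 2))"
  using DERIV_exp unfolding has_field_derivative_def .
 have "((\<lambda>x. cr (exp (- (x \<bullet> x) / 2))) has_derivative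
   (\<lambda>v. cr (exp (- (x \<bullet> x) / 2) * (- (x \<bullet> v))))) (at x)"
  by (intro has_derivative_of_real has_derivative_compose[OF 1 2])
 then show ?thesis unfolding gauss_def[abs_def] by (simp add: mult.commute)
qed

text \<open>The inequality \<open>1 + r \<le> M * exp ((1 + r) / M)\<close> is raised to the power
  \<open>M\<close>, and \<open>1 + r - r\<^sup>2 / 2\<close> never exceeds 3/2.\<close>

lemma poly_exp_bound: "\<exists>C. \<forall>r\<ge>0. (1 + r) ^ M * exp (- r\<^sup>2 / 2) \<le> (C::real)"
proof (cases "M = 0")
 case True then show ?thesis by (intro exI[of _ 1]) auto
next
 case False
 have "(1 + r) ^ M * exp (- r\<^sup>2 / 2) \<le> real M ^ M * exp (3 / 2)" if "0 \<le> r" for r :: real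
 proof -
  have "(1 + r) / real M \<le> exp ((1 + r) / real M)"
   using exp_ge_add_one_self[of "(1 + r) / real M"] by linarith
  then have "1 + r \<le> real M * exp ((1 + r) / real M)" using False by (simp add: field_simps)
  then have "(1 + r) ^ M \<le> (real M * exp ((1 + r) / real M)) ^ M" using that by (intro power_mono) auto
  also have "\<dots> = real M ^ M * exp (1 + r)"
   using False by (simp add: power_mult_distrib exp_of_nat_mult[symmetric])
  finally have "(1 + r) ^ M * exp (- r\<^sup>2 / 2) \<le> real M ^ M * exp (1 + r) * exp (- r\<^sup>2 / 2)"
   by (intro mult_right_mono) auto
  also have "\<dots> = real M ^ M * exp (1 + r - r\<^sup>2 / 2)" by (simp add: exp_add[symmetric] mult.assoc)
  also have "1 + r - r\<^sup>2 / 2 \<le> 3 / 2"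
   using zero_le_power2[of "r - 1"] by (simp add: power2_eq_square algebra_simps)
  then have "real M ^ M * exp (1 + r - r\<^sup>2 / 2) \<le> real M ^ M * exp (3 / 2)" by (intro mult_left_mono) auto
  finally show ?thesis .
 qed
 then show ?thesis by blast
qed

lemma sch_gauss: "sch (gauss :: 'a::euclidean_space => complex)"
 unfolding sch_def
proof
 fix N
 let ?X = "{f :: 'a => complex. \<exists>c k. sm (\<lambda>x. (1 + norm x) ^ k) c \<and> f = (\<lambda>x. c x * gauss x)}"
 have gd: "gauss differentiable at x" for x :: 'a using gauss_has_derivative differentiable_def by blast
 show "sm (dec N) (gauss :: 'a => complex)"
 proof (rule sm_coinduct[of _ ?X])
  have "sm (\<lambda>x::'a. (1 + norm x) ^ 0) (\<lambda>x. 1 :: complex)" by (rule sm_const[of 1]) simp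
  moreover have "gauss = (\<lambda>x::'a. 1 * gauss x)" by simp
  ultimately show "gauss \<in> ?X" by blast
  fix f assume "f \<in> ?X"
  then obtain c k where c: "sm (\<lambda>x. (1 + norm x) ^ k) c" "f = (\<lambda>x. c x * gauss x)" by blast
  show "f differentiable at x" for x unfolding c(2) by (intro differentiable_mult gd smD(1)[OF c(1)])
  show "\<exists>C. \<forall>x. norm (f x) \<le> C * dec N x"
  proof -
   obtain C where C: "0 < C" "\<And>x. norm (c x) \<le> C * (1 + norm x) ^ k" using sm_boundE[OF c(1)] by auto
   obtain D where D: "\<And>r::real. 0 \<le> r \<Longrightarrow> (1 + r) ^ (k + N) * exp (- r\<^sup>2 / 2) \<le> D" using poly_exp_bound by blast
   have "norm (f x) \<le> (C * D) * dec N x" for x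
   proof -
    have "norm (f x) \<le> C * (1 + norm x) ^ k * exp (- (norm x)\<^sup>2 / 2)"
     unfolding c(2) using C by (simp add: norm_mult gauss_def power2_norm_eq_inner mult_right_mono)
    also have "\<dots> = C * ((1 + norm x) ^ (k + N) * exp (- (norm x)\<^sup>2 / 2)) * dec N x"
    proof -
     have "(1 + norm x) ^ k = (1 + norm x) ^ (k + N) * dec N x" by (simp add: power_add power_dec mult.assoc)
     then show ?thesis by (simp only: mult_ac)
    qed
    also have "\<dots> \<le> C * D * dec N x" using C by (intro mult_right_mono mult_left_mono D) auto
    finally show ?thesis .
   qed
   then show ?thesis by blast
  qed
  fix v
  let ?l = "\<lambda>x :: 'a. cr (v \<bullet> x)"
  have L: "bounded_linear ?l"
   by (intro bounded_linear_compose[OF bounded_linear_of_real] bounded_linear_inner_right)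
  have "dd v f = (\<lambda>x. (dd v c x - ?l x * c x) * gauss x)"
  proof
   fix x
   have "dd v f x = c x * dd v gauss x + dd v c x * gauss x"
    unfolding c(2) by (intro dd_mult gd smD(1)[OF c(1)])
   also have "dd v gauss x = - ?l x * gauss x" using dd_eq[OF gauss_has_derivative] by (simp add: inner_commute)
   finally show "dd v f x = (dd v c x - ?l x * c x) * gauss x" by (simp add: algebra_simps)
  qed
  moreover have "sm (\<lambda>x. (1 + norm x) ^ Suc k) (\<lambda>x. dd v c x - ?l x * c x)"
  proof (rule sm_diff)
   show "sm (\<lambda>x. (1 + norm x) ^ Suc k) (dd v c)"
    by (rule sm_mono[OF smD(2)[OF c(1)], of 1]) (auto simp del: power_Suc intro!: power_increasing)
   show "sm (\<lambda>x. (1 + norm x) ^ Suc k) (\<lambda>x. ?l x * c x)"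
    using sm_mult[OF sm_linear[OF L] c(1)] by simp
  qed
  ultimately show "dd v f \<in> ?X" by blast
 qed
qed

lemma integral_gauss: "(\<integral>x. gauss x \<partial>(lborel :: 'a::euclidean_space measure)) = cr ((2 * pi) powr (DIM('a) / 2))"
proof -
 have 1: "(\<integral>\<^sup>+x. ennreal (exp (- x\<^sup>2 / 2)) \<partial>(lborel :: real measure)) = ennreal (sqrt (2 * pi))"
 proof -
  have h: "has_bochner_integral lborel (\<lambda>x. sqrt (2 * pi) * (std_normal_density x * x ^ (2 * 0))) (sqrt (2 * pi) * (fact (2 * 0) / (2^0 * fact 0)))"
   by (intro has_bochner_integral_mult_right std_normal_moment_even)
  have e: "(\<lambda>x. sqrt (2 * pi) * (std_normal_density x * x ^ (2 * 0))) = (\<lambda>x. exp (- x\<^sup>2 / 2))"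
   by (auto simp: std_normal_density_def)
  have i: "L1 (\<lambda>x. exp (- x\<^sup>2 / 2) :: real)" "(\<integral>x. exp (- x\<^sup>2 / 2) \<partial>(lborel :: real measure)) = sqrt (2 * pi)"
   using h unfolding e has_bochner_integral_iff by auto
  show ?thesis using nn_integral_eq_integral[OF i(1)] i(2) by simp
 qed
 have "(\<integral>\<^sup>+x. ennreal (exp (- (x \<bullet> x) / 2)) \<partial>(lborel :: 'a measure))
   = (\<integral>\<^sup>+x. (\<Prod>b\<in>Basis. ennreal (exp (- (x \<bullet> b)\<^sup>2 / 2))) \<partial>(lborel :: 'a measure))"
  by (simp add: prod_ennreal exp_sum[symmetric] sum_negf sum_divide_distrib[symmetric] euclidean_inner[symmetric] power2_eq_square)
 also have "\<dots> = (\<Prod>b\<in>(Basis :: 'a set). (\<integral>\<^sup>+x. ennreal (exp (- x\<^sup>2 / 2)) \<partial>(lborel :: real measure)))"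
  by (rule nn_integral_lborel_prod) auto
 also have "\<dots> = ennreal (sqrt (2 * pi) ^ DIM('a))" by (simp only: 1 prod_constant ennreal_power[OF real_sqrt_ge_zero] pi_ge_zero mult_nonneg_nonneg zero_le_numeral)
 finally have "(\<integral>x. exp (- (x \<bullet> x) / 2) \<partial>(lborel :: 'a measure)) = sqrt (2 * pi) ^ DIM('a)"
  by (intro integral_eq_nn_integral[THEN trans]) auto
 moreover have "sqrt (2 * pi) ^ DIM('a) = (2 * pi) powr (DIM('a) / 2)"
  by (simp add: powr_half_sqrt[symmetric] powr_realpow[symmetric] powr_powr)
 ultimately show ?thesis unfolding gauss_def by (simp only: integral_complex_of_real)
qed

text \<open>The Gaussian and its transform solve the same equation
  \<open>dd v u x = - cr (x \<bullet> v) * u x\<close>, so the transform times the reciprocal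
  Gaussian \<open>E\<close> is constant; its value at 0 is the Gaussian integral.\<close>

lemma fm_gauss: "fm gauss x = cr ((2 * pi) powr (DIM('a) / 2)) * gauss (x :: 'a::euclidean_space)"
proof -
 have d: "dd v (fm gauss) x = - cr (x \<bullet> v) * fm gauss x" for v x :: 'a
 proof -
  have e: "(\<lambda>z :: 'a. - \<i> * cr (v \<bullet> z) * gauss z) = (\<lambda>z. \<i> * dd v gauss z)"
   by (simp add: fun_eq_iff dd_eq[OF gauss_has_derivative] inner_commute[of v])
  have "dd v (fm gauss) x = fm (\<lambda>z. \<i> * dd v gauss z) x" unfolding dd_fm[OF sch_gauss] e ..
  also have "\<dots> = \<i> * fm (dd v gauss) x" by (simp add: fm_def mult.left_commute[of _ \<i>])
  also have "\<dots> = - cr (x \<bullet> v) * fm gauss x" by (simp add: fm_dd[OF sch_gauss] inner_commute[of x v] mult.assoc)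
  finally show ?thesis .
 qed
 define E where "E x = cr (exp ((x \<bullet> x) / 2))" for x :: 'a
 have Ed: "(E has_derivative (\<lambda>v. cr (x \<bullet> v) * E x)) (at x)" for x
 proof -
  have 1: "((\<lambda>x :: 'a. (x \<bullet> x) / 2) has_derivative (\<lambda>v. (x \<bullet> v))) (at x)"
   by (auto intro!: derivative_eq_intros simp: inner_commute)
  have 2: "(exp has_derivative (\<lambda>z. exp ((x \<bullet> x) / 2) * z)) (at ((x \<bullet> x) / 2))"
   using DERIV_exp unfolding has_field_derivative_def .
  have "((\<lambda>x. cr (exp ((x \<bullet> x) / 2))) has_derivative
    (\<lambda>v. cr (exp ((x \<bullet> x) / 2) * (x \<bullet> v)))) (at x)"
   by (intro has_derivative_of_real has_derivative_compose[OF 1 2])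
  then show ?thesis unfolding E_def[abs_def] by (simp add: mult.commute)
 qed
 have "((\<lambda>x. fm gauss x * E x) has_derivative (\<lambda>v. 0)) (at x within UNIV)" for x
  using has_derivative_mult[OF has_derivative_dd[OF sch_differentiable[OF sch_fm[OF sch_gauss]], of x] Ed[of x]]
  by (simp add: d algebra_simps)
 then obtain c where c: "\<And>x. x \<in> UNIV \<Longrightarrow> fm gauss x * E x = c"
  using has_derivative_zero_constant[of UNIV "\<lambda>x. fm gauss x * E x"] by blast
 have "fm gauss x * E x = fm gauss (0 :: 'a) * E 0" using c[of x] c[of 0] by simp
 moreover have "fm gauss (0 :: 'a) = cr ((2 * pi) powr (DIM('a) / 2))"
  using integral_gauss[where 'a = 'a] by (simp add: fm_def)
 moreover have "E 0 = 1" "E x * gauss x = 1"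
  by (auto simp: E_def gauss_def of_real_mult[symmetric] exp_add[symmetric] simp del: of_real_mult)
 ultimately show ?thesis by (metis mult.assoc mult.right_neutral)
qed

lemma integral_scale:
 fixes f :: "'a::euclidean_space => complex"
 assumes "f \<in> borel_measurable borel" "s \<noteq> 0"
 shows "(\<integral>x. f x) = cr (\<bar>s\<bar> ^ DIM('a)) * (\<integral>x. f (s *\<^sub>R x))"
proof -
 have "(\<integral>x. f x) = (\<integral>x. f x \<partial>density (distr lborel borel (\<lambda>x. 0 + s *\<^sub>R x)) (\<lambda>_. ennreal (\<bar>s\<bar> ^ DIM('a))))"
  using lborel_affine[OF assms(2), of "0 :: 'a"] by (simp add: ennreal_power)
 also have "\<dots> = (\<integral>x. \<bar>s\<bar> ^ DIM('a) *\<^sub>R f (s *\<^sub>R x))"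
  using assms(1) by (simp add: integral_density integral_distr)
 finally show ?thesis by (simp add: scaleR_conv_of_real)
qed

lemma integrable_pair_mult:
 fixes a :: "'a => complex" and b :: "'b => complex"
 assumes "sigma_finite_measure M1" "sigma_finite_measure M2" "integrable M1 a" "integrable M2 b"
  and k: "k \<in> borel_measurable (M1 \<Otimes>\<^sub>M M2)" "\<And>x. cmod (k x) \<le> K"
 shows "integrable (M1 \<Otimes>\<^sub>M M2) (\<lambda>(x, y). k (x, y) * (a x * b y))"
proof -
 interpret M1: sigma_finite_measure M1 by fact
 interpret M2: sigma_finite_measure M2 by fact
 interpret P: pair_sigma_finite M1 M2 ..
 have [measurable]: "a \<in> borel_measurable M1" "b \<in> borel_measurable M2" using assms by auto
 have "integrable (M1 \<Otimes>\<^sub>M M2) (\<lambda>(x, y). a x * b y)"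
 proof (rule P.Fubini_integrable)
  show "integrable M1 (\<lambda>x. LINT y|M2. norm (case (x, y) of (x, y) => a x * b y))"
   using assms by (simp add: norm_mult)
  show "AE x in M1. integrable M2 (\<lambda>y. case (x, y) of (x, y) => a x * b y)"
   using assms by simp
 qed simp
 then have "integrable (M1 \<Otimes>\<^sub>M M2) (\<lambda>x. K * norm (case x of (x, y) => a x * b y))" by simp
 then show ?thesis
 proof (rule Bochner_Integration.integrable_bound)
  show "(\<lambda>(x, y). k (x, y) * (a x * b y)) \<in> borel_measurable (M1 \<Otimes>\<^sub>M M2)"
   using k(1) by (simp add: case_prod_beta')
  show "AE x in M1 \<Otimes>\<^sub>M M2. norm (case x of (x, y) => k (x, y) * (a x * b y)) \<le> norm (K * norm (case x of (x, y) => a x * b y))"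
  proof (rule AE_I2, clarify)
   fix x y
   have "0 \<le> K" using k(2) norm_ge_zero order_trans by blast
   then show "norm (k (x, y) * (a x * b y)) \<le> norm (K * norm (a x * b y))"
    using mult_right_mono[OF k(2)[of "(x, y)"], of "norm (a x * b y)"] by (simp add: norm_mult)
  qed
 qed
qed

lemma fm_parseval:
 fixes a b :: "'a::euclidean_space => complex"
 assumes "L1 a" "L1 b"
 shows "(\<integral>x. fm a x * b x) = (\<integral>x. a x * fm b x)"
proof -
 let ?k = "\<lambda>x :: 'a \<times> 'a. en (fst x) (snd x)"
 have "continuous_on UNIV ?k" by (intro continuous_intros)
 then have k: "?k \<in> borel_measurable (lborel \<Otimes>\<^sub>M lborel)"
  using borel_measurable_continuous_onI by (simp add: borel_prod[symmetric] cong: measurable_cong_sets)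
 have i: "integrable (lborel \<Otimes>\<^sub>M lborel) (\<lambda>(x, z). ?k (x, z) * (b x * a z))"
  by (rule integrable_pair_mult[where K = 1]) (use assms k in \<open>auto simp: lborel.sigma_finite_measure_axioms\<close>)
 have 1: "fm a x * b x = (\<integral>z. ?k (x, z) * (b x * a z))" for x
  unfolding fm_def integral_mult_left_zero[symmetric]
  by (rule integral_cong) (auto simp: mult_ac inner_commute)
 have 2: "(\<integral>x. ?k (x, z) * (b x * a z)) = a z * fm b z" for z
  unfolding fm_def integral_mult_right_zero[symmetric]
  by (rule integral_cong) (auto simp: mult_ac inner_commute)
 have "(\<integral>x. fm a x * b x) = (\<integral>x. (\<integral>z. ?k (x, z) * (b x * a z)))"
  by (simp only: 1)
 also have "\<dots> = (\<integral>z. (\<integral>x. ?k (x, z) * (b x * a z)))"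
  using lborel_pair.Fubini_integral[OF i] by simp
 also have "\<dots> = (\<integral>z. a z * fm b z)" by (simp only: 2)
 finally show ?thesis .
qed

text \<open>Inversion at the origin. A Gaussian of width 1/s damps the transform;
  \<open>fm_parseval\<close> and a rescaling turn this into an average of \<open>w\<close> near 0,
  and s tends to 0 on both sides.\<close>

lemma integral_fm:
 fixes w :: "'a::euclidean_space => complex"
 assumes w: "sch w"
 shows "(\<integral>x. fm w x) = cr ((2 * pi) powr DIM('a)) * w 0"
proof -
 define c where "c = cr ((2 * pi) powr (DIM('a) / 2))"
 define s where "s n = inverse (real (Suc n))" for n
 have s0: "0 < s n" for n by (simp add: s_def)
 have sl: "s \<longlonglongrightarrow> 0" unfolding s_def by (rule LIMSEQ_inverse_real_of_nat)
 have iw: "L1 w" "L1 (fm w)" by (intro sch_integrable sch_fm w)+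
 have gb: "gauss \<in> borel_measurable (borel :: 'a measure)" by (rule sch_measurable[OF sch_gauss])
 have wb: "w \<in> borel_measurable borel" by (rule sch_measurable[OF w])
 have gs: "sch (\<lambda>x :: 'a. gauss (s n *\<^sub>R x))" for n
 proof -
  have "norm x \<le> inverse (s n) * norm (s n *\<^sub>R x)" for x :: 'a using s0[of n] by (simp add: mult.assoc[symmetric])
  from sch_comp_affine[OF bounded_linear_scaleR_right this _ sch_gauss, of 0] s0[of n]
  show ?thesis by simp
 qed
 have fg: "cr (s n ^ DIM('a)) * fm (\<lambda>x. gauss (s n *\<^sub>R x)) (s n *\<^sub>R z) = c * gauss z" for n and z :: 'a
 proof -
  have "c * gauss z = fm gauss z" by (simp add: fm_gauss c_def)
  also have "\<dots> = cr (s n ^ DIM('a)) * fm (\<lambda>x. gauss (s n *\<^sub>R x)) (s n *\<^sub>R z)"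
   unfolding fm_def
   by (subst integral_scale[of _ "s n"]) (use s0[of n] gb in simp_all)
  finally show ?thesis by simp
 qed
 have eq: "(\<integral>x. fm w x * gauss (s n *\<^sub>R x)) = (\<integral>z. w (s n *\<^sub>R z) * (c * gauss z))" for n
 proof -
  have "(\<integral>x. fm w x * gauss (s n *\<^sub>R x)) = (\<integral>x. w x * fm (\<lambda>x. gauss (s n *\<^sub>R x)) x)"
   by (intro fm_parseval iw sch_integrable gs)
  also have "\<dots> = cr (s n ^ DIM('a)) * (\<integral>z. w (s n *\<^sub>R z) * fm (\<lambda>x. gauss (s n *\<^sub>R x)) (s n *\<^sub>R z))"
   using s0[of n] by (subst integral_scale[of _ "s n"])
    (auto intro!: borel_measurable_times wb sch_measurable[OF sch_fm[OF gs]])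
  also have "\<dots> = (\<integral>z. w (s n *\<^sub>R z) * (c * gauss z))"
   unfolding fg[of n, symmetric] integral_mult_right_zero[symmetric]
   by (rule integral_cong) (simp_all only: mult_ac)
  finally show ?thesis .
 qed
 have ng: "cmod (gauss x) \<le> 1" for x :: 'a by (simp add: gauss_def)
 have l1: "(\<lambda>n. \<integral>x. fm w x * gauss (s n *\<^sub>R x) \<partial>lborel) \<longlonglongrightarrow> (\<integral>x. fm w x)"
 proof (rule integral_dominated_convergence[where w = "\<lambda>x. cmod (fm w x)"])
  show "AE x :: 'a in lborel. (\<lambda>n. fm w x * gauss (s n *\<^sub>R x)) \<longlonglongrightarrow> fm w x"
  proof (rule AE_I2)
   fix x :: 'a
   have "(\<lambda>n. gauss (s n *\<^sub>R x)) \<longlonglongrightarrow> gauss (0 *\<^sub>R x)"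
    using sch_continuous[OF sch_gauss]
    by (intro continuous_on_tendsto_compose[of UNIV gauss] tendsto_intros sl) auto
   then show "(\<lambda>n. fm w x * gauss (s n *\<^sub>R x)) \<longlonglongrightarrow> fm w x"
    using tendsto_mult_left[of _ 1 sequentially "fm w x"] by (simp add: gauss_def)
  qed
  show "AE x :: 'a in lborel. norm (fm w x * gauss (s n *\<^sub>R x)) \<le> cmod (fm w x)" for n
   using ng by (intro AE_I2) (simp add: norm_mult mult_left_le)
 qed (use iw sch_measurable[OF gs] in auto)
 obtain K where K: "0 < K" "\<And>x. cmod (w x) \<le> K * dec 0 x"
  using sch_boundE[OF w, where N = 0] by blast
 have l2: "(\<lambda>n. \<integral>z. w (s n *\<^sub>R z) * (c * gauss z) \<partial>lborel) \<longlonglongrightarrow> (\<integral>z. w 0 * (c * gauss z) \<partial>(lborel :: 'a measure))"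
 proof (rule integral_dominated_convergence[where w = "\<lambda>z. K * cmod (c * gauss z)"])
  show "AE z :: 'a in lborel. (\<lambda>n. w (s n *\<^sub>R z) * (c * gauss z)) \<longlonglongrightarrow> w 0 * (c * gauss z)"
  proof (rule AE_I2)
   fix z :: 'a
   have "(\<lambda>n. w (s n *\<^sub>R z)) \<longlonglongrightarrow> w (0 *\<^sub>R z)"
    using sch_continuous[OF w]
    by (intro continuous_on_tendsto_compose[of UNIV w] tendsto_intros sl) auto
   then show "(\<lambda>n. w (s n *\<^sub>R z) * (c * gauss z)) \<longlonglongrightarrow> w 0 * (c * gauss z)"
    by (intro tendsto_intros) simp
  qed
  show "AE z :: 'a in lborel. norm (w (s n *\<^sub>R z) * (c * gauss z)) \<le> K * cmod (c * gauss z)" for n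
  proof (rule AE_I2)
   fix z :: 'a
   have "cmod (w (s n *\<^sub>R z)) \<le> K" using K(2)[of "s n *\<^sub>R z"] by simp
   then show "norm (w (s n *\<^sub>R z) * (c * gauss z)) \<le> K * cmod (c * gauss z)"
    by (simp add: norm_mult mult_right_mono)
  qed
  show "L1 (\<lambda>z :: 'a. K * cmod (c * gauss z))"
   by (intro integrable_mult_right integrable_norm sch_integrable sch_gauss)
 qed (use wb gb in auto)
 have "(\<integral>x. fm w x) = (\<integral>z. w 0 * (c * gauss z) \<partial>(lborel :: 'a measure))"
  using LIMSEQ_unique[OF l1] l2 eq by simp
 also have "\<dots> = w 0 * (c * c)" by (simp add: integral_gauss c_def)
 also have "c * c = cr ((2 * pi) powr DIM('a))"
  unfolding c_def of_real_mult[symmetric] by (subst powr_add[symmetric]) simp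
 finally show ?thesis by simp
qed

text \<open>Inversion at \<open>x\<close> is inversion at 0 for the translate of \<open>u\<close> by
  \<open>x\<close>, whose transform is that of \<open>u\<close> times a character.\<close>

lemma fm_fm:
 fixes u :: "'a::euclidean_space => complex"
 assumes u: "sch u"
 shows "fm (fm u) (- x) = cr ((2 * pi) powr DIM('a)) * u x"
proof -
 define w where "w z = u (z + x)" for z
 have w: "sch w" unfolding w_def by (rule sch_translate[OF u])
 have fw: "fm w k = en k (- x) * fm u k" for k
 proof -
  have m: "(\<lambda>z. en z k * u z) \<in> borel_measurable borel"
   using sch_measurable[OF u] by measurable
  have "fm u k = (\<integral>z. en (x + z) k * u (x + z))"
   unfolding fm_def using integral_translate[OF m, of x] by simp
  also have "\<dots> = (\<integral>z. en x k * (en z k * w z))"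
   by (rule integral_cong)
    (simp_all add: w_def inner_add_left exp_add[symmetric] mult.assoc[symmetric] distrib_left add_ac)
  also have "\<dots> = en x k * fm w k" by (simp add: fm_def)
  finally have "fm u k = en x k * fm w k" .
  then show ?thesis by (simp add: mult.assoc[symmetric] exp_add[symmetric] inner_commute)
 qed
 have "fm (fm u) (- x) = (\<integral>k. fm w k)" by (simp add: fm_def[of "fm u"] fw)
 then show ?thesis using integral_fm[OF w] by (simp add: w_def)
qed

text \<open>The normalising factor depends on the space only through its dimension, hence the
  argument of type \<open>itself\<close>.\<close>

definition kap :: "'a::euclidean_space itself => complex" where
 "kap _ = cr ((2 * pi) powr (- real DIM('a) / 2))"

lemma kap_square: "kap TYPE('a::euclidean_space) * kap TYPE('a) * cr ((2 * pi) powr DIM('a)) = 1"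
 unfolding kap_def of_real_mult[symmetric] by (simp add: powr_add[symmetric])

lemma kap_neq_0: "kap TYPE('a::euclidean_space) \<noteq> 0" and cnj_kap: "cnj (kap TYPE('a)) = kap TYPE('a)"
 by (auto simp: kap_def)

definition four :: "('a::euclidean_space => complex) => 'a => complex" where
 "four u x = kap TYPE('a) * fm u x"

lemma fourier_eq: "fourier = four"
 by (auto simp: fun_eq_iff fourier_def four_def fm_def kap_def)

lemma sch_four: "sch u \<Longrightarrow> sch (four u)"
 unfolding four_def[abs_def] by (intro sch_cmult sch_fm)

lemma four_four:
 fixes u :: "'a::euclidean_space => complex"
 assumes "sch u" shows "four (four u) (- x) = u x"
proof -
 have "four (four u) (- x) = kap TYPE('a) * kap TYPE('a) * fm (fm u) (- x)"
  by (simp add: four_def fm_def mult.left_commute)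
 then show ?thesis using kap_square[where 'a = 'a] by (simp add: fm_fm[OF assms] mult.assoc[symmetric])
qed

definition ifour :: "('a::euclidean_space => complex) => 'a => complex" where
 "ifour u x = four u (- x)"

lemma sch_ifour: "sch u \<Longrightarrow> sch (ifour u)"
 unfolding ifour_def[abs_def] by (intro sch_uminus sch_four)

lemma ifour_four: "sch u \<Longrightarrow> ifour (four u) = u"
 by (auto simp: ifour_def four_four)

lemma four_uminus: "four (\<lambda>x. u (- x)) x = four u (- x)" if "sch u"
proof -
 have m: "(\<lambda>z. en z (- x) * u z) \<in> borel_measurable borel"
  using sch_measurable[OF that] by measurable
 show ?thesis unfolding four_def fm_def
  using integral_scale[OF m, of "-1"] by simp
qed

lemma four_ifour: "sch u \<Longrightarrow> four (ifour u) = u"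
proof
 fix x assume u: "sch u"
 have "four (ifour u) x = four (four u) (- x)"
  unfolding ifour_def[abs_def] by (rule four_uminus[OF sch_four[OF u]])
 then show "four (ifour u) x = u x" by (simp add: four_four[OF u])
qed

lemma ifour_eq: "ifour h x = kap TYPE('a) * (\<integral>z. ee x z * h z \<partial>(lborel :: 'a::euclidean_space measure))"
 by (simp add: ifour_def four_def fm_def inner_commute)

lemma cnj_fm: "cnj (fm h x) = fm (\<lambda>z. cnj (h z)) (- x)"
proof -
 have "cnj (fm h x) = (\<integral>z. cnj (en z x * h z))"
  unfolding fm_def by (rule Bochner_Integration.integral_cnj[symmetric])
 then show ?thesis by (simp add: fm_def exp_cnj)
qed

lemma cnj_ifour: "cnj (ifour h x) = four (\<lambda>z. cnj (h z)) x"
 by (simp add: ifour_def four_def cnj_kap cnj_fm)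

lemma plancherel:
 fixes u v :: "'a::euclidean_space => complex"
 assumes "sch u" "sch v"
 shows "(\<integral>x. u x * cnj (v x)) = (\<integral>x. four u x * cnj (four v x))"
proof -
 have "cnj (v x) = four (\<lambda>z. cnj (four v z)) x" for x
  using cnj_ifour[of "four v" x] by (simp add: ifour_four assms)
 then have "(\<integral>x. u x * cnj (v x)) = kap TYPE('a) * (\<integral>x. u x * fm (\<lambda>z. cnj (four v z)) x)"
  by (simp add: four_def mult.left_commute)
 also have "\<dots> = kap TYPE('a) * (\<integral>x. fm u x * cnj (four v x))"
  by (subst fm_parseval) (auto intro!: sch_integrable sch_cnj sch_four assms)
 also have "\<dots> = (\<integral>x. four u x * cnj (four v x))" by (simp add: four_def mult.assoc)
 finally show ?thesis .
qed

section \<open>Boundedness of oscillatory forms\<close>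

definition ten :: "('a => complex) => ('a => complex) => 'a \<times> 'a => complex" where
 "ten h l z = h (fst z) * l (snd z)"

lemma sch_ten:
 fixes h l :: "'a::euclidean_space => complex"
 assumes "sch h" "sch l"
 shows "sch (ten h l)"
 unfolding sch_def
proof
 fix N
 have "sm (\<lambda>x. dec N (fst x) * dec N (snd x)) (\<lambda>x. h (fst x) * l (snd x))"
  by (intro sm_mult sm_comp[OF bounded_linear_fst] sm_comp[OF bounded_linear_snd] schD assms)
 then show "sm (dec N) (ten h l)"
  unfolding ten_def[abs_def]
 proof (rule sm_mono[where c = 1])
  fix x :: "'a \<times> 'a"
  have "norm x \<le> norm (fst x) + norm (snd x)" using norm_Pair_le[of "fst x" "snd x"] by simp
  then have "1 + norm x \<le> (1 + norm (fst x)) * (1 + norm (snd x))"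
   by (simp add: algebra_simps) (smt (verit) mult_nonneg_nonneg norm_ge_zero)
  then have "(1 + norm x) ^ N \<le> (1 + norm (fst x)) ^ N * (1 + norm (snd x)) ^ N"
   by (metis norm_ge_zero power_mono power_mult_distrib add_nonneg_nonneg zero_le_one)
  moreover have "0 < (1 + norm x) ^ N" by (intro zero_less_power) (simp add: add_pos_nonneg)
  ultimately show "dec N (fst x) * dec N (snd x) \<le> 1 * dec N x"
   unfolding dec_def inverse_mult_distrib[symmetric] mult_1 by (rule le_imp_inverse_le)
 qed simp
qed

text \<open>On Fourier transforms this is multiplication by
  \<open>1 + \<i> * cr (v \<bullet> z)\<close> under the transform (\<open>eop_four\<close>), which
  has no zeros and is undone by a factor of \<open>window\<close>.\<close>

definition eop :: "'a::real_normed_vector => ('a => complex) => 'a => complex" where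
 "eop v H = (\<lambda>x. H x - dd v H x)"

definition eops :: "'a::real_normed_vector list => ('a => complex) => 'a => complex" where
 "eops vs H = foldr eop vs H"

lemma eops_simps [simp]: "eops [] H = H" "eops (v # vs) H = eop v (eops vs H)"
 "eops (vs @ ws) H = eops vs (eops ws H)"
 by (auto simp: eops_def)

lemma sch_eop: "sch H \<Longrightarrow> sch (eop v H)"
 unfolding eop_def by (intro sch_diff sch_dd)

lemma sch_eops: "sch H \<Longrightarrow> sch (eops vs H)"
 by (induction vs) (auto intro: sch_eop)

lemma eop_ten:
 fixes h l :: "'a::euclidean_space => complex"
 assumes "sch h" "sch l"
 shows "eop (b, 0) (ten h l) = ten (eop b h) l" "eop (0, b) (ten h l) = ten h (eop b l)"
proof -
 have z: "dd 0 f x = 0" if "sch f" for f :: "'a => complex" and x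
  unfolding dd_def using linear_0[OF linear_frechet_derivative[OF sch_differentiable[OF that]]] .
 have 1: "dd v (\<lambda>x. h (fst x)) x = dd (fst v) h (fst x)" "dd v (\<lambda>x. l (snd x)) x = dd (snd v) l (snd x)"
  "(\<lambda>x. h (fst x)) differentiable at x" "(\<lambda>x. l (snd x)) differentiable at x" for v x :: "'a \<times> 'a"
  using dd_comp_affine(1)[OF bounded_linear_fst, of h x 0 v] dd_comp_affine(1)[OF bounded_linear_snd, of l x 0 v]
   dd_comp_affine(2)[OF bounded_linear_fst, of h x 0] dd_comp_affine(2)[OF bounded_linear_snd, of l x 0]
   sch_differentiable[OF assms(1)] sch_differentiable[OF assms(2)] by simp_all
 have d: "dd v (ten h l) x = h (fst x) * dd (snd v) l (snd x) + dd (fst v) h (fst x) * l (snd x)" for v x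
  unfolding ten_def[abs_def] using dd_mult[OF 1(3,4), of v x] by (simp add: 1)
 show "eop (b, 0) (ten h l) = ten (eop b h) l" "eop (0, b) (ten h l) = ten h (eop b l)"
  by (auto simp: fun_eq_iff eop_def d z assms ten_def algebra_simps)
qed

lemma eops_ten:
 fixes h l :: "'a::euclidean_space => complex"
 assumes "sch h" "sch l"
 shows "eops (map (\<lambda>b. (b, 0)) bs @ map (\<lambda>b. (0, b)) bs') (ten h l) = ten (eops bs h) (eops bs' l)"
proof -
 have "eops (map (\<lambda>b. (0, b)) bs') (ten h l) = ten h (eops bs' l)"
  by (induction bs') (simp_all add: eop_ten(2) sch_eops assms)
 moreover have "eops (map (\<lambda>b. (b, 0)) bs) (ten h l') = ten (eops bs h) l'" if "sch l'" for l'
  by (induction bs) (simp_all add: eop_ten(1) sch_eops assms that)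
 ultimately show ?thesis by (simp add: sch_eops assms)
qed

lemma eop_cnj: "sch h \<Longrightarrow> eop b (\<lambda>x. cnj (h x)) = (\<lambda>x. cnj (eop b h x))"
proof
 fix x assume h: "sch h"
 have "((\<lambda>x. cnj (h x)) has_derivative (\<lambda>v. cnj (dd v h x))) (at x)"
  by (intro bounded_linear.has_derivative[OF bounded_linear_cnj] has_derivative_dd sch_differentiable h)
 then show "eop b (\<lambda>x. cnj (h x)) x = cnj (eop b h x)" by (simp add: eop_def dd_eq)
qed

lemma eops_cnj: "sch h \<Longrightarrow> eops bs (\<lambda>x. cnj (h x)) = (\<lambda>x. cnj (eops bs h x))"
 by (induction bs) (simp_all add: eop_cnj sch_eops)

text \<open>The variables are ((y, x), (\<xi>, \<eta>)): y is the centre of a localisation and x the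
  position relative to it. The degree \<open>j\<close> in x is produced by integrations by parts,
  the degree \<open>M\<close> in \<xi> - \<eta> is there from the start.\<close>

definition pw :: "nat => nat => ('a::real_normed_vector \<times> 'a) \<times> ('a \<times> 'a) => real" where
 "pw j M = (\<lambda>(p, z). (1 + norm (snd p)) ^ j * (1 + norm (fst z - snd z)) ^ M)"

lemma pw_nonneg: "0 \<le> pw j M z"
 by (simp add: pw_def case_prod_beta')

definition osf :: "(('a::euclidean_space \<times> 'a) \<times> ('a \<times> 'a) => complex) => 'a => 'a => ('a \<times> 'a => complex) => complex" where
 "osf c y x H = (\<integral>z. (ee (x, - x) z * c ((y, x), z)) * H z)"

lemma norm_diff_le_Pair: "1 + norm (fst z - snd z) \<le> 2 * (1 + norm z)"
 using norm_triangle_ineq4[of "fst z" "snd z"] norm_fst_le[of "fst z" "snd z"] norm_snd_le[of "snd z" "fst z"]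
 by simp

lemma osf_slice:
 fixes c :: "('a::euclidean_space \<times> 'a) \<times> ('a \<times> 'a) => complex"
 assumes c: "sm (pw j M) c"
 shows "sm (\<lambda>z. (1 + norm x) ^ j * (1 + norm (fst z - snd z)) ^ M) (\<lambda>z. c ((y, x), z))"
  "sm (\<lambda>z. (1 + norm x) ^ j * (1 + norm (fst z - snd z)) ^ M) (\<lambda>z. ee d z * c ((y, x), z))"
proof -
 show 1: "sm (\<lambda>z. (1 + norm x) ^ j * (1 + norm (fst z - snd z)) ^ M) (\<lambda>z. c ((y, x), z))"
  using sm_comp_affine[OF bounded_linear_Pairs(1) c, of "((y, x), 0)"] by (simp add: pw_def)
 show "sm (\<lambda>z. (1 + norm x) ^ j * (1 + norm (fst z - snd z)) ^ M) (\<lambda>z. ee d z * c ((y, x), z))"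
  using sm_mult[OF sm_cis 1] by simp
qed

lemma osf_weight: "(1 + norm x) ^ j * (1 + norm (fst z - snd z)) ^ M \<le> ((1 + norm x) ^ j * 2 ^ M) * (1 + norm z) ^ M"
proof -
 have "(1 + norm (fst z - snd z)) ^ M \<le> (2 * (1 + norm z)) ^ M"
  by (intro power_mono norm_diff_le_Pair) simp
 then have "(1 + norm x) ^ j * (1 + norm (fst z - snd z)) ^ M \<le> (1 + norm x) ^ j * (2 * (1 + norm z)) ^ M"
  by (intro mult_left_mono) auto
 then show ?thesis by (simp only: power_mult_distrib mult.assoc)
qed

text \<open>By parts the derivative moves from \<open>H\<close> to the exponential, at the cost of
  one power of \<open>1 + norm x\<close>, and to the amplitude, which stays in its class. The new
  amplitude is the same for all \<open>H\<close>, \<open>y\<close>, \<open>x\<close>, so constants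
  stay uniform.\<close>

lemma osf_eop:
 fixes c :: "('a::euclidean_space \<times> 'a) \<times> ('a \<times> 'a) => complex"
 assumes c: "sm (pw j M) c"
 shows "\<exists>c'. sm (pw (Suc j) M) c' \<and> (\<forall>H y x. sch H \<longrightarrow> osf c y x (eop v H) = osf c' y x H)"
proof (intro exI conjI allI impI)
 define lin where "lin = (\<lambda>z :: ('a \<times> 'a) \<times> ('a \<times> 'a). \<i> * cr (snd (fst z) \<bullet> (fst v - snd v)))"
 define c' where "c' = (\<lambda>z. c z + (lin z * c z + dd (0, v) c z))"
 let ?l = "\<lambda>x :: 'a. cr (x \<bullet> (fst v - snd v))"
 have l: "bounded_linear ?l"
  by (intro bounded_linear_compose[OF bounded_linear_of_real] bounded_linear_inner_left)
 have "sm (\<lambda>z. 1 + norm (snd (fst z))) lin"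
  unfolding lin_def
  using sm_cmult[OF sm_comp[OF bounded_linear_compose[OF bounded_linear_snd bounded_linear_fst] sm_linear[OF l]]] .
 from sm_mult[OF this c] have lc: "sm (pw (Suc j) M) (\<lambda>z. lin z * c z)"
  by (simp add: pw_def case_prod_beta' mult.assoc)
 have up: "sm (pw (Suc j) M) d" if "sm (pw j M) d" for d :: "('a \<times> 'a) \<times> ('a \<times> 'a) => complex"
  by (rule sm_mono[OF that pw_nonneg, of 1])
   (auto simp: pw_def case_prod_beta' simp del: power_Suc intro!: mult_right_mono power_increasing)
 show "sm (pw (Suc j) M) c'"
  unfolding c'_def by (intro sm_add lc up c smD(2)[OF c])
 fix H :: "'a \<times> 'a => complex" and y x :: 'a
 assume H: "sch H"
 let ?e = "\<lambda>w. ee (x, - x) w"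
 let ?g = "\<lambda>w. ?e w * c ((y, x), w)"
 note g = osf_slice(2)[OF c, of x "(x, - x)" y]
 have dg: "dd v ?g w = ?e w * dd (0, v) c ((y, x), w) + (\<i> * cr ((x, - x) \<bullet> v) * ?e w) * c ((y, x), w)" for w
 proof -
  have cd: "c differentiable at z" for z by (rule smD(1)[OF c])
  have "(\<lambda>w. c ((y, x), w)) differentiable at w" by (rule smD(1)[OF osf_slice(1)[OF c]])
  moreover have "?e differentiable at w" using cis_has_derivative differentiable_def by blast
  ultimately show ?thesis
   by (simp add: dd_mult dd_slice(1)[OF cd] dd_eq[OF cis_has_derivative])
 qed
 have i: "L1 (\<lambda>w. ?g w * H w)" "L1 (\<lambda>w. ?g w * dd v H w)" "L1 (\<lambda>w. dd v ?g w * H w)"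
  by (intro sch_integrable sch_mult[OF g _ osf_weight] sch_mult[OF smD(2)[OF g] _ osf_weight] H sch_dd, simp)+
 have "osf c y x (eop v H) = (\<integral>w. ?g w * H w - ?g w * dd v H w)"
  by (simp add: osf_def eop_def right_diff_distrib)
 also have "\<dots> = (\<integral>w. ?g w * H w) - (\<integral>w. ?g w * dd v H w)"
  by (rule integral_diff[OF i(1,2)])
 also have "(\<integral>w. ?g w * dd v H w) = - (\<integral>w. dd v ?g w * H w)"
  by (rule integral_by_parts[OF g _ osf_weight H]) simp
 also have "(\<integral>w. ?g w * H w) - - (\<integral>w. dd v ?g w * H w)
   = (\<integral>w. ?g w * H w + dd v ?g w * H w)"
  using integral_add[OF i(1,3)] by simp
 also have "\<dots> = osf c' y x H"
  unfolding osf_def dg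
  by (rule integral_cong)
   (simp_all add: c'_def lin_def algebra_simps inner_diff_right inner_Pair_0 inner_prod_def)
 finally show "osf c y x (eop v H) = osf c' y x H" .
qed

lemma osf_eops:
 fixes c :: "('a::euclidean_space \<times> 'a) \<times> ('a \<times> 'a) => complex"
 assumes c: "sm (pw j M) c"
 shows "\<exists>j' c'. sm (pw j' M) c' \<and> (\<forall>H y x. sch H \<longrightarrow> osf c y x (eops vs H) = osf c' y x H)"
 using c
proof (induction vs arbitrary: c j)
 case Nil then show ?case by auto
next
 case (Cons v vs)
 obtain c1 where c1: "sm (pw (Suc j) M) c1" "\<And>H y x. sch H \<Longrightarrow> osf c y x (eop v H) = osf c1 y x H"
  using osf_eop[OF Cons.prems, of v] by blast
 obtain j' c' where c': "sm (pw j' M) c'" "\<And>H y x. sch H \<Longrightarrow> osf c1 y x (eops vs H) = osf c' y x H"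
  using Cons.IH[OF c1(1)] by blast
 have "osf c y x (eops (v # vs) H) = osf c' y x H" if "sch H" for H y x
  using c1(2)[OF sch_eops[OF that, of vs]] c'(2)[OF that] by simp
 then show ?case using c'(1) by blast
qed

lemma norm_integral_le_nn:
 fixes f :: "'a => complex"
 shows "ennreal (cmod (\<integral>x. f x \<partial>M)) \<le> (\<integral>\<^sup>+x. ennreal (cmod (f x)) \<partial>M)"
 by (cases "integrable M f") (auto simp: integral_norm_bound_ennreal not_integrable_integral_eq)

lemma nn_integral_translate:
 fixes f :: "'a::euclidean_space => ennreal"
 assumes "f \<in> borel_measurable borel"
 shows "(\<integral>\<^sup>+x. f (a + x) \<partial>lborel) = (\<integral>\<^sup>+x. f x \<partial>lborel)"
 using nn_integral_distr[of "(+) a" lborel borel f] assms by (simp add: lborel_distr_plus)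

lemma sch_integrable_poly:
 fixes f :: "'a::euclidean_space => complex"
 assumes f: "sch f" and w: "w \<in> borel_measurable borel" "\<And>x. cmod (w x) \<le> A * (1 + norm x) ^ k"
 shows "L1 (\<lambda>x. w x * f x)"
proof -
 obtain C where C: "0 < C" "\<And>x. norm (f x) \<le> C * dec (k + 2 * DIM('a)) x" using sch_boundE[OF f] by metis
 show ?thesis
 proof (rule Bochner_Integration.integrable_bound)
  show "L1 (\<lambda>x::'a. (A * C) * dec (2 * DIM('a)) x)"
   by (intro integrable_mult_right integrable_dec) simp
  show "AE x in lborel. norm (w x * f x) \<le> norm ((A * C) * dec (2 * DIM('a)) x)"
  proof (rule AE_I2)
   fix x
   have "norm (w x * f x) \<le> (A * (1 + norm x) ^ k) * (C * dec (k + 2 * DIM('a)) x)"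
    unfolding norm_mult by (intro mult_mono w C order_trans[OF norm_ge_zero w(2)]) simp
   also have "\<dots> = (A * C) * dec (2 * DIM('a)) x * ((1 + norm x) ^ k * dec k x)"
    by (simp only: dec_add mult_ac)
   also have "\<dots> \<le> norm ((A * C) * dec (2 * DIM('a)) x)" by (simp add: power_dec)
   finally show "norm (w x * f x) \<le> norm ((A * C) * dec (2 * DIM('a)) x)" .
  qed
 qed (use w sch_measurable[OF f] in auto)
qed

lemma nn_integral_dec_finite: "(\<integral>\<^sup>+x. ennreal (dec (2 * DIM('a)) x) \<partial>(lborel :: 'a::euclidean_space measure)) < \<infinity>"
 using integrable_dec[of "2 * DIM('a)", where 'a = 'a] by (simp add: integrable_iff_bounded)

lemma sch_square_integrable:
 fixes g :: "'a::euclidean_space => complex"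
 assumes "sch g"
 shows "L1 (\<lambda>x. (cmod (g x))\<^sup>2)"
proof -
 have "L1 (\<lambda>x. cnj (g x) * g x)"
  by (intro sch_integrable sch_mult_1 assms sm_mono[OF schD[OF sch_cnj[OF assms], of 0], of 1]) auto
 then have "L1 (\<lambda>x. cmod (cnj (g x) * g x))" by (rule integrable_norm)
 then show ?thesis by (simp add: norm_mult power2_eq_square)
qed

lemma sch_square_nn_integral:
 fixes g :: "'a::euclidean_space => complex"
 assumes "sch g"
 shows "ennreal (\<integral>x. (cmod (g x))\<^sup>2) = (\<integral>\<^sup>+x. ennreal ((cmod (g x))\<^sup>2) \<partial>lborel)"
 using nn_integral_eq_integral[OF sch_square_integrable[OF assms]] by simp

text \<open>A simple form of Schur's test: the product of the moduli is at most the sum of their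
  squares, and since the kernel depends on the difference alone, integrating out the idle variable
  leaves \<open>D\<close>.\<close>

lemma schur_bound:
 fixes h l :: "'a::euclidean_space => complex"
 assumes h: "sch h" and l: "sch l"
 defines "D \<equiv> enn2real (\<integral>\<^sup>+x. ennreal (dec (2 * DIM('a)) x) \<partial>(lborel :: 'a measure))"
 shows "(\<integral>\<^sup>+z. ennreal (dec (2 * DIM('a)) (fst z - snd z) * (cmod (h (fst z)) * cmod (l (snd z)))) \<partial>lborel)
  \<le> ennreal (D * ((\<integral>x. (cmod (h x))\<^sup>2) + (\<integral>x. (cmod (l x))\<^sup>2)))"
proof -
 have De: "(\<integral>\<^sup>+x. ennreal (dec (2 * DIM('a)) x) \<partial>(lborel :: 'a measure)) = ennreal D"
  unfolding D_def using nn_integral_dec_finite[where 'a = 'a] by (simp add: less_top)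
 have [measurable]: "h \<in> borel_measurable borel" "l \<in> borel_measurable borel" using sch_measurable h l by auto
 have tr: "(\<integral>\<^sup>+y. ennreal (dec (2 * DIM('a)) (w - y)) \<partial>lborel) = ennreal D"
  "(\<integral>\<^sup>+y. ennreal (dec (2 * DIM('a)) (y - w)) \<partial>lborel) = ennreal D" for w :: 'a
 proof -
  show 1: "(\<integral>\<^sup>+y. ennreal (dec (2 * DIM('a)) (y - w)) \<partial>lborel) = ennreal D"
   using nn_integral_translate[of "\<lambda>x::'a. ennreal (dec (2 * DIM('a)) x)" "- w"] De by simp
  have "dec (2 * DIM('a)) (w - y) = dec (2 * DIM('a)) (y - w)" for y by (simp add: dec_def norm_minus_commute)
  then show "(\<integral>\<^sup>+y. ennreal (dec (2 * DIM('a)) (w - y)) \<partial>lborel) = ennreal D" using 1 by simp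
 qed
 note sq = sch_square_nn_integral
 have "(\<integral>\<^sup>+z. ennreal (dec (2 * DIM('a)) (fst z - snd z) * (cmod (h (fst z)) * cmod (l (snd z)))) \<partial>(lborel :: ('a \<times> 'a) measure))
  \<le> (\<integral>\<^sup>+z. ennreal (dec (2 * DIM('a)) (fst z - snd z)) * ennreal ((cmod (h (fst z)))\<^sup>2)
    + ennreal (dec (2 * DIM('a)) (fst z - snd z)) * ennreal ((cmod (l (snd z)))\<^sup>2) \<partial>(lborel :: ('a \<times> 'a) measure))"
 proof (rule nn_integral_mono)
  fix z :: "'a \<times> 'a"
  have "cmod (h (fst z)) * cmod (l (snd z)) \<le> (cmod (h (fst z)))\<^sup>2 + (cmod (l (snd z)))\<^sup>2"
  proof -
   have "2 * (cmod (h (fst z)) * cmod (l (snd z))) \<le> (cmod (h (fst z)))\<^sup>2 + (cmod (l (snd z)))\<^sup>2"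
    using sum_squares_bound[of "cmod (h (fst z))" "cmod (l (snd z))"] by (simp only: mult.assoc)
   moreover have "0 \<le> cmod (h (fst z)) * cmod (l (snd z))" by simp
   ultimately show ?thesis by linarith
  qed
  then have "dec (2 * DIM('a)) (fst z - snd z) * (cmod (h (fst z)) * cmod (l (snd z)))
   \<le> dec (2 * DIM('a)) (fst z - snd z) * (cmod (h (fst z)))\<^sup>2 + dec (2 * DIM('a)) (fst z - snd z) * (cmod (l (snd z)))\<^sup>2"
   unfolding distrib_left[symmetric] by (intro mult_left_mono) auto
  then show "ennreal (dec (2 * DIM('a)) (fst z - snd z) * (cmod (h (fst z)) * cmod (l (snd z))))
   \<le> ennreal (dec (2 * DIM('a)) (fst z - snd z)) * ennreal ((cmod (h (fst z)))\<^sup>2)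
    + ennreal (dec (2 * DIM('a)) (fst z - snd z)) * ennreal ((cmod (l (snd z)))\<^sup>2)"
   by (simp add: ennreal_mult'[symmetric] ennreal_plus[symmetric] ennreal_leI del: ennreal_plus)
 qed
 also have "\<dots> = (\<integral>\<^sup>+w. \<integral>\<^sup>+y. ennreal (dec (2 * DIM('a)) (w - y)) * ennreal ((cmod (h w))\<^sup>2) \<partial>lborel \<partial>lborel)
   + (\<integral>\<^sup>+y. \<integral>\<^sup>+w. ennreal (dec (2 * DIM('a)) (w - y)) * ennreal ((cmod (l y))\<^sup>2) \<partial>lborel \<partial>lborel)"
  unfolding lborel_prod[symmetric]
  by (subst nn_integral_add, simp, simp, subst lborel.nn_integral_fst[symmetric], simp, subst lborel_pair.nn_integral_snd[symmetric], simp)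
    simp
 also have "\<dots> = ennreal D * ennreal (\<integral>x. (cmod (h x))\<^sup>2) + ennreal D * ennreal (\<integral>x. (cmod (l x))\<^sup>2)"
  by (simp add: nn_integral_multc tr nn_integral_cmult sq h l)
 also have "\<dots> = ennreal (D * ((\<integral>x. (cmod (h x))\<^sup>2) + (\<integral>x. (cmod (l x))\<^sup>2)))"
  by (simp add: D_def distrib_left ennreal_mult'[symmetric] ennreal_plus[symmetric] del: ennreal_plus)
 finally show ?thesis .
qed

text \<open>The x-integral is carried out first. The Gaussian absorbs the growth of degree
  \<open>j\<close>, and the oscillation exp(i x (\<xi> - \<eta>)) yields any decay in \<xi> -
  \<eta>: enough to absorb the degree \<open>M\<close> and to leave an integrable kernel for
  \<open>schur_bound\<close>. Nothing depends on the centre \<open>y\<close>.\<close>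

lemma osf_gauss_bound:
 fixes c :: "('a::euclidean_space \<times> 'a) \<times> ('a \<times> 'a) => complex"
 assumes c: "sm (pw j M) c"
 shows "\<exists>C\<ge>0. \<forall>y h l. sch h \<longrightarrow> sch l \<longrightarrow> cmod (\<integral>x. gauss x * osf c y x (ten h l))
   \<le> C * ((\<integral>x. (cmod (h x))\<^sup>2) + (\<integral>x. (cmod (l x))\<^sup>2))"
proof -
 let ?n = "2 * DIM('a)"
 define W where "W p = (1 + norm (fst (snd p) - snd (snd p))) ^ M" for p :: "'a \<times> ('a \<times> 'a)"
 define G where "G z = gauss (snd z) * c ((fst (fst z), snd z), snd (fst z))" for z :: "('a \<times> ('a \<times> 'a)) \<times> 'a"
 have W0: "0 \<le> W p" for p by (simp add: W_def)
 have L: "bounded_linear (\<lambda>z :: ('a \<times> ('a \<times> 'a)) \<times> 'a. ((fst (fst z), snd z), snd (fst z)))"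
  by (intro bounded_linear_Pair bounded_linear_snd bounded_linear_compose[OF bounded_linear_fst] bounded_linear_compose[OF bounded_linear_snd] bounded_linear_fst)
 have osym: "osym W G"
  unfolding osym_def
 proof
  fix N
  have "sm (\<lambda>z :: ('a \<times> ('a \<times> 'a)) \<times> 'a. dec (j + N) (snd z) * pw j M ((fst (fst z), snd z), snd (fst z))) G"
   unfolding G_def by (intro sm_mult sm_comp[OF bounded_linear_snd] sm_comp[OF L] c schD sch_gauss)
  moreover have "dec (j + N) (snd z) * pw j M ((fst (fst z), snd z), snd (fst z)) = (case z of (p, z) => W p * dec N z)" for z :: "('a \<times> ('a \<times> 'a)) \<times> 'a"
  proof -
   have "dec (j + N) (snd z) * pw j M ((fst (fst z), snd z), snd (fst z)) = ((1 + norm (snd z)) ^ j * dec j (snd z)) * (W (fst z) * dec N (snd z))"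
    by (simp only: pw_def W_def dec_add prod.case fst_conv snd_conv mult_ac)
   then show ?thesis by (simp add: power_dec case_prod_beta')
  qed
  ultimately show "sm (\<lambda>(p, z). W p * dec N z) G" by simp
 qed
 \<comment> \<open>\<open>M\<close> powers of the decay cancel \<open>W\<close>; the other
   \<open>?n\<close> make the kernel integrable.\<close>
 obtain C0 where C0: "\<And>p y. cmod (osc G p y) \<le> C0 * (W p * dec (M + ?n) y)" using osc_decay[OF osym W0] by blast
 define C1 where "C1 = max 0 C0"
 have C1: "0 \<le> C1" by (simp add: C1_def)
 have K: "cmod (osc G (y, v) (fst v - snd v)) \<le> C1 * dec ?n (fst v - snd v)" for y v
 proof -
  have "cmod (osc G (y, v) (fst v - snd v)) \<le> C0 * (W (y, v) * dec (M + ?n) (fst v - snd v))" by (rule C0)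
  also have "W (y, v) * dec (M + ?n) (fst v - snd v) = dec ?n (fst v - snd v)"
   using power_dec[of "fst v - snd v" M] by (simp add: W_def dec_add mult.assoc[symmetric])
  also have "C0 * dec ?n (fst v - snd v) \<le> C1 * dec ?n (fst v - snd v)" unfolding C1_def by (intro mult_right_mono) auto
  finally show ?thesis .
 qed
 define D where "D = enn2real (\<integral>\<^sup>+x. ennreal (dec ?n x) \<partial>(lborel :: 'a measure))"
 have "cmod (\<integral>x. gauss x * osf c y x (ten h l)) \<le> (C1 * D) * ((\<integral>x. (cmod (h x))\<^sup>2) + (\<integral>x. (cmod (l x))\<^sup>2))"
  (is "_ \<le> _ * ?S") if h: "sch h" and l: "sch l" for y h l
 proof -
  note H = sch_ten[OF h l]
  obtain B where B: "0 < B" "\<And>z. cmod (c z) \<le> B * pw j M z" using sm_boundE[OF c pw_nonneg] by metis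
  \<comment> \<open>For Fubini's theorem the polynomial growth is moved to the Schwartz factors, so
    that the quotient \<open>k\<close> is a bounded kernel.\<close>
  define wx where "wx x = cr ((1 + norm x) ^ j)" for x :: 'a
  define wz where "wz v = cr ((1 + norm (fst v - snd v)) ^ M)" for v :: "'a \<times> 'a"
  have nw: "cmod (wx x) = (1 + norm x) ^ j" "cmod (wz v) = (1 + norm (fst v - snd v)) ^ M" for x v
   unfolding wx_def wz_def norm_of_real by simp_all
  have nw0: "0 < cmod (wx x)" "0 < cmod (wz v)" for x v
   unfolding nw by (auto intro!: zero_less_power add_pos_nonneg)
  then have w0: "wx x \<noteq> 0" "wz v \<noteq> 0" for x v by (metis norm_zero less_irrefl)+
  define e where "e = (\<lambda>z :: 'a \<times> ('a \<times> 'a). ee (fst z, - fst z) (snd z) * c ((y, fst z), snd z))"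
  define k where "k = (\<lambda>z. e z / (wx (fst z) * wz (snd z)))"
  have cont: "continuous_on UNIV k"
   unfolding k_def
  proof (intro continuous_on_divide ballI)
   show "continuous_on UNIV e" unfolding e_def
    by (intro continuous_intros continuous_on_compose2[OF smD(3)[OF c]]) auto
   show "continuous_on UNIV (\<lambda>z. wx (fst z) * wz (snd z))" unfolding wx_def wz_def by (intro continuous_intros)
  qed (simp add: w0)
  have kb: "cmod (k z) \<le> B" for z
  proof -
   have "cmod (e z) \<le> B * (cmod (wx (fst z)) * cmod (wz (snd z)))"
    using B(2)[of "((y, fst z), snd z)"] by (simp add: e_def norm_mult pw_def nw)
   moreover have "0 < cmod (wx (fst z)) * cmod (wz (snd z))" by (intro mult_pos_pos nw0)
   ultimately show ?thesis by (simp add: k_def norm_divide norm_mult pos_divide_le_eq)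
  qed
  have i: "integrable (lborel \<Otimes>\<^sub>M lborel) (\<lambda>(x, v). k (x, v) * ((wx x * gauss x) * (wz v * ten h l v)))"
  proof (rule integrable_pair_mult)
   have "wx \<in> borel_measurable borel" "wz \<in> borel_measurable borel"
    unfolding wx_def[abs_def] wz_def[abs_def] by (intro borel_measurable_continuous_onI continuous_intros)+
   moreover have "cmod (wz v) \<le> 2 ^ M * (1 + norm v) ^ M" for v
    using osf_weight[of "0 :: 'a" 0 v M] by (simp add: nw)
   moreover have "cmod (wx x) \<le> 1 * (1 + norm x) ^ j" for x by (simp add: nw)
   ultimately show "L1 (\<lambda>x. wx x * gauss x)" "L1 (\<lambda>v. wz v * ten h l v)"
    using sch_integrable_poly[OF sch_gauss] sch_integrable_poly[OF H] by blast+
   show "k \<in> borel_measurable (lborel \<Otimes>\<^sub>M lborel)"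
    using borel_measurable_continuous_onI[OF cont] by (simp add: lborel_prod)
  qed (use kb in \<open>auto simp: lborel.sigma_finite_measure_axioms\<close>)
  have kw: "k (x, v) * ((wx x * gauss x) * (wz v * ten h l v)) = gauss x * (e (x, v) * ten h l v)" for x v
   by (simp add: k_def w0)
  have "(\<integral>x. gauss x * osf c y x (ten h l)) = (\<integral>x. (\<integral>v. gauss x * (e (x, v) * ten h l v)))"
   by (simp add: osf_def e_def)
  also have "\<dots> = (\<integral>v. (\<integral>x. gauss x * (e (x, v) * ten h l v)))"
   using lborel_pair.Fubini_integral[OF i] by (simp add: kw)
  also have "\<dots> = (\<integral>v. osc G (y, v) (fst v - snd v) * ten h l v)"
  proof (rule integral_cong[OF refl])
   fix v
   have "gauss x * (e (x, v) * ten h l v) = (ee (fst v - snd v) x * G ((y, v), x)) * ten h l v" for x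
   proof -
    have "(x, - x) \<bullet> v = (fst v - snd v) \<bullet> x" by (simp add: inner_prod_def inner_diff_left inner_diff_right inner_commute)
    then show ?thesis by (simp add: G_def e_def)
   qed
   then show "(\<integral>x. gauss x * (e (x, v) * ten h l v)) = osc G (y, v) (fst v - snd v) * ten h l v"
    unfolding osc_def by (simp only: integral_mult_left_zero)
  qed
  finally have "ennreal (cmod (\<integral>x. gauss x * osf c y x (ten h l)))
    \<le> (\<integral>\<^sup>+v. ennreal (cmod (osc G (y, v) (fst v - snd v) * ten h l v)) \<partial>lborel)"
   using norm_integral_le_nn by simp
  also have "\<dots> \<le> (\<integral>\<^sup>+v. ennreal C1 * ennreal (dec ?n (fst v - snd v) * (cmod (h (fst v)) * cmod (l (snd v)))) \<partial>lborel)"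
  proof (rule nn_integral_mono)
   fix v
   have "cmod (osc G (y, v) (fst v - snd v) * ten h l v) \<le> C1 * dec ?n (fst v - snd v) * (cmod (h (fst v)) * cmod (l (snd v)))"
    unfolding norm_mult ten_def by (intro mult_right_mono K) auto
   then show "ennreal (cmod (osc G (y, v) (fst v - snd v) * ten h l v)) \<le> ennreal C1 * ennreal (dec ?n (fst v - snd v) * (cmod (h (fst v)) * cmod (l (snd v))))"
    by (simp add: ennreal_mult'[symmetric] C1 ennreal_leI mult.assoc)
  qed
  also have "\<dots> = ennreal C1 * (\<integral>\<^sup>+v. ennreal (dec ?n (fst v - snd v) * (cmod (h (fst v)) * cmod (l (snd v)))) \<partial>lborel)"
  proof (rule nn_integral_cmult)
   have [measurable]: "h \<in> borel_measurable borel" "l \<in> borel_measurable borel" using sch_measurable h l by auto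
   show "(\<lambda>v. ennreal (dec ?n (fst v - snd v) * (cmod (h (fst v)) * cmod (l (snd v))))) \<in> borel_measurable lborel"
    unfolding lborel_prod[symmetric] by simp
  qed
  also have "\<dots> \<le> ennreal C1 * ennreal (D * ?S)"
   unfolding D_def by (intro mult_left_mono schur_bound h l) simp
  also have "\<dots> = ennreal (C1 * D * ?S)" by (simp add: ennreal_mult'[symmetric] C1 mult.assoc)
  finally show ?thesis
   by (subst (asm) ennreal_le_iff) (auto simp: C1 D_def intro!: mult_nonneg_nonneg add_nonneg_nonneg integral_nonneg)
 qed
 then show ?thesis by (intro exI[of _ "C1 * D"]) (auto simp: C1 D_def)
qed

lemma sm_inverse_linear: "sm (\<lambda>x. 1) (\<lambda>x. inverse (1 + \<i> * cr (b \<bullet> x)))"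
proof -
 let ?f = "\<lambda>x. 1 + \<i> * cr (b \<bullet> x)"
 let ?X = "{g. \<exists>c k. g = (\<lambda>x. c * inverse (?f x) ^ k)}"
 have n: "1 \<le> cmod (?f x)" for x
  using abs_Re_le_cmod[of "?f x"] by simp
 then have nz: "?f x \<noteq> 0" for x by (metis norm_zero not_one_le_zero)
 have d: "((\<lambda>x. inverse (?f x)) has_derivative (\<lambda>v. - (inverse (?f x) * (\<i> * cr (b \<bullet> v)) * inverse (?f x)))) (at x)" for x
  by (rule Deriv.has_derivative_inverse[where f = ?f, OF nz])
   (auto intro!: derivative_eq_intros simp: fun_eq_iff)
 show ?thesis
 proof (rule sm_coinduct[of _ ?X])
  show "(\<lambda>x. inverse (?f x)) \<in> ?X" by (auto intro!: exI[of _ 1] exI[of _ "1 :: complex"] simp: fun_eq_iff)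
  fix g assume "g \<in> ?X"
  then obtain c k where g: "g = (\<lambda>x. c * inverse (?f x) ^ k)" by blast
  have gd: "(g has_derivative (\<lambda>v. c * (of_nat k * - (inverse (?f x) * (\<i> * cr (b \<bullet> v)) * inverse (?f x)) * inverse (?f x) ^ (k - 1)))) (at x)" for x
   unfolding g by (intro has_derivative_mult_right has_derivative_power d)
  show "g differentiable at x" for x using gd differentiable_def by blast
  have "norm (g x) \<le> cmod c * 1" for x
  proof -
   have "cmod (inverse (?f x)) \<le> 1" using n[of x] by (simp add: norm_inverse inverse_le_1_iff)
   then show ?thesis unfolding g by (simp add: norm_mult norm_power mult_left_le power_le_one)
  qed
  then show "\<exists>C. \<forall>x. norm (g x) \<le> C * 1" by blast
  show "dd v g \<in> ?X" for v
  proof -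
   have "dd v g = (\<lambda>x. (- c * of_nat k * (\<i> * cr (b \<bullet> v))) * inverse (?f x) ^ Suc k)"
   proof
    fix x show "dd v g x = (- c * of_nat k * (\<i> * cr (b \<bullet> v))) * inverse (?f x) ^ Suc k"
     unfolding dd_eq[OF gd] by (cases k) (simp_all add: algebra_simps)
   qed
   then show ?thesis by blast
  qed
 qed
qed

lemma sm_prod_list_1: "(\<And>b. b \<in> set bs \<Longrightarrow> sm (\<lambda>x. 1) (f b)) \<Longrightarrow> sm (\<lambda>x. 1) (\<lambda>x. \<Prod>b\<leftarrow>bs. f b x :: complex)"
proof (induction bs)
 case Nil then show ?case by (simp add: sm_const[of 1])
next
 case (Cons b bs)
 then show ?case using sm_mult[of "\<lambda>_. 1" "f b" "\<lambda>_. 1" "\<lambda>x. \<Prod>b\<leftarrow>bs. f b x"] by simp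
qed

lemma sch_mult_linear:
 assumes "sch v"
 shows "sch (\<lambda>z. \<i> * cr (b \<bullet> z) * v z)" "sch (\<lambda>z. (1 + \<i> * cr (b \<bullet> z)) * v z)"
proof -
 have L: "bounded_linear (\<lambda>z. cr (b \<bullet> z))"
  by (intro bounded_linear_compose[OF bounded_linear_of_real] bounded_linear_inner_right)
 show 1: "sch (\<lambda>z. \<i> * cr (b \<bullet> z) * v z)"
  by (rule sch_mult[OF sm_cmult[OF sm_linear[OF L]] _ _ assms, of 1 1]) auto
 show "sch (\<lambda>z. (1 + \<i> * cr (b \<bullet> z)) * v z)"
  using sch_add[OF assms 1] by (simp add: distrib_right)
qed

lemma eop_four:
 fixes v :: "'a::euclidean_space => complex"
 assumes v: "sch v"
 shows "eop b (four v) = four (\<lambda>z. (1 + \<i> * cr (b \<bullet> z)) * v z)"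
proof
 fix x
 have i: "L1 (\<lambda>z. en z x * w z)" if "sch w" for w :: "'a => complex"
  using sch_integrable_poly[OF that, of "\<lambda>z. en z x" 1 0] by simp
 have "dd b (four v) x = kap TYPE('a) * dd b (fm v) x"
  unfolding four_def[abs_def]
  by (intro dd_eq has_derivative_mult_right has_derivative_dd sch_differentiable sch_fm v)
 also have "dd b (fm v) x = - fm (\<lambda>z. \<i> * cr (b \<bullet> z) * v z) x"
  unfolding dd_fm[OF v] by (simp add: fm_def)
 finally have "eop b (four v) x = kap TYPE('a) * fm v x - kap TYPE('a) * - fm (\<lambda>z. \<i> * cr (b \<bullet> z) * v z) x"
  by (simp only: eop_def four_def[of v x])
 also have "\<dots> = kap TYPE('a) * (fm v x + fm (\<lambda>z. \<i> * cr (b \<bullet> z) * v z) x)"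
  by (simp only: distrib_left mult_minus_right diff_minus_eq_add)
 also have "fm v x + fm (\<lambda>z. \<i> * cr (b \<bullet> z) * v z) x = fm (\<lambda>z. (1 + \<i> * cr (b \<bullet> z)) * v z) x"
  unfolding fm_def
  by (subst integral_add[symmetric, OF i[OF v] i[OF sch_mult_linear(1)[OF v]]])
   (simp add: algebra_simps)
 finally show "eop b (four v) x = four (\<lambda>z. (1 + \<i> * cr (b \<bullet> z)) * v z) x"
  by (simp only: four_def[of "\<lambda>z. (1 + \<i> * cr (b \<bullet> z)) * v z"])
qed

lemma eops_four:
 fixes v :: "'a::euclidean_space => complex"
 assumes v: "sch v"
 shows "eops bs (four v) = four (\<lambda>z. (\<Prod>b\<leftarrow>bs. 1 + \<i> * cr (b \<bullet> z)) * v z)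
  \<and> sch (\<lambda>z. (\<Prod>b\<leftarrow>bs. 1 + \<i> * cr (b \<bullet> z)) * v z)"
proof (induction bs)
 case Nil then show ?case using v by simp
next
 case (Cons b bs)
 then show ?case using eop_four[of "\<lambda>z. (\<Prod>b\<leftarrow>bs. 1 + \<i> * cr (b \<bullet> z)) * v z" b]
   sch_mult_linear(2)[of "\<lambda>z. (\<Prod>b\<leftarrow>bs. 1 + \<i> * cr (b \<bullet> z)) * v z" b]
  by (simp add: mult.assoc)
qed

lemma four_translate:
 fixes u :: "'a::euclidean_space => complex"
 assumes u: "sch u"
 shows "four (\<lambda>z. u (z + y)) w = ee y w * four u w"
proof -
 have m: "(\<lambda>z. en z w * u z) \<in> borel_measurable borel"
  using sch_measurable[OF u] by measurable
 have "fm u w = (\<integral>z. en (y + z) w * u (y + z))"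
  unfolding fm_def using integral_translate[OF m, of y] by simp
 also have "\<dots> = (\<integral>z. en y w * (en z w * u (z + y)))"
  by (rule integral_cong)
   (simp_all add: inner_add_left exp_add[symmetric] mult.assoc[symmetric] distrib_left add_ac)
 also have "\<dots> = en y w * fm (\<lambda>z. u (z + y)) w" by (simp add: fm_def)
 finally have "ee y w * fm u w = fm (\<lambda>z. u (z + y)) w"
  by (simp add: mult.assoc[symmetric] exp_add[symmetric])
 then show ?thesis by (simp add: four_def mult.left_commute)
qed

definition amp_weight :: "nat => 'a::real_normed_vector \<times> ('a \<times> 'a) => real" where
 "amp_weight M = (\<lambda>(x, z). (1 + norm (fst z - snd z)) ^ M)"

text \<open>The frequency integral comes first: integrability in x is a result of the oscillation,
  not of the amplitude.\<close>

definition ampx :: "('a::euclidean_space \<times> ('a \<times> 'a) => complex) => ('a => complex) => ('a => complex) => 'a => complex" where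
 "ampx a h l x = (\<integral>z. (ee (x, - x) z * a (x, z)) * ten h l z)"

definition amp :: "('a::euclidean_space \<times> ('a \<times> 'a) => complex) => ('a => complex) => ('a => complex) => complex" where
 "amp a h l = (\<integral>x. ampx a h l x)"

lemma amp_slice:
 fixes a :: "'a::euclidean_space \<times> ('a \<times> 'a) => complex"
 assumes a: "sm (amp_weight M) a" and h: "sch h" and l: "sch l"
 shows "sch (\<lambda>z. (ee c z * a (x, z)) * ten h l z)"
proof -
 have 1: "sm (\<lambda>z. (1 + norm (fst z - snd z)) ^ M) (\<lambda>z. a (x, z))"
  using sm_comp_affine[OF bounded_linear_Pairs(1) a, of "(x, 0)"] by (simp add: amp_weight_def)
 have 2: "sm (\<lambda>z. (1 + norm (fst z - snd z)) ^ M) (\<lambda>z. ee c z * a (x, z))"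
  using sm_mult[OF sm_cis 1] by simp
 show ?thesis
  by (rule sch_mult[OF 2 _ _ sch_ten[OF h l], of "2 ^ M" M]) (use osf_weight[of 0 0 _ M] in auto)
qed

text \<open>With Schwartz \<open>h\<close> and \<open>l\<close> the frequency integrand is an
  \<open>osym\<close> amplitude with parameter x and phase variable (x, -x), whose norm is at least
  that of x.\<close>

lemma ampx_bound:
 fixes a :: "'a::euclidean_space \<times> ('a \<times> 'a) => complex"
 assumes a: "sm (amp_weight M) a" and h: "sch h" and l: "sch l"
 shows "\<exists>C. \<forall>x. cmod (ampx a h l x) \<le> C * dec N x" "L1 (ampx a h l)"
proof -
 define c where "c = (\<lambda>z. a z * ten h l (snd z))"
 have o: "osym (\<lambda>_. 1) c"
  unfolding osym_def
 proof
  fix N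
  have "sm (\<lambda>z. amp_weight M z * dec (M + N) (snd z)) c"
   unfolding c_def by (intro sm_mult a sm_comp[OF bounded_linear_snd] schD sch_ten h l)
  then show "sm (\<lambda>(p, z). 1 * dec N z) c"
  proof (rule sm_mono)
   fix z :: "'a \<times> ('a \<times> 'a)"
   show "0 \<le> amp_weight M z * dec (M + N) (snd z)" by (simp add: amp_weight_def case_prod_beta')
   have "amp_weight M z * dec (M + N) (snd z) \<le> (2 ^ M * (1 + norm (snd z)) ^ M) * dec (M + N) (snd z)"
    using osf_weight[of "0 :: 'a" 0 "snd z" M] by (intro mult_right_mono) (simp_all add: amp_weight_def case_prod_beta')
   also have "\<dots> = 2 ^ M * dec N (snd z) * ((1 + norm (snd z)) ^ M * dec M (snd z))" by (simp only: dec_add mult_ac)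
   finally show "amp_weight M z * dec (M + N) (snd z) \<le> 2 ^ M * (case z of (p, z) => 1 * dec N z)"
    by (simp add: power_dec case_prod_beta')
  qed
 qed
 have e: "ampx a h l x = osc c x (x, - x)" for x by (simp add: ampx_def osc_def c_def mult.assoc)
 have bd: "\<exists>C. \<forall>x. cmod (ampx a h l x) \<le> C * dec N x" for N
 proof -
  obtain C where C: "\<And>p y. cmod (osc c p y) \<le> C * (1 * dec N y)" using osc_decay[OF o] by (metis zero_le_one)
  have "cmod (ampx a h l x) \<le> \<bar>C\<bar> * dec N x" for x
  proof -
   have "cmod (ampx a h l x) \<le> C * dec N (x, - x)" using C[of x "(x, - x)"] by (simp add: e)
   also have "\<dots> \<le> \<bar>C\<bar> * dec N (x, - x)" by (intro mult_right_mono) auto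
   also have "\<dots> \<le> \<bar>C\<bar> * dec N x" using norm_fst_le[of x "- x"] by (intro mult_left_mono dec_mono_norm) auto
   finally show ?thesis .
  qed
  then show ?thesis by blast
 qed
 show "\<exists>C. \<forall>x. cmod (ampx a h l x) \<le> C * dec N x" by (rule bd)
 obtain C where C: "\<And>x. cmod (ampx a h l x) \<le> C * dec (2 * DIM('a)) x" using bd by blast
 show "L1 (ampx a h l)"
 proof (rule Bochner_Integration.integrable_bound)
  show "L1 (\<lambda>x::'a. C * dec (2 * DIM('a)) x)" by (intro integrable_mult_right integrable_dec) simp
  show "AE x in lborel. norm (ampx a h l x) \<le> norm (C * dec (2 * DIM('a)) x)"
   by (intro AE_I2 order_trans[OF C]) simp
  have "continuous_on UNIV (\<lambda>z. (ee (fst z, - fst z) (snd z) * a z) * ten h l (snd z))"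
   by (intro continuous_intros smD(3)[OF a] continuous_on_compose2[OF sch_continuous[OF sch_ten[OF h l]]]) auto
  then have "(\<lambda>z. (ee (fst z, - fst z) (snd z) * a z) * ten h l (snd z)) \<in> borel_measurable (lborel \<Otimes>\<^sub>M lborel)"
   using borel_measurable_continuous_onI by (simp add: lborel_prod)
  then have "(\<lambda>(x, v). (ee (x, - x) v * a (x, v)) * ten h l v) \<in> borel_measurable (lborel \<Otimes>\<^sub>M lborel)"
   by (simp add: case_prod_beta')
  from lborel.borel_measurable_lebesgue_integral[OF this]
  show "ampx a h l \<in> borel_measurable lborel" unfolding ampx_def[abs_def] .
 qed
qed

lemma plancherel_norm:
 fixes u :: "'a::euclidean_space => complex"
 assumes "sch u"
 shows "(\<integral>x. (cmod (four u x))\<^sup>2) = (\<integral>x. (cmod (u x))\<^sup>2)"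
proof -
 have "cr (\<integral>x. (cmod (g x))\<^sup>2) = (\<integral>x. g x * cnj (g x))" for g :: "'a => complex"
  unfolding complex_norm_square[symmetric] of_real_power[symmetric] by (rule integral_complex_of_real[symmetric])
 then have "cr (\<integral>x. (cmod (four u x))\<^sup>2) = cr (\<integral>x. (cmod (u x))\<^sup>2)"
  using plancherel[OF assms assms] by simp
 then show ?thesis by (simp only: of_real_eq_iff)
qed

text \<open>When \<open>bs\<close> lists the basis, the squared modulus is a product of functions
  1/(1 + t^2), hence integrable; the reciprocal is the polynomial that \<open>eops bs\<close>
  creates on the Fourier side.\<close>

definition window :: "'a::euclidean_space list => 'a => complex" where
 "window bs x = (\<Prod>b\<leftarrow>bs. inverse (1 + \<i> * cr (b \<bullet> x)))"

lemma sm_window: "sm (\<lambda>x. 1) (window bs)"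
 unfolding window_def[abs_def] by (intro sm_prod_list_1 sm_inverse_linear)

lemma window_inverse: "(\<Prod>b\<leftarrow>bs. 1 + \<i> * cr (b \<bullet> z)) * window bs z = 1"
proof (induction bs)
 case (Cons b bs)
 have "1 + \<i> * cr (b \<bullet> z) \<noteq> 0"
  by (metis Re_i_times complex_Re_of_int Im_complex_of_real add.right_neutral neg_equal_0_iff_equal of_int_0 one_complex.sel(1) plus_complex.sel(1) zero_neq_one)
 then show ?case using Cons by (simp add: window_def field_simps)
qed (simp add: window_def)

lemma nn_integral_window:
 fixes bs :: "'a::euclidean_space list"
 assumes bs: "distinct bs" "set bs = Basis"
 shows "(\<integral>\<^sup>+x. ennreal ((cmod (window bs x))\<^sup>2) \<partial>lborel) = ennreal (pi ^ DIM('a))"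
proof -
 have "(cmod (window bs x))\<^sup>2 = (\<Prod>b\<in>Basis. inverse (1 + (x \<bullet> b)\<^sup>2))" for x
 proof -
  have "(cmod (window cs x))\<^sup>2 = (\<Prod>b\<leftarrow>cs. inverse (1 + (x \<bullet> b)\<^sup>2))" for cs
  proof (induction cs)
   case (Cons b cs)
   have "(cmod (1 + \<i> * cr (b \<bullet> x)))\<^sup>2 = 1 + (x \<bullet> b)\<^sup>2"
    by (simp add: cmod_power2 inner_commute)
   then show ?case using Cons by (simp add: window_def norm_mult power_mult_distrib norm_inverse power_inverse)
  qed (simp add: window_def)
  then show ?thesis using bs by (simp add: prod.distinct_set_conv_list[symmetric])
 qed
 then show ?thesis by (simp add: nn_integral_prod_inverse_1_plus_square)
qed

text \<open>A bound of Calderon-Vaillancourt type. The constant \<open>g0\<close>, as the integral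
  of gauss(x - y) over y, localises the form at all centres y. After x is replaced by x + y, the
  factors exp(i y \<xi>) and exp(-i y \<eta>) turn \<open>h\<close> and \<open>l\<close> into
  transforms of translates of \<open>u\<close> and \<open>v\<close>. Such a transform is
  \<open>eops bs\<close> of the transform of the windowed translate, and integration by parts leaves
  the L2 norms of the windowed translates, whose squares integrate over y to a multiple of the norm
  of \<open>u\<close> or \<open>v\<close>. The right-hand side is a sum of squares so that this last
  step is an application of Fubini's theorem.\<close>

theorem amp_bounded:
 fixes a :: "'a::euclidean_space \<times> ('a \<times> 'a) => complex"
 assumes a: "sm (amp_weight M) a"
 shows "\<exists>C\<ge>0. \<forall>h l. sch h \<longrightarrow> sch l \<longrightarrow> cmod (amp a h l)
   \<le> C * ((\<integral>x. (cmod (h x))\<^sup>2) + (\<integral>x. (cmod (l x))\<^sup>2))"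
proof -
 obtain bs :: "'a list" where bs: "distinct bs" "set bs = Basis" using finite_distinct_list[OF finite_Basis] by blast
 let ?w = "window bs"
 have w1: "sm (\<lambda>x. 1) ?w" by (rule sm_window)
 have [measurable]: "?w \<in> borel_measurable borel" using borel_measurable_continuous_onI[OF smD(3)[OF w1]] .
 let ?vs = "map (\<lambda>b. (b, 0)) bs @ map (\<lambda>b. (0, b)) bs"
 define c0 where "c0 z = a (snd (fst z) + fst (fst z), snd z)" for z :: "('a \<times> 'a) \<times> ('a \<times> 'a)"
 have L: "bounded_linear (\<lambda>z :: ('a \<times> 'a) \<times> ('a \<times> 'a). (snd (fst z) + fst (fst z), snd z))"
  by (intro bounded_linear_Pair bounded_linear_add bounded_linear_compose[OF bounded_linear_fst]
    bounded_linear_compose[OF bounded_linear_snd] bounded_linear_fst bounded_linear_snd)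
 have "sm (pw 0 M) c0"
  using sm_comp[OF L a] by (simp add: c0_def[abs_def] pw_def amp_weight_def case_prod_beta')
 \<comment> \<open>All derivatives that restore the two windowed functions are moved to the
   amplitude at once, before a centre is fixed.\<close>
 from osf_eops[OF this, of ?vs] obtain j c where c: "sm (pw j M) c"
  "\<And>H y x. sch H \<Longrightarrow> osf c0 y x (eops ?vs H) = osf c y x H" by blast
 obtain C where C: "0 \<le> C" "\<And>y h l. sch h \<Longrightarrow> sch l \<Longrightarrow> cmod (\<integral>x. gauss x * osf c y x (ten h l))
   \<le> C * ((\<integral>x. (cmod (h x))\<^sup>2) + (\<integral>x. (cmod (l x))\<^sup>2))"
  using osf_gauss_bound[OF c(1)] by blast
 define g0 where "g0 = (\<integral>x. gauss x \<partial>(lborel :: 'a measure))"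
 have g0: "g0 \<noteq> 0" by (simp add: g0_def integral_gauss)
 define P where "P = pi ^ DIM('a)"
 have P0: "0 \<le> P" by (simp add: P_def)

 define sh where "sh u y = (\<lambda>x. u (x + y) * ?w x)" for u :: "'a => complex" and y
 have sh: "sch (sh u y)" if "sch u" for u y
  unfolding sh_def using sch_mult_1[OF w1 sch_translate[OF that]] by (simp add: mult.commute)
 have esh: "eops bs (four (sh u y)) = (\<lambda>k. ee y k * four u k)" if u: "sch u" for u y
 proof -
  have "(\<lambda>z. (\<Prod>b\<leftarrow>bs. 1 + \<i> * cr (b \<bullet> z)) * sh u y z) = (\<lambda>z. u (z + y))"
   by (simp add: sh_def mult.left_commute[of _ "u _"] window_inverse)
  then show ?thesis using eops_four[OF sh[OF u], of bs y] four_translate[OF u] by auto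
 qed
 have nsh: "(\<integral>\<^sup>+y. ennreal (\<integral>k. (cmod (four (sh u y) k))\<^sup>2) \<partial>lborel) = ennreal (P * (\<integral>x. (cmod (u x))\<^sup>2))"
  "(\<lambda>y. ennreal (\<integral>k. (cmod (four (sh u y) k))\<^sup>2)) \<in> borel_measurable lborel" if u: "sch u" for u
 proof -
  have [measurable]: "u \<in> borel_measurable borel" by (rule sch_measurable[OF u])
  have e: "ennreal (\<integral>k. (cmod (four (sh u y) k))\<^sup>2) = (\<integral>\<^sup>+x. ennreal ((cmod (u (x + y)))\<^sup>2) * ennreal ((cmod (?w x))\<^sup>2) \<partial>lborel)" for y
   unfolding plancherel_norm[OF sh[OF u]] sch_square_nn_integral[OF sh[OF u]]
   by (simp add: sh_def norm_mult power_mult_distrib ennreal_mult'[symmetric])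
  show "(\<lambda>y. ennreal (\<integral>k. (cmod (four (sh u y) k))\<^sup>2)) \<in> borel_measurable lborel"
   unfolding e by measurable
  have "(\<integral>\<^sup>+y. ennreal (\<integral>k. (cmod (four (sh u y) k))\<^sup>2) \<partial>lborel)
   = (\<integral>\<^sup>+y. \<integral>\<^sup>+x. ennreal ((cmod (u (x + y)))\<^sup>2) * ennreal ((cmod (?w x))\<^sup>2) \<partial>lborel \<partial>lborel)"
   by (simp only: e)
  also have "\<dots> = (\<integral>\<^sup>+x. \<integral>\<^sup>+y. ennreal ((cmod (u (x + y)))\<^sup>2) * ennreal ((cmod (?w x))\<^sup>2) \<partial>lborel \<partial>lborel)"
   by (rule lborel_pair.Fubini') measurable
  also have "\<dots> = (\<integral>\<^sup>+x. ennreal (\<integral>x. (cmod (u x))\<^sup>2) * ennreal ((cmod (?w x))\<^sup>2) \<partial>lborel)"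
  proof (rule nn_integral_cong)
   fix x
   have "(\<integral>\<^sup>+y. ennreal ((cmod (u (x + y)))\<^sup>2) \<partial>lborel) = ennreal (\<integral>x. (cmod (u x))\<^sup>2)"
    using nn_integral_translate[of "\<lambda>x. ennreal ((cmod (u x))\<^sup>2)" x] by (simp add: sch_square_nn_integral[OF u])
   then show "(\<integral>\<^sup>+y. ennreal ((cmod (u (x + y)))\<^sup>2) * ennreal ((cmod (?w x))\<^sup>2) \<partial>lborel) = ennreal (\<integral>x. (cmod (u x))\<^sup>2) * ennreal ((cmod (?w x))\<^sup>2)"
    by (subst nn_integral_multc) simp_all
  qed
  also have "\<dots> = ennreal (P * (\<integral>x. (cmod (u x))\<^sup>2))"
   by (subst nn_integral_cmult) (simp_all add: nn_integral_window[OF bs] P_def ennreal_mult'[symmetric] mult.commute)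
  finally show "(\<integral>\<^sup>+y. ennreal (\<integral>k. (cmod (four (sh u y) k))\<^sup>2) \<partial>lborel) = ennreal (P * (\<integral>x. (cmod (u x))\<^sup>2))" .
 qed

 have "cmod (amp a h l) \<le> (C * P / cmod g0) * ((\<integral>x. (cmod (h x))\<^sup>2) + (\<integral>x. (cmod (l x))\<^sup>2))"
  if h: "sch h" and l: "sch l" for h l
 proof -
  define u where "u = ifour h"
  \<comment> \<open>\<open>l\<close> receives the opposite phase exp(-i y \<eta>), hence the
    conjugations.\<close>
  define v where "v = ifour (\<lambda>x. cnj (l x))"
  have u: "sch u" "four u = h" unfolding u_def using h by (auto simp: sch_ifour four_ifour)
  have v: "sch v" "four v = (\<lambda>x. cnj (l x))" unfolding v_def using l by (auto simp: sch_ifour four_ifour sch_cnj)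
  define hy where "hy y = four (sh u y)" for y
  define ly where "ly y = (\<lambda>\<eta>. cnj (four (sh v y) \<eta>))" for y
  have hy: "sch (hy y)" and ly: "sch (ly y)" for y
   unfolding hy_def ly_def by (intro sch_four sch_cnj sh u v)+
  let ?b = "ampx a h l"
  have bi: "integrable lborel ?b" by (rule ampx_bound(2)[OF a h l])
  have bxy: "?b (x + y) = osf c y x (ten (hy y) (ly y))" for x y
  proof -
   have e1: "eops bs (hy y) = (\<lambda>k. ee y k * h k)" unfolding hy_def esh[OF u(1)] u(2) ..
   have e2: "eops bs (ly y) = (\<lambda>k. en y k * l k)"
    unfolding ly_def eops_cnj[OF sch_four[OF sh[OF v(1)]]] esh[OF v(1)] v(2) by (simp add: exp_cnj)
   have "osf c y x (ten (hy y) (ly y)) = osf c0 y x (ten (eops bs (hy y)) (eops bs (ly y)))"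
    using c(2)[OF sch_ten[OF hy ly]] eops_ten[OF hy ly] by metis
   also have "\<dots> = ?b (x + y)"
    unfolding osf_def ampx_def e1 e2
   proof (rule integral_cong[OF refl])
    fix \<zeta> :: "'a \<times> 'a"
    have "ee (x + y, - (x + y)) \<zeta> = ee (x, - x) \<zeta>
      * (exp (\<i> * cr (y \<bullet> fst \<zeta>)) * exp (- (\<i> * cr (y \<bullet> snd \<zeta>))))"
     by (simp add: inner_prod_def exp_add[symmetric] algebra_simps inner_add_left inner_diff_left)
    then show "ee (x, - x) \<zeta> * c0 ((y, x), \<zeta>) *
      ten (\<lambda>k. ee y k * h k) (\<lambda>k. en y k * l k) \<zeta> =
      ee (x + y, - (x + y)) \<zeta> * a (x + y, \<zeta>) * ten h l \<zeta>"
     by (simp add: ten_def c0_def mult_ac)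
   qed
   finally show ?thesis by simp
  qed
  have gm [measurable]: "gauss \<in> borel_measurable (borel :: 'a measure)" by (rule sch_measurable[OF sch_gauss])
  have bm [measurable]: "?b \<in> borel_measurable borel" using bi by auto
  have ge: "gauss (x - y) = gauss (- x + y)" for x y :: 'a by (simp add: gauss_def inner_diff_left inner_diff_right inner_add_left inner_add_right)
  have gi: "(\<integral>y. f (gauss (x - y))) = (\<integral>y. f (gauss y) \<partial>(lborel :: 'a measure))" if "f \<in> borel_measurable borel"
   for x :: 'a and f :: "complex => 'c::{banach, second_countable_topology}"
   unfolding ge by (rule integral_translate) (rule measurable_compose[OF gm that])
  have F: "integrable (lborel \<Otimes>\<^sub>M lborel) (\<lambda>(x, y). gauss (x - y) * ?b x)"
  proof (rule lborel_pair.Fubini_integrable)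
   show "L1 (\<lambda>x. \<integral>y. norm (case (x, y) of (x, y) => gauss (x - y) * ?b x) \<partial>lborel)"
    using integrable_norm[OF bi] gi[of norm] by (simp add: norm_mult)
   show "AE x in lborel. L1 (\<lambda>y. case (x, y) of (x, y) => gauss (x - y) * ?b x)"
   proof (rule AE_I2)
    fix x :: 'a
    have "(\<lambda>y. case (x, y) of (x, y) => gauss (x - y) * ?b x) = (\<lambda>y. gauss (y + - x) * ?b x)"
     unfolding prod.case ge by (simp only: add.commute)
    then show "L1 (\<lambda>y. case (x, y) of (x, y) => gauss (x - y) * ?b x)"
     using integrable_mult_left[OF sch_integrable[OF sch_translate[OF sch_gauss, of "- x"]]] by simp
   qed
  qed measurable
  have "g0 * amp a h l = (\<integral>x. g0 * ?b x)" by (simp add: amp_def)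
  also have "\<dots> = (\<integral>x. (\<integral>y. gauss (x - y) * ?b x))"
   using gi[of "\<lambda>x. x"] by (simp add: g0_def)
  also have "\<dots> = (\<integral>y. (\<integral>x. gauss (x - y) * ?b x))"
   using lborel_pair.Fubini_integral[OF F] by simp
  also have "\<dots> = (\<integral>y. (\<integral>x. gauss x * osf c y x (ten (hy y) (ly y))))"
  proof (rule integral_cong[OF refl])
   fix y
   have "(\<integral>x. gauss (x - y) * ?b x) = (\<integral>x. gauss x * ?b (x + y))"
    using integral_translate[of "\<lambda>x. gauss (x - y) * ?b x" y] by (simp add: add.commute)
   then show "(\<integral>x. gauss (x - y) * ?b x) = (\<integral>x. gauss x * osf c y x (ten (hy y) (ly y)))"
    by (simp only: bxy)
  qed
  finally have "ennreal (cmod (g0 * amp a h l)) \<le> (\<integral>\<^sup>+y. ennreal (cmod (\<integral>x. gauss x * osf c y x (ten (hy y) (ly y)))) \<partial>lborel)"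
   using norm_integral_le_nn by simp
  also have "\<dots> \<le> (\<integral>\<^sup>+y. ennreal C * (ennreal (\<integral>k. (cmod (four (sh u y) k))\<^sup>2) + ennreal (\<integral>k. (cmod (four (sh v y) k))\<^sup>2)) \<partial>lborel)"
  proof (rule nn_integral_mono)
   fix y
   have "cmod (\<integral>x. gauss x * osf c y x (ten (hy y) (ly y)))
    \<le> C * ((\<integral>k. (cmod (four (sh u y) k))\<^sup>2) + (\<integral>k. (cmod (four (sh v y) k))\<^sup>2))"
    using C(2)[OF hy[of y] ly[of y], of y] by (simp add: hy_def ly_def)
   then show "ennreal (cmod (\<integral>x. gauss x * osf c y x (ten (hy y) (ly y))))
    \<le> ennreal C * (ennreal (\<integral>k. (cmod (four (sh u y) k))\<^sup>2) + ennreal (\<integral>k. (cmod (four (sh v y) k))\<^sup>2))"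
    using C(1) by (simp add: ennreal_plus[symmetric] ennreal_mult'[symmetric] ennreal_leI del: ennreal_plus)
  qed
  also have "\<dots> = ennreal C * (ennreal (P * (\<integral>x. (cmod (u x))\<^sup>2)) + ennreal (P * (\<integral>x. (cmod (v x))\<^sup>2)))"
   using nsh[OF u(1)] nsh[OF v(1)] by (simp add: nn_integral_cmult nn_integral_add)
  also have "\<dots> = ennreal (C * P * ((\<integral>x. (cmod (h x))\<^sup>2) + (\<integral>x. (cmod (l x))\<^sup>2)))"
  proof -
   have "(\<integral>x. (cmod (u x))\<^sup>2) = (\<integral>x. (cmod (h x))\<^sup>2)" "(\<integral>x. (cmod (v x))\<^sup>2) = (\<integral>x. (cmod (l x))\<^sup>2)"
    using plancherel_norm[OF u(1)] plancherel_norm[OF v(1)] by (simp_all add: u v)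
   then show ?thesis using C(1) P0
    by (simp add: ennreal_plus[symmetric] ennreal_mult'[symmetric] distrib_left mult.assoc del: ennreal_plus)
  qed
  finally have "cmod (g0 * amp a h l) \<le> C * P * ((\<integral>x. (cmod (h x))\<^sup>2) + (\<integral>x. (cmod (l x))\<^sup>2))"
   using C(1) P0 by (subst (asm) ennreal_le_iff) (auto intro!: mult_nonneg_nonneg add_nonneg_nonneg integral_nonneg)
  moreover have "0 < cmod g0" using g0 by simp
  ultimately show ?thesis by (simp add: norm_mult field_simps)
 qed
 moreover have "0 \<le> C * P / cmod g0" using C P0 by simp
 ultimately show ?thesis by blast
qed

section \<open>Weights\<close>

text \<open>What is kept of the class \<Lambda>: derivatives of L are bounded by L, and by its
  square root as soon as at least one is taken. \<open>Lambda_weight\<close> provides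
  instances.\<close>

locale weight =
 fixes L :: "'a::euclidean_space => real"
 assumes L1: "1 \<le> L \<xi>"
  and Lsm: "sm L L"
  and Ldd: "sm (\<lambda>\<xi>. L \<xi> powr (1/2)) (dd v L)"
begin

lemma Lpos: "0 < L w" using L1[of w] by linarith

lemma Lneq0 [simp]: "L w \<noteq> 0" using Lpos[of w] by simp

lemma Lpowr_has_derivative:
 "((\<lambda>w. L w powr r) has_derivative (\<lambda>v. r * L w powr (r - 1) * dd v L w)) (at w)"
proof -
 have 1: "(L has_derivative (\<lambda>v. dd v L w)) (at w)" by (intro has_derivative_dd smD(1)[OF Lsm])
 have 2: "((\<lambda>z. z powr r) has_derivative (\<lambda>h. r * L w powr (r - 1) * h)) (at (L w))"
  using has_real_derivative_powr[OF Lpos, of r w] unfolding has_field_derivative_def .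
 show ?thesis using has_derivative_compose[OF 1 2] .
qed

lemma Lpowr_differentiable: "(\<lambda>w. L w powr r) differentiable at w"
 by (rule differentiableI[OF Lpowr_has_derivative])

lemma Lpowr_mono: "r \<le> s \<Longrightarrow> L w powr r \<le> L w powr s"
 using L1 by (intro powr_mono) auto

text \<open>Induction on the order for all exponents at once, since differentiating
  \<open>L powr r\<close> produces \<open>L powr (r - 1)\<close>; the accompanying factor
  \<open>dd v L\<close> costs only half a power.\<close>

lemma sm_Lpowr: "sm (\<lambda>w. L w powr r) (\<lambda>w. L w powr r)"
 unfolding sm_def
proof
 fix k
 show "bdk k (\<lambda>w. L w powr r) (\<lambda>w. L w powr r)"
 proof (induction k arbitrary: r)
  case 0
  show ?case by (auto intro!: exI[of _ 1] differentiable_imp_continuous Lpowr_differentiable)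
 next
  case (Suc k)
  have "bdk k (\<lambda>w. L w powr r) (dd v (\<lambda>w. L w powr r))" for v
  proof -
   have "bdk k (\<lambda>w. L w powr (r - 1) * L w powr (1/2)) (\<lambda>w. L w powr (r - 1) * dd v L w)"
    using bdk_mult[OF Suc.IH[of "r - 1"]] Ldd unfolding sm_def by blast
   then have "bdk k (\<lambda>w. L w powr r) (\<lambda>w. L w powr (r - 1) * dd v L w)"
    by (rule bdk_mono[where c = 1, rotated -1])
     (auto simp: powr_add[symmetric] Lpowr_mono)
   then have "bdk k (\<lambda>w. L w powr r) (\<lambda>w. r * (L w powr (r - 1) * dd v L w))"
    by (rule bdk_bounded_linear[OF bounded_linear_mult_right])
   moreover have "dd v (\<lambda>w. L w powr r) = (\<lambda>w. r * (L w powr (r - 1) * dd v L w))"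
    by (rule ext, subst dd_eq[OF Lpowr_has_derivative]) simp
   ultimately show ?thesis by simp
  qed
  then show ?case by (auto intro!: exI[of _ 1] Lpowr_differentiable)
 qed
qed

lemma sm_dd_Lpowr: "sm (\<lambda>w. L w powr (r - 1/2)) (dd v (\<lambda>w. L w powr r))"
proof -
 have "sm (\<lambda>w. L w powr (r - 1) * L w powr (1/2)) (\<lambda>w. r * (L w powr (r - 1) * dd v L w))"
  by (intro sm_cmult sm_mult sm_Lpowr Ldd)
 moreover have "dd v (\<lambda>w. L w powr r) = (\<lambda>w. r * (L w powr (r - 1) * dd v L w))"
  by (rule ext, subst dd_eq[OF Lpowr_has_derivative]) simp
 moreover have "r - 1 + 1 / 2 = r - 1 / 2" by simp
 ultimately show ?thesis by (simp add: powr_add[symmetric])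
qed

lemma gradient_bound:
 fixes f :: "'a => real"
 assumes "\<And>v. sm W (dd v f)" "\<And>x. 0 \<le> W x" "\<And>x. f differentiable at x"
 shows "\<exists>C\<ge>0. \<forall>x. onorm (\<lambda>v. dd v f x) \<le> C * W x"
proof -
 have "\<forall>b. \<exists>C>0. \<forall>x. norm (dd b f x) \<le> C * W x" using sm_boundE[OF assms(1,2)] by metis
 then obtain C where C: "\<And>b. 0 < C b" "\<And>b x. norm (dd b f x) \<le> C b * W x" by metis
 have "onorm (\<lambda>v. dd v f x) \<le> (\<Sum>b\<in>Basis. C b) * W x" for x
 proof (rule onorm_le)
  fix v
  have lin: "linear (\<lambda>v. dd v f x)" using has_derivative_linear[OF has_derivative_dd[OF assms(3)]] .
  have "dd v f x = dd (\<Sum>b\<in>Basis. (v \<bullet> b) *\<^sub>R b) f x" by (simp add: euclidean_representation)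
  also have "\<dots> = (\<Sum>b\<in>Basis. (v \<bullet> b) *\<^sub>R dd b f x)"
   by (simp only: linear_sum[OF lin] linear_scale[OF lin])
  also have "norm \<dots> \<le> (\<Sum>b\<in>Basis. norm v * (C b * W x))"
  proof (rule sum_norm_le)
   fix b :: 'a assume "b \<in> Basis"
   then have "\<bar>v \<bullet> b\<bar> * norm (dd b f x) \<le> norm v * (C b * W x)"
    by (intro mult_mono Basis_le_norm C) auto
   then show "norm ((v \<bullet> b) *\<^sub>R dd b f x) \<le> norm v * (C b * W x)" by (simp add: abs_mult)
  qed
  finally show "norm (dd v f x) \<le> (\<Sum>b\<in>Basis. C b) * W x * norm v"
   by (simp add: sum_distrib_left sum_distrib_right mult_ac)
 qed
 moreover have "0 \<le> (\<Sum>b\<in>Basis. C b)" using C(1) by (intro sum_nonneg) (simp add: less_imp_le)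
 ultimately show ?thesis by blast
qed

lemma Lpowr_0: "L w powr 0 = 1"
 using Lpos[of w] by simp

lemma Lpowr_square: "(L w powr (r / 2))\<^sup>2 = L w powr r"
 by (simp add: power2_eq_square powr_add[symmetric])

text \<open>The square root of L has a bounded gradient, hence is Lipschitz, and L is at least
  1.\<close>

lemma Lsqrt_shift: "\<exists>K\<ge>1. \<forall>w y. L w powr (1/2) \<le> K * (1 + norm (w - y)) * L y powr (1/2)"
proof -
 note d = Lpowr_differentiable
 have "sm (\<lambda>x. 1) (dd v (\<lambda>w. L w powr (1/2)))" for v
  using sm_dd_Lpowr[of "1/2" v] by (simp only: diff_self Lpowr_0)
 from gradient_bound[OF this _ d] obtain C
  where C: "0 \<le> C" "\<And>x. onorm (\<lambda>v. dd v (\<lambda>w. L w powr (1/2)) x) \<le> C * 1" by auto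
 have "L w powr (1/2) \<le> (1 + C) * (1 + norm (w - y)) * L y powr (1/2)" for w y
 proof -
  have "norm (L w powr (1/2) - L y powr (1/2)) \<le> C * norm (w - y)"
  proof (rule differentiable_bound[of UNIV])
   show "((\<lambda>w. L w powr (1/2)) has_derivative (\<lambda>v. dd v (\<lambda>w. L w powr (1/2)) x)) (at x within UNIV)" for x
    using has_derivative_dd[OF d] by simp
  qed (use C in auto)
  then have "L w powr (1/2) \<le> L y powr (1/2) + C * norm (w - y) * 1" by simp
  also have "\<dots> \<le> L y powr (1/2) + C * norm (w - y) * L y powr (1/2)"
   using C(1) L1[of y] by (intro add_left_mono mult_left_mono ge_one_powr_ge_zero) auto
  also have "\<dots> = (1 + C * norm (w - y)) * L y powr (1/2)" by (simp add: algebra_simps)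
  also have "\<dots> \<le> ((1 + C) * (1 + norm (w - y))) * L y powr (1/2)"
   using C(1) by (intro mult_right_mono) (auto simp: algebra_simps)
  finally show ?thesis .
 qed
 then show ?thesis using C(1) by (intro exI[of _ "1 + C"]) auto
qed

text \<open>\<open>Lsqrt_shift\<close> raised to the power 2r; for negative \<open>r\<close> the
  points \<open>w\<close> and \<open>y\<close> change roles.\<close>

lemma Lpowr_shift: "\<exists>C M. 0 \<le> C \<and> (\<forall>w y. L w powr r \<le> C * (1 + norm (w - y)) ^ M * L y powr r)"
proof -
 obtain K where K: "1 \<le> K" "\<And>w y. L w powr (1/2) \<le> K * (1 + norm (w - y)) * L y powr (1/2)"
  using Lsqrt_shift by blast
 define M where "M = nat \<lceil>2 * \<bar>r\<bar>\<rceil>"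
 have K1: "1 \<le> K * (1 + norm (w - y))" for w y :: 'a
  using mult_mono[of 1 K 1 "1 + norm (w - y)"] K(1) by simp
 have pos: "L w powr s \<le> (K * (1 + norm (w - y))) ^ M * L y powr s" if "0 \<le> s" "2 * s \<le> real M" for w y and s :: real
 proof -
  have "L w powr s = (L w powr (1/2)) powr (2 * s)" by (simp add: powr_powr)
  also have "\<dots> \<le> (K * (1 + norm (w - y)) * L y powr (1/2)) powr (2 * s)"
   using that by (intro powr_mono2 K) auto
  also have "\<dots> = (K * (1 + norm (w - y))) powr (2 * s) * L y powr s"
   using K(1) by (subst powr_mult) (auto simp: powr_powr)
  also have "\<dots> \<le> (K * (1 + norm (w - y))) powr M * L y powr s"
   using that K1 by (intro mult_right_mono powr_mono) auto
  also have "(K * (1 + norm (w - y))) powr M = (K * (1 + norm (w - y))) ^ M"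
   using K1[of w y] by (intro powr_realpow) linarith
  finally show ?thesis .
 qed
 have "L w powr r \<le> (K * (1 + norm (w - y))) ^ M * L y powr r" for w y
 proof (cases "0 \<le> r")
  case True
  then have "2 * r \<le> real M" by (auto simp: M_def)
  then show ?thesis using pos True by blast
 next
  case False
  then have "2 * - r \<le> real M" "0 \<le> - r" by (auto simp: M_def)
  then have "L y powr (- r) \<le> (K * (1 + norm (y - w))) ^ M * L w powr (- r)" using pos by blast
  then have "L w powr r * L y powr (- r) * L y powr r \<le> L w powr r * ((K * (1 + norm (y - w))) ^ M * L w powr (- r)) * L y powr r"
   by (intro mult_right_mono mult_left_mono) auto
  then show ?thesis using Lpos[of w] Lpos[of y]
   by (simp add: powr_minus field_simps norm_minus_commute)
 qed
 then show ?thesis using K(1) by (intro exI[of _ "K ^ M"] exI[of _ M]) (simp add: power_mult_distrib)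
qed

lemma Lpowr_poly: "\<exists>C M. 0 \<le> C \<and> (\<forall>w. L w powr r \<le> C * (1 + norm w) ^ M)"
proof -
 obtain C M where C: "0 \<le> C" "\<And>w y. L w powr r \<le> C * (1 + norm (w - y)) ^ M * L y powr r" using Lpowr_shift by blast
 have "L w powr r \<le> (C * L 0 powr r) * (1 + norm w) ^ M" for w using C(2)[of w 0] by (simp add: mult_ac)
 then show ?thesis using C(1) by (intro exI[of _ "C * L 0 powr r"] exI[of _ M]) auto
qed

text \<open>The operator L(D)^r seen on the Fourier side, where all arguments \<open>h\<close>
  live.\<close>

definition mul :: "real => ('a => complex) => 'a => complex" where
 "mul r h = (\<lambda>w. cr (L w powr r) * h w)"

lemma sch_mul: "sch h \<Longrightarrow> sch (mul r h)"
proof -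
 assume h: "sch h"
 obtain C M where "\<And>w. L w powr r \<le> C * (1 + norm w) ^ M" using Lpowr_poly by blast
 from sch_mult[OF sm_of_real[OF sm_Lpowr[of r]] _ this h] show ?thesis unfolding mul_def by simp
qed

lemma mul_mul: "mul r (mul s h) = mul (r + s) h"
 by (auto simp: mul_def fun_eq_iff powr_add)

lemma mul_0: "mul 0 h = h"
 using Lpos by (auto simp: mul_def fun_eq_iff less_imp_neq[THEN not_sym])

lemma cnj_mul: "cnj (mul r h w) = mul r (\<lambda>w. cnj (h w)) w"
 by (simp add: mul_def)

text \<open>With \<open>L = 1 + \<psi>0\<close> and \<open>h = four u\<close> this is the square of
  the norm of u in H^(\<psi>0, r).\<close>

definition wn :: "real => ('a => complex) => real" where
 "wn r h = (\<integral>w. L w powr r * (cmod (h w))\<^sup>2)"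

lemma wn_mul: "wn r h = (\<integral>w. (cmod (mul (r / 2) h w))\<^sup>2)"
 unfolding wn_def mul_def by (simp add: norm_mult power_mult_distrib Lpowr_square)

lemma wn_mul': "wn r (mul s h) = wn (r + 2 * s) h"
 by (simp add: wn_mul mul_mul add_divide_distrib)

lemma wn_integrable: "sch h \<Longrightarrow> L1 (\<lambda>w. L w powr r * (cmod (h w))\<^sup>2)"
 using sch_square_integrable[OF sch_mul, of h "r / 2"]
 by (simp add: mul_def norm_mult power_mult_distrib Lpowr_square)

lemma wn_nonneg: "0 \<le> wn r h"
 unfolding wn_def by (rule integral_nonneg) simp

lemma wn_mono: "r \<le> s \<Longrightarrow> sch h \<Longrightarrow> wn r h \<le> wn s h"
 unfolding wn_def by (intro Bochner_Integration.integral_mono wn_integrable mult_right_mono Lpowr_mono) auto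

lemma wn_interpolate:
 assumes "c < 1" "0 < e"
 obtains K where "0 \<le> K" "\<And>h. sch h \<Longrightarrow> wn c h \<le> e * wn 1 h + K * wn 0 h"
proof -
 \<comment> \<open>Above \<open>T\<close> the factor \<open>L powr (1 - c)\<close> is at least
   \<open>1 / e\<close>; below \<open>T\<close> the power \<open>L powr c\<close> is at most
   \<open>K\<close>, where the absolute value takes care of negative \<open>c\<close>.\<close>
 define T where "T = (1 / e) powr (1 / (1 - c))"
 define K where "K = T powr \<bar>c\<bar>"
 have T: "0 < T" using assms by (simp add: T_def)
 have le: "L w powr c \<le> e * L w powr 1 + K * L w powr 0" for w
 proof (cases "T \<le> L w")
  case True
  have "1 / e = T powr (1 - c)" using assms by (simp add: T_def powr_powr)
  also have "\<dots> \<le> L w powr (1 - c)" using True T assms by (intro powr_mono2) auto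
  finally have "1 \<le> e * L w powr (1 - c)" using assms by (simp add: field_simps)
  then have "L w powr c * 1 \<le> L w powr c * (e * L w powr (1 - c))" by (intro mult_left_mono) auto
  also have "\<dots> = e * L w powr 1" by (simp add: powr_add[symmetric] mult.left_commute)
  finally show ?thesis by (simp add: K_def) (smt (verit) mult_nonneg_nonneg powr_ge_zero)
 next
  case False
  have "L w powr c \<le> L w powr \<bar>c\<bar>" by (intro Lpowr_mono) simp
  also have "\<dots> \<le> K" unfolding K_def using False Lpos[of w] by (intro powr_mono2) auto
  also have "K = K * L w powr 0" using Lpos[of w] by simp
  finally show ?thesis using assms(2) by (smt (verit) mult_nonneg_nonneg powr_ge_zero)
 qed
 have "wn c h \<le> e * wn 1 h + K * wn 0 h" if h: "sch h" for h
 proof -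
  note i = wn_integrable[OF h]
  have "wn c h \<le> (\<integral>w. e * (L w powr 1 * (cmod (h w))\<^sup>2) + K * (L w powr 0 * (cmod (h w))\<^sup>2))"
   unfolding wn_def
  proof (intro Bochner_Integration.integral_mono integrable_add integrable_mult_right i)
   show "L w powr c * (cmod (h w))\<^sup>2 \<le> e * (L w powr 1 * (cmod (h w))\<^sup>2) + K * (L w powr 0 * (cmod (h w))\<^sup>2)" for w
    using mult_right_mono[OF le[of w], of "(cmod (h w))\<^sup>2"] by (simp add: distrib_right mult.assoc)
  qed
  also have "\<dots> = e * wn 1 h + K * wn 0 h"
   unfolding wn_def by (subst integral_add) (intro integrable_mult_right i, intro integrable_mult_right i, simp)
  finally show ?thesis .
 qed
 then show ?thesis using that[of K] by (simp add: K_def)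
qed

end

section \<open>Double amplitudes of a given order and the commutator gain\<close>

context weight
begin

definition tw :: "real => nat => 'a \<times> ('a \<times> 'a) => real" where
 "tw r M z = L (fst (snd z)) powr r * (1 + norm (fst (snd z) - snd (snd z))) ^ M"

text \<open>The order is measured in \<xi>. By \<open>Lpowr_shift\<close> it could as well be
  measured in \<eta>, at the price of powers of 1 + |\<xi> - \<eta>|, so the exponent
  \<open>M\<close> is left open.\<close>

definition acls :: "real => ('a \<times> ('a \<times> 'a) => complex) => bool" where
 "acls r a \<longleftrightarrow> (\<exists>M. sm (tw r M) a)"

lemma tw_nonneg: "0 \<le> tw r M z" by (simp add: tw_def)

lemma acls_mono:
 assumes "acls r a" "r \<le> s" shows "acls s a"
proof -
 obtain M where "sm (tw r M) a" using assms by (auto simp: acls_def)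
 then have "sm (tw s M) a"
  by (rule sm_mono[where c = 1]) (auto simp: tw_def assms intro!: mult_right_mono Lpowr_mono)
 then show ?thesis by (auto simp: acls_def)
qed

lemma tw_max: "sm (tw r M) a \<Longrightarrow> M \<le> M' \<Longrightarrow> sm (tw r M') a"
 by (rule sm_mono[where c = 1]) (auto simp: tw_def intro!: mult_left_mono power_increasing)

lemma acls_add:
 assumes "acls r a" "acls r b" shows "acls r (\<lambda>z. a z + b z)"
proof -
 obtain M N where "sm (tw r M) a" "sm (tw r N) b" using assms by (auto simp: acls_def)
 then have "sm (tw r (max M N)) a" "sm (tw r (max M N)) b" by (auto intro: tw_max)
 then show ?thesis unfolding acls_def using sm_add by blast
qed

lemma acls_mult:
 assumes "acls r a" "acls s b" shows "acls (r + s) (\<lambda>z. a z * b z)"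
proof -
 obtain M N where "sm (tw r M) a" "sm (tw s N) b" using assms by (auto simp: acls_def)
 then have "sm (\<lambda>z. tw r M z * tw s N z) (\<lambda>z. a z * b z)" by (rule sm_mult)
 moreover have "(\<lambda>z. tw r M z * tw s N z) = tw (r + s) (M + N)"
  by (auto simp: tw_def powr_add power_add mult_ac)
 ultimately show ?thesis by (auto simp: acls_def)
qed

lemma bl_xi: "bounded_linear (\<lambda>z :: 'a \<times> ('a \<times> 'a). fst (snd z))"
 and bl_eta: "bounded_linear (\<lambda>z :: 'a \<times> ('a \<times> 'a). snd (snd z))"
 and bl_x_xi: "bounded_linear (\<lambda>z :: 'a \<times> ('a \<times> 'a). (fst z, fst (snd z)))"
 by (intro bounded_linear_Pair bounded_linear_compose[OF bounded_linear_fst] bounded_linear_compose[OF bounded_linear_snd]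
   bounded_linear_fst bounded_linear_snd)+

lemma acls_xi: "sm (\<lambda>w. L w powr r) f \<Longrightarrow> acls r (\<lambda>z. f (fst (snd z)))"
proof -
 assume "sm (\<lambda>w. L w powr r) f"
 from sm_comp[OF bl_xi this] have "sm (tw r 0) (\<lambda>z. f (fst (snd z)))" by (simp add: tw_def[abs_def])
 then show ?thesis by (auto simp: acls_def)
qed

lemma acls_eta: "sm (\<lambda>w. L w powr r) f \<Longrightarrow> acls r (\<lambda>z. f (snd (snd z)))"
proof -
 assume f: "sm (\<lambda>w. L w powr r) f"
 obtain C M where C: "0 \<le> C" "\<And>w y. L w powr r \<le> C * (1 + norm (w - y)) ^ M * L y powr r" using Lpowr_shift by blast
 from sm_comp[OF bl_eta f] have "sm (tw r M) (\<lambda>z. f (snd (snd z)))"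
 proof (rule sm_mono)
  show "L (snd (snd z)) powr r \<le> C * tw r M z" for z
   using C(2)[of "snd (snd z)" "fst (snd z)"] by (simp add: tw_def norm_minus_commute mult_ac)
 qed simp
 then show ?thesis by (auto simp: acls_def)
qed

lemma acls_Lxi: "acls r (\<lambda>z. cr (L (fst (snd z)) powr r))"
 by (rule acls_xi[OF sm_of_real[OF sm_Lpowr]])

lemma acls_Leta: "acls r (\<lambda>z. cr (L (snd (snd z)) powr r))"
 by (rule acls_eta[OF sm_of_real[OF sm_Lpowr]])

lemma acls_symbol: "sm (\<lambda>(x, w). L w powr r) p \<Longrightarrow> acls r (\<lambda>z. p (fst z, fst (snd z)))"
proof -
 assume "sm (\<lambda>(x, w). L w powr r) p"
 from sm_comp[OF bl_x_xi this] have "sm (tw r 0) (\<lambda>z. p (fst z, fst (snd z)))" by (simp add: tw_def[abs_def])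
 then show ?thesis by (auto simp: acls_def)
qed

lemma acls_amp: "acls r a \<Longrightarrow> r \<le> 0 \<Longrightarrow> \<exists>M. sm (amp_weight M) a"
proof -
 assume "acls r a" "r \<le> 0"
 then obtain M where "sm (tw 0 M) a" using acls_mono[of r a 0] by (auto simp: acls_def)
 moreover have "tw 0 M = amp_weight M" by (simp add: tw_def[abs_def] amp_weight_def fun_eq_iff)
 ultimately show ?thesis by auto
qed

text \<open>Inserting L(\<xi>)^(-s) and L(\<eta>)^s into a form multiplies its amplitude by 1 +
  \<open>comm_symbol s\<close>.\<close>

definition comm_symbol :: "real => 'a \<times> ('a \<times> 'a) => complex" where
 "comm_symbol s z = cr (L (snd (snd z)) powr s * L (fst (snd z)) powr (- s) - 1)"

text \<open>The factor vanishes on the diagonal, which gains half an order.\<close>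

lemma acls_comm_symbol: "acls (- 1/2) (comm_symbol s)"
proof -
 let ?f = "\<lambda>z :: 'a \<times> ('a \<times> 'a). L (snd (snd z)) powr s * L (fst (snd z)) powr (- s) - 1 :: real"
 note Ld = Lpowr_differentiable
 have d: "(\<lambda>z :: 'a \<times> ('a \<times> 'a). L (snd (snd z)) powr r) differentiable at z" "(\<lambda>z :: 'a \<times> ('a \<times> 'a). L (fst (snd z)) powr r) differentiable at z"
  "dd v (\<lambda>z :: 'a \<times> ('a \<times> 'a). L (snd (snd z)) powr r) z = dd (snd (snd v)) (\<lambda>\<xi>. L \<xi> powr r) (snd (snd z))"
  "dd v (\<lambda>z :: 'a \<times> ('a \<times> 'a). L (fst (snd z)) powr r) z = dd (fst (snd v)) (\<lambda>\<xi>. L \<xi> powr r) (fst (snd z))" for r z v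
  using dd_comp_affine(1)[OF bl_eta, of "\<lambda>\<xi>. L \<xi> powr r" z 0] dd_comp_affine(1)[OF bl_xi, of "\<lambda>\<xi>. L \<xi> powr r" z 0]
   dd_comp_affine(2)[OF bl_eta, of "\<lambda>\<xi>. L \<xi> powr r" z 0] dd_comp_affine(2)[OF bl_xi, of "\<lambda>\<xi>. L \<xi> powr r" z 0] Ld by simp_all
 obtain C0 where C0: "0 \<le> C0" "\<And>x. onorm (\<lambda>v. dd v (\<lambda>\<xi>. L \<xi> powr s) x) \<le> C0 * L x powr (s - 1/2)"
  using gradient_bound[OF sm_dd_Lpowr _ Ld, of s] by auto
 obtain C M where C: "0 \<le> C" "\<And>\<xi> \<eta>. L \<xi> powr (s - 1/2) \<le> C * (1 + norm (\<xi> - \<eta>)) ^ M * L \<eta> powr (s - 1/2)" using Lpowr_shift by blast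
 \<comment> \<open>Mean value bound on the segment from \<xi> to \<eta>: the gradient of
   \<open>L powr s\<close> has size \<open>L powr (s - 1/2)\<close> at intermediate points, and slow
   variation carries this back to \<xi>.\<close>
 have bd: "cmod (comm_symbol s z) \<le> (C0 * C) * tw (- 1/2) (Suc M) z" for z
 proof -
  define \<xi> where "\<xi> = fst (snd z)"
  define \<eta> where "\<eta> = snd (snd z)"
  let ?B = "C0 * (C * (1 + norm (\<xi> - \<eta>)) ^ M * L \<xi> powr (s - 1/2))"
  have "norm (L \<eta> powr s - L \<xi> powr s) \<le> ?B * norm (\<eta> - \<xi>)"
  proof (rule differentiable_bound[of "closed_segment \<xi> \<eta>"])
   fix x assume x: "x \<in> closed_segment \<xi> \<eta>"
   show "((\<lambda>\<xi>. L \<xi> powr s) has_derivative (\<lambda>v. dd v (\<lambda>\<xi>. L \<xi> powr s) x)) (at x within closed_segment \<xi> \<eta>)"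
    by (rule has_derivative_at_withinI[OF has_derivative_dd[OF Ld]])
   have "norm (x - \<xi>) \<le> norm (\<xi> - \<eta>)" using segment_bound1[OF x] by (simp add: norm_minus_commute)
   then have "(1 + norm (x - \<xi>)) ^ M \<le> (1 + norm (\<xi> - \<eta>)) ^ M" by (intro power_mono) auto
   then have "L x powr (s - 1/2) \<le> C * (1 + norm (\<xi> - \<eta>)) ^ M * L \<xi> powr (s - 1/2)"
    by (intro order_trans[OF C(2)[of x \<xi>]] mult_right_mono mult_left_mono C) auto
   then show "onorm (\<lambda>v. dd v (\<lambda>\<xi>. L \<xi> powr s) x) \<le> ?B"
    by (intro order_trans[OF C0(2)] mult_left_mono C0)
  qed auto
  also have "\<dots> \<le> ?B * (1 + norm (\<xi> - \<eta>))"
   using C0 C by (intro mult_left_mono) (auto simp: norm_minus_commute)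
  finally have 1: "\<bar>L \<eta> powr s - L \<xi> powr s\<bar> \<le> ?B * (1 + norm (\<xi> - \<eta>))" by simp
  have "comm_symbol s z = cr ((L \<eta> powr s - L \<xi> powr s) * L \<xi> powr (- s))"
   unfolding comm_symbol_def \<xi>_def[symmetric] \<eta>_def[symmetric] left_diff_distrib powr_add[symmetric] by simp
  then have "cmod (comm_symbol s z) = \<bar>L \<eta> powr s - L \<xi> powr s\<bar> * L \<xi> powr (- s)" by (simp only: norm_of_real abs_mult) simp
  also have "\<dots> \<le> (?B * (1 + norm (\<xi> - \<eta>))) * L \<xi> powr (- s)" by (intro mult_right_mono 1) simp
  also have "\<dots> = (C0 * C) * (L \<xi> powr (s - 1/2) * L \<xi> powr (- s) * (1 + norm (\<xi> - \<eta>)) ^ Suc M)" by simp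
  also have "L \<xi> powr (s - 1/2) * L \<xi> powr (- s) = L \<xi> powr (- 1/2)" by (simp add: powr_add[symmetric])
  finally show ?thesis by (simp add: tw_def \<xi>_def \<eta>_def)
 qed
 have p: "(\<lambda>z :: 'a \<times> ('a \<times> 'a). L (snd (snd z)) powr s * L (fst (snd z)) powr (- s)) differentiable at z" for z
  by (intro differentiable_mult d)
 have dc: "(comm_symbol s has_derivative (\<lambda>v. cr (
   L (snd (snd z)) powr s * dd (fst (snd v)) (\<lambda>\<xi>. L \<xi> powr (- s)) (fst (snd z)) +
   dd (snd (snd v)) (\<lambda>\<xi>. L \<xi> powr s) (snd (snd z)) * L (fst (snd z)) powr (- s)))) (at z)" for z
 proof -
  have "((\<lambda>z. L (snd (snd z)) powr s * L (fst (snd z)) powr (- s) - 1) has_derivative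
   (\<lambda>v. dd v (\<lambda>z :: 'a \<times> ('a \<times> 'a). L (snd (snd z)) powr s * L (fst (snd z)) powr (- s)) z - 0)) (at z)"
   by (rule has_derivative_diff[OF has_derivative_dd[OF p] has_derivative_const])
  from has_derivative_of_real[OF this] show ?thesis
   unfolding comm_symbol_def[abs_def] by (simp add: dd_mult d)
 qed
 \<comment> \<open>After differentiation nothing cancels any more, but each of the two terms
   contains a derivative of a power of L and so gains the half order by itself.\<close>
 have ac: "acls (- 1/2) (dd v (comm_symbol s))" for v
 proof -
  have 1: "acls (s + (- s - 1/2)) (\<lambda>z. cr (L (snd (snd z)) powr s) * cr (dd (fst (snd v)) (\<lambda>\<xi>. L \<xi> powr (- s)) (fst (snd z))))"
   by (rule acls_mult[OF acls_Leta acls_xi[OF sm_of_real[OF sm_dd_Lpowr]]])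
  have 2: "acls ((s - 1/2) + (- s)) (\<lambda>z. cr (dd (snd (snd v)) (\<lambda>\<xi>. L \<xi> powr s) (snd (snd z))) * cr (L (fst (snd z)) powr (- s)))"
   by (rule acls_mult[OF acls_eta[OF sm_of_real[OF sm_dd_Lpowr]] acls_Lxi])
  have e: "s + (- s - 1/2) = - 1/2" "(s - 1/2) + (- s) = - 1/2" by simp_all
  have "dd v (comm_symbol s) = (\<lambda>z. cr (L (snd (snd z)) powr s) * cr (dd (fst (snd v)) (\<lambda>\<xi>. L \<xi> powr (- s)) (fst (snd z)))
   + cr (dd (snd (snd v)) (\<lambda>\<xi>. L \<xi> powr s) (snd (snd z))) * cr (L (fst (snd z)) powr (- s)))"
   by (rule ext, subst dd_eq[OF dc]) (simp only: of_real_add of_real_mult)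
  then show ?thesis using acls_add[OF 1[unfolded e] 2[unfolded e]] by (simp only:)
 qed
 have "\<forall>v. \<exists>M'. sm (tw (- 1/2) M') (dd v (comm_symbol s))" using ac unfolding acls_def by blast
 then obtain M' where M': "\<And>v. sm (tw (- 1/2) (M' v)) (dd v (comm_symbol s))" by metis
 \<comment> \<open>\<open>sm\<close> allows one weight only, so a single exponent has to serve the
   function and all basis directions.\<close>
 define N where "N = Suc M + (\<Sum>b\<in>Basis. M' b)"
 have M'N: "M' b \<le> N" if "b \<in> Basis" for b
  using member_le_sum[OF that, of M'] by (simp add: N_def)
 have "sm (tw (- 1/2) N) (comm_symbol s)"
 proof (rule smI)
  show "comm_symbol s differentiable at z" for z by (rule differentiableI[OF dc])
  show "norm (comm_symbol s z) \<le> (C0 * C) * tw (- 1/2) N z" for z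
  proof -
   have "tw (- 1/2) (Suc M) z \<le> tw (- 1/2) N z" unfolding tw_def N_def by (intro mult_left_mono power_increasing) auto
   then show ?thesis using C0 C by (intro order_trans[OF bd] mult_left_mono) auto
  qed
  show "sm (tw (- 1/2) N) (dd v (comm_symbol s))" for v
  proof -
   have "dd v (comm_symbol s) = (\<lambda>z. \<Sum>b\<in>Basis. (v \<bullet> b) *\<^sub>R dd b (comm_symbol s) z)"
   proof
    fix z
    have lin: "linear (\<lambda>v. dd v (comm_symbol s) z)"
     by (rule has_derivative_linear[OF has_derivative_dd[OF differentiableI[OF dc]]])
    have "dd v (comm_symbol s) z = dd (\<Sum>b\<in>Basis. (v \<bullet> b) *\<^sub>R b) (comm_symbol s) z" by (simp add: euclidean_representation)
    then show "dd v (comm_symbol s) z = (\<Sum>b\<in>Basis. (v \<bullet> b) *\<^sub>R dd b (comm_symbol s) z)"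
     by (simp only: linear_sum[OF lin] linear_scale[OF lin])
   qed
   moreover have "sm (tw (- 1/2) N) (\<lambda>z. \<Sum>b\<in>Basis. (v \<bullet> b) *\<^sub>R dd b (comm_symbol s) z)"
    by (rule sm_sum[OF finite_Basis sm_scaleR[OF tw_max[OF M' M'N]] tw_nonneg])
   ultimately show ?thesis by simp
  qed
 qed
 then show ?thesis by (auto simp: acls_def)
qed

lemma amp_acls_bound:
 assumes "acls r a" "r \<le> 0"
 shows "\<exists>C\<ge>0. \<forall>h l. sch h \<longrightarrow> sch l \<longrightarrow> cmod (amp a h l) \<le> C * (wn 0 h + wn 0 l)"
proof -
 obtain M where "sm (amp_weight M) a" using acls_amp[OF assms] by blast
 from amp_bounded[OF this] show ?thesis by (simp add: wn_def)
qed

lemma amp_mul: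
 "amp a (mul r h) (mul s l) = amp (\<lambda>z. a z * (cr (L (fst (snd z)) powr r) * cr (L (snd (snd z)) powr s))) h l"
 unfolding amp_def ampx_def by (simp add: ten_def mul_def mult_ac)

lemma amp_scale: "amp a (\<lambda>x. c * h x) (\<lambda>x. d * l x) = c * d * amp a h l"
proof -
 have "ampx a (\<lambda>x. c * h x) (\<lambda>x. d * l x) x = c * d * ampx a h l x" for x
  unfolding ampx_def integral_mult_right_zero[symmetric]
  by (rule integral_cong) (simp_all add: ten_def mult_ac)
 then show ?thesis by (simp add: amp_def)
qed

lemma amp_diff:
 assumes "sm (amp_weight M) a" "sm (amp_weight N) b" "sch h" "sch l"
 shows "amp (\<lambda>z. a z - b z) h l = amp a h l - amp b h l"
proof -
 have "ampx (\<lambda>z. a z - b z) h l x = ampx a h l x - ampx b h l x" for x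
 proof -
  have "L1 (\<lambda>y. (ee (x, - x) y * a (x, y)) * ten h l y)"
   "L1 (\<lambda>y. (ee (x, - x) y * b (x, y)) * ten h l y)"
   by (intro sch_integrable amp_slice[OF assms(1,3,4)] amp_slice[OF assms(2,3,4)])+
  from integral_diff[OF this] show ?thesis
   unfolding ampx_def by (simp only: left_diff_distrib right_diff_distrib)
 qed
 then show ?thesis using ampx_bound(2)[OF assms(1,3,4)] ampx_bound(2)[OF assms(2,3,4)] by (simp add: amp_def)
qed

end

section \<open>Density of the range\<close>

text \<open>The input for the density of the range: a symbol of size \<open>L powr (k0 / 2)\<close>,
  a Garding inequality in the weight L, and an integrable negative power of L by which weighted L2
  norms dominate the supremum. \<open>k0 < 3\<close> is what the half-order gain of a commutator can
  pay for.\<close>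

locale pdo = weight L for L :: "'a::euclidean_space => real" +
 fixes p :: "'a \<times> 'a => complex" and k0 \<gamma> lam0 m :: real
 assumes k0: "1 \<le> k0" "k0 < 3"
  and psm: "sm (\<lambda>(x, \<xi>). L \<xi> powr (k0 / 2)) p"
  and \<gamma>: "0 < \<gamma>"
  and garding: "\<And>u. sch u \<Longrightarrow> \<gamma> * wn 1 (four u) - lam0 * wn 0 (four u)
    \<le> Re (\<integral>x. (kap TYPE('a) * osc (\<lambda>z. p z * four u (snd z)) x x) * cnj (u x))"
  and Lint: "L1 (\<lambda>\<xi>. L \<xi> powr (- m))"
begin

definition Pop :: "('a => complex) => 'a => complex" where
 "Pop u x = kap TYPE('a) * osc (\<lambda>z. p z * four u (snd z)) x x"

definition p3 :: "'a \<times> ('a \<times> 'a) => complex" where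
 "p3 z = p (fst z, fst (snd z))"

text \<open>The form of the operator on the Fourier side, bilinear because the conjugation is left
  to the second argument (\<open>Pop_pairing\<close>). One factor \<open>kap\<close> belongs to the
  operator, the other to the inversion formula for the test function.\<close>

definition Phi :: "('a => complex) => ('a => complex) => complex" where
 "Phi h l = kap TYPE('a) * kap TYPE('a) * amp p3 h l"

lemma acls_p3: "acls (k0 / 2) p3"
 unfolding p3_def[abs_def] by (rule acls_symbol[OF psm])

lemma osym_symbol:
 assumes h: "sch h" shows "osym (\<lambda>_. 1) (\<lambda>z. p z * h (snd z))"
 unfolding osym_def
proof
 fix N
 obtain C M where C: "0 \<le> C" "\<And>w. L w powr (k0 / 2) \<le> C * (1 + norm w) ^ M" using Lpowr_poly by blast
 have "sm (\<lambda>z. (case z of (x, w) => L w powr (k0 / 2)) * dec (M + N) (snd z)) (\<lambda>z. p z * h (snd z))"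
  by (rule sm_mult[OF psm sm_comp[OF bounded_linear_snd schD[OF h]]])
 then show "sm (\<lambda>(p, z). 1 * dec N z) (\<lambda>z. p z * h (snd z))"
 proof (rule sm_mono)
  fix z :: "'a \<times> 'a"
  show "0 \<le> (case z of (x, w) => L w powr (k0 / 2)) * dec (M + N) (snd z)" by (simp add: case_prod_beta')
  have "L (snd z) powr (k0 / 2) * dec (M + N) (snd z) \<le> (C * (1 + norm (snd z)) ^ M) * dec (M + N) (snd z)"
   by (intro mult_right_mono C) simp
  also have "\<dots> = C * dec N (snd z) * ((1 + norm (snd z)) ^ M * dec M (snd z))" by (simp only: dec_add mult_ac)
  finally show "(case z of (x, w) => L w powr (k0 / 2)) * dec (M + N) (snd z) \<le> C * (case z of (p, z) => 1 * dec N z)"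
   by (simp add: power_dec case_prod_beta')
 qed
qed

lemma sch_Pop: "sch u \<Longrightarrow> sch (Pop u)"
 unfolding Pop_def[abs_def] by (rule sch_cmult[OF sch_osc_diag[OF osym_symbol[OF sch_four]]])

text \<open>\<open>p3\<close> does not depend on \<eta>, so the double frequency integral is a
  product.\<close>

lemma amp_p3_slice:
 assumes h: "sch h" and l: "sch l"
 shows "ampx p3 h l x = osc (\<lambda>z. p z * h (snd z)) x x * fm l x"
proof -
 let ?a = "\<lambda>w. ee x w * (p (x, w) * h w)"
 let ?b = "\<lambda>y. en y x * l y"
 have "sch ?a" using sch_mult_1[OF sm_cis osym_slice[OF osym_symbol[OF h]]] by simp
 then have a: "integrable lborel ?a" by (rule sch_integrable)
 have b: "integrable lborel ?b"
  using sch_integrable_poly[OF l, of "\<lambda>y. en y x" 1 0] by simp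
 have i: "integrable (lborel \<Otimes>\<^sub>M lborel) (\<lambda>(w, y). 1 * (?a w * ?b y))"
  by (rule integrable_pair_mult[OF lborel.sigma_finite_measure_axioms lborel.sigma_finite_measure_axioms a b, of "\<lambda>_. 1" 1]) auto
 have "ampx p3 h l x = (\<integral>z. ?a (fst z) * ?b (snd z) \<partial>(lborel \<Otimes>\<^sub>M lborel))"
  unfolding ampx_def lborel_prod
  by (rule integral_cong)
   (auto simp: p3_def ten_def inner_prod_def exp_add[symmetric] exp_diff exp_minus inner_commute field_simps)
 also have "\<dots> = (\<integral>w. (\<integral>y. ?a w * ?b y))"
  using lborel_pair.integral_fst'[of "\<lambda>z. ?a (fst z) * ?b (snd z)"] i by (simp add: case_prod_beta')
 also have "\<dots> = (\<integral>w. ?a w * (\<integral>y. ?b y))" by (simp only: integral_mult_right_zero)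
 also have "\<dots> = (\<integral>w. ?a w) * (\<integral>y. ?b y)" by (simp only: integral_mult_left_zero)
 finally show ?thesis by (simp add: osc_def fm_def)
qed

lemma Pop_pairing:
 assumes u: "sch u" and v: "sch v"
 shows "(\<integral>x. Pop u x * cnj (v x)) = Phi (four u) (\<lambda>x. cnj (four v x))"
proof -
 have "cnj (v x) = kap TYPE('a) * fm (\<lambda>x. cnj (four v x)) x" for x
  using cnj_ifour[of "four v" x] by (simp add: ifour_four v four_def)
 then have "Pop u x * cnj (v x) = kap TYPE('a) * kap TYPE('a) * ampx p3 (four u) (\<lambda>x. cnj (four v x)) x" for x
  by (simp add: Pop_def amp_p3_slice sch_four sch_cnj u v)
 then show ?thesis by (simp add: Phi_def amp_def)
qed

text \<open>\<open>L powr (- r)\<close> and \<open>L powr (- s)\<close> go into the amplitude, whose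
  order drops to at most 0; \<open>mul r\<close> and \<open>mul s\<close> on the arguments
  compensate for them.\<close>

lemma amp_mul_bound:
 assumes a: "acls r0 a" and "r0 - r - s \<le> 0"
 shows "\<exists>C\<ge>0. \<forall>h l. sch h \<longrightarrow> sch l \<longrightarrow> cmod (amp a h l) \<le> C * (wn (2 * r) h + wn (2 * s) l)"
proof -
 have "acls (r0 + (- r + - s)) (\<lambda>z. a z * (cr (L (fst (snd z)) powr (- r)) * cr (L (snd (snd z)) powr (- s))))"
  by (rule acls_mult[OF a acls_mult[OF acls_Lxi acls_Leta]])
 from amp_acls_bound[OF this] assms(2) obtain C where C: "0 \<le> C"
  "\<And>h l. sch h \<Longrightarrow> sch l \<Longrightarrow> cmod (amp a (mul (- r) h) (mul (- s) l)) \<le> C * (wn 0 h + wn 0 l)"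
  unfolding amp_mul by auto
 have "cmod (amp a h l) \<le> C * (wn (2 * r) h + wn (2 * s) l)" if h: "sch h" and l: "sch l" for h l
  using C(2)[OF sch_mul[OF h, of r] sch_mul[OF l, of s]] by (simp add: mul_mul mul_0 wn_mul')
 then show ?thesis using C(1) by blast
qed

lemma Phi_mul_bound:
 assumes "k0 / 2 - r - s \<le> 0"
 shows "\<exists>C\<ge>0. \<forall>h l. sch h \<longrightarrow> sch l \<longrightarrow> cmod (Phi h l) \<le> C * (wn (2 * r) h + wn (2 * s) l)"
proof -
 obtain C where C: "0 \<le> C"
  "\<And>h l. sch h \<Longrightarrow> sch l \<Longrightarrow> cmod (amp p3 h l) \<le> C * (wn (2 * r) h + wn (2 * s) l)"
  using amp_mul_bound[OF acls_p3 assms] by blast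
 have "cmod (Phi h l) \<le> (cmod (kap TYPE('a) * kap TYPE('a)) * C) * (wn (2 * r) h + wn (2 * s) l)" if h: "sch h" and l: "sch l" for h l
  unfolding Phi_def norm_mult[of _ "amp p3 h l"]
  using mult_left_mono[OF C(2)[OF h l], of "cmod (kap TYPE('a) * kap TYPE('a))"] by (simp add: mult.assoc)
 then show ?thesis using C(1) by (intro exI[of _ "cmod (kap TYPE('a) * kap TYPE('a)) * C"]) auto
qed

lemma Phi_scale: "Phi (\<lambda>x. c * h x) (\<lambda>x. d * l x) = c * d * Phi h l"
 by (simp add: Phi_def amp_scale)

lemma wn_scale: "wn r (\<lambda>x. cr c * h x) = c\<^sup>2 * wn r h"
 unfolding wn_def integral_mult_right_zero[symmetric]
 by (rule integral_cong) (simp_all add: norm_mult power_mult_distrib mult_ac)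

text \<open>Duality: the squared norm is the form at \<open>v\<close> and at L(D)^t applied to the
  image. As the bound for \<open>Phi\<close> is a sum of squares, its arguments are scaled by s and
  1/s until the part that contains the image can be absorbed.\<close>

lemma Pop_bound: "\<exists>C\<ge>0. \<forall>v. sch v \<longrightarrow> wn t (four (Pop v)) \<le> C * wn (t + k0) (four v)"
proof -
 obtain C where C: "0 \<le> C" "\<And>h l. sch h \<Longrightarrow> sch l \<Longrightarrow> cmod (Phi h l) \<le> C * (wn (t + k0) h + wn (- t) l)"
 proof -
  have "2 * ((t + k0) / 2) = t + k0" "2 * (- t / 2) = - t" "k0 / 2 - (t + k0) / 2 - - t / 2 \<le> 0"
   by (simp_all add: field_simps)
  from Phi_mul_bound[OF this(3), unfolded this(1,2)] show ?thesis using that by blast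
 qed
 \<comment> \<open>\<open>s\<^sup>2\<close> is at least \<open>2 * C\<close>, so the absorbed term
   carries a factor of at most 1/2.\<close>
 define s where "s = 2 * C + 1"
 have s: "0 < s" using C(1) by (simp add: s_def)
 have "wn t (four (Pop v)) \<le> (2 * C * s\<^sup>2) * wn (t + k0) (four v)" if v: "sch v" for v
 proof -
  let ?w = "four (Pop v)"
  define N where "N = wn t ?w"
  have w: "sch ?w" by (intro sch_four sch_Pop v)
  have "cr N = (\<integral>k. ?w k * cnj (mul t ?w k))"
   unfolding N_def wn_def by (subst integral_complex_of_real[symmetric]) (simp add: mul_def complex_norm_square mult_ac del: of_real_power)
  also have "\<dots> = (\<integral>x. Pop v x * cnj (ifour (mul t ?w) x))"
   using plancherel[OF sch_Pop[OF v] sch_ifour[OF sch_mul[OF w, of t]]] by (simp add: four_ifour sch_mul w)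
  also have "\<dots> = Phi (four v) (\<lambda>x. cnj (mul t ?w x))"
   using Pop_pairing[OF v sch_ifour[OF sch_mul[OF w, of t]]] by (simp add: four_ifour sch_mul w)
  finally have 1: "cr N = Phi (four v) (\<lambda>x. cnj (mul t ?w x))" .
  have cw: "wn (- t) (\<lambda>x. cnj (mul t ?w x)) = N"
   unfolding N_def using wn_mul'[of "- t" t ?w] by (simp add: wn_def)
  have "cr N = Phi (\<lambda>x. cr s * four v x) (\<lambda>x. cr (1 / s) * cnj (mul t ?w x))"
   unfolding Phi_scale 1[symmetric] using s by simp
  then have "\<bar>N\<bar> \<le> C * (wn (t + k0) (\<lambda>x. cr s * four v x) + wn (- t) (\<lambda>x. cr (1 / s) * cnj (mul t ?w x)))"
   using C(2)[of "\<lambda>x. cr s * four v x" "\<lambda>x. cr (1 / s) * cnj (mul t ?w x)"]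
   by (metis norm_of_real sch_cmult sch_cnj sch_four sch_mul v w)
  then have "N \<le> C * (s\<^sup>2 * wn (t + k0) (four v)) + (C / s\<^sup>2) * N"
   unfolding wn_scale cw by (simp add: distrib_left power_divide)
  moreover have "(C / s\<^sup>2) * N \<le> (1 / 2) * N"
  proof (rule mult_right_mono)
   have "2 * C \<le> s\<^sup>2" using C(1) by (simp add: s_def power2_eq_square algebra_simps)
   then show "C / s\<^sup>2 \<le> 1 / 2" using s by (simp add: field_simps)
   show "0 \<le> N" unfolding N_def by (rule wn_nonneg)
  qed
  ultimately have "N \<le> 2 * (C * (s\<^sup>2 * wn (t + k0) (four v)))" by linarith
  then show ?thesis unfolding N_def by (simp add: mult.assoc)
 qed
 then show ?thesis using C(1) by (intro exI[of _ "2 * C * s\<^sup>2"]) auto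
qed

end

section \<open>The Garding inequality after conjugation with powers of L\<close>

context pdo
begin

lemma Phi_garding:
 assumes h: "sch h"
 shows "\<gamma> * wn 1 h - lam0 * wn 0 h \<le> Re (Phi h (\<lambda>x. cnj (h x)))"
 using garding[OF sch_ifour[OF h]] Pop_pairing[OF sch_ifour[OF h] sch_ifour[OF h]]
 by (simp add: four_ifour h Pop_def)

lemma amp_p3_conj:
 assumes h: "sch h" and l: "sch l"
 shows "amp p3 (mul (- s) h) (mul s l) - amp p3 h l = amp (\<lambda>z. p3 z * comm_symbol s z) h l"
proof -
 \<comment> \<open>\<open>amp_diff\<close> works with amplitudes of order 0: a factor
   \<open>L powr (- c)\<close> in each frequency removes the order \<open>k0 / 2\<close> of
   \<open>p3\<close>, and \<open>mul c\<close> restores it on the arguments.\<close>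
 define c where "c = k0 / 4"
 define A where "A = (\<lambda>r r' z. p3 z * (cr (L (fst (snd z)) powr r) * cr (L (snd (snd z)) powr r')))"
 have A: "\<exists>M. sm (amp_weight M) (A (- s - c) (s - c))" "\<exists>M. sm (amp_weight M) (A (- c) (- c))"
 proof -
  have "acls (k0 / 2 + ((- s - c) + (s - c))) (A (- s - c) (s - c))" "acls (k0 / 2 + ((- c) + (- c))) (A (- c) (- c))"
   unfolding A_def by (rule acls_mult[OF acls_p3 acls_mult[OF acls_Lxi acls_Leta]])+
  then show "\<exists>M. sm (amp_weight M) (A (- s - c) (s - c))" "\<exists>M. sm (amp_weight M) (A (- c) (- c))"
   by (auto intro!: acls_amp simp: c_def)
 qed
 then obtain M N where M: "sm (amp_weight M) (A (- s - c) (s - c))" and N: "sm (amp_weight N) (A (- c) (- c))" by blast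
 have e: "mul (- s) h = mul (- s - c) (mul c h)" "mul s l = mul (s - c) (mul c l)" "h = mul (- c) (mul c h)" "l = mul (- c) (mul c l)"
  by (simp_all add: mul_mul mul_0)
 have "amp p3 (mul (- s) h) (mul s l) = amp (A (- s - c) (s - c)) (mul c h) (mul c l)"
  unfolding e(1,2) amp_mul A_def ..
 moreover have "amp p3 h l = amp (A (- c) (- c)) (mul c h) (mul c l)"
  by (subst e(3), subst e(4)) (simp only: amp_mul A_def)
 moreover have "amp (\<lambda>z. p3 z * comm_symbol s z) h l = amp (\<lambda>z. A (- s - c) (s - c) z - A (- c) (- c) z) (mul c h) (mul c l)"
 proof -
  have "(\<lambda>z. p3 z * comm_symbol s z * (cr (L (fst (snd z)) powr (- c)) * cr (L (snd (snd z)) powr (- c))))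
   = (\<lambda>z. A (- s - c) (s - c) z - A (- c) (- c) z)"
  proof
   fix z :: "'a \<times> ('a \<times> 'a)"
   have "L (fst (snd z)) powr (- s - c) = L (fst (snd z)) powr (- s) * L (fst (snd z)) powr (- c)"
    "L (snd (snd z)) powr (s - c) = L (snd (snd z)) powr s * L (snd (snd z)) powr (- c)"
    by (simp_all add: powr_add[symmetric])
   then show "p3 z * comm_symbol s z * (cr (L (fst (snd z)) powr (- c)) * cr (L (snd (snd z)) powr (- c)))
    = A (- s - c) (s - c) z - A (- c) (- c) z"
    by (simp add: A_def comm_symbol_def algebra_simps)
  qed
  then show ?thesis by (subst e(3), subst e(4)) (simp only: amp_mul)
 qed
 ultimately show ?thesis by (simp add: amp_diff[OF M N sch_mul[OF h] sch_mul[OF l]])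
qed

text \<open>The conjugation error has order k0/2 - 1/2 = \<theta>, split evenly between the
  arguments. As k0 < 3 gives \<theta> < 1, interpolation lets the coercive term \<gamma>
  \<open>wn 1\<close> absorb it up to a multiple of \<open>wn 0\<close>.\<close>

lemma Phi_conj_garding: "\<exists>lam1. \<forall>h. sch h \<longrightarrow> - lam1 * wn 0 h \<le> Re (Phi (mul (- s) h) (mul s (\<lambda>x. cnj (h x))))"
proof -
 define \<theta> where "\<theta> = (k0 - 1) / 2"
 have \<theta>: "\<theta> < 1" using k0 by (simp add: \<theta>_def)
 have e1: "k0 / 2 + - 1/2 - \<theta> / 2 - \<theta> / 2 \<le> 0" and e2: "2 * (\<theta> / 2) = \<theta>" by (simp_all add: \<theta>_def field_simps)
 have "acls (k0 / 2 + (- 1/2)) (\<lambda>z. p3 z * comm_symbol s z)" by (rule acls_mult[OF acls_p3 acls_comm_symbol])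
 from amp_mul_bound[OF this, of "\<theta> / 2" "\<theta> / 2", unfolded e2] obtain C where C: "0 \<le> C"
  "\<And>h l. sch h \<Longrightarrow> sch l \<Longrightarrow> cmod (amp (\<lambda>z. p3 z * comm_symbol s z) h l) \<le> C * (wn \<theta> h + wn \<theta> l)"
  using e1 by blast
 define K where "K = cmod (kap TYPE('a) * kap TYPE('a)) * C * 2"
 have K0: "0 \<le> K" using C(1) by (simp add: K_def)
 \<comment> \<open>K \<gamma> / (K + 1) is at most \<gamma>; the shift by 1 avoids a division by
   zero.\<close>
 obtain K1 where K1: "0 \<le> K1" "\<And>h. sch h \<Longrightarrow> wn \<theta> h \<le> (\<gamma> / (K + 1)) * wn 1 h + K1 * wn 0 h"
  using wn_interpolate[OF \<theta>, of "\<gamma> / (K + 1)"] \<gamma> K0 by (auto simp: field_simps)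
 have "- (lam0 + K * K1) * wn 0 h \<le> Re (Phi (mul (- s) h) (mul s (\<lambda>x. cnj (h x))))" if h: "sch h" for h
 proof -
  let ?l = "\<lambda>x. cnj (h x)"
  have l: "sch ?l" by (rule sch_cnj[OF h])
  have wl: "wn \<theta> ?l = wn \<theta> h" by (simp add: wn_def)
  have "Phi (mul (- s) h) (mul s ?l) - Phi h ?l = kap TYPE('a) * kap TYPE('a) * amp (\<lambda>z. p3 z * comm_symbol s z) h ?l"
   unfolding Phi_def amp_p3_conj[OF h l, symmetric] by (simp add: algebra_simps)
  then have "cmod (Phi (mul (- s) h) (mul s ?l) - Phi h ?l) \<le> cmod (kap TYPE('a) * kap TYPE('a)) * (C * (wn \<theta> h + wn \<theta> h))"
   using mult_left_mono[OF C(2)[OF h l], of "cmod (kap TYPE('a) * kap TYPE('a))"] by (simp add: norm_mult wl)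
  then have "\<bar>Re (Phi (mul (- s) h) (mul s ?l)) - Re (Phi h ?l)\<bar> \<le> K * wn \<theta> h"
   using abs_Re_le_cmod[of "Phi (mul (- s) h) (mul s ?l) - Phi h ?l"] by (simp add: K_def mult_ac)
  moreover have "K * wn \<theta> h \<le> \<gamma> * wn 1 h + K * K1 * wn 0 h"
  proof -
   have "K * wn \<theta> h \<le> K * ((\<gamma> / (K + 1)) * wn 1 h + K1 * wn 0 h)" by (intro mult_left_mono K1 h K0)
   also have "\<dots> = (K / (K + 1)) * (\<gamma> * wn 1 h) + K * K1 * wn 0 h" by (simp add: field_simps)
   also have "(K / (K + 1)) * (\<gamma> * wn 1 h) \<le> 1 * (\<gamma> * wn 1 h)"
    using K0 \<gamma> wn_nonneg[of 1 h] by (intro mult_right_mono) (auto simp: field_simps)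
   finally show ?thesis by simp
  qed
  moreover have "\<gamma> * wn 1 h - lam0 * wn 0 h \<le> Re (Phi h ?l)" by (rule Phi_garding[OF h])
  moreover have "- (lam0 + K * K1) * wn 0 h = - (lam0 * wn 0 h) - K * K1 * wn 0 h" by (simp add: algebra_simps)
  ultimately show ?thesis by linarith
 qed
 then show ?thesis by blast
qed

definition Tlam :: "real => ('a => complex) => 'a => complex" where
 "Tlam lam u x = Pop u x + cr lam * u x"

lemma sch_Tlam: "sch u \<Longrightarrow> sch (Tlam lam u)"
 unfolding Tlam_def[abs_def] by (intro sch_add sch_cmult sch_Pop)

lemma four_integrable:
 assumes "sch u" shows "L1 (\<lambda>z. en z x * u z)"
 using sch_integrable_poly[OF assms, of "\<lambda>z. en z x" 1 0] by simp

lemma four_add: "sch u \<Longrightarrow> sch v \<Longrightarrow> four (\<lambda>x. u x + v x) = (\<lambda>x. four u x + four v x)"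
 by (rule ext) (simp add: four_def fm_def distrib_left integral_add[OF four_integrable four_integrable])

lemma four_cmult: "four (\<lambda>x. c * u x) = (\<lambda>x. c * four u x)"
 by (rule ext) (simp add: four_def fm_def mult.left_commute[of _ c])

lemma Pop_lin: "sch u \<Longrightarrow> sch v \<Longrightarrow> Pop (\<lambda>x. u x + c * v x) = (\<lambda>x. Pop u x + c * Pop v x)"
proof
 fix x assume u: "sch u" and v: "sch v"
 have i: "L1 (\<lambda>z. ee x z * (p (x, z) * four u z))" if "sch u" for u
  using sch_integrable[OF sch_mult_1[OF sm_cis osym_slice[OF osym_symbol[OF sch_four[OF that]]]]] by simp
 show "Pop (\<lambda>x. u x + c * v x) x = Pop u x + c * Pop v x"
  using integral_add[OF i[OF u] i[OF sch_cmult[OF v, of c]]]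
  by (simp add: Pop_def osc_def four_add u v sch_cmult four_cmult distrib_left mult.left_commute[of _ c])
qed

lemma Tlam_lin: "sch u \<Longrightarrow> sch v \<Longrightarrow> Tlam lam (\<lambda>x. u x + c * v x) = (\<lambda>x. Tlam lam u x + c * Tlam lam v x)"
 by (auto simp: Tlam_def[abs_def] Pop_lin algebra_simps)

lemma wn_add_le: "sch a \<Longrightarrow> sch b \<Longrightarrow> wn r (\<lambda>x. a x + b x) \<le> 2 * wn r a + 2 * wn r b"
proof -
 assume a: "sch a" and b: "sch b"
 have "(cmod (a x + b x))\<^sup>2 \<le> 2 * (cmod (a x))\<^sup>2 + 2 * (cmod (b x))\<^sup>2" for x
 proof -
  have "(cmod (a x + b x))\<^sup>2 \<le> (cmod (a x) + cmod (b x))\<^sup>2" by (intro power_mono norm_triangle_ineq) simp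
  also have "\<dots> \<le> 2 * (cmod (a x))\<^sup>2 + 2 * (cmod (b x))\<^sup>2"
   using sum_squares_bound[of "cmod (a x)" "cmod (b x)"] by (simp add: power2_sum)
  finally show ?thesis .
 qed
 then have le: "L x powr r * (cmod (a x + b x))\<^sup>2 \<le> 2 * (L x powr r * (cmod (a x))\<^sup>2) + 2 * (L x powr r * (cmod (b x))\<^sup>2)" for x
  using mult_left_mono[of "(cmod (a x + b x))\<^sup>2" "2 * (cmod (a x))\<^sup>2 + 2 * (cmod (b x))\<^sup>2" "L x powr r"]
  by (simp add: distrib_left mult.left_commute)
 note i = integrable_mult_right[OF wn_integrable[OF a]] integrable_mult_right[OF wn_integrable[OF b]]
 have "wn r (\<lambda>x. a x + b x) \<le> (\<integral>w. 2 * (L w powr r * (cmod (a w))\<^sup>2) + 2 * (L w powr r * (cmod (b w))\<^sup>2))"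
  unfolding wn_def
  by (rule Bochner_Integration.integral_mono[OF wn_integrable[OF sch_add[OF a b]] integrable_add[OF i] le])
 also have "\<dots> = 2 * wn r a + 2 * wn r b"
  unfolding wn_def using integral_add[OF i] by simp
 finally show ?thesis .
qed

lemma wn_expand:
 assumes a: "sch a" and b: "sch b"
 shows "wn r (\<lambda>x. a x + cr (- c) * b x) = wn r a - 2 * c * Re (\<integral>x. b x * cnj (mul r a x)) + c\<^sup>2 * wn r b"
proof -
 have i: "L1 (\<lambda>x. b x * cnj (mul r a x))"
  by (intro sch_integrable sch_mult_1[OF sm_mono[OF schD[OF b, of 0]]] sch_cnj sch_mul a) auto
 note j = wn_integrable[OF a] integrable_mult_right[OF integrable_Re[OF i]]
 have "L x powr r * (cmod (a x + cr (- c) * b x))\<^sup>2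
   = L x powr r * (cmod (a x))\<^sup>2 - 2 * c * Re (b x * cnj (mul r a x)) + c\<^sup>2 * (L x powr r * (cmod (b x))\<^sup>2)" for x
  unfolding cmod_power2 mul_def by (simp add: power2_eq_square algebra_simps)
 then have "wn r (\<lambda>x. a x + cr (- c) * b x)
   = (\<integral>x. (L x powr r * (cmod (a x))\<^sup>2 - 2 * c * Re (b x * cnj (mul r a x))) + c\<^sup>2 * (L x powr r * (cmod (b x))\<^sup>2))"
  unfolding wn_def by simp
 also have "\<dots> = (\<integral>x. L x powr r * (cmod (a x))\<^sup>2 - 2 * c * Re (b x * cnj (mul r a x))) + (\<integral>x. c\<^sup>2 * (L x powr r * (cmod (b x))\<^sup>2))"
  by (rule integral_add[OF integrable_diff[OF j] integrable_mult_right[OF wn_integrable[OF b]]])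
 also have "(\<integral>x. L x powr r * (cmod (a x))\<^sup>2 - 2 * c * Re (b x * cnj (mul r a x))) =
   (\<integral>x. L x powr r * (cmod (a x))\<^sup>2) - (\<integral>x. 2 * c * Re (b x * cnj (mul r a x)))"
  by (rule integral_diff[OF j])
 also have "(\<integral>x. 2 * c * Re (b x * cnj (mul r a x))) = 2 * c * Re (\<integral>x. b x * cnj (mul r a x))"
  using integral_Re[OF i] by simp
 finally show ?thesis by (simp add: wn_def)
qed

end

section \<open>Almost minimal residuals and density of the range\<close>

context pdo
begin

text \<open>Inversion bounds \<open>r\<close> by the L1 norm of its transform \<rho>, and pointwise
  |\<rho>| is at most d L^(-m) + L^m |\<rho>|^2 / d. The free parameter \<open>d\<close> does the
  work of the Cauchy-Schwarz inequality.\<close>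

lemma sup_bound:
 assumes r: "sch r" and "0 < d"
 shows "cmod (r x) \<le> cmod (kap TYPE('a)) * (d * (\<integral>w. L w powr (- m)) + wn m (four r) / d)"
proof -
 let ?\<rho> = "four r"
 have \<rho>: "sch ?\<rho>" by (rule sch_four[OF r])
 note i = wn_integrable[OF \<rho>, of m]
 have "r x = kap TYPE('a) * (\<integral>z. ee x z * ?\<rho> z)"
  using ifour_four[OF r] ifour_eq[of ?\<rho> x] by simp
 then have "cmod (r x) \<le> cmod (kap TYPE('a)) * (\<integral>z. cmod (?\<rho> z))"
  using integral_norm_bound[of lborel "\<lambda>z. ee x z * ?\<rho> z"]
  by (simp add: norm_mult mult_left_mono)
 also have "(\<integral>z. cmod (?\<rho> z)) \<le> (\<integral>z. d * L z powr (- m) + (L z powr m * (cmod (?\<rho> z))\<^sup>2) / d)"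
 proof (rule Bochner_Integration.integral_mono[OF integrable_norm[OF sch_integrable[OF \<rho>]]
    integrable_add[OF integrable_mult_right[OF Lint] integrable_divide[OF i]]])
  fix z
  define b where "b = L z powr (- m)"
  have b: "0 < b" by (simp add: b_def Lpos)
  have Lm: "L z powr m = 1 / b" by (simp add: b_def powr_minus_divide)
  have "cmod (?\<rho> z) \<le> d * b + (cmod (?\<rho> z))\<^sup>2 / (d * b)"
  proof (cases "cmod (?\<rho> z) \<le> d * b")
   case True
   have "0 \<le> (cmod (?\<rho> z))\<^sup>2 / (d * b)" using b assms(2) by simp
   then show ?thesis using True by linarith
  next
   case False
   have "d * b * cmod (?\<rho> z) \<le> cmod (?\<rho> z) * cmod (?\<rho> z)" using False by (intro mult_right_mono) auto
   then have "cmod (?\<rho> z) \<le> (cmod (?\<rho> z))\<^sup>2 / (d * b)" using b assms(2) by (simp add: pos_le_divide_eq power2_eq_square mult_ac)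
   moreover have "0 \<le> d * b" using b assms(2) by simp
   ultimately show ?thesis by linarith
  qed
  then show "cmod (?\<rho> z) \<le> d * L z powr (- m) + (L z powr m * (cmod (?\<rho> z))\<^sup>2) / d"
   unfolding Lm b_def[symmetric] by (simp add: mult.commute)
 qed
 also have "\<dots> = d * (\<integral>w. L w powr (- m)) + wn m ?\<rho> / d"
  using integral_add[OF integrable_mult_right[OF Lint, of d] integrable_divide[OF i, of d]] by (simp add: wn_def)
 finally show ?thesis by (simp add: mult_left_mono)
qed

text \<open>For an almost minimal residual in the norm with weight \<open>L powr (m + 2)\<close> the first-order
 optimality condition is tested with \<open>mul (- 2 * s + (m + 2))\<close> of the residual; coercivity then
 makes the residual small in the weaker norm with weight \<open>L powr m\<close>.\<close>

lemma residual_small: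
 obtains lam1 where
  "\<And>lam g e. lam1 \<le> lam \<Longrightarrow> sch g \<Longrightarrow> 0 < e \<Longrightarrow>
   \<exists>u. sch u \<and> wn m (four (\<lambda>x. Tlam lam u x - g x)) \<le> e"
proof -
 \<comment> \<open>With these values \<open>t - s = m / 2\<close>, which turns \<open>wn 0 h\<close>
   into \<open>wn m \<rho>\<close>, and \<open>t - 2 * s = - 2\<close>: the test direction is
   L(D)^(-2) of the residual, and since \<open>t + k0 - 4 \<le> t\<close> its image is controlled in
   the weight \<open>L powr t\<close> by the residual itself.\<close>
 define t where "t = m + 2"
 define s where "s = t / 2 + 1"
 obtain lam1 where lam1: "\<And>h. sch h \<Longrightarrow> - lam1 * wn 0 h \<le> Re (Phi (mul (- s) h) (mul s (\<lambda>x. cnj (h x))))"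
  using Phi_conj_garding by blast
 obtain C where C: "0 \<le> C" "\<And>v. sch v \<Longrightarrow> wn t (four (Pop v)) \<le> C * wn (t + k0) (four v)" using Pop_bound by blast
 have "\<exists>u. sch u \<and> wn m (four (\<lambda>x. Tlam lam u x - g x)) \<le> e"
  if lam: "lam1 + 1 \<le> lam" and g: "sch g" and e: "0 < e" for lam g e
 proof -
  define res where "res u = (\<lambda>x. Tlam lam u x - g x)" for u
  define E where "E u = wn t (four (res u))" for u
  define d where "d = Inf (E ` Collect sch)"
  have bdd: "bdd_below (E ` Collect sch)" by (intro bdd_belowI[of _ 0]) (auto simp: E_def wn_nonneg)
  have "sch (\<lambda>x::'a. 0 :: complex)" using sch_cmult[OF sch_gauss, of 0] by simp
  then have ne: "E ` Collect sch \<noteq> {}" by blast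
  have dle: "d \<le> E u" if "sch u" for u unfolding d_def using that bdd by (intro cInf_lower) auto
  have d0: "0 \<le> d" unfolding d_def using ne by (intro cInf_greatest) (auto simp: E_def wn_nonneg)
  \<comment> \<open>\<open>K - 1\<close> will bound \<open>wn t q\<close>, the squared norm of the
    image of the test direction; the step length \<open>c\<close> is then chosen with
    \<open>c * K \<le> e\<close>.\<close>
  define K where "K = 1 + (2 * C + 2 * lam\<^sup>2) * (d + 1)"
  have K: "1 \<le> K" using C(1) d0 by (simp add: K_def)
  define c where "c = min 1 (e / K)"
  have c: "0 < c" "c \<le> 1" "c * K \<le> e" using e K by (auto simp: c_def min_def field_simps)
  \<comment> \<open>Minimal up to c^2, which is also the size of the quadratic term of a step of
    length \<open>c\<close>.\<close>
  obtain u where u: "sch u" "E u < d + c\<^sup>2"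
   using cInf_lessD[OF ne, of "d + c\<^sup>2"] c by (auto simp: d_def)
  define \<rho> where "\<rho> = four (res u)"
  have res: "sch (res u)" if "sch u" for u unfolding res_def by (intro sch_diff sch_Tlam that g)
  have \<rho>: "sch \<rho>" unfolding \<rho>_def by (intro sch_four res u)
  define h where "h = mul (t - s) \<rho>"
  have h: "sch h" unfolding h_def by (rule sch_mul[OF \<rho>])
  define v where "v = ifour (mul (- s) h)"
  have v: "sch v" "four v = mul (- s) h" unfolding v_def by (simp_all add: sch_ifour four_ifour sch_mul h)
  define q where "q = four (Tlam lam v)"
  have q: "sch q" unfolding q_def by (intro sch_four sch_Tlam v)
  define w where "w = ifour (mul t \<rho>)"
  have w: "sch w" "four w = mul t \<rho>" unfolding w_def by (simp_all add: sch_ifour four_ifour sch_mul \<rho>)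
  have tr: "mul t \<rho> = mul s h" by (simp add: h_def mul_mul)
  define X where "X = Re (\<integral>x. q x * cnj (mul t \<rho> x))"
  \<comment> \<open>\<open>2 * X\<close> is the rate at which the residual decreases along
    \<open>v\<close>. By the choice of \<open>v\<close> and \<open>w\<close> it involves the form
    conjugated with L(D)^s at \<open>h\<close>, to which \<open>lam1\<close> applies, plus
    \<open>lam * wn 0 h\<close>.\<close>
  have X: "wn 0 h \<le> X"
  proof -
   have "(\<integral>x. q x * cnj (mul t \<rho> x)) = (\<integral>x. Tlam lam v x * cnj (w x))"
    using plancherel[OF sch_Tlam[OF v(1)] w(1)] by (simp add: q_def w(2))
   also have "\<dots> = (\<integral>x. Pop v x * cnj (w x) + cr lam * (v x * cnj (w x)))"
    by (simp add: Tlam_def distrib_right mult.assoc)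
   also have "\<dots> = (\<integral>x. Pop v x * cnj (w x)) + (\<integral>x. cr lam * (v x * cnj (w x)))"
   proof (rule integral_add)
    have b: "sm (\<lambda>x. 1) f" if "sch f" for f :: "'a => complex" using sm_mono[OF schD[OF that, of 0], of 1] by simp
    show "L1 (\<lambda>x. Pop v x * cnj (w x))" "L1 (\<lambda>x. cr lam * (v x * cnj (w x)))"
     by (intro sch_integrable sch_cmult sch_mult_1[OF b] sch_cnj sch_Pop v w)+
   qed
   also have "(\<integral>x. Pop v x * cnj (w x)) = Phi (mul (- s) h) (mul s (\<lambda>x. cnj (h x)))"
    using Pop_pairing[OF v(1) w(1)] by (simp add: v(2) w(2) tr cnj_mul)
   also have "(\<integral>x. cr lam * (v x * cnj (w x))) = cr (lam * wn 0 h)"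
   proof -
    have "(\<integral>x. v x * cnj (w x)) = (\<integral>x. mul (- s) h x * cnj (mul s h x))"
     using plancherel[OF v(1) w(1)] by (simp add: v(2) w(2) tr)
    also have "\<dots> = (\<integral>x. cr (L x powr 0 * (cmod (h x))\<^sup>2))"
    proof (rule integral_cong[OF refl])
     fix x
     have "mul (- s) h x * cnj (mul s h x) = cr (L x powr (- s) * L x powr s) * (h x * cnj (h x))"
      by (simp add: mul_def mult_ac)
     also have "L x powr (- s) * L x powr s = L x powr 0" by (simp add: powr_add[symmetric])
     finally show "mul (- s) h x * cnj (mul s h x) = cr (L x powr 0 * (cmod (h x))\<^sup>2)"
      by (simp add: complex_norm_square del: of_real_power)
    qed
    also have "\<dots> = cr (wn 0 h)" unfolding wn_def by (rule integral_complex_of_real)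
    finally show ?thesis by simp
   qed
   finally have "X = Re (Phi (mul (- s) h) (mul s (\<lambda>x. cnj (h x)))) + lam * wn 0 h" by (simp add: X_def)
   moreover have "(lam1 + 1) * wn 0 h \<le> lam * wn 0 h" using lam by (intro mult_right_mono wn_nonneg)
   ultimately show ?thesis using lam1[OF h] by (simp add: distrib_right)
  qed
  have Y: "wn t q \<le> K - 1"
  proof -
   have "q = (\<lambda>x. four (Pop v) x + cr lam * four v x)"
    unfolding q_def Tlam_def[abs_def] by (simp add: four_add sch_Pop v(1) sch_cmult four_cmult)
   then have "wn t q \<le> 2 * wn t (four (Pop v)) + 2 * wn t (\<lambda>x. cr lam * four v x)"
    using wn_add_le[OF sch_four[OF sch_Pop[OF v(1)]] sch_cmult[OF sch_four[OF v(1)]]] by simp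
   also have "\<dots> \<le> 2 * (C * wn (t + k0) (four v)) + 2 * (lam\<^sup>2 * wn (t + k0) (four v))"
    unfolding wn_scale using k0 by (intro add_mono mult_left_mono C v wn_mono sch_four) auto
   also have "wn (t + k0) (four v) = wn (t + k0 + 2 * (- s) + 2 * (t - s)) \<rho>"
    unfolding v(2) h_def wn_mul' ..
   also have "2 * (C * wn (t + k0 + 2 * (- s) + 2 * (t - s)) \<rho>) + 2 * (lam\<^sup>2 * wn (t + k0 + 2 * (- s) + 2 * (t - s)) \<rho>)
     = (2 * C + 2 * lam\<^sup>2) * wn (t + k0 + 2 * (- s) + 2 * (t - s)) \<rho>" by (simp add: algebra_simps)
   also have "\<dots> \<le> (2 * C + 2 * lam\<^sup>2) * (d + 1)"
   proof (rule mult_left_mono)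
    have "wn (t + k0 + 2 * (- s) + 2 * (t - s)) \<rho> \<le> wn t \<rho>" using k0 by (intro wn_mono \<rho>) (simp add: s_def)
    also have "\<dots> \<le> d + c\<^sup>2" using u(2) by (simp add: E_def \<rho>_def)
    also have "c\<^sup>2 \<le> 1" using c by (simp add: power_le_one)
    finally show "wn (t + k0 + 2 * (- s) + 2 * (t - s)) \<rho> \<le> d + 1" by simp
   qed (use C(1) in simp)
   finally show ?thesis by (simp add: K_def)
  qed
  have uv: "sch (\<lambda>x. u x + cr (- c) * v x)" by (intro sch_add sch_cmult u v)
  have "four (res (\<lambda>x. u x + cr (- c) * v x)) = (\<lambda>x. \<rho> x + cr (- c) * q x)"
  proof -
   have "res (\<lambda>x. u x + cr (- c) * v x) = (\<lambda>x. res u x + cr (- c) * Tlam lam v x)"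
    unfolding res_def Tlam_lin[OF u(1) v(1)] by (simp add: algebra_simps)
   then show ?thesis by (simp only: \<rho>_def q_def four_add[OF res[OF u(1)] sch_cmult[OF sch_Tlam[OF v(1)]]] four_cmult)
  qed
  then have "d \<le> wn t (\<lambda>x. \<rho> x + cr (- c) * q x)" using dle[OF uv] by (simp only: E_def)
  also have "\<dots> = E u - 2 * c * X + c\<^sup>2 * wn t q"
   using wn_expand[OF \<rho> q, of t c] by (simp only: X_def E_def \<rho>_def)
  also have "\<dots> \<le> (d + c\<^sup>2) - 2 * c * X + c\<^sup>2 * (K - 1)"
   using u(2) mult_left_mono[OF Y, of "c\<^sup>2"] by simp
  \<comment> \<open>The infimum \<open>d\<close> has cancelled; after division by \<open>c\<close>
    the bound is of the size of the step length.\<close>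
  finally have "c * (2 * X) \<le> c * (c * K)" by (simp add: power2_eq_square algebra_simps)
  then have "2 * X \<le> c * K" using c(1) by simp
  moreover have "0 \<le> X" using X wn_nonneg[of 0 h] by linarith
  ultimately have "wn 0 h \<le> e" using X c(3) by linarith
  moreover have "wn 0 h = wn m \<rho>"
  proof -
   have "0 + 2 * (t - s) = m" by (simp add: s_def t_def field_simps)
   then show ?thesis unfolding h_def wn_mul' by (simp only:)
  qed
  ultimately have "wn m (four (res u)) \<le> e" by (simp add: \<rho>_def)
  then show ?thesis using u(1) by (auto simp: res_def)
 qed
 then show ?thesis using that by blast
qed

theorem range_dense:
 obtains lam1 where
  "\<And>lam g \<epsilon>. lam1 \<le> lam \<Longrightarrow> sch g \<Longrightarrow> 0 < \<epsilon> \<Longrightarrow>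
   \<exists>u. sch u \<and> (\<forall>x. cmod (Tlam lam u x - g x) \<le> \<epsilon>)"
proof -
 obtain lam1 where lam1: "\<And>lam g e. lam1 \<le> lam \<Longrightarrow> sch g \<Longrightarrow> 0 < e \<Longrightarrow>
   \<exists>u. sch u \<and> wn m (four (\<lambda>x. Tlam lam u x - g x)) \<le> e"
  using residual_small by blast
 define A where "A = (\<integral>w. L w powr (- m))"
 have A: "0 \<le> A" unfolding A_def by (rule integral_nonneg) simp
 define k where "k = cmod (kap TYPE('a))"
 have k: "0 < k" unfolding k_def using kap_neq_0[where 'a = 'a] by simp
 have "\<exists>u. sch u \<and> (\<forall>x. cmod (Tlam lam u x - g x) \<le> e)" if lam: "lam1 \<le> lam" and g: "sch g" and e: "0 < e" for lam g e
 proof -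
  \<comment> \<open>If \<open>wn m\<close> of the residual is at most \<delta>^2, then
    \<open>sup_bound\<close> with \<open>d = \<delta>\<close> gives k \<delta> (A + 1) = e /
    2.\<close>
  define \<delta> where "\<delta> = e / (2 * k * (A + 1))"
  have \<delta>: "0 < \<delta>" unfolding \<delta>_def using e k A by simp
  obtain u where u: "sch u" "wn m (four (\<lambda>x. Tlam lam u x - g x)) \<le> \<delta> * \<delta>"
   using lam1[OF lam g, of "\<delta> * \<delta>"] \<delta> by auto
  have "cmod (Tlam lam u x - g x) \<le> e" for x
  proof -
   have "cmod (Tlam lam u x - g x) \<le> k * (\<delta> * A + wn m (four (\<lambda>x. Tlam lam u x - g x)) / \<delta>)"
    unfolding k_def A_def by (rule sup_bound[OF sch_diff[OF sch_Tlam[OF u(1)] g] \<delta>])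
   also have "wn m (four (\<lambda>x. Tlam lam u x - g x)) / \<delta> \<le> \<delta>" using u(2) \<delta> by (simp add: field_simps)
   then have "k * (\<delta> * A + wn m (four (\<lambda>x. Tlam lam u x - g x)) / \<delta>) \<le> k * (\<delta> * A + \<delta>)" using k by simp
   also have "\<dots> = e / 2"
   proof -
    have "\<delta> * (2 * k * (A + 1)) = e" unfolding \<delta>_def using k A by simp
    then show ?thesis by (simp add: algebra_simps)
   qed
   also have "\<dots> \<le> e" using e by simp
   finally show ?thesis .
  qed
  then show ?thesis using u(1) by blast
 qed
 then show ?thesis using that by blast
qed

end

section \<open>Bounded operators as a Banach algebra\<close>

text \<open>A copy of the bounded operators on which composition is declared as multiplication, so
  that \<open>exp\<close> and its calculus in Banach algebras apply.\<close>

typedef (overloaded) 'a endo = "UNIV :: ('a::banach \<Rightarrow>\<^sub>L 'a) set"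
 by simp

setup_lifting type_definition_endo

instantiation endo :: (banach) real_normed_vector
begin

lift_definition zero_endo :: "'a endo" is 0 .
lift_definition plus_endo :: "'a endo => 'a endo => 'a endo" is "(+)" .
lift_definition minus_endo :: "'a endo => 'a endo => 'a endo" is "(-)" .
lift_definition uminus_endo :: "'a endo => 'a endo" is uminus .
lift_definition scaleR_endo :: "real => 'a endo => 'a endo" is "(*\<^sub>R)" .
lift_definition norm_endo :: "'a endo => real" is norm .

definition dist_endo :: "'a endo => 'a endo => real" where
 "dist_endo a b = norm (a - b)"
definition sgn_endo :: "'a endo => 'a endo" where
 "sgn_endo a = scaleR (inverse (norm a)) a"
definition [code del]: "(uniformity :: ('a endo \<times> 'a endo) filter) = (INF e\<in>{0 <..}. principal {(x, y). dist x y < e})"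
definition open_endo :: "'a endo set => bool" where
 [code del]: "open_endo S = (\<forall>x\<in>S. \<forall>\<^sub>F (x', y) in uniformity. x' = x \<longrightarrow> y \<in> S)"

instance
 apply standard
 unfolding dist_endo_def open_endo_def sgn_endo_def uniformity_endo_def
 apply (rule refl | (transfer, force simp: norm_triangle_ineq algebra_simps))+
 done

end

instance endo :: (banach) banach
proof
 fix X :: "nat => 'a endo" assume X: "Cauchy X"
 have d: "dist (Rep_endo a) (Rep_endo b) = dist a b" for a b :: "'a endo"
  by (simp add: dist_norm norm_endo.rep_eq minus_endo.rep_eq)
 have "Cauchy (\<lambda>n. Rep_endo (X n))" using X by (simp add: Cauchy_def d)
 then obtain l where l: "(\<lambda>n. Rep_endo (X n)) \<longlonglongrightarrow> l" using Cauchy_convergent convergent_def by blast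
 have "X \<longlonglongrightarrow> Abs_endo l"
  using l unfolding tendsto_iff d[symmetric] by (simp add: Abs_endo_inverse)
 then show "convergent X" by (auto simp: convergent_def)
qed

text \<open>A perfect space is nontrivial, which gives \<open>norm 1 = 1\<close> and
  \<open>0 \<noteq> 1\<close>.\<close>

instantiation endo :: ("{banach, perfect_space}") real_normed_algebra_1
begin

lift_definition one_endo :: "'a endo" is id_blinfun .
lift_definition times_endo :: "'a endo => 'a endo => 'a endo" is "(o\<^sub>L)" .

instance
proof
 fix a b c :: "'a endo" and r :: real
 show "a * b * c = a * (b * c)" by transfer (rule blinfun_eqI, simp)
 show "1 * a = a" "a * 1 = a" by (transfer, rule blinfun_eqI, simp)+
 show "(a + b) * c = a * c + b * c" by transfer (rule blinfun_eqI, simp add: blinfun.bilinear_simps)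
 show "a * (b + c) = a * b + a * c" by transfer (rule blinfun_eqI, simp add: blinfun.bilinear_simps)
 show "r *\<^sub>R a * b = r *\<^sub>R (a * b)" by transfer (rule blinfun_eqI, simp add: blinfun.bilinear_simps)
 show "a * r *\<^sub>R b = r *\<^sub>R (a * b)" by transfer (rule blinfun_eqI, simp add: blinfun.bilinear_simps)
 show "norm (a * b) \<le> norm a * norm b" by transfer (rule norm_blinfun_compose)
 show "norm (1 :: 'a endo) = 1" by transfer simp
 show "(0 :: 'a endo) \<noteq> 1"
 proof
  assume "(0 :: 'a endo) = 1"
  then have "(0 :: 'a \<Rightarrow>\<^sub>L 'a) = id_blinfun" by transfer
  then have "norm (id_blinfun :: 'a \<Rightarrow>\<^sub>L 'a) = 0" by (metis norm_zero)
  then show False by simp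
 qed
qed

end

definition app :: "'a::banach endo => 'a => 'a" where
 "app a x = blinfun_apply (Rep_endo a) x"

definition mk_endo :: "('a::banach => 'a) => 'a endo" where
 "mk_endo f = Abs_endo (Blinfun f)"

lemma app_mk_endo: "bounded_linear f \<Longrightarrow> app (mk_endo f) = f"
 by (auto simp: app_def mk_endo_def Abs_endo_inverse bounded_linear_Blinfun_apply)

lemma endo_eqI: "(\<And>x. app a x = app b x) \<Longrightarrow> a = b"
 unfolding app_def by (metis Rep_endo_inject blinfun_eqI)

lemma norm_app: "norm (app a x) \<le> norm a * norm x"
 unfolding app_def norm_endo.rep_eq by (rule norm_blinfun)

lemma app_times: "app (a * b) x = app a (app b x)" for a :: "'a::{banach, perfect_space} endo"
 by (simp add: app_def times_endo.rep_eq)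

lemma app_one: "app 1 x = x" for x :: "'a::{banach, perfect_space}"
 by (simp add: app_def one_endo.rep_eq)

lemma bounded_linear_app: "bounded_linear (app a)"
 unfolding app_def[abs_def] by (rule blinfun.bounded_linear_right)

lemma bounded_linear_app_left: "bounded_linear (\<lambda>a. app a x)"
proof (rule bounded_linear_intro[where K = "norm x"])
 show "app (a + b) x = app a x + app b x" for a b by (simp add: app_def plus_endo.rep_eq blinfun.add_left)
 show "app (r *\<^sub>R a) x = r *\<^sub>R app a x" for r a by (simp add: app_def scaleR_endo.rep_eq blinfun.scaleR_left)
 show "norm (app a x) \<le> norm a * norm x" for a by (rule norm_app)
qed

lemmas app_add = linear_add[OF bounded_linear.linear[OF bounded_linear_app]]
lemmas app_diff = linear_diff[OF bounded_linear.linear[OF bounded_linear_app]]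
lemmas app_scaleR = linear_scale[OF bounded_linear.linear[OF bounded_linear_app]]
lemmas app_diff_left = linear_diff[OF bounded_linear.linear[OF bounded_linear_app_left]]
lemmas app_scaleR_left = linear_scale[OF bounded_linear.linear[OF bounded_linear_app_left]]

section \<open>Generation of contraction semigroups\<close>

text \<open>Besides the norm, \<open>NN\<close> holds sublinear functionals in which
  \<open>A\<close> is dissipative, and \<open>JJ\<close> holds bounded operators that commute with
  \<open>A\<close>; the semigroup will contract the former and commute with the latter. Half norms
  in \<open>NN\<close> yield positivity, multiplications by complex numbers in \<open>JJ\<close>
  yield complex linearity over a real Banach space.\<close>

locale generation =
 fixes D :: "'a::{banach, perfect_space} set" and A :: "'a => 'a" and lam0 :: real
  and NN :: "('a => real) set" and JJ :: "('a => 'a) set"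
 assumes D_lin: "\<And>u v c. u \<in> D \<Longrightarrow> v \<in> D \<Longrightarrow> u + c *\<^sub>R v \<in> D" and D_ne: "D \<noteq> {}"
  and A_lin: "\<And>u v c. u \<in> D \<Longrightarrow> v \<in> D \<Longrightarrow> A (u + c *\<^sub>R v) = A u + c *\<^sub>R A v"
  and D_dense: "\<And>g \<epsilon>. 0 < \<epsilon> \<Longrightarrow> \<exists>u\<in>D. norm (u - g) < \<epsilon>"
  and lam0: "0 < lam0"
  and range: "\<And>lam g \<epsilon>. lam0 \<le> lam \<Longrightarrow> 0 < \<epsilon> \<Longrightarrow> \<exists>u\<in>D. norm (lam *\<^sub>R u - A u - g) < \<epsilon>"
  and N_add: "\<And>N a b. N \<in> NN \<Longrightarrow> N (a + b) \<le> N a + N b"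
  and N_scale: "\<And>N a c. N \<in> NN \<Longrightarrow> 0 \<le> c \<Longrightarrow> N (c *\<^sub>R a) = c * N a"
  and N_le: "\<And>N a. N \<in> NN \<Longrightarrow> N a \<le> norm a"
  and N_diss: "\<And>N u lam. N \<in> NN \<Longrightarrow> u \<in> D \<Longrightarrow> 0 < lam \<Longrightarrow> lam * N u \<le> N (lam *\<^sub>R u - A u)"
  and norm_NN: "norm \<in> NN"
  and J_bl: "\<And>J. J \<in> JJ \<Longrightarrow> bounded_linear J"
  and J_D: "\<And>J u. J \<in> JJ \<Longrightarrow> u \<in> D \<Longrightarrow> J u \<in> D \<and> A (J u) = J (A u)"
begin

lemma N_tendsto:
 assumes N: "N \<in> NN" and X: "X \<longlonglongrightarrow> x"
 shows "(\<lambda>n. N (X n)) \<longlonglongrightarrow> N x"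
proof -
 have d: "\<bar>N a - N b\<bar> \<le> norm (a - b)" for a b
  using N_add[OF N, of "a - b" b] N_add[OF N, of "b - a" a] N_le[OF N, of "a - b"] N_le[OF N, of "b - a"]
  by (simp add: norm_minus_commute)
 have "(\<lambda>n. norm (X n - x)) \<longlonglongrightarrow> 0" using X by (simp add: LIM_zero tendsto_norm_zero)
 then have "(\<lambda>n. N (X n) - N x) \<longlonglongrightarrow> 0" by (rule Lim_null_comparison[rotated]) (use d in auto)
 then show ?thesis by (simp add: LIM_zero_iff)
qed

text \<open>The closure of \<open>A\<close> as a graph; linearity, dissipativity and commutation
  pass to it by taking limits.\<close>

definition G :: "'a => 'a => bool" where
 "G x y \<longleftrightarrow> (\<exists>u. (\<forall>n::nat. u n \<in> D) \<and> u \<longlonglongrightarrow> x \<and> (\<lambda>n. A (u n)) \<longlonglongrightarrow> y)"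

lemma G_D: "u \<in> D \<Longrightarrow> G u (A u)"
 unfolding G_def by (intro exI[of _ "\<lambda>_. u"]) auto

lemma G_lin: "G x y \<Longrightarrow> G x' y' \<Longrightarrow> G (x + c *\<^sub>R x') (y + c *\<^sub>R y')"
proof -
 assume "G x y" "G x' y'"
 then obtain u u' where u: "\<And>n::nat. u n \<in> D" "u \<longlonglongrightarrow> x" "(\<lambda>n. A (u n)) \<longlonglongrightarrow> y"
  and u': "\<And>n::nat. u' n \<in> D" "u' \<longlonglongrightarrow> x'" "(\<lambda>n. A (u' n)) \<longlonglongrightarrow> y'" unfolding G_def by blast
 show ?thesis unfolding G_def
  by (intro exI[of _ "\<lambda>n. u n + c *\<^sub>R u' n"] conjI allI)
   (auto simp: A_lin u u' intro!: D_lin u u' tendsto_intros)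
qed

lemma G_J: "J \<in> JJ \<Longrightarrow> G x y \<Longrightarrow> G (J x) (J y)"
proof -
 assume J: "J \<in> JJ" and "G x y"
 then obtain u where u: "\<And>n::nat. u n \<in> D" "u \<longlonglongrightarrow> x" "(\<lambda>n. A (u n)) \<longlonglongrightarrow> y" unfolding G_def by blast
 show ?thesis unfolding G_def
  by (intro exI[of _ "\<lambda>n. J (u n)"]) (use J_D[OF J u(1)] bounded_linear.tendsto[OF J_bl[OF J]] u in auto)
qed

lemma G_diss: "N \<in> NN \<Longrightarrow> G x y \<Longrightarrow> 0 < lam \<Longrightarrow> lam * N x \<le> N (lam *\<^sub>R x - y)"
proof -
 assume N: "N \<in> NN" and "G x y" and lam: "0 < lam"
 then obtain u where u: "\<And>n::nat. u n \<in> D" "u \<longlonglongrightarrow> x" "(\<lambda>n. A (u n)) \<longlonglongrightarrow> y" unfolding G_def by blast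
 show ?thesis
 proof (rule LIMSEQ_le)
  show "(\<lambda>n. lam * N (u n)) \<longlonglongrightarrow> lam * N x" by (intro tendsto_intros N_tendsto N u)
  show "(\<lambda>n. N (lam *\<^sub>R u n - A (u n))) \<longlonglongrightarrow> N (lam *\<^sub>R x - y)" by (intro tendsto_intros N_tendsto N u)
 qed (use N_diss[OF N u(1) lam] in auto)
qed

text \<open>Solutions up to 1/(n + 1) exist by density of the range, and dissipativity in the norm
  makes them a Cauchy sequence.\<close>

lemma G_surj:
 assumes lam: "lam0 \<le> lam"
 shows "\<exists>x. G x (lam *\<^sub>R x - g)"
proof -
 have lp: "0 < lam" using lam lam0 by simp
 have "\<exists>u\<in>D. norm (lam *\<^sub>R u - A u - g) < inverse (real (Suc n))" for n using range[OF lam] by simp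
 then obtain u where u: "\<And>n. u n \<in> D" "\<And>n. norm (lam *\<^sub>R u n - A (u n) - g) < inverse (real (Suc n))" by metis
 have l: "(\<lambda>n. lam *\<^sub>R u n - A (u n)) \<longlonglongrightarrow> g"
 proof (rule LIM_zero_cancel, rule Lim_null_comparison)
  show "\<forall>\<^sub>F n in sequentially. norm (lam *\<^sub>R u n - A (u n) - g) \<le> inverse (real (Suc n))"
   by (intro always_eventually allI less_imp_le u(2))
 qed (rule LIMSEQ_inverse_real_of_nat)
 have "Cauchy u"
 proof (rule CauchyI)
  fix e :: real assume e: "0 < e"
  have "Cauchy (\<lambda>n. lam *\<^sub>R u n - A (u n))" using l by (rule LIMSEQ_imp_Cauchy)
  from CauchyD[OF this, of "lam * e"] e lp obtain M where
   M: "\<And>m n. M \<le> m \<Longrightarrow> M \<le> n \<Longrightarrow> norm ((lam *\<^sub>R u m - A (u m)) - (lam *\<^sub>R u n - A (u n))) < lam * e" by auto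
  have "norm (u m - u n) < e" if "M \<le> m" "M \<le> n" for m n
  proof -
   have "lam * norm (u m + (-1) *\<^sub>R u n) \<le> norm (lam *\<^sub>R (u m + (-1) *\<^sub>R u n) - A (u m + (-1) *\<^sub>R u n))"
    by (intro N_diss norm_NN D_lin u lp)
   also have "lam *\<^sub>R (u m + (-1) *\<^sub>R u n) - A (u m + (-1) *\<^sub>R u n) = (lam *\<^sub>R u m - A (u m)) - (lam *\<^sub>R u n - A (u n))"
    unfolding A_lin[OF u(1) u(1)] by (simp add: algebra_simps)
   also have "norm \<dots> < lam * e" by (rule M[OF that])
   finally show ?thesis using lp by simp
  qed
  then show "\<exists>M. \<forall>m\<ge>M. \<forall>n\<ge>M. norm (u m - u n) < e" by blast
 qed
 then obtain x where x: "u \<longlonglongrightarrow> x" using Cauchy_convergent convergent_def by blast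
 have "(\<lambda>n. lam *\<^sub>R u n - (lam *\<^sub>R u n - A (u n))) \<longlonglongrightarrow> lam *\<^sub>R x - g" by (intro tendsto_intros x l)
 then have "G x (lam *\<^sub>R x - g)" unfolding G_def using u(1) x by auto
 then show ?thesis by blast
qed

lemma G_unique:
 assumes "0 < lam" "G x (lam *\<^sub>R x - g)" "G x' (lam *\<^sub>R x' - g)"
 shows "x = x'"
proof -
 have "G (x + (-1) *\<^sub>R x') ((lam *\<^sub>R x - g) + (-1) *\<^sub>R (lam *\<^sub>R x' - g))" by (rule G_lin) fact+
 from G_diss[OF norm_NN this assms(1)] have "lam * norm (x - x') \<le> 0" by (simp add: algebra_simps)
 then show ?thesis using assms(1) by (simp add: mult_le_0_iff)
qed

definition R :: "real => 'a => 'a" where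
 "R lam g = (THE x. G x (lam *\<^sub>R x - g))"

lemma R_G:
 assumes lam: "lam0 \<le> lam"
 shows "G (R lam g) (lam *\<^sub>R R lam g - g)"
proof -
 have lp: "0 < lam" using lam lam0 by simp
 have "\<exists>!x. G x (lam *\<^sub>R x - g)" using G_surj[OF lam] G_unique[OF lp] by (rule ex_ex1I)
 then show ?thesis unfolding R_def by (rule theI')
qed

lemma R_eqI:
 assumes lam: "lam0 \<le> lam" and x: "G x (lam *\<^sub>R x - g)"
 shows "R lam g = x"
proof -
 have "0 < lam" using lam lam0 by simp
 then show ?thesis using R_G[OF lam] x by (rule G_unique)
qed

lemma R_lin: "lam0 \<le> lam \<Longrightarrow> R lam (g + c *\<^sub>R h) = R lam g + c *\<^sub>R R lam h"
proof (rule R_eqI)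
 assume l: "lam0 \<le> lam"
 have "(lam *\<^sub>R R lam g - g) + c *\<^sub>R (lam *\<^sub>R R lam h - h) = lam *\<^sub>R (R lam g + c *\<^sub>R R lam h) - (g + c *\<^sub>R h)"
  by (simp add: algebra_simps)
 then show "G (R lam g + c *\<^sub>R R lam h) (lam *\<^sub>R (R lam g + c *\<^sub>R R lam h) - (g + c *\<^sub>R h))"
  using G_lin[OF R_G[OF l, of g] R_G[OF l, of h], of c] by (simp only:)
qed

lemma R_N:
 assumes lam: "lam0 \<le> lam" and N: "N \<in> NN"
 shows "lam * N (R lam g) \<le> N g"
proof -
 have "0 < lam" using lam lam0 by simp
 from G_diss[OF N R_G[OF lam, of g] this] show ?thesis by simp
qed

lemma R_J:
 assumes lam: "lam0 \<le> lam" and J: "J \<in> JJ"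
 shows "R lam (J g) = J (R lam g)"
proof (rule R_eqI[OF lam])
 have "J (lam *\<^sub>R R lam g - g) = lam *\<^sub>R J (R lam g) - J g"
  using bounded_linear.linear[OF J_bl[OF J]] by (simp add: linear_diff linear_scale)
 then show "G (J (R lam g)) (lam *\<^sub>R J (R lam g) - J g)" using G_J[OF J R_G[OF lam, of g]] by simp
qed

text \<open>\<open>R b g\<close> solves the equation for \<open>a\<close> with right-hand side
  \<open>g + (a - b) *\<^sub>R R b g\<close>.\<close>

lemma R_identity:
 assumes a: "lam0 \<le> a" and b: "lam0 \<le> b"
 shows "(a - b) *\<^sub>R R a (R b g) = R b g - R a g"
proof -
 have "a *\<^sub>R R b g - (g + (a - b) *\<^sub>R R b g) = b *\<^sub>R R b g - g" by (simp add: algebra_simps)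
 then have "R a (g + (a - b) *\<^sub>R R b g) = R b g" using R_G[OF b, of g] by (intro R_eqI[OF a]) (simp only:)
 then have "R a g + (a - b) *\<^sub>R R a (R b g) = R b g" by (simp only: R_lin[OF a])
 then show ?thesis by (metis add_diff_cancel_left')
qed

lemma R_commute:
 assumes l: "lam0 \<le> lam" and m: "lam0 \<le> mu"
 shows "R lam (R mu g) = R mu (R lam g)"
proof (cases "lam = mu")
 case False
 have "(lam - mu) *\<^sub>R R lam (R mu g) = - ((mu - lam) *\<^sub>R R mu (R lam g))"
  unfolding R_identity[OF l m] R_identity[OF m l] by simp
 also have "\<dots> = (lam - mu) *\<^sub>R R mu (R lam g)" by (simp add: scaleR_left_diff_distrib)
 finally show ?thesis using False by simp
qed simp

end

section \<open>Yosida approximations and their exponentials\<close>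

context generation
begin

definition Q :: "real => 'a endo" where
 "Q lam = mk_endo (\<lambda>g. lam *\<^sub>R R lam g)"

lemma Q_bounded_linear:
 assumes lam: "lam0 \<le> lam"
 shows "bounded_linear (\<lambda>g. lam *\<^sub>R R lam g)"
proof (rule bounded_linear_intro[where K = 1])
 have lp: "0 < lam" using lam lam0 by simp
 have R0: "R lam 0 = 0" using R_lin[OF lam, of 0 "-1" 0] by simp
 show "lam *\<^sub>R R lam (x + y) = lam *\<^sub>R R lam x + lam *\<^sub>R R lam y" for x y
  using R_lin[OF lam, of x 1 y] by (simp add: scaleR_add_right)
 show "lam *\<^sub>R R lam (r *\<^sub>R x) = r *\<^sub>R lam *\<^sub>R R lam x" for r x
  using R_lin[OF lam, of 0 r x] R0 by simp
 show "norm (lam *\<^sub>R R lam x) \<le> norm x * 1" for x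
  using R_N[OF lam norm_NN, of x] lp by simp
qed

lemma app_Q: "lam0 \<le> lam \<Longrightarrow> app (Q lam) g = lam *\<^sub>R R lam g"
 unfolding Q_def by (simp add: app_mk_endo[OF Q_bounded_linear])

lemma Q_commute: "lam0 \<le> lam \<Longrightarrow> lam0 \<le> mu \<Longrightarrow> Q lam * Q mu = Q mu * Q lam"
proof (rule endo_eqI)
 fix x assume l: "lam0 \<le> lam" and m: "lam0 \<le> mu"
 have s: "R lam (mu *\<^sub>R y) = mu *\<^sub>R R lam y" "R mu (lam *\<^sub>R y) = lam *\<^sub>R R mu y" for y
  using R_lin[OF l, of 0 mu y] R_lin[OF l, of 0 "-1" 0] R_lin[OF m, of 0 lam y] R_lin[OF m, of 0 "-1" 0] by simp_all
 show "app (Q lam * Q mu) x = app (Q mu * Q lam) x"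
  by (simp add: app_times app_Q l m s R_commute[OF l m])
qed

lemma Q_N: "lam0 \<le> lam \<Longrightarrow> N \<in> NN \<Longrightarrow> N (app (Q lam) g) \<le> N g"
 using R_N[of lam N g] lam0 by (simp add: app_Q N_scale)

lemma Q_J: "lam0 \<le> lam \<Longrightarrow> J \<in> JJ \<Longrightarrow> app (Q lam) (J g) = J (app (Q lam) g)"
 by (simp add: app_Q R_J linear_scale[OF bounded_linear.linear[OF J_bl]])

lemma Q_power_N: "lam0 \<le> lam \<Longrightarrow> N \<in> NN \<Longrightarrow> N (app (Q lam ^ k) g) \<le> N g"
proof (induction k arbitrary: g)
 case 0 then show ?case by (simp add: app_one)
next
 case (Suc k)
 then show ?case using Q_N[of lam N "app (Q lam ^ k) g"] by (simp add: app_times) (metis order_trans)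
qed

lemma Q_power_J: "lam0 \<le> lam \<Longrightarrow> J \<in> JJ \<Longrightarrow> app (Q lam ^ k) (J g) = J (app (Q lam ^ k) g)"
 by (induction k) (simp_all add: app_one app_times Q_J)

text \<open>The Yosida approximation: on \<open>D\<close> it is \<open>Q lam\<close> after
  \<open>A\<close> (\<open>B_D\<close>), and \<open>Q lam\<close> tends strongly to the
  identity.\<close>

definition B :: "real => 'a endo" where
 "B lam = lam *\<^sub>R (Q lam - 1)"

definition E :: "real => real => 'a endo" where
 "E lam t = exp (t *\<^sub>R B lam)"

lemma B_commute: "lam0 \<le> lam \<Longrightarrow> lam0 \<le> mu \<Longrightarrow> B lam * B mu = B mu * B lam"
 by (simp add: B_def algebra_simps Q_commute)

lemma E_eq: "E lam t = exp (- (t * lam)) *\<^sub>R exp ((t * lam) *\<^sub>R Q lam)"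
proof -
 have "t *\<^sub>R B lam = (t * lam) *\<^sub>R Q lam + of_real (- (t * lam))"
  by (simp add: B_def scaleR_right_diff_distrib of_real_def)
 moreover have "exp ((t * lam) *\<^sub>R Q lam + of_real (- (t * lam))) = exp ((t * lam) *\<^sub>R Q lam) * exp (of_real (- (t * lam)))"
  by (rule exp_add_commuting) (simp add: of_real_def)
 moreover have "exp (of_real (- (t * lam)) :: 'a endo) = of_real (exp (- (t * lam)))" by (rule exp_of_real)
 ultimately show ?thesis by (simp add: E_def of_real_def)
qed

text \<open>By \<open>E_eq\<close> the operator is \<open>exp (- c)\<close> times a power series in
  the \<open>N\<close>-contraction \<open>Q lam\<close>. Its coefficients are nonnegative, so
  subadditivity and nonnegative homogeneity of \<open>N\<close> suffice; a half norm has no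
  more.\<close>

lemma E_N:
 assumes lam: "lam0 \<le> lam" and t: "0 \<le> t" and N: "N \<in> NN"
 shows "N (app (E lam t) g) \<le> N g"
proof -
 define c where "c = t * lam"
 have c: "0 \<le> c" using lam lam0 t by (simp add: c_def)
 define S where "S k = (\<Sum>n<k. (c ^ n / fact n) *\<^sub>R app (Q lam ^ n) g)" for k
 have "(\<lambda>n. (c *\<^sub>R Q lam) ^ n /\<^sub>R fact n) sums exp (c *\<^sub>R Q lam)" by (rule exp_converges)
 from bounded_linear.sums[OF bounded_linear_app_left this, of g]
 have "(\<lambda>n. (c ^ n / fact n) *\<^sub>R app (Q lam ^ n) g) sums app (exp (c *\<^sub>R Q lam)) g"
  by (simp add: app_scaleR_left scaleR_power field_simps)
 then have Sl: "S \<longlonglongrightarrow> app (exp (c *\<^sub>R Q lam)) g" unfolding sums_def S_def .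
 have NS: "N (S k) \<le> (\<Sum>n<k. c ^ n / fact n) * N g" for k
 proof (induction k)
  case 0
  have "N 0 = 0" using N_scale[OF N, of 0 0] by simp
  then show ?case by (simp add: S_def)
 next
  case (Suc k)
  have "N (S (Suc k)) \<le> N (S k) + N ((c ^ k / fact k) *\<^sub>R app (Q lam ^ k) g)"
   unfolding S_def by (simp add: N_add[OF N])
  also have "\<dots> \<le> (\<Sum>n<k. c ^ n / fact n) * N g + (c ^ k / fact k) * N g"
   using Suc c Q_power_N[OF lam N, of k g] by (intro add_mono) (auto simp: N_scale[OF N] intro!: divide_right_mono mult_left_mono)
  finally show ?case by (simp add: distrib_right)
 qed
 have "N (app (exp (c *\<^sub>R Q lam)) g) \<le> exp c * N g"
 proof (rule LIMSEQ_le)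
  show "(\<lambda>k. N (S k)) \<longlonglongrightarrow> N (app (exp (c *\<^sub>R Q lam)) g)" by (rule N_tendsto[OF N Sl])
  have "(\<lambda>n. c ^ n / fact n) sums exp c" using exp_converges[of c] by (simp add: field_simps)
  then show "(\<lambda>k. (\<Sum>n<k. c ^ n / fact n) * N g) \<longlonglongrightarrow> exp c * N g"
   unfolding sums_def by (rule tendsto_mult_right)
 qed (use NS in auto)
 then have "exp (- c) * N (app (exp (c *\<^sub>R Q lam)) g) \<le> exp (- c) * (exp c * N g)" by (intro mult_left_mono) auto
 also have "\<dots> = N g" by (simp add: mult.assoc[symmetric] exp_add[symmetric])
 finally show ?thesis unfolding E_eq c_def[symmetric] by (simp add: app_scaleR_left N_scale[OF N])
qed

lemma E_J:
 assumes lam: "lam0 \<le> lam" and J: "J \<in> JJ"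
 shows "app (E lam t) (J g) = J (app (E lam t) g)"
proof -
 define c where "c = t * lam"
 note Jl = bounded_linear.linear[OF J_bl[OF J]]
 have "(\<lambda>n. (c *\<^sub>R Q lam) ^ n /\<^sub>R fact n) sums exp (c *\<^sub>R Q lam)" by (rule exp_converges)
 note s = bounded_linear.sums[OF bounded_linear_app_left this]
 have "(\<lambda>n. app ((c *\<^sub>R Q lam) ^ n /\<^sub>R fact n) (J g)) sums J (app (exp (c *\<^sub>R Q lam)) g)"
  using bounded_linear.sums[OF J_bl[OF J] s[of g]]
  by (simp add: app_scaleR_left scaleR_power Q_power_J[OF lam J] linear_scale[OF Jl])
 then have "app (exp (c *\<^sub>R Q lam)) (J g) = J (app (exp (c *\<^sub>R Q lam)) g)"
  using s[of "J g"] sums_unique2 by blast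
 then show ?thesis unfolding E_eq c_def[symmetric] by (simp add: app_scaleR_left linear_scale[OF Jl])
qed

text \<open>The path exp(s B1) exp((t - s) B2) joins the two exponentials, and by commutation its
  derivative is the path applied to B1 - B2.\<close>

lemma exp_difference:
 fixes B1 B2 :: "'a endo"
 assumes c: "B1 * B2 = B2 * B1" and t: "0 \<le> t"
  and 1: "\<And>s x. 0 \<le> s \<Longrightarrow> norm (app (exp (s *\<^sub>R B1)) x) \<le> norm x"
  and 2: "\<And>s x. 0 \<le> s \<Longrightarrow> norm (app (exp (s *\<^sub>R B2)) x) \<le> norm x"
 shows "norm (app (exp (t *\<^sub>R B1)) g - app (exp (t *\<^sub>R B2)) g) \<le> t * norm (app B1 g - app B2 g)"
proof -
 define F where "F s = exp (s *\<^sub>R B1) * exp ((t - s) *\<^sub>R B2)" for s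
 have comm: "exp (s *\<^sub>R B2) * B1 = B1 * exp (s *\<^sub>R B2)" for s
 proof -
  have p: "(s *\<^sub>R B2) ^ n * B1 = B1 * (s *\<^sub>R B2) ^ n" for n
   by (rule power_commuting_commutes) (simp add: c)
  have e: "(\<lambda>n. (s *\<^sub>R B2) ^ n /\<^sub>R fact n) sums exp (s *\<^sub>R B2)" by (rule exp_converges)
  have "(\<lambda>n. B1 * ((s *\<^sub>R B2) ^ n /\<^sub>R fact n)) sums (exp (s *\<^sub>R B2) * B1)"
   using bounded_linear.sums[OF bounded_linear_mult_left e, of B1] by (simp only: mult_scaleR_left mult_scaleR_right p)
  from sums_unique2[OF this bounded_linear.sums[OF bounded_linear_mult_right e]] show ?thesis .
 qed
 have d1: "((\<lambda>s. exp (s *\<^sub>R B1)) has_vector_derivative exp (s *\<^sub>R B1) * B1) (at s within {0..t})" for s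
  by (rule exp_scaleR_has_vector_derivative_right)
 have d2: "((\<lambda>s. exp ((t - s) *\<^sub>R B2)) has_vector_derivative - (exp ((t - s) *\<^sub>R B2) * B2)) (at s within {0..t})" for s
 proof -
  have "((\<lambda>s. t - s) has_vector_derivative -1) (at s within {0..t})" by (auto intro!: derivative_eq_intros)
  from vector_diff_chain_within[OF this exp_scaleR_has_vector_derivative_right] show ?thesis by (simp add: comp_def)
 qed
 have d: "((\<lambda>s. app (F s) g) has_vector_derivative app (F s) (app B1 g - app B2 g)) (at s within {0..t})" for s
 proof -
  have "(F has_vector_derivative (exp (s *\<^sub>R B1) * - (exp ((t - s) *\<^sub>R B2) * B2) + (exp (s *\<^sub>R B1) * B1) * exp ((t - s) *\<^sub>R B2))) (at s within {0..t})"
   unfolding F_def by (rule has_vector_derivative_mult[OF d1 d2])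
  moreover have "exp (s *\<^sub>R B1) * - (exp ((t - s) *\<^sub>R B2) * B2) + (exp (s *\<^sub>R B1) * B1) * exp ((t - s) *\<^sub>R B2) = F s * (B1 - B2)"
   unfolding F_def using comm[of "t - s"] by (simp add: algebra_simps)
  ultimately have "(F has_vector_derivative F s * (B1 - B2)) (at s within {0..t})" by simp
  from bounded_linear.has_vector_derivative[OF bounded_linear_app_left this, of g] show ?thesis
   by (simp add: app_times app_diff_left)
 qed
 have "norm (app (F t) g - app (F 0) g) \<le> norm (app B1 g - app B2 g) * norm (t - 0)"
 proof (rule differentiable_bound[of "{0..t}" _ "\<lambda>s h. h *\<^sub>R app (F s) (app B1 g - app B2 g)"])
  fix s assume s: "s \<in> {0..t}"
  show "((\<lambda>s. app (F s) g) has_derivative (\<lambda>h. h *\<^sub>R app (F s) (app B1 g - app B2 g))) (at s within {0..t})"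
   using d[of s] by (simp add: has_vector_derivative_def)
  have "norm (app (F s) x) \<le> norm x" for x
   unfolding F_def app_times using 1[of s] 2[of "t - s" x] s by (meson atLeastAtMost_iff diff_ge_0_iff_ge order_trans)
  then show "onorm (\<lambda>h. h *\<^sub>R app (F s) (app B1 g - app B2 g)) \<le> norm (app B1 g - app B2 g)"
   by (intro onorm_le) (simp add: mult.commute mult_left_mono)
 qed (use t in auto)
 then show ?thesis using t by (simp add: F_def mult.commute)
qed

lemma E_contraction: "lam0 \<le> lam \<Longrightarrow> 0 \<le> t \<Longrightarrow> norm (app (E lam t) x) \<le> norm x"
 using E_N[OF _ _ norm_NN] .

lemma E_difference:
 assumes "lam0 \<le> lam" "lam0 \<le> mu" "0 \<le> t"
 shows "norm (app (E lam t) g - app (E mu t) g) \<le> t * norm (app (B lam) g - app (B mu) g)"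
 unfolding E_def
 by (rule exp_difference[OF B_commute[OF assms(1,2)] assms(3)])
  (use E_contraction[OF assms(1)] E_contraction[OF assms(2)] in \<open>auto simp: E_def\<close>)

lemma E_near_id:
 assumes "lam0 \<le> lam" "0 \<le> t"
 shows "norm (app (E lam t) g - g) \<le> t * norm (app (B lam) g)"
 using exp_difference[of "B lam" 0 t g] E_contraction[OF assms(1)] assms(2)
 by (simp add: E_def app_one) (simp add: app_def zero_endo.rep_eq)

lemma B_D: "lam0 \<le> lam \<Longrightarrow> u \<in> D \<Longrightarrow> app (B lam) u = app (Q lam) (A u)"
proof -
 assume lam: "lam0 \<le> lam" and u: "u \<in> D"
 have "R lam (lam *\<^sub>R u - A u) = u" using G_D[OF u] by (intro R_eqI[OF lam]) simp
 moreover have "R lam (lam *\<^sub>R u - A u) = lam *\<^sub>R R lam u - R lam (A u)"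
  using R_lin[OF lam, of "lam *\<^sub>R u" "-1" "A u"] R_lin[OF lam, of 0 lam u] R_lin[OF lam, of 0 "-1" 0] by simp
 ultimately have "lam *\<^sub>R R lam u - u = R lam (A u)" by (simp add: algebra_simps)
 then show ?thesis by (simp add: B_def app_scaleR_left app_diff_left app_one app_Q lam)
qed

lemma Q_D: "lam0 \<le> lam \<Longrightarrow> u \<in> D \<Longrightarrow> norm (app (Q lam) u - u) \<le> norm (A u) / lam"
proof -
 assume lam: "lam0 \<le> lam" and u: "u \<in> D"
 have lp: "0 < lam" using lam lam0 by simp
 have "lam *\<^sub>R (app (Q lam) u - u) = lam *\<^sub>R R lam (A u)"
  using B_D[OF lam u] by (simp add: B_def app_scaleR_left app_diff_left app_one app_Q[OF lam])
 then have "app (Q lam) u - u = R lam (A u)" using lp by simp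
 then show ?thesis using R_N[OF lam norm_NN, of "A u"] lp by (simp add: field_simps)
qed

abbreviation lamn :: "nat => real" where "lamn n \<equiv> lam0 + real n"

lemma norm_add3: "norm (a + b + c) \<le> norm a + norm b + norm c" for a b c :: 'a
 using norm_triangle_ineq[of "a + b" c] norm_triangle_ineq[of a b] by simp

text \<open>On \<open>D\<close> the difference is at most \<open>norm (A u) / lam\<close>;
  contractivity carries the convergence to the closure of \<open>D\<close>.\<close>

lemma Q_tendsto: "(\<lambda>n. app (Q (lamn n)) g) \<longlonglongrightarrow> g"
proof (rule LIMSEQ_I)
 fix e :: real assume e: "0 < e"
 obtain u where u: "u \<in> D" "norm (u - g) < e / 3" using D_dense[of "e / 3" g] e by auto
 have "(\<lambda>n. norm (A u) / lamn n) \<longlonglongrightarrow> 0"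
  by (rule real_tendsto_divide_at_top[OF tendsto_const filterlim_tendsto_add_at_top[OF tendsto_const filterlim_real_sequentially]])
 then obtain M where M: "\<And>n. M \<le> n \<Longrightarrow> \<bar>norm (A u) / lamn n\<bar> < e / 3"
  using LIMSEQ_D[of _ 0 "e / 3"] e by fastforce
 have "norm (app (Q (lamn n)) g - g) < e" if n: "M \<le> n" for n
 proof -
  have "norm (app (Q (lamn n)) g - g) \<le> norm (app (Q (lamn n)) (g - u)) + norm (app (Q (lamn n)) u - u) + norm (u - g)"
   using norm_add3[of "app (Q (lamn n)) (g - u)" "app (Q (lamn n)) u - u" "u - g"] by (simp add: app_diff)
  moreover have "norm (app (Q (lamn n)) (g - u)) \<le> norm (g - u)" using Q_N[OF _ norm_NN] by simp
  moreover have "norm (app (Q (lamn n)) u - u) \<le> norm (A u) / lamn n" by (rule Q_D[OF _ u(1)]) simp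
  ultimately show ?thesis using u(2) M[OF n] norm_minus_commute[of u g] by linarith
 qed
 then show "\<exists>M. \<forall>n\<ge>M. norm (app (Q (lamn n)) g - g) < e" by blast
qed

lemma B_tendsto: "u \<in> D \<Longrightarrow> (\<lambda>n. app (B (lamn n)) u) \<longlonglongrightarrow> A u"
 using Q_tendsto[of "A u"] by (simp add: B_D)

text \<open>On \<open>D\<close> the Yosida approximations converge, so their exponentials are Cauchy
  by \<open>E_difference\<close>; contractivity extends this to all \<open>g\<close>.\<close>

lemma E_convergent:
 assumes t: "0 \<le> t"
 shows "convergent (\<lambda>n. app (E (lamn n) t) g)"
proof (rule Cauchy_convergent, rule CauchyI)
 fix e :: real assume e: "0 < e"
 obtain u where u: "u \<in> D" "norm (u - g) < e / 3" using D_dense[of "e / 3" g] e by auto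
 have "Cauchy (\<lambda>n. app (B (lamn n)) u)" by (rule LIMSEQ_imp_Cauchy[OF B_tendsto[OF u(1)]])
 from CauchyD[OF this, of "e / (3 * (t + 1))"] e t obtain M where
  M: "\<And>m n. M \<le> m \<Longrightarrow> M \<le> n \<Longrightarrow> norm (app (B (lamn m)) u - app (B (lamn n)) u) < e / (3 * (t + 1))" by auto
 have "norm (app (E (lamn m) t) g - app (E (lamn n) t) g) < e" if mn: "M \<le> m" "M \<le> n" for m n
 proof -
  have "norm (app (E (lamn m) t) g - app (E (lamn n) t) g)
   \<le> norm (app (E (lamn m) t) (g - u)) + norm (app (E (lamn m) t) u - app (E (lamn n) t) u) + norm (app (E (lamn n) t) (g - u))"
   using norm_add3[of "app (E (lamn m) t) (g - u)" "app (E (lamn m) t) u - app (E (lamn n) t) u" "- app (E (lamn n) t) (g - u)"]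
   unfolding norm_minus_cancel by (simp add: app_diff)
  moreover have "norm (app (E (lamn m) t) (g - u)) \<le> norm (g - u)" "norm (app (E (lamn n) t) (g - u)) \<le> norm (g - u)"
   using E_contraction t by auto
  moreover have "norm (app (E (lamn m) t) u - app (E (lamn n) t) u) \<le> e / 3"
  proof -
   have "norm (app (E (lamn m) t) u - app (E (lamn n) t) u) \<le> t * norm (app (B (lamn m)) u - app (B (lamn n)) u)"
    using E_difference t by simp
   also have "\<dots> \<le> (t + 1) * (e / (3 * (t + 1)))" using M[OF mn] t by (intro mult_mono) auto
   also have "\<dots> = e / 3" using nonzero_mult_divide_mult_cancel_right[of "t + 1" e 3] t by (simp only: times_divide_eq_right) (simp add: mult.commute)
   finally show ?thesis .
  qed
  ultimately show ?thesis using u(2) norm_minus_commute[of u g] by linarith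
 qed
 then show "\<exists>M. \<forall>m\<ge>M. \<forall>n\<ge>M. norm (app (E (lamn m) t) g - app (E (lamn n) t) g) < e" by blast
qed

section \<open>The limit semigroup and its derivative at 0\<close>

definition T :: "real => 'a => 'a" where
 "T t g = lim (\<lambda>n. app (E (lamn n) t) g)"

lemma T_tendsto: "0 \<le> t \<Longrightarrow> (\<lambda>n. app (E (lamn n) t) g) \<longlonglongrightarrow> T t g"
 unfolding T_def using E_convergent by (simp add: convergent_LIMSEQ_iff)

lemma T_N: "0 \<le> t \<Longrightarrow> N \<in> NN \<Longrightarrow> N (T t g) \<le> N g"
 using N_tendsto[OF _ T_tendsto] E_N by (intro LIMSEQ_le_const2[of "\<lambda>n. N (app (E (lamn n) t) g)"]) auto

lemma T_lin: "0 \<le> t \<Longrightarrow> T t (a + c *\<^sub>R b) = T t a + c *\<^sub>R T t b"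
proof (rule LIMSEQ_unique[OF T_tendsto])
 assume t: "0 \<le> t"
 have "(\<lambda>n. app (E (lamn n) t) a + c *\<^sub>R app (E (lamn n) t) b) \<longlonglongrightarrow> T t a + c *\<^sub>R T t b"
  by (intro tendsto_intros T_tendsto t)
 then show "(\<lambda>n. app (E (lamn n) t) (a + c *\<^sub>R b)) \<longlonglongrightarrow> T t a + c *\<^sub>R T t b" by (simp add: app_add app_scaleR)
qed

lemma T_J: "0 \<le> t \<Longrightarrow> J \<in> JJ \<Longrightarrow> T t (J g) = J (T t g)"
proof (rule LIMSEQ_unique[OF T_tendsto])
 assume t: "0 \<le> t" and J: "J \<in> JJ"
 have "(\<lambda>n. J (app (E (lamn n) t) g)) \<longlonglongrightarrow> J (T t g)" by (rule bounded_linear.tendsto[OF J_bl[OF J] T_tendsto[OF t]])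
 then show "(\<lambda>n. app (E (lamn n) t) (J g)) \<longlonglongrightarrow> J (T t g)" by (simp add: E_J J)
qed

lemma T_0: "T 0 g = g"
 by (rule LIMSEQ_unique[OF T_tendsto]) (simp_all add: E_def app_one)

lemma T_diff_contraction: "0 \<le> t \<Longrightarrow> norm (T t a - T t b) \<le> norm (a - b)"
 using T_N[OF _ norm_NN, of t "a - b"] T_lin[of t a "-1" b] by simp

text \<open>The error in the inner limit passes through the contractions \<open>E (lamn n) s\<close>
  without growing.\<close>

lemma T_add:
 assumes s: "0 \<le> s" and t: "0 \<le> t"
 shows "T (s + t) g = T s (T t g)"
proof (rule LIMSEQ_unique)
 show "(\<lambda>n. app (E (lamn n) (s + t)) g) \<longlonglongrightarrow> T (s + t) g" using T_tendsto s t by simp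
 have e: "app (E (lamn n) (s + t)) g = app (E (lamn n) s) (app (E (lamn n) t) g)" for n
  unfolding E_def scaleR_left_distrib app_times[symmetric]
  by (subst exp_add_commuting) (simp_all add: mult.commute)
 have "(\<lambda>n. app (E (lamn n) s) (T t g) + (app (E (lamn n) s) (app (E (lamn n) t) g) - app (E (lamn n) s) (T t g))) \<longlonglongrightarrow> T s (T t g) + 0"
 proof (intro tendsto_add T_tendsto s)
  have "(\<lambda>n. norm (app (E (lamn n) t) g - T t g)) \<longlonglongrightarrow> 0" using T_tendsto[OF t, of g] by (simp add: LIM_zero tendsto_norm_zero)
  then show "(\<lambda>n. app (E (lamn n) s) (app (E (lamn n) t) g) - app (E (lamn n) s) (T t g)) \<longlonglongrightarrow> 0"
   by (rule Lim_null_comparison[rotated]) (simp add: app_diff[symmetric] E_contraction s)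
 qed
 then show "(\<lambda>n. app (E (lamn n) (s + t)) g) \<longlonglongrightarrow> T s (T t g)" by (simp add: e)
qed

lemma T_near_id: "u \<in> D \<Longrightarrow> 0 \<le> t \<Longrightarrow> norm (T t u - u) \<le> t * norm (A u)"
proof (rule LIMSEQ_le_const2)
 assume u: "u \<in> D" and t: "0 \<le> t"
 show "(\<lambda>n. norm (app (E (lamn n) t) u - u)) \<longlonglongrightarrow> norm (T t u - u)" by (intro tendsto_intros T_tendsto t)
 have "norm (app (E (lamn n) t) u - u) \<le> t * norm (A u)" for n
 proof -
  have "norm (app (E (lamn n) t) u - u) \<le> t * norm (app (B (lamn n)) u)" using E_near_id t by simp
  also have "\<dots> \<le> t * norm (A u)" using Q_N[OF _ norm_NN, of "lamn n" "A u"] t u by (intro mult_left_mono) (simp_all add: B_D)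
  finally show ?thesis .
 qed
 then show "\<exists>N. \<forall>n\<ge>N. norm (app (E (lamn n) t) u - u) \<le> t * norm (A u)" by blast
qed

lemma T_continuous: "((\<lambda>t. norm (T t g - g)) \<longlongrightarrow> 0) (at_right 0)"
proof (rule tendstoI)
 fix e :: real assume e: "0 < e"
 obtain u where u: "u \<in> D" "norm (u - g) < e / 3" using D_dense[of "e / 3" g] e by auto
 define d where "d = e / (3 * (norm (A u) + 1))"
 have d: "0 < d" using e by (simp add: d_def add_nonneg_pos)
 have "norm (T t g - g) < e" if t: "0 < t" "t < d" for t
 proof -
  have "norm (T t g - g) \<le> norm (T t g - T t u) + norm (T t u - u) + norm (u - g)"
   using norm_add3[of "T t g - T t u" "T t u - u" "u - g"] by simp
  moreover have "norm (T t g - T t u) \<le> norm (u - g)" using T_diff_contraction[of t g u] t by (simp add: norm_minus_commute)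
  moreover have "norm (T t u - u) \<le> e / 3"
  proof -
   have "norm (T t u - u) \<le> t * norm (A u)" using T_near_id[OF u(1)] t by simp
   also have "\<dots> \<le> d * (norm (A u) + 1)" using t by (intro mult_mono) auto
   also have "\<dots> = e / 3" unfolding d_def using norm_ge_zero[of "A u"] by (simp add: field_simps add_nonneg_eq_0_iff)
   finally show ?thesis .
  qed
  ultimately show ?thesis using u(2) by linarith
 qed
 then show "\<forall>\<^sub>F t in at_right 0. dist (norm (T t g - g)) 0 < e"
  unfolding eventually_at_right_field using d by (intro exI[of _ d]) auto
qed

text \<open>The derivative of s \<mapsto> E(s) u - s A u is E(s) B u - A u, split through B u - A u,
  A u - z, E(s) z - z and z - A u. The element \<open>z\<close> of \<open>D\<close> stands in for
  \<open>A u\<close>, because the bound for E(s) z - z uses \<open>A z\<close>.\<close>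

lemma T_derivative_estimate:
 assumes u: "u \<in> D" and z: "z \<in> D" "norm (A u - z) < e" and t: "0 \<le> t"
 shows "norm (T t u - u - t *\<^sub>R A u) \<le> t * (2 * e + t * norm (A z))"
proof -
 have est: "norm (app (E (lamn n) t) u - u - t *\<^sub>R A u) \<le> (norm (app (B (lamn n)) u - A u) + (2 * e + t * norm (A z))) * norm (t - 0)" for n
 proof -
  define \<phi> where "\<phi> s = app (E (lamn n) s) u - s *\<^sub>R A u" for s
  have "norm (\<phi> t - \<phi> 0) \<le> (norm (app (B (lamn n)) u - A u) + (2 * e + t * norm (A z))) * norm (t - 0)"
  proof (rule differentiable_bound[of "{0..t}" \<phi> "\<lambda>s h. h *\<^sub>R (app (E (lamn n) s) (app (B (lamn n)) u) - A u)"])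
   fix s assume s: "s \<in> {0..t}"
   have "((\<lambda>s. app (E (lamn n) s) u) has_vector_derivative app (E (lamn n) s * B (lamn n)) u) (at s within {0..t})"
    unfolding E_def by (intro bounded_linear.has_vector_derivative[OF bounded_linear_app_left] exp_scaleR_has_vector_derivative_right)
   then have "(\<phi> has_vector_derivative (app (E (lamn n) s) (app (B (lamn n)) u) - A u)) (at s within {0..t})"
    unfolding \<phi>_def app_times by (auto intro!: derivative_eq_intros)
   then show "(\<phi> has_derivative (\<lambda>h. h *\<^sub>R (app (E (lamn n) s) (app (B (lamn n)) u) - A u))) (at s within {0..t})"
    by (simp add: has_vector_derivative_def)
   have s0: "0 \<le> s" using s by simp
   have "norm (app (E (lamn n) s) (app (B (lamn n)) u) - A u) \<le> norm (app (E (lamn n) s) (app (B (lamn n)) u - A u))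
     + norm (app (E (lamn n) s) (A u - z)) + norm (app (E (lamn n) s) z - z) + norm (z - A u)"
    using norm_add3[of "app (E (lamn n) s) (app (B (lamn n)) u - A u)" "app (E (lamn n) s) (A u - z)" "app (E (lamn n) s) z - z + (z - A u)"]
     norm_triangle_ineq[of "app (E (lamn n) s) z - z" "z - A u"] unfolding app_diff by simp
   also have "\<dots> \<le> norm (app (B (lamn n)) u - A u) + e + t * norm (A z) + e"
   proof (intro add_mono)
    show "norm (app (E (lamn n) s) (app (B (lamn n)) u - A u)) \<le> norm (app (B (lamn n)) u - A u)" using E_contraction s0 by simp
    show "norm (app (E (lamn n) s) (A u - z)) \<le> e" using E_contraction[of "lamn n" s "A u - z"] s0 z(2) by simp
    show "norm (z - A u) \<le> e" using z(2) by (simp add: norm_minus_commute)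
    have "norm (app (E (lamn n) s) z - z) \<le> s * norm (app (B (lamn n)) z)" using E_near_id s0 by simp
    also have "\<dots> \<le> t * norm (A z)" using Q_N[OF _ norm_NN, of "lamn n" "A z"] s z by (intro mult_mono) (simp_all add: B_D)
    finally show "norm (app (E (lamn n) s) z - z) \<le> t * norm (A z)" .
   qed
   finally have b: "norm (app (E (lamn n) s) (app (B (lamn n)) u) - A u) \<le> norm (app (B (lamn n)) u - A u) + (2 * e + t * norm (A z))" by simp
   show "onorm (\<lambda>h. h *\<^sub>R (app (E (lamn n) s) (app (B (lamn n)) u) - A u)) \<le> norm (app (B (lamn n)) u - A u) + (2 * e + t * norm (A z))"
    by (rule onorm_le) (use mult_left_mono[OF b] in \<open>simp add: mult.commute\<close>)
  qed (use t in auto)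
  then show ?thesis by (simp add: \<phi>_def E_def app_one algebra_simps)
 qed
 have "norm (T t u - u - t *\<^sub>R A u) \<le> (0 + (2 * e + t * norm (A z))) * norm (t - 0)"
 proof (rule LIMSEQ_le)
  show "(\<lambda>n. norm (app (E (lamn n) t) u - u - t *\<^sub>R A u)) \<longlonglongrightarrow> norm (T t u - u - t *\<^sub>R A u)"
   by (intro tendsto_intros T_tendsto t)
  have "(\<lambda>n. norm (app (B (lamn n)) u - A u)) \<longlonglongrightarrow> 0" using B_tendsto[OF u] by (simp add: LIM_zero tendsto_norm_zero)
  then show "(\<lambda>n. (norm (app (B (lamn n)) u - A u) + (2 * e + t * norm (A z))) * norm (t - 0)) \<longlonglongrightarrow> (0 + (2 * e + t * norm (A z))) * norm (t - 0)"
   by (intro tendsto_intros)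
 qed (use est in auto)
 then show ?thesis using t by (simp add: mult.commute)
qed

lemma T_generator:
 assumes u: "u \<in> D"
 shows "((\<lambda>t. norm ((1 / t) *\<^sub>R (T t u - u) - A u)) \<longlongrightarrow> 0) (at_right 0)"
proof (rule tendstoI)
 fix e :: real assume e: "0 < e"
 obtain z where z: "z \<in> D" "norm (A u - z) < e / 4" using D_dense[of "e / 4" "A u"] e by (auto simp: norm_minus_commute)
 define d where "d = e / (4 * (norm (A z) + 1))"
 have d: "0 < d" using e by (simp add: d_def add_nonneg_pos)
 have "norm ((1 / t) *\<^sub>R (T t u - u) - A u) < e" if t: "0 < t" "t < d" for t
 proof -
  have n: "norm (T t u - u - t *\<^sub>R A u) \<le> t * (2 * (e / 4) + t * norm (A z))" using t by (intro T_derivative_estimate[OF u z]) simp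
  have "(1 / t) *\<^sub>R (T t u - u) - A u = (1 / t) *\<^sub>R (T t u - u - t *\<^sub>R A u)" using t by (simp add: algebra_simps)
  then have eq: "norm ((1 / t) *\<^sub>R (T t u - u) - A u) = norm (T t u - u - t *\<^sub>R A u) / t" using t by simp
  have "t * norm (A z) \<le> d * (norm (A z) + 1)" using t by (intro mult_mono) auto
  moreover have "d * (norm (A z) + 1) = e / 4" unfolding d_def using norm_ge_zero[of "A z"] by (simp add: field_simps add_nonneg_eq_0_iff)
  ultimately have "t * (2 * (e / 4) + t * norm (A z)) < t * e" using t e by (intro mult_strict_left_mono) auto
  with n have "norm (T t u - u - t *\<^sub>R A u) < t * e" by (rule le_less_trans)
  then show ?thesis unfolding eq using t by (simp add: divide_less_eq mult.commute)
 qed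
 then show "\<forall>\<^sub>F t in at_right 0. dist (norm ((1 / t) *\<^sub>R (T t u - u) - A u)) 0 < e"
  unfolding eventually_at_right_field using d by (intro exI[of _ d]) auto
qed

end

section \<open>Functions vanishing at infinity\<close>

text \<open>Complex-valued functions, but as a real Banach space; complex scalars return as the
  operators \<open>cscale\<close>.\<close>

typedef (overloaded) 'a c0fun = "{f :: 'a::euclidean_space \<Rightarrow>\<^sub>C complex. (apply_bcontfun f \<longlongrightarrow> 0) at_infinity}"
 by (intro exI[of _ 0]) (simp add: zero_bcontfun.rep_eq)

setup_lifting type_definition_c0fun

instantiation c0fun :: (euclidean_space) real_normed_vector
begin

lift_definition zero_c0fun :: "'a c0fun" is 0
 by (simp add: zero_bcontfun.rep_eq)
lift_definition plus_c0fun :: "'a c0fun => 'a c0fun => 'a c0fun" is "(+)"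
 by (auto simp: plus_bcontfun.rep_eq intro: tendsto_add_zero)
lift_definition minus_c0fun :: "'a c0fun => 'a c0fun => 'a c0fun" is "(-)"
 by (auto simp: minus_bcontfun.rep_eq intro: tendsto_eq_intros)
lift_definition uminus_c0fun :: "'a c0fun => 'a c0fun" is uminus
 by (auto simp: uminus_bcontfun.rep_eq intro: tendsto_eq_intros)
lift_definition scaleR_c0fun :: "real => 'a c0fun => 'a c0fun" is "(*\<^sub>R)"
 by (auto simp: scaleR_bcontfun.rep_eq intro: tendsto_eq_intros)
lift_definition norm_c0fun :: "'a c0fun => real" is norm .

definition dist_c0fun :: "'a c0fun => 'a c0fun => real" where
 "dist_c0fun a b = norm (a - b)"
definition sgn_c0fun :: "'a c0fun => 'a c0fun" where
 "sgn_c0fun a = scaleR (inverse (norm a)) a"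
definition [code del]: "(uniformity :: ('a c0fun \<times> 'a c0fun) filter) = (INF e\<in>{0 <..}. principal {(x, y). dist x y < e})"
definition open_c0fun :: "'a c0fun set => bool" where
 [code del]: "open_c0fun S = (\<forall>x\<in>S. \<forall>\<^sub>F (x', y) in uniformity. x' = x \<longrightarrow> y \<in> S)"

instance
 apply standard
 unfolding dist_c0fun_def open_c0fun_def sgn_c0fun_def uniformity_c0fun_def
 apply (rule refl | (transfer, force simp: norm_triangle_ineq algebra_simps))+
 done

end

definition c0app :: "'a::euclidean_space c0fun => 'a => complex" where
 "c0app f = apply_bcontfun (Rep_c0fun f)"

definition c0mk :: "('a::euclidean_space => complex) => 'a c0fun" where
 "c0mk u = Abs_c0fun (Bcontfun u)"

definition vanishing :: "('a::euclidean_space => complex) => bool" where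
 "vanishing u \<longleftrightarrow> continuous_on UNIV u \<and> (u \<longlongrightarrow> 0) at_infinity"

lemma vanishing_small:
 assumes u: "vanishing u" and e: "0 < e"
 obtains r where "0 < r" "\<And>x. r \<le> norm x \<Longrightarrow> cmod (u x) < e"
proof -
 have "\<forall>\<^sub>F x in at_infinity. cmod (u x) < e"
  using u e tendstoD[of u 0 at_infinity e] by (simp add: vanishing_def)
 then obtain r where "\<forall>x. r \<le> norm x \<longrightarrow> cmod (u x) < e" by (auto simp: eventually_at_infinity)
 then show ?thesis by (intro that[of "max r 1"]) auto
qed

lemma vanishing_bounded:
 assumes u: "vanishing u"
 obtains M where "\<And>x. cmod (u x) \<le> M"
proof -
 obtain r where r: "0 < r" "\<And>x. r \<le> norm x \<Longrightarrow> cmod (u x) < 1" using vanishing_small[OF u] by (metis zero_less_one)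
 have "compact (u ` cball 0 r)"
  using u by (intro compact_continuous_image) (auto simp: vanishing_def intro: continuous_on_subset)
 then obtain M where M: "\<And>x. norm x \<le> r \<Longrightarrow> cmod (u x) \<le> M"
  by (metis bounded_iff compact_imp_bounded image_eqI mem_cball_0)
 show ?thesis
 proof (rule that)
  show "cmod (u x) \<le> max M 1" for x using r(2)[of x] M[of x] by fastforce
 qed
qed

lemma vanishing_bcontfun: "vanishing u \<Longrightarrow> u \<in> bcontfun"
 unfolding bcontfun_def using vanishing_bounded[of u] by (auto simp: bounded_iff vanishing_def)

lemma vanishing_c0app: "vanishing (c0app f)"
 using Rep_c0fun[of f] by (simp add: vanishing_def c0app_def)

lemma c0app_c0mk: "vanishing u \<Longrightarrow> c0app (c0mk u) = u"
 by (simp add: c0app_def c0mk_def Abs_c0fun_inverse Bcontfun_inverse vanishing_bcontfun vanishing_def)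

lemma c0mk_c0app: "c0mk (c0app f) = f"
 by (simp add: c0app_def c0mk_def apply_bcontfun_inverse Rep_c0fun_inverse)

lemma c0fun_eqI: "(\<And>x. c0app f x = c0app g x) \<Longrightarrow> f = g"
 by (metis c0mk_c0app ext)

lemma c0app_simps [simp]:
 "c0app (f + g) x = c0app f x + c0app g x"
 "c0app (f - g) x = c0app f x - c0app g x"
 "c0app (- f) x = - c0app f x"
 "c0app (a *\<^sub>R f) x = of_real a * c0app f x"
 "c0app 0 x = 0"
 by (simp_all add: c0app_def plus_c0fun.rep_eq minus_c0fun.rep_eq uminus_c0fun.rep_eq scaleR_c0fun.rep_eq zero_c0fun.rep_eq
   plus_bcontfun.rep_eq minus_bcontfun.rep_eq uminus_bcontfun.rep_eq scaleR_bcontfun.rep_eq zero_bcontfun.rep_eq scaleR_conv_of_real)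

lemma norm_c0app: "cmod (c0app f x) \<le> norm f"
 unfolding c0app_def norm_c0fun.rep_eq by (rule norm_bounded)

lemma norm_c0_le: "(\<And>x. cmod (c0app f x) \<le> b) \<Longrightarrow> norm f \<le> b"
 unfolding c0app_def norm_c0fun.rep_eq by (rule norm_bound)

lemma norm_c0_Sup: "norm f = (SUP x. cmod (c0app f x))"
proof (rule antisym)
 have bdd: "bdd_above (range (\<lambda>x. cmod (c0app f x)))" by (rule bdd_aboveI2, rule norm_c0app)
 show "norm f \<le> (SUP x. cmod (c0app f x))" by (rule norm_c0_le, rule cSUP_upper[OF UNIV_I bdd])
 show "(SUP x. cmod (c0app f x)) \<le> norm f" by (rule cSUP_least) (auto simp: norm_c0app)
qed

instance c0fun :: (euclidean_space) banach
proof
 fix X :: "nat => 'a c0fun" assume X: "Cauchy X"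
 have d: "dist (Rep_c0fun a) (Rep_c0fun b) = dist a b" for a b :: "'a c0fun"
  by (simp add: dist_norm norm_c0fun.rep_eq minus_c0fun.rep_eq)
 have "Cauchy (\<lambda>n. Rep_c0fun (X n))" using X by (simp add: Cauchy_def d)
 then obtain l where l: "(\<lambda>n. Rep_c0fun (X n)) \<longlonglongrightarrow> l" using Cauchy_convergent convergent_def by blast
 have "(apply_bcontfun l \<longlongrightarrow> 0) at_infinity"
 proof (rule tendstoI)
  fix e :: real assume e: "0 < e"
  obtain n where n: "dist (Rep_c0fun (X n)) l < e / 2"
   using tendstoD[OF l, of "e / 2"] e by (auto simp: eventually_sequentially)
  have "\<forall>\<^sub>F x in at_infinity. dist (apply_bcontfun (Rep_c0fun (X n)) x) 0 < e / 2"
   using tendstoD[of "apply_bcontfun (Rep_c0fun (X n))" 0 at_infinity "e / 2"] Rep_c0fun[of "X n"] e by simp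
  then show "\<forall>\<^sub>F x in at_infinity. dist (apply_bcontfun l x) 0 < e"
  proof eventually_elim
   case (elim x)
   have "dist (apply_bcontfun (Rep_c0fun (X n)) x) (apply_bcontfun l x) < e / 2"
    using dist_bounded[of "Rep_c0fun (X n)" x l] n by linarith
   then show ?case using elim dist_triangle3[of "apply_bcontfun l x" 0 "apply_bcontfun (Rep_c0fun (X n)) x"] by linarith
  qed
 qed
 then have "Rep_c0fun (Abs_c0fun l) = l" by (simp add: Abs_c0fun_inverse)
 then have "X \<longlonglongrightarrow> Abs_c0fun l"
  using l unfolding tendsto_iff d[symmetric] by simp
 then show "convergent X" by (auto simp: convergent_def)
qed

lemma sch_vanishing: "sch f \<Longrightarrow> vanishing f"
 unfolding vanishing_def
proof
 assume f: "sch f"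
 obtain C where C: "0 < C" "\<And>x. norm (f x) \<le> C * dec 1 x" using sch_boundE[OF f] by metis
 have "((\<lambda>x::'a. inverse (1 + norm x)) \<longlongrightarrow> 0) at_infinity"
  by (intro tendsto_inverse_0_at_top filterlim_tendsto_add_at_top[OF tendsto_const] filterlim_norm_at_top)
 then have "((\<lambda>x::'a. C * dec 1 x) \<longlongrightarrow> 0) at_infinity" unfolding dec_def by (auto intro: tendsto_mult_right_zero)
 then show "(f \<longlongrightarrow> 0) at_infinity" by (rule Lim_null_comparison[rotated]) (use C in auto)
qed (rule sch_continuous)

text \<open>Demanded by the algebra structure of \<open>endo\<close>; small multiples of a nonzero
  function supply neighbours of every point.\<close>

instance c0fun :: (euclidean_space) perfect_space
proof
 fix x :: "'a c0fun"
 show "\<not> open {x}"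
 proof
  assume "open {x}"
  then obtain e where e: "0 < e" "ball x e \<subseteq> {x}" by (auto simp: open_contains_ball)
  have "c0app (c0mk gauss) (0 :: 'a) \<noteq> 0"
   by (simp add: c0app_c0mk[OF sch_vanishing[OF sch_gauss]] gauss_def)
  then obtain g :: "'a c0fun" where g: "g \<noteq> 0" using c0app_simps(5) by metis
  define y where "y = x + (e / (2 * norm g)) *\<^sub>R g"
  have "y \<in> ball x e" using e g by (simp add: y_def dist_norm)
  then have "y = x" using e by auto
  then show False using e g by (simp add: y_def)
 qed
qed

lemma vanishing_uniformly_continuous:
 assumes u: "vanishing u" and e: "0 < e"
 obtains d where "0 < d" "\<And>x y. dist x y < d \<Longrightarrow> cmod (u x - u y) < e"
proof -
 obtain r where r: "0 < r" "\<And>x. r \<le> norm x \<Longrightarrow> cmod (u x) < e / 2" using vanishing_small[OF u] e by (metis half_gt_zero)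
 have "uniformly_continuous_on (cball 0 (r + 1)) u"
  using u by (intro compact_uniformly_continuous) (auto simp: vanishing_def intro: continuous_on_subset)
 then obtain d where d: "0 < d" "\<And>x y. norm x \<le> r + 1 \<Longrightarrow> norm y \<le> r + 1 \<Longrightarrow> dist y x < d \<Longrightarrow> dist (u y) (u x) < e"
  using e unfolding uniformly_continuous_on_def by (metis mem_cball_0)
 show ?thesis
 proof (rule that[of "min d 1"])
  fix x y :: 'a assume xy: "dist x y < min d 1"
  show "cmod (u x - u y) < e"
  proof (cases "norm x \<le> r + 1 \<and> norm y \<le> r + 1")
   case True
   then show ?thesis using d(2)[of y x] xy by (simp add: dist_norm)
  next
   case False
   have "norm x \<le> norm y + 1" "norm y \<le> norm x + 1"
    using xy norm_triangle_sub[of x y] norm_triangle_sub[of y x] by (auto simp: dist_norm norm_minus_commute)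
   then have "r \<le> norm x" "r \<le> norm y" using False by linarith+
   then have "cmod (u x) < e / 2" "cmod (u y) < e / 2" using r(2) by blast+
   then show ?thesis using norm_triangle_ineq4[of "u x" "u y"] by linarith
  qed
 qed (use d in auto)
qed

text \<open>Convolution with the reflection of \<open>h\<close>, written so that \<open>x\<close>
  enters through the Schwartz factor only and derivatives fall on it.\<close>

definition smear :: "('a::euclidean_space => complex) => ('a => complex) => 'a => complex" where
 "smear g h x = (\<integral>y. g y * h (y - x))"

lemma smear_integrable:
 assumes g: "g \<in> borel_measurable borel" "\<And>x. cmod (g x) \<le> M" and h: "sch h"
 shows "L1 (\<lambda>y. g y * h (y - x))"
proof (rule Bochner_Integration.integrable_bound)
 have s: "sch (\<lambda>y. h (y - x))" using sch_translate[OF h, of "- x"] by simp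
 show "L1 (\<lambda>y. M * cmod (h (y - x)))"
  by (intro integrable_mult_right integrable_norm sch_integrable s)
 show "(\<lambda>y. g y * h (y - x)) \<in> borel_measurable lborel"
  using g(1) sch_measurable[OF s] by simp
 show "AE y in lborel. cmod (g y * h (y - x)) \<le> norm (M * cmod (h (y - x)))"
  using g(2) by (auto simp: norm_mult abs_mult intro!: AE_I2 mult_right_mono order_trans[OF g(2) abs_ge_self])
qed

lemma integrable_dec_diff: "L1 (\<lambda>y. dec (2 * DIM('a)) (y - x :: 'a::euclidean_space))"
 using integrable_distr[of "(+) (- x)" lborel borel "dec (2 * DIM('a)) :: 'a => real"] integrable_dec[of "2 * DIM('a)", where 'a = 'a]
 by (simp add: lborel_distr_plus)

lemma smear_has_derivative:
 fixes g :: "'a::euclidean_space => complex"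
 assumes g: "g \<in> borel_measurable borel" "\<And>x. cmod (g x) \<le> M" and h: "sch h"
 shows "(smear g h has_derivative (\<lambda>v. smear g (\<lambda>z. - dd v h z) x)) (at x)"
proof -
 have M: "0 \<le> M" using g(2)[of undefined] norm_ge_zero order_trans by blast
 let ?N = "2 * DIM('a)"
 have "\<forall>b. \<exists>C. 0 < C \<and> (\<forall>z. cmod (dd b h z) \<le> C * dec ?N z)" using sch_boundE[OF sch_dd[OF h]] by metis
 then obtain C where C: "\<And>b. 0 < C b" "\<And>b z. cmod (dd b h z) \<le> C b * dec ?N z" by metis
 define K where "K = M * ((\<Sum>b\<in>Basis. C b) * 2 ^ ?N)"
 have "((\<lambda>x. \<integral>y. g y * h (y - x) \<partial>lborel) has_derivative (\<lambda>v. \<integral>y. g y * - dd v h (y - x) \<partial>lborel)) (at x)"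
 proof (rule has_derivative_integral_param[where g = "\<lambda>y. K * dec ?N (y - x)"])
  show "L1 (\<lambda>y. g y * h (y - x'))" for x' by (rule smear_integrable[OF g h])
  fix x' y :: 'a
  have "((\<lambda>x. y - x) has_derivative (\<lambda>v. - v)) (at x')" by (auto intro!: derivative_eq_intros)
  from diff_chain_at[OF this has_derivative_dd[OF sch_differentiable[OF h]]]
  have "((\<lambda>x. h (y - x)) has_derivative (\<lambda>v. dd (- v) h (y - x'))) (at x')" by (simp add: comp_def)
  then have "((\<lambda>x. h (y - x)) has_derivative (\<lambda>v. - dd v h (y - x'))) (at x')"
   using linear_neg[OF bounded_linear.linear[OF has_derivative_bounded_linear[OF has_derivative_dd[OF sch_differentiable[OF h]]]]] by simp
  then show "((\<lambda>x. g y * h (y - x)) has_derivative (\<lambda>v. g y * - dd v h (y - x'))) (at x')"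
   by (rule has_derivative_mult_right)
 next
  fix x' y b :: 'a assume x': "dist x' x \<le> 1" and b: "b \<in> Basis"
  have "dec ?N ((y - x) + (x - x')) * 1 \<le> (1 + norm (x - x')) ^ ?N * dec ?N (y - x)"
   using dec_shift[of ?N "y - x'" "x' - x"] dec_shift[of ?N "y - x" "x - x'"] by simp
  also have "\<dots> \<le> 2 ^ ?N * dec ?N (y - x)"
   using x' by (intro mult_right_mono power_mono) (auto simp: dist_norm norm_minus_commute)
  finally have d: "dec ?N (y - x') \<le> 2 ^ ?N * dec ?N (y - x)" by simp
  have "C b \<le> (\<Sum>b\<in>Basis. C b)" using C(1) b by (intro member_le_sum) (auto intro: less_imp_le)
  have "cmod (g y * - dd b h (y - x')) \<le> M * (C b * dec ?N (y - x'))"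
   using g(2) C(2) M by (simp add: norm_mult mult_mono)
  also have "\<dots> \<le> M * ((\<Sum>b\<in>Basis. C b) * (2 ^ ?N * dec ?N (y - x)))"
   using \<open>C b \<le> _\<close> d M C(1)[of b] by (intro mult_left_mono mult_mono) auto
  finally show "cmod (g y * - dd b h (y - x')) \<le> K * dec ?N (y - x)" by (simp add: K_def mult_ac)
 next
  fix v
  show "(\<lambda>y. g y * - dd v h (y - x)) \<in> borel_measurable lborel"
   using g(1) sch_measurable[OF sch_translate[OF sch_dd[OF h], of v "- x"]] by simp
  show "L1 (\<lambda>y. K * dec ?N (y - x))"
   by (intro integrable_mult_right integrable_dec_diff)
 qed
 then show ?thesis by (simp add: smear_def[abs_def])
qed

lemma sm_smear:
 fixes g :: "'a::euclidean_space => complex"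
 assumes g: "g \<in> borel_measurable borel" "\<And>x. cmod (g x) \<le> M" and h: "sch h"
 shows "sm (\<lambda>_. 1) (smear g h)"
proof (rule sm_coinduct[where X = "{smear g h |h. sch h}"])
 show "smear g h \<in> {smear g h |h. sch h}" using h by blast
 fix f assume "f \<in> {smear g h |h. sch h}"
 then obtain c where c: "sch c" and f: "f = smear g c" by blast
 show "f differentiable at x" for x unfolding f by (rule differentiableI[OF smear_has_derivative[OF g c]])
 have "sch (\<lambda>z. - dd v c z)" for v using sch_cmult[OF sch_dd[OF c], of "-1"] by simp
 moreover have "dd v f = smear g (\<lambda>z. - dd v c z)" for v
  unfolding f by (rule ext, rule dd_eq[OF smear_has_derivative[OF g c]])
 ultimately show "dd v f \<in> {smear g h |h. sch h}" for v by blast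
 have "cmod (f x) \<le> (M * (\<integral>y. cmod (c y))) * 1" for x
 proof -
  have s: "sch (\<lambda>y. c (y - x))" using sch_translate[OF c, of "- x"] by simp
  have "cmod (f x) \<le> (\<integral>y. M * cmod (c (y - x)))"
   unfolding f smear_def
   by (rule integral_norm_bound_integral[OF smear_integrable[OF g c]])
    (auto simp: norm_mult intro!: integrable_mult_right integrable_norm sch_integrable s mult_right_mono g(2))
  also have "\<dots> = M * (\<integral>y. cmod (c y))"
   using integral_translate[of "\<lambda>y. cmod (c y)" "- x"] sch_measurable[OF c] by (simp add: add.commute)
  finally show ?thesis by simp
 qed
 then show "\<exists>C. \<forall>x. cmod (f x) \<le> C * 1" by blast
qed

text \<open>Convolution with a Gaussian of integral 1 at scale \<open>s\<close>. Where the shift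
  exceeds the modulus of continuity \<open>d\<close>, the factor \<open>s * norm z / d\<close>,
  which is at least 1 there, is inserted, so that the first moment \<open>A\<close> controls the
  tail.\<close>

lemma smear_close:
 fixes u :: "'a::euclidean_space => complex"
 assumes u: "vanishing u" and e: "0 < e"
 obtains \<phi> where "sch \<phi>" "\<And>x. cmod (smear u \<phi> x - u x) \<le> e"
proof -
 obtain M where M: "\<And>x. cmod (u x) \<le> M" using vanishing_bounded[OF u] by blast
 have M0: "0 \<le> M" using M[of undefined] norm_ge_zero order_trans by blast
 obtain d where d: "0 < d" "\<And>x y. dist x y < d \<Longrightarrow> cmod (u x - u y) < e / 2"
  using vanishing_uniformly_continuous[OF u] e by (metis half_gt_zero)
 have um: "u \<in> borel_measurable borel" using u by (auto simp: vanishing_def intro: borel_measurable_continuous_onI)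
 define c where "c = (2 * pi) powr (- (DIM('a) / 2))"
 have c: "0 < c" by (simp add: c_def)
 define \<phi> :: "'a => complex" where "\<phi> z = of_real c * gauss z" for z
 have \<phi>: "sch \<phi>" unfolding \<phi>_def by (rule sch_cmult[OF sch_gauss])
 have nphi: "\<phi> z = of_real (cmod (\<phi> z))" for z using c by (simp add: \<phi>_def gauss_def norm_mult)
 have I1: "(\<integral>z. \<phi> z) = 1"
  by (simp add: \<phi>_def integral_gauss c_def powr_minus flip: of_real_mult)
 have "L1 (\<lambda>z. cr (norm z) * \<phi> z)"
  by (rule sch_integrable_poly[OF \<phi>, of _ 1 1]) auto
 then have nint: "L1 (\<lambda>z. norm z * cmod (\<phi> z))"
  using integrable_norm by (fastforce simp: norm_mult)
 define A where "A = (\<integral>z. norm z * cmod (\<phi> z))"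
 have A: "0 \<le> A" by (auto simp: A_def intro!: integral_nonneg)
 \<comment> \<open>Makes \<open>2 * M * s / d * A\<close> at most \<open>e / 2\<close>; the shifts
   by 1 avoid divisions by zero.\<close>
 define s where "s = d * e / (4 * (M + 1) * (A + 1))"
 have s: "0 < s" using d e M0 A by (simp add: s_def)
 define \<theta> :: "'a => complex" where "\<theta> z = of_real (inverse s ^ DIM('a)) * \<phi> (inverse s *\<^sub>R z)" for z
 have \<theta>: "sch \<theta>" unfolding \<theta>_def
  using sch_comp_affine[of "\<lambda>z. inverse s *\<^sub>R z" s \<phi> 0, OF bounded_linear_scaleR_right _ s \<phi>] s
  by (intro sch_cmult) (simp add: mult.assoc[symmetric])
 have "cmod (smear u \<theta> x - u x) \<le> e" for x
 proof -
  have "smear u \<theta> x = (\<integral>y. u (x + y) * \<theta> y)"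
   unfolding smear_def using integral_translate[of "\<lambda>y. u y * \<theta> (y - x)" x] um
    sch_measurable[OF sch_translate[OF \<theta>, of "- x", simplified]] by simp
  also have "\<dots> = of_real (s ^ DIM('a)) * (\<integral>z. u (x + s *\<^sub>R z) * \<theta> (s *\<^sub>R z))"
   using s um sch_measurable[OF \<theta>] by (subst integral_scale[of _ s]) (auto simp: abs_of_pos)
  also have "\<dots> = (\<integral>z. of_real (s ^ DIM('a)) * (u (x + s *\<^sub>R z) * \<theta> (s *\<^sub>R z)))" by simp
  also have "\<dots> = (\<integral>z. u (x + s *\<^sub>R z) * \<phi> z)"
   using s by (intro integral_cong refl) (simp add: \<theta>_def power_inverse)
  finally have 1: "smear u \<theta> x = (\<integral>z. u (x + s *\<^sub>R z) * \<phi> z)" .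
  have i1: "L1 (\<lambda>z. u (x + s *\<^sub>R z) * \<phi> z)"
  proof (rule Bochner_Integration.integrable_bound)
   show "L1 (\<lambda>z. M * cmod (\<phi> z))" by (intro integrable_mult_right integrable_norm sch_integrable \<phi>)
   show "(\<lambda>z. u (x + s *\<^sub>R z) * \<phi> z) \<in> borel_measurable lborel" using um sch_measurable[OF \<phi>] by simp
   show "AE z in lborel. cmod (u (x + s *\<^sub>R z) * \<phi> z) \<le> norm (M * cmod (\<phi> z))"
    using M0 M by (auto simp: norm_mult abs_mult intro!: mult_right_mono)
  qed
  have i2: "L1 (\<lambda>z. u x * \<phi> z)" by (intro integrable_mult_right sch_integrable \<phi>)
  have "smear u \<theta> x - u x = (\<integral>z. u (x + s *\<^sub>R z) * \<phi> z) - (\<integral>z. u x * \<phi> z)"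
   unfolding 1 by (simp add: I1)
  also have "\<dots> = (\<integral>z. u (x + s *\<^sub>R z) * \<phi> z - u x * \<phi> z)"
   by (rule integral_diff[OF i1 i2, symmetric])
  also have "cmod \<dots> \<le> (\<integral>z. (e / 2) * cmod (\<phi> z) + (2 * M * s / d) * (norm z * cmod (\<phi> z)))"
  proof (rule integral_norm_bound_integral)
   show "L1 (\<lambda>z. u (x + s *\<^sub>R z) * \<phi> z - u x * \<phi> z)" using i1 i2 by simp
   show "L1 (\<lambda>z. (e / 2) * cmod (\<phi> z) + (2 * M * s / d) * (norm z * cmod (\<phi> z)))"
    by (intro integrable_add integrable_mult_right integrable_norm sch_integrable \<phi> nint)
   fix z :: 'a
   have "cmod (u (x + s *\<^sub>R z) - u x) \<le> e / 2 + 2 * M * s / d * norm z"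
   proof (cases "norm (s *\<^sub>R z) < d")
    case True
    then have "cmod (u (x + s *\<^sub>R z) - u x) < e / 2" by (intro d(2)) (simp add: dist_norm)
    moreover have "0 \<le> 2 * M * s / d * norm z" using M0 s d by simp
    ultimately show ?thesis by simp
   next
    case False
    then have "1 \<le> s * norm z / d" using s d by simp
    then have "2 * M * 1 \<le> 2 * M * (s * norm z / d)" using M0 by (intro mult_left_mono) auto
    moreover have "cmod (u (x + s *\<^sub>R z) - u x) \<le> 2 * M"
     using norm_triangle_ineq4[of "u (x + s *\<^sub>R z)" "u x"] M[of x] M[of "x + s *\<^sub>R z"] by linarith
    ultimately show ?thesis using e by simp
   qed
   then have "cmod (u (x + s *\<^sub>R z) - u x) * cmod (\<phi> z) \<le> (e / 2 + 2 * M * s / d * norm z) * cmod (\<phi> z)"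
    by (rule mult_right_mono) simp
   then show "cmod (u (x + s *\<^sub>R z) * \<phi> z - u x * \<phi> z) \<le> (e / 2) * cmod (\<phi> z) + (2 * M * s / d) * (norm z * cmod (\<phi> z))"
    by (simp add: norm_mult[symmetric] left_diff_distrib distrib_right)
  qed
  also have "\<dots> = e / 2 * (\<integral>z. cmod (\<phi> z)) + 2 * M * s / d * A"
   unfolding A_def
   by (subst integral_add) (auto intro!: integrable_mult_right integrable_norm sch_integrable \<phi> nint)
  also have "(\<integral>z. cmod (\<phi> z)) = 1"
  proof -
   have "cr (\<integral>z. cmod (\<phi> z)) = (\<integral>z. \<phi> z)"
    unfolding integral_complex_of_real[symmetric] using nphi by simp
   then show ?thesis using I1 by (simp only: of_real_eq_1_iff)
  qed
  also have "2 * M * s / d * A \<le> e / 2"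
  proof -
   have "s / d = e / (4 * (M + 1) * (A + 1))" using d(1) by (simp add: s_def)
   then have "2 * M * s / d * A = 2 * M * (e / (4 * (M + 1) * (A + 1))) * A" by (metis times_divide_eq_right)
   also have "\<dots> = (M / (M + 1)) * (A / (A + 1)) * (e / 2)"
   proof -
    have "2 * M * (e / (4 * a * b)) * A = (M / a) * (A / b) * (e / 2)" for a b :: real by (simp add: mult_ac)
    then show ?thesis .
   qed
   also have "\<dots> \<le> 1 * 1 * (e / 2)" using M0 A e by (intro mult_right_mono mult_mono) auto
   finally show ?thesis by simp
  qed
  finally show ?thesis by simp
 qed
 with \<theta> show ?thesis by (rule that)
qed

text \<open>Mollification bounds all derivatives but gives no rapid decay; a wide Gaussian factor
  supplies it and is close to 1 where \<open>g\<close> is not small.\<close>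

lemma sch_dense:
 fixes g :: "'a::euclidean_space c0fun"
 assumes e: "0 < e"
 shows "\<exists>u. sch u \<and> norm (c0mk u - g) < e"
proof -
 note g = vanishing_c0app[of g]
 obtain M where M: "\<And>x. cmod (c0app g x) \<le> M" using vanishing_bounded[OF g] by blast
 obtain h where h: "sch h" "\<And>x. cmod (smear (c0app g) h x - c0app g x) \<le> e / 4" using smear_close[OF g, of "e / 4"] e by auto
 have gm: "c0app g \<in> borel_measurable borel" using g by (auto simp: vanishing_def intro: borel_measurable_continuous_onI)
 obtain r where r: "0 < r" "\<And>x. r \<le> norm x \<Longrightarrow> cmod (c0app g x) < e / 4" using vanishing_small[OF g, of "e / 4"] e by auto
 have M0: "0 \<le> M" using M[of undefined] norm_ge_zero order_trans by blast
 \<comment> \<open>Then \<open>(\<delta> * r)\<^sup>2 = e / (4 * (M + e))\<close>, and within radius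
   \<open>r\<close> the Gaussian differs from 1 by at most half of that.\<close>
 define \<delta> where "\<delta> = sqrt (e / (4 * (M + e))) / r"
 have \<delta>: "0 < \<delta>" using e M0 r by (simp add: \<delta>_def)
 define u where "u x = smear (c0app g) h x * gauss (\<delta> *\<^sub>R x)" for x
 have u: "sch u" unfolding u_def
 proof (rule sch_mult_1[OF sm_smear[OF gm M h(1)]])
  show "sch (\<lambda>x. gauss (\<delta> *\<^sub>R x) :: complex)"
   using sch_comp_affine[of "\<lambda>z. \<delta> *\<^sub>R z" "inverse \<delta>" gauss 0, OF bounded_linear_scaleR_right _ _ sch_gauss] \<delta>
   by (simp add: mult.assoc[symmetric])
 qed
 have "cmod (u x - c0app g x) \<le> e / 2 + e / 4" for x
 proof -
  define t where "t = exp (- (norm (\<delta> *\<^sub>R x))\<^sup>2 / 2)"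
  have t: "0 \<le> t" "t \<le> 1" by (simp_all add: t_def)
  have g: "gauss (\<delta> *\<^sub>R x) = cr t" by (simp only: t_def gauss_def power2_norm_eq_inner)
  have "u x - c0app g x = (smear (c0app g) h x - c0app g x) * of_real t - of_real (1 - t) * c0app g x"
   by (simp add: u_def g algebra_simps)
  then have "cmod (u x - c0app g x) \<le> cmod (smear (c0app g) h x - c0app g x) * t + (1 - t) * cmod (c0app g x)"
   using norm_triangle_ineq4[of "(smear (c0app g) h x - c0app g x) * of_real t" "of_real (1 - t) * c0app g x"] t
   by (simp add: norm_mult del: of_real_diff)
  also have "\<dots> \<le> e / 4 * 1 + e / 4"
  proof (rule add_mono)
   show "cmod (smear (c0app g) h x - c0app g x) * t \<le> e / 4 * 1" using h(2) t e by (intro mult_mono) auto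
   show "(1 - t) * cmod (c0app g x) \<le> e / 4"
   proof (cases "r \<le> norm x")
    case True
    then have "(1 - t) * cmod (c0app g x) \<le> 1 * (e / 4)" using r(2)[of x] t e by (intro mult_mono) auto
    then show ?thesis by simp
   next
    case False
    have "1 - t \<le> (norm (\<delta> *\<^sub>R x))\<^sup>2 / 2" unfolding t_def using exp_ge_add_one_self[of "- (norm (\<delta> *\<^sub>R x))\<^sup>2 / 2"] by simp
    also have "\<dots> \<le> (\<delta> * r)\<^sup>2 / 2" using False \<delta> by (intro divide_right_mono power_mono) auto
    also have "(\<delta> * r)\<^sup>2 = e / (4 * (M + e))" using r e M0 by (simp add: \<delta>_def)
    finally have "1 - t \<le> e / (4 * (M + e))" using e M0 by (simp add: field_simps)
    then have "(1 - t) * cmod (c0app g x) \<le> e / (4 * (M + e)) * (M + e)"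
     using M[of x] t e M0 by (intro mult_mono) auto
    also have "\<dots> = e / 4" using M0 e by (simp add: field_simps)
    finally show ?thesis .
   qed
  qed
  finally show ?thesis using e by simp
 qed
 then have "norm (c0mk u - g) \<le> e / 2 + e / 4"
  by (intro norm_c0_le) (simp add: c0app_c0mk[OF sch_vanishing[OF u]])
 then show ?thesis using u e by (intro exI[of _ u]) auto
qed

section \<open>The positive maximum principle\<close>

text \<open>A half norm. Contraction for \<open>c\<close> equal to -1, \<i> and -\<i> together says
  that nonnegative functions, which includes being real, are preserved.\<close>

definition pos_part_norm :: "complex => 'a::euclidean_space c0fun => real" where
 "pos_part_norm c g = (SUP x. max 0 (Re (c * c0app g x)))"

lemma pos_part_le_norm:
 assumes "cmod c = 1"
 shows "max 0 (Re (c * c0app g x)) \<le> norm g"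
proof -
 have "Re (c * c0app g x) \<le> cmod (c * c0app g x)" by (rule complex_Re_le_cmod)
 also have "\<dots> \<le> norm g" using assms norm_c0app[of g x] by (simp add: norm_mult)
 finally show ?thesis by simp
qed

lemma pos_part_norm_upper: "cmod c = 1 \<Longrightarrow> max 0 (Re (c * c0app g x)) \<le> pos_part_norm c g"
 unfolding pos_part_norm_def
 by (rule cSUP_upper[OF UNIV_I bdd_aboveI2]) (rule pos_part_le_norm)

lemma pos_part_norm_least: "(\<And>x. Re (c * c0app g x) \<le> b) \<Longrightarrow> 0 \<le> b \<Longrightarrow> pos_part_norm c g \<le> b"
 unfolding pos_part_norm_def by (rule cSUP_least) auto

lemma pos_part_norm_le_norm: "cmod c = 1 \<Longrightarrow> pos_part_norm c g \<le> norm g"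
 using pos_part_le_norm[of c g] by (intro pos_part_norm_least) auto

lemma pos_part_norm_nonneg: "cmod c = 1 \<Longrightarrow> 0 \<le> pos_part_norm c g"
 using pos_part_norm_upper[of c g undefined] by simp

lemma pos_part_norm_add:
 assumes "cmod c = 1"
 shows "pos_part_norm c (f + g) \<le> pos_part_norm c f + pos_part_norm c g"
proof (rule pos_part_norm_least)
 show "Re (c * c0app (f + g) x) \<le> pos_part_norm c f + pos_part_norm c g" for x
  using pos_part_norm_upper[OF assms, of f x] pos_part_norm_upper[OF assms, of g x]
  by (simp add: distrib_left del: times_complex.simps)
qed (use pos_part_norm_nonneg[OF assms] in \<open>auto intro!: add_nonneg_nonneg\<close>)

lemma pos_part_norm_scale_le:
 assumes "cmod d = 1" "0 \<le> c"
 shows "pos_part_norm d (c *\<^sub>R g) \<le> c * pos_part_norm d g"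
proof (rule pos_part_norm_least)
 fix x
 have "Re (d * c0app (c *\<^sub>R g) x) = c * Re (d * c0app g x)" by (simp add: algebra_simps)
 also have "\<dots> \<le> c * pos_part_norm d g"
  using pos_part_norm_upper[OF assms(1), of g x] by (intro mult_left_mono assms) simp
 finally show "Re (d * c0app (c *\<^sub>R g) x) \<le> c * pos_part_norm d g" .
next
 show "0 \<le> c * pos_part_norm d g" by (rule mult_nonneg_nonneg[OF assms(2) pos_part_norm_nonneg[OF assms(1)]])
qed

lemma pos_part_norm_scale:
 assumes "cmod d = 1" "0 \<le> c"
 shows "pos_part_norm d (c *\<^sub>R g) = c * pos_part_norm d g"
proof (cases "c = 0")
 case True
 then show ?thesis using pos_part_norm_scale_le[OF assms, of g] pos_part_norm_nonneg[OF assms(1), of "c *\<^sub>R g"] by simp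
next
 case False
 then have c: "0 < c" using assms(2) by simp
 have "pos_part_norm d ((1 / c) *\<^sub>R (c *\<^sub>R g)) \<le> (1 / c) * pos_part_norm d (c *\<^sub>R g)"
  using c by (intro pos_part_norm_scale_le assms) simp
 then have "c * pos_part_norm d g \<le> pos_part_norm d (c *\<^sub>R g)" using c by (simp add: field_simps)
 then show ?thesis using pos_part_norm_scale_le[OF assms, of g] by simp
qed

lemma vanishing_attains_max:
 assumes u: "vanishing u" and x1: "0 < Re (u x1)"
 obtains x0 where "\<And>x. Re (u x) \<le> Re (u x0)"
proof -
 obtain r where r: "0 < r" "\<And>x. r \<le> norm x \<Longrightarrow> cmod (u x) < Re (u x1)" using vanishing_small[OF u x1] by blast
 have "continuous_on (cball 0 r) (\<lambda>x. Re (u x))"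
  using u by (intro continuous_on_Re) (auto simp: vanishing_def intro: continuous_on_subset)
 then obtain x0 where x0: "x0 \<in> cball 0 r" "\<And>x. norm x \<le> r \<Longrightarrow> Re (u x) \<le> Re (u x0)"
  using continuous_attains_sup[of "cball 0 r" "\<lambda>x. Re (u x)"] r(1) by (auto simp: not_less)
 have x1r: "norm x1 \<le> r"
  using r(2)[of x1] complex_Re_le_cmod[of "u x1"] by (cases "norm x1 \<le> r") auto
 have "Re (u x) \<le> Re (u x0)" for x
 proof (cases "norm x \<le> r")
  case False
  then have "Re (u x) \<le> Re (u x1)" using r(2)[of x] complex_Re_le_cmod[of "u x"] by simp
  then show ?thesis using x0(2)[OF x1r] by simp
 qed (rule x0(2))
 then show ?thesis by (rule that)
qed

text \<open>\<open>Pop\<close> is minus the generator, hence the sign in this positive maximum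
  principle.\<close>

locale feller_pdo = pdo L p k0 \<gamma> lam0 m for L :: "'a::euclidean_space => real" and p k0 \<gamma> lam0 m +
 assumes pmp: "\<And>u x0. sch u \<Longrightarrow> 0 \<le> Re (u x0) \<Longrightarrow> (\<And>x. Re (u x) \<le> Re (u x0)) \<Longrightarrow> 0 \<le> Re (Pop u x0)"
begin

definition dom :: "'a c0fun set" where
 "dom = {g. sch (c0app g)}"

definition Aop :: "'a c0fun => 'a c0fun" where
 "Aop g = c0mk (\<lambda>x. - Pop (c0app g) x)"

definition cscale :: "complex => 'a c0fun => 'a c0fun" where
 "cscale a g = c0mk (\<lambda>x. a * c0app g x)"

lemma vanishing_cmult: "vanishing u \<Longrightarrow> vanishing (\<lambda>x. a * u x)"
 unfolding vanishing_def by (auto intro!: continuous_intros tendsto_mult_right_zero)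

lemma c0app_cscale: "c0app (cscale a g) = (\<lambda>x. a * c0app g x)"
 unfolding cscale_def by (rule c0app_c0mk[OF vanishing_cmult[OF vanishing_c0app]])

lemma c0app_Aop: "g \<in> dom \<Longrightarrow> c0app (Aop g) = (\<lambda>x. - Pop (c0app g) x)"
 unfolding Aop_def dom_def
 using sch_cmult[OF sch_Pop, of "c0app g" "-1"] by (intro c0app_c0mk sch_vanishing) simp

lemma Pop_cmult:
 assumes "sch u"
 shows "Pop (\<lambda>x. c * u x) = (\<lambda>x. c * Pop u x)"
 using Pop_lin[OF assms assms, of "c - 1"] by (simp add: algebra_simps)

lemma c0app_lin: "c0app (g + c *\<^sub>R h) = (\<lambda>x. c0app g x + of_real c * c0app h x)"
 by (rule ext) simp

lemma dom_lin: "g \<in> dom \<Longrightarrow> h \<in> dom \<Longrightarrow> g + c *\<^sub>R h \<in> dom"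
 unfolding dom_def by (simp add: c0app_lin sch_add sch_cmult)

lemma Aop_lin: "g \<in> dom \<Longrightarrow> h \<in> dom \<Longrightarrow> Aop (g + c *\<^sub>R h) = Aop g + c *\<^sub>R Aop h"
proof (rule c0fun_eqI)
 fix x assume g: "g \<in> dom" and h: "h \<in> dom"
 show "c0app (Aop (g + c *\<^sub>R h)) x = c0app (Aop g + c *\<^sub>R Aop h) x"
  using Pop_lin[of "c0app g" "c0app h" "of_real c"] g h
  by (simp add: c0app_Aop dom_lin) (simp add: dom_def c0app_lin)
qed

text \<open>A positive supremum of \<open>Re (c * g)\<close> is attained because \<open>g\<close>
  vanishes at infinity, and at the point of attainment the maximum principle gives the
  estimate.\<close>

lemma pos_part_dissipative:
 assumes c: "cmod c = 1" and u: "g \<in> dom" and lam: "0 < lam"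
 shows "lam * pos_part_norm c g \<le> pos_part_norm c (lam *\<^sub>R g - Aop g)"
proof (cases "\<forall>x. Re (c * c0app g x) \<le> 0")
 case True
 then have "pos_part_norm c g \<le> 0" by (intro pos_part_norm_least) auto
 then have "lam * pos_part_norm c g \<le> 0" using lam by (simp add: mult_le_0_iff)
 then show ?thesis using pos_part_norm_nonneg[OF c, of "lam *\<^sub>R g - Aop g"] by simp
next
 case False
 then obtain x1 where x1: "0 < Re (c * c0app g x1)" by (auto simp: not_le)
 obtain x0 where x0: "\<And>x. Re (c * c0app g x) \<le> Re (c * c0app g x0)"
  using vanishing_attains_max[OF vanishing_cmult[OF vanishing_c0app] x1] by blast
 have s: "sch (c0app g)" using u by (simp add: dom_def)
 have pos: "0 \<le> Re (c * c0app g x0)" using x0[of x1] x1 by linarith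
 have "0 \<le> Re (Pop (\<lambda>x. c * c0app g x) x0)" by (rule pmp[OF sch_cmult[OF s] pos x0])
 then have P: "0 \<le> Re (c * Pop (c0app g) x0)" by (simp only: Pop_cmult[OF s])
 have "pos_part_norm c g \<le> Re (c * c0app g x0)" by (intro pos_part_norm_least x0 pos)
 then have "lam * pos_part_norm c g \<le> lam * Re (c * c0app g x0)" using lam by simp
 also have "\<dots> \<le> lam * Re (c * c0app g x0) + Re (c * Pop (c0app g) x0)" using P by simp
 also have "\<dots> = Re (c * c0app (lam *\<^sub>R g - Aop g) x0)" by (simp add: c0app_Aop[OF u] algebra_simps)
 also have "\<dots> \<le> pos_part_norm c (lam *\<^sub>R g - Aop g)" using pos_part_norm_upper[OF c, of "lam *\<^sub>R g - Aop g" x0] by simp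
 finally show ?thesis .
qed

text \<open>At each point the modulus is bounded by the half norm for the phase \<theta> that
  rotates the value to the positive axis.\<close>

lemma norm_dissipative:
 assumes u: "g \<in> dom" and lam: "0 < lam"
 shows "lam * norm g \<le> norm (lam *\<^sub>R g - Aop g)"
proof -
 have "cmod (c0app g x) \<le> norm (lam *\<^sub>R g - Aop g) / lam" for x
 proof (cases "c0app g x = 0")
  case True then show ?thesis using lam by simp
 next
  case False
  define \<theta> where "\<theta> = cnj (c0app g x) / of_real (cmod (c0app g x))"
  have \<theta>: "cmod \<theta> = 1" using False by (simp add: \<theta>_def norm_divide)
  have "\<theta> * c0app g x = of_real (cmod (c0app g x))"
   using False complex_norm_square[of "c0app g x"] by (simp add: \<theta>_def field_simps power2_eq_square)
  then have "cmod (c0app g x) \<le> pos_part_norm \<theta> g" using pos_part_norm_upper[OF \<theta>, of g x] by simp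
  then have "lam * cmod (c0app g x) \<le> lam * pos_part_norm \<theta> g" using lam by simp
  also have "\<dots> \<le> pos_part_norm \<theta> (lam *\<^sub>R g - Aop g)" by (rule pos_part_dissipative[OF \<theta> u lam])
  also have "\<dots> \<le> norm (lam *\<^sub>R g - Aop g)" by (rule pos_part_norm_le_norm[OF \<theta>])
  finally show ?thesis using lam by (simp add: field_simps)
 qed
 then have "norm g \<le> norm (lam *\<^sub>R g - Aop g) / lam" by (rule norm_c0_le)
 then show ?thesis using lam by (simp add: field_simps)
qed

lemma bounded_linear_cscale: "bounded_linear (cscale a)"
proof (rule bounded_linear_intro[where K = "cmod a"])
 show "cscale a (x + y) = cscale a x + cscale a y" for x y by (rule c0fun_eqI) (simp add: c0app_cscale distrib_left)
 show "cscale a (r *\<^sub>R x) = r *\<^sub>R cscale a x" for r x by (rule c0fun_eqI) (simp add: c0app_cscale)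
 show "norm (cscale a x) \<le> norm x * cmod a" for x
  by (rule norm_c0_le) (simp add: c0app_cscale norm_mult norm_c0app mult.commute[of "norm x"] mult_left_mono)
qed

lemma semigroup:
 obtains T :: "real => 'a c0fun => 'a c0fun"
 where "\<And>t f g. 0 \<le> t \<Longrightarrow> T t (f + g) = T t f + T t g"
  and "\<And>t a f. 0 \<le> t \<Longrightarrow> T t (cscale a f) = cscale a (T t f)"
  and "\<And>f. T 0 f = f"
  and "\<And>s t f. 0 \<le> s \<Longrightarrow> 0 \<le> t \<Longrightarrow> T (s + t) f = T s (T t f)"
  and "\<And>f. ((\<lambda>t. norm (T t f - f)) \<longlongrightarrow> 0) (at_right 0)"
  and "\<And>t f. 0 \<le> t \<Longrightarrow> norm (T t f) \<le> norm f"
  and "\<And>t k f. 0 \<le> t \<Longrightarrow> cmod k = 1 \<Longrightarrow> pos_part_norm k (T t f) \<le> pos_part_norm k f"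
  and "\<And>f. f \<in> dom \<Longrightarrow> ((\<lambda>t. norm ((1 / t) *\<^sub>R (T t f - f) - Aop f)) \<longlongrightarrow> 0) (at_right 0)"
proof -
 obtain lam1 where lam1: "\<And>lam g e. lam1 \<le> lam \<Longrightarrow> sch g \<Longrightarrow> 0 < e \<Longrightarrow> \<exists>u. sch u \<and> (\<forall>x. cmod (Tlam lam u x - g x) \<le> e)"
  using range_dense by blast
 interpret gen: generation dom Aop "max lam1 1" "insert norm (pos_part_norm ` {k. cmod k = 1})" "range cscale"
 proof (rule generation.intro)
  show "u + c *\<^sub>R v \<in> dom" if "u \<in> dom" "v \<in> dom" for u v c using that by (rule dom_lin)
  show "dom \<noteq> {}" proof -
   have "c0mk gauss \<in> dom" by (simp add: dom_def c0app_c0mk[OF sch_vanishing[OF sch_gauss]] sch_gauss)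
   then show ?thesis by blast
  qed
  show "Aop (u + c *\<^sub>R v) = Aop u + c *\<^sub>R Aop v" if "u \<in> dom" "v \<in> dom" for u v c using that by (rule Aop_lin)
  show dense: "\<exists>u\<in>dom. norm (u - g) < e" if e: "0 < e" for g e
  proof -
   obtain u where "sch u" "norm (c0mk u - g) < e" using sch_dense[OF e] by blast
   then show ?thesis by (intro bexI[of _ "c0mk u"]) (simp_all add: dom_def c0app_c0mk sch_vanishing)
  qed
  show "0 < max lam1 1" by simp
  show "\<exists>u\<in>dom. norm (lam *\<^sub>R u - Aop u - g) < e" if lam: "max lam1 1 \<le> lam" and e: "0 < e" for lam g e
  proof -
   \<comment> \<open>\<open>range_dense\<close> treats Schwartz right-hand sides, so
     \<open>g\<close> is first approximated by one.\<close>
   obtain h where h: "h \<in> dom" "norm (h - g) < e / 2" using dense[of "e / 2"] e by auto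
   obtain u where u: "sch u" "\<And>x. cmod (Tlam lam u x - c0app h x) \<le> e / 2"
    using lam1[of lam "c0app h" "e / 2"] lam e h(1) by (auto simp: dom_def)
   have d: "c0mk u \<in> dom" and a: "c0app (c0mk u) = u" using u(1) by (simp_all add: dom_def c0app_c0mk sch_vanishing)
   have "norm (lam *\<^sub>R c0mk u - Aop (c0mk u) - h) \<le> e / 2"
    by (rule norm_c0_le) (use u(2) in \<open>simp add: c0app_Aop[OF d] a Tlam_def add.commute\<close>)
   moreover have "norm (lam *\<^sub>R c0mk u - Aop (c0mk u) - g) \<le> norm (lam *\<^sub>R c0mk u - Aop (c0mk u) - h) + norm (h - g)"
    using norm_triangle_ineq[of "lam *\<^sub>R c0mk u - Aop (c0mk u) - h" "h - g"] by simp
   ultimately show ?thesis using d h(2) by (intro bexI[of _ "c0mk u"]) auto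
  qed
  fix N :: "'a c0fun => real" assume "N \<in> insert norm (pos_part_norm ` {k. cmod k = 1})"
  then consider "N = norm" | k where "cmod k = 1" "N = pos_part_norm k" by blast
  note N = this
  show "N (a + b) \<le> N a + N b" for a b using N by cases (auto simp: norm_triangle_ineq pos_part_norm_add)
  show "N (c *\<^sub>R a) = c * N a" if "0 \<le> c" for a c using N that by cases (auto simp: pos_part_norm_scale)
  show "N a \<le> norm a" for a using N by cases (auto simp: pos_part_norm_le_norm)
  show "lam * N u \<le> N (lam *\<^sub>R u - Aop u)" if "u \<in> dom" "0 < lam" for u lam
   using N that by cases (auto simp: norm_dissipative pos_part_dissipative)
 next
  show "norm \<in> insert norm (pos_part_norm ` {k. cmod k = 1})" by simp
  fix J :: "'a c0fun => 'a c0fun" assume "J \<in> range cscale"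
  then obtain a where J: "J = cscale a" by blast
  show "bounded_linear J" unfolding J by (rule bounded_linear_cscale)
  fix u assume u: "u \<in> dom"
  have d: "cscale a u \<in> dom" using u by (simp add: dom_def c0app_cscale sch_cmult)
  have "Aop (cscale a u) = cscale a (Aop u)"
   by (rule c0fun_eqI) (use u in \<open>simp add: c0app_Aop[OF u] c0app_Aop[OF d] c0app_cscale Pop_cmult dom_def\<close>)
  then show "J u \<in> dom \<and> Aop (J u) = J (Aop u)" using d by (simp add: J)
 qed
 show thesis
 proof (rule that)
  show "gen.T t (f + g) = gen.T t f + gen.T t g" if "0 \<le> t" for t f g using gen.T_lin[OF that, of f 1 g] by simp
  show "gen.T t (cscale a f) = cscale a (gen.T t f)" if "0 \<le> t" for t a f using gen.T_J[OF that, of "cscale a"] by simp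
  show "gen.T 0 f = f" for f by (rule gen.T_0)
  show "gen.T (s + t) f = gen.T s (gen.T t f)" if "0 \<le> s" "0 \<le> t" for s t f using gen.T_add[OF that] .
  show "((\<lambda>t. norm (gen.T t f - f)) \<longlongrightarrow> 0) (at_right 0)" for f by (rule gen.T_continuous)
  show "norm (gen.T t f) \<le> norm f" if "0 \<le> t" for t f using gen.T_N[OF that, of norm] by simp
  show "pos_part_norm k (gen.T t f) \<le> pos_part_norm k f" if "0 \<le> t" "cmod k = 1" for t k f
   using gen.T_N[OF that(1), of "pos_part_norm k"] that(2) by simp
  show "((\<lambda>t. norm ((1 / t) *\<^sub>R (gen.T t f - f) - Aop f)) \<longlongrightarrow> 0) (at_right 0)" if "f \<in> dom" for f
   by (rule gen.T_generator[OF that])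
 qed
qed

end

section \<open>Sub-Markovian Fourier multipliers\<close>

definition syn :: "('a::euclidean_space => complex) => 'a => complex" where
 "syn h x = (\<integral>w. ee x w * h w)"

text \<open>In place of a representing measure of mass at most 1, the maximum property of the
  Fourier multiplier is taken as definition. It is stable under products, pointwise limits and
  mixtures, and these lead from translations to exp(-t Q).\<close>

definition submarkov :: "('a::euclidean_space => complex) => bool" where
 "submarkov m \<longleftrightarrow> m \<in> borel_measurable borel \<and> (\<forall>w. cmod (m w) \<le> 1) \<and>
  (\<forall>h M. integrable lborel h \<longrightarrow> 0 \<le> M \<longrightarrow> (\<forall>x. Re (syn h x) \<le> M) \<longrightarrow> (\<forall>x. Re (syn (\<lambda>w. m w * h w) x) \<le> M))"

lemma submarkovI:
 assumes "m \<in> borel_measurable borel" "\<And>w. cmod (m w) \<le> 1"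
  and "\<And>h M x. integrable lborel h \<Longrightarrow> 0 \<le> M \<Longrightarrow> (\<And>x. Re (syn h x) \<le> M) \<Longrightarrow> Re (syn (\<lambda>w. m w * h w) x) \<le> M"
 shows "submarkov m"
 using assms unfolding submarkov_def by blast

lemma submarkov_measurable: "submarkov m \<Longrightarrow> m \<in> borel_measurable borel"
 and submarkov_norm: "submarkov m \<Longrightarrow> cmod (m w) \<le> 1"
 and submarkovD: "submarkov m \<Longrightarrow> integrable lborel h \<Longrightarrow> 0 \<le> M \<Longrightarrow> (\<And>x. Re (syn h x) \<le> M) \<Longrightarrow> Re (syn (\<lambda>w. m w * h w) x) \<le> M"
 unfolding submarkov_def by blast+

lemma cis_measurable [measurable]: "(\<lambda>w::'a::euclidean_space. ee x w) \<in> borel_measurable borel"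
 by (intro borel_measurable_continuous_onI continuous_intros)

lemma integrable_bounded_mult:
 fixes h :: "'a::euclidean_space => complex"
 assumes h: "L1 h" and m: "m \<in> borel_measurable borel" "\<And>w. cmod (m w) \<le> C"
 shows "L1 (\<lambda>w. m w * h w)"
proof (rule Bochner_Integration.integrable_bound)
 show "L1 (\<lambda>w. C * cmod (h w))" using h by simp
 show "(\<lambda>w. m w * h w) \<in> borel_measurable lborel" using h m by simp
 show "AE w in lborel. cmod (m w * h w) \<le> norm (C * cmod (h w))"
  using order_trans[OF m(2) abs_ge_self] by (auto simp: norm_mult abs_mult intro!: mult_right_mono)
qed

lemma syn_integrable: "L1 h \<Longrightarrow> L1 (\<lambda>w::'a::euclidean_space. ee x w * h w)"
 by (rule integrable_bounded_mult[where C = 1]) auto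

lemma submarkov_integrable: "submarkov m \<Longrightarrow> integrable lborel h \<Longrightarrow> L1 (\<lambda>w. m w * h w)"
 by (rule integrable_bounded_mult[OF _ submarkov_measurable submarkov_norm])

lemma syn_add: "L1 g \<Longrightarrow> integrable lborel h \<Longrightarrow> syn (\<lambda>w. g w + h w) x = syn g x + syn h x"
 unfolding syn_def by (simp add: distrib_left syn_integrable)

lemma syn_cmult: "syn (\<lambda>w. c * h w) x = c * syn h x"
proof -
 have "syn (\<lambda>w. c * h w) x = (\<integral>w. c * (ee x w * h w))" unfolding syn_def by (simp add: mult_ac)
 then show ?thesis by (simp add: syn_def)
qed

lemma syn_tendsto:
 fixes h :: "'a::euclidean_space => complex"
 assumes w: "L1 w" and m: "\<And>n. h' n \<in> borel_measurable borel" and h: "h \<in> borel_measurable borel"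
  and lim: "\<And>k. (\<lambda>n. h' n k) \<longlonglongrightarrow> h k" and bd: "\<And>n k. cmod (h' n k) \<le> w k"
 shows "(\<lambda>n. syn (h' n) x) \<longlonglongrightarrow> syn h x"
 unfolding syn_def
proof (rule integral_dominated_convergence[OF _ _ w])
 show "(\<lambda>k. ee x k * h k) \<in> borel_measurable lborel" using h by simp
 show "(\<lambda>k. ee x k * h' n k) \<in> borel_measurable lborel" for n using m by simp
 show "AE k in lborel. (\<lambda>n. ee x k * h' n k) \<longlonglongrightarrow> ee x k * h k"
  by (intro AE_I2 tendsto_mult_left lim)
 show "AE k in lborel. cmod (ee x k * h' n k) \<le> w k" for n
  by (intro AE_I2) (simp add: norm_mult bd)
qed

lemma submarkov_translation: "submarkov (\<lambda>w. ee y w)"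
proof (rule submarkovI)
 fix h :: "'a => complex" and M x assume h: "\<And>x. Re (syn h x) \<le> M"
 have "syn (\<lambda>w. ee y w * h w) x = syn h (x + y)"
  unfolding syn_def by (intro integral_cong refl) (simp add: inner_add_left distrib_left exp_add)
 then show "Re (syn (\<lambda>w. ee y w * h w) x) \<le> M" using h by simp
qed auto

lemma submarkov_const:
 assumes "0 \<le> c" "c \<le> 1"
 shows "submarkov (\<lambda>w. cr c)"
proof (rule submarkovI)
 fix h :: "'a => complex" and M x assume M: "0 \<le> M" and h: "\<And>x. Re (syn h x) \<le> M"
 have "c * Re (syn h x) \<le> c * M" using h assms by (intro mult_left_mono) auto
 also have "\<dots> \<le> M" using assms M by (simp add: mult_left_le_one_le)
 finally show "Re (syn (\<lambda>w. cr c * h w) x) \<le> M" by (simp add: syn_cmult)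
qed (use assms in auto)

lemma submarkov_mult:
 assumes "submarkov m" "submarkov n"
 shows "submarkov (\<lambda>w. m w * n w)"
proof (rule submarkovI)
 show "(\<lambda>w. m w * n w) \<in> borel_measurable borel" using assms[THEN submarkov_measurable] by simp
 show "cmod (m w * n w) \<le> 1" for w
  using assms[THEN submarkov_norm, of w] by (simp add: norm_mult mult_le_one)
 fix h :: "'a => complex" and M x assume h: "L1 h" and M: "0 \<le> M" "\<And>x. Re (syn h x) \<le> M"
 show "Re (syn (\<lambda>w. m w * n w * h w) x) \<le> M"
  unfolding mult.assoc
  by (rule submarkovD[OF assms(1) submarkov_integrable[OF assms(2) h] M(1) submarkovD[OF assms(2) h M]])
qed

lemma submarkov_power: "submarkov m \<Longrightarrow> submarkov (\<lambda>w. m w ^ k)"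
 by (induction k) (use submarkov_const[of 1] in \<open>auto intro: submarkov_mult\<close>)

lemma submarkov_limit:
 assumes s: "\<And>n. submarkov (\<mu> n)" and lim: "\<And>w. (\<lambda>n. \<mu> n w) \<longlonglongrightarrow> \<nu> w"
 shows "submarkov \<nu>"
proof (rule submarkovI)
 show m: "\<nu> \<in> borel_measurable borel" by (rule borel_measurable_LIMSEQ_metric[OF submarkov_measurable[OF s] lim])
 show "cmod (\<nu> w) \<le> 1" for w
  by (rule LIMSEQ_le_const2[OF tendsto_norm[OF lim]]) (use submarkov_norm[OF s] in auto)
 fix h :: "'a => complex" and M x assume h: "L1 h" and M: "0 \<le> M" "\<And>x. Re (syn h x) \<le> M"
 have "(\<lambda>n. syn (\<lambda>w. \<mu> n w * h w) x) \<longlonglongrightarrow> syn (\<lambda>w. \<nu> w * h w) x"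
 proof (rule syn_tendsto[OF integrable_norm[OF h]])
  show "(\<lambda>w. \<mu> n w * h w) \<in> borel_measurable borel" for n using submarkov_measurable[OF s] h by auto
  show "(\<lambda>w. \<nu> w * h w) \<in> borel_measurable borel" using m h by auto
  show "(\<lambda>n. \<mu> n w * h w) \<longlonglongrightarrow> \<nu> w * h w" for w by (intro tendsto_intros lim)
  show "cmod (\<mu> n w * h w) \<le> cmod (h w)" for n w
   using mult_right_mono[OF submarkov_norm[OF s, of n w], of "cmod (h w)"] by (simp add: norm_mult)
 qed
 from tendsto_Re[OF this] show "Re (syn (\<lambda>w. \<nu> w * h w) x) \<le> M"
  by (rule LIMSEQ_le_const2) (use submarkovD[OF s h M] in blast)
qed

text \<open>Fubini's theorem takes the average over \<open>y\<close> out of the synthesis; an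
  average with mass at most 1 respects the bound \<open>M\<close> because \<open>M\<close> is
  nonnegative.\<close>

lemma submarkov_mixture:
 fixes \<mu> :: "'b => 'a::euclidean_space => complex"
 assumes N: "finite_measure N" "measure N (space N) \<le> 1" and s: "\<And>y. submarkov (\<mu> y)"
  and m: "(\<lambda>(y, w). \<mu> y w) \<in> borel_measurable (N \<Otimes>\<^sub>M lborel)"
 shows "submarkov (\<lambda>w. \<integral>y. \<mu> y w \<partial>N)"
proof -
 interpret N: finite_measure N by (rule N)
 interpret P: pair_sigma_finite N "lborel :: 'a measure" by unfold_locales
 have m': "(\<lambda>(w, y). \<mu> y w) \<in> borel_measurable (lborel \<Otimes>\<^sub>M N)"
  using m measurable_pair_swap_iff[of "\<lambda>(w, y). \<mu> y w" lborel N borel] by (simp add: case_prod_beta)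
 show ?thesis
 proof (rule submarkovI)
  show "(\<lambda>w. \<integral>y. \<mu> y w \<partial>N) \<in> borel_measurable borel"
   using N.borel_measurable_lebesgue_integral[OF m'] by simp
  show "cmod (\<integral>y. \<mu> y w \<partial>N) \<le> 1" for w
  proof -
   have "cmod (\<integral>y. \<mu> y w \<partial>N) \<le> (\<integral>y. cmod (\<mu> y w) \<partial>N)" by (rule integral_norm_bound)
   also have "\<dots> \<le> (\<integral>y. 1 \<partial>N)" by (rule integral_mono_AE') (auto simp: submarkov_norm[OF s])
   finally show ?thesis using N(2) by simp
  qed
  fix h :: "'a => complex" and M x assume h: "L1 h" and M: "0 \<le> M" "\<And>x. Re (syn h x) \<le> M"
  define f where "f = (\<lambda>(y, w). \<mu> y w * (ee x w * h w))"
  have hm: "h \<in> borel_measurable lborel" using h by (rule borel_measurable_integrable)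
  have fm: "f \<in> borel_measurable (N \<Otimes>\<^sub>M lborel)"
  proof -
   have "(\<lambda>z. ee x (snd z) * h (snd z)) \<in> borel_measurable (N \<Otimes>\<^sub>M lborel)"
    using measurable_compose[OF measurable_snd hm] measurable_compose[OF measurable_snd, of "\<lambda>w. ee x w" lborel borel N]
    by (intro borel_measurable_times) auto
   then show ?thesis using m unfolding f_def by (simp add: case_prod_beta borel_measurable_times)
  qed
  have fi: "integrable (N \<Otimes>\<^sub>M lborel) f"
  proof (rule P.Fubini_integrable[OF fm])
   show "AE y in N. L1 (\<lambda>w. f (y, w))"
    unfolding f_def using submarkov_integrable[OF s syn_integrable[OF h]] by auto
   show "integrable N (\<lambda>y. \<integral>w. cmod (f (y, w)) \<partial>lborel)"
   proof (rule N.integrable_const_bound)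
    show "AE y in N. norm (\<integral>w. cmod (f (y, w))) \<le> (\<integral>w. cmod (h w))"
    proof (rule AE_I2)
     fix y
     have "(\<integral>w. cmod (f (y, w))) \<le> (\<integral>w. cmod (h w))"
     proof (rule integral_mono_AE')
      show "AE w in lborel. cmod (f (y, w)) \<le> cmod (h w)"
       using mult_right_mono[OF submarkov_norm[OF s, of y], of "cmod (h _)"] by (auto simp: f_def norm_mult)
     qed (use h in auto)
     then show "norm (\<integral>w. cmod (f (y, w))) \<le> (\<integral>w. cmod (h w))" by simp
    qed
    show "(\<lambda>y. \<integral>w. cmod (f (y, w)) \<partial>lborel) \<in> borel_measurable N"
     using fm by measurable
   qed
  qed
  have "syn (\<lambda>w. (\<integral>y. \<mu> y w \<partial>N) * h w) x = (\<integral>w. (\<integral>y. f (y, w) \<partial>N))"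
   unfolding syn_def f_def by (simp add: mult.left_commute)
  also have "\<dots> = (\<integral>y. (\<integral>w. f (y, w)) \<partial>N)"
   using P.Fubini_integral[of "\<lambda>y w. f (y, w)"] fi by simp
  also have "\<dots> = (\<integral>y. syn (\<lambda>w. \<mu> y w * h w) x \<partial>N)"
   unfolding syn_def f_def by (simp add: mult.left_commute)
  finally have e: "syn (\<lambda>w. (\<integral>y. \<mu> y w \<partial>N) * h w) x = (\<integral>y. syn (\<lambda>w. \<mu> y w * h w) x \<partial>N)" .
  have si: "integrable N (\<lambda>y. syn (\<lambda>w. \<mu> y w * h w) x)"
   using P.integrable_fst'[OF fi] unfolding syn_def f_def by (simp add: mult.left_commute)
  have "Re (\<integral>y. syn (\<lambda>w. \<mu> y w * h w) x \<partial>N) = (\<integral>y. Re (syn (\<lambda>w. \<mu> y w * h w) x) \<partial>N)"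
   using si by simp
  also have "\<dots> \<le> (\<integral>y. M \<partial>N)"
   using si by (intro Bochner_Integration.integral_mono) (auto intro: submarkovD[OF s h M])
  also have "\<dots> \<le> M" using N(2) M(1) by (simp add: mult_left_le_one_le)
  finally show "Re (syn (\<lambda>w. (\<integral>y. \<mu> y w \<partial>N) * h w) x) \<le> M" unfolding e .
 qed
qed

text \<open>The compound Poisson construction: exp(-t (1 - m)) mixes the powers of \<open>m\<close>
  with the Poisson weights \<open>a k\<close>, whose sum is 1.\<close>

lemma submarkov_exp:
 assumes s: "submarkov m" and t: "0 \<le> t"
 shows "submarkov (\<lambda>w. exp (- (of_real t * (1 - m w))))"
proof (rule submarkov_limit)
 define a where "a k = exp (- t) * t ^ k / fact k" for k :: nat
 have a: "0 \<le> a k" for k using t by (simp add: a_def)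
 have as: "a sums (exp (- t) * exp t)"
  unfolding a_def using sums_mult[OF exp_converges[of t], of "exp (- t)"] by (simp add: field_simps)
 then have a1: "a sums 1" by (simp add: exp_minus)
 have aK: "(\<Sum>k<n. a k) \<le> 1" for n using sum_le_suminf[OF sums_summable[OF a1], of "{..<n}"] a sums_unique[OF a1] by simp
 show "submarkov (\<lambda>w. \<Sum>k<n. of_real (a k) * m w ^ k)" for n
 proof (rule submarkovI)
  show "(\<lambda>w. \<Sum>k<n. of_real (a k) * m w ^ k) \<in> borel_measurable borel" using submarkov_measurable[OF s] by simp
  show "cmod (\<Sum>k<n. of_real (a k) * m w ^ k) \<le> 1" for w
  proof -
   have "cmod (\<Sum>k<n. of_real (a k) * m w ^ k) \<le> (\<Sum>k<n. a k)"
    using a submarkov_norm[OF submarkov_power[OF s], of w]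
    by (intro sum_norm_le) (simp add: norm_mult norm_power mult_left_le)
   then show ?thesis using aK[of n] by linarith
  qed
  fix h :: "'a => complex" and M x assume h: "L1 h" and M: "0 \<le> M" "\<And>x. Re (syn h x) \<le> M"
  have "Re (syn (\<lambda>w. (\<Sum>k<n. of_real (a k) * m w ^ k) * h w) x) \<le> (\<Sum>k<n. a k) * M \<and> L1 (\<lambda>w. (\<Sum>k<n. of_real (a k) * m w ^ k) * h w)"
  proof (induction n)
   case 0 show ?case by (simp add: syn_def)
  next
   case (Suc n)
   have i: "L1 (\<lambda>w. of_real (a n) * (m w ^ n * h w))"
    by (intro integrable_mult_right submarkov_integrable[OF submarkov_power[OF s] h])
   have "Re (syn (\<lambda>w. m w ^ n * h w) x) \<le> M" by (rule submarkovD[OF submarkov_power[OF s] h M])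
   then have "a n * Re (syn (\<lambda>w. m w ^ n * h w) x) \<le> a n * M" using a by (intro mult_left_mono) auto
   then have "Re (syn (\<lambda>w. of_real (a n) * (m w ^ n * h w)) x) \<le> a n * M" by (simp add: syn_cmult)
   then show ?case using Suc i by (simp add: distrib_right syn_add mult.assoc)
  qed
  moreover have "(\<Sum>k<n. a k) * M \<le> M" using aK[of n] M(1) a by (simp add: mult_left_le_one_le sum_nonneg)
  ultimately show "Re (syn (\<lambda>w. (\<Sum>k<n. of_real (a k) * m w ^ k) * h w) x) \<le> M" by linarith
 qed
 fix w
 have "(\<lambda>k. exp (- of_real t) * ((of_real t * m w) ^ k /\<^sub>R fact k)) sums (exp (- of_real t) * exp (of_real t * m w))"
  by (intro sums_mult exp_converges)
 also have "exp (- of_real t) * exp (of_real t * m w) = exp (- (of_real t * (1 - m w)))"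
  by (simp add: exp_add[symmetric] algebra_simps)
 also have "(\<lambda>k. exp (- of_real t) * ((of_real t * m w) ^ k /\<^sub>R fact k)) = (\<lambda>k. of_real (a k) * m w ^ k)"
  by (rule ext) (simp add: a_def power_mult_distrib scaleR_conv_of_real exp_of_real[symmetric] field_simps)
 finally show "(\<lambda>n. \<Sum>k<n. of_real (a k) * m w ^ k) \<longlonglongrightarrow> exp (- (of_real t * (1 - m w)))" by (simp add: sums_def)
qed

lemma submarkov_cos: "submarkov (\<lambda>w. of_real (cos (y \<bullet> w)))"
proof (rule submarkovI)
 show "(\<lambda>w. cr (cos (y \<bullet> w))) \<in> borel_measurable borel" by (intro borel_measurable_continuous_onI continuous_intros)
 show "cmod (cr (cos (y \<bullet> w))) \<le> 1" for w by simp
 fix h :: "'a => complex" and M x assume h: "L1 h" and M: "0 \<le> M" "\<And>x. Re (syn h x) \<le> M"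
 have c: "cr (cos (y \<bullet> w)) = (1 / 2) * ee y w + (1 / 2) * ee (- y) w" for w
  by (simp add: cos_of_real[symmetric] cos_exp_eq field_simps)
 have e: "syn (\<lambda>w. cr (cos (y \<bullet> w)) * h w) x
   = (1 / 2) * syn (\<lambda>w. ee y w * h w) x + (1 / 2) * syn (\<lambda>w. ee (- y) w * h w) x"
  unfolding c distrib_right mult.assoc
  by (subst syn_add) (simp_all only: syn_cmult integrable_mult_right syn_integrable h)
 have "Re (syn (\<lambda>w. ee y w * h w) x) \<le> M" "Re (syn (\<lambda>w. ee (- y) w * h w) x) \<le> M"
  by (rule submarkovD[OF submarkov_translation h M])+
 then show "Re (syn (\<lambda>w. cr (cos (y \<bullet> w)) * h w) x) \<le> M" unfolding e by simp
qed

text \<open>2 t n^2 (1 - cos (s / n)) tends to t s^2: the Gaussian is a limit of symmetric compound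
  Poisson laws.\<close>

lemma submarkov_square:
 assumes t: "0 \<le> t"
 shows "submarkov (\<lambda>w. of_real (exp (- (t * (y \<bullet> w)\<^sup>2))))"
proof (rule submarkov_limit)
 have r: "submarkov (\<lambda>w. of_real (exp (- (s * (1 - cos (y \<bullet> w))))))" if "0 \<le> s" for s and y :: 'a
  using submarkov_exp[OF submarkov_cos[of y] that] by (simp add: exp_of_real[symmetric])
 show "submarkov (\<lambda>w. of_real (exp (- (2 * t * (real n)\<^sup>2 * (1 - cos ((inverse (real n) *\<^sub>R y) \<bullet> w))))))" for n
  using t by (intro r) simp
 fix w
 have "((\<lambda>n. 2 * t * (real n)\<^sup>2 * (1 - cos (inverse (real n) * s))) \<longlonglongrightarrow> t * s\<^sup>2)" for s :: real
 proof -
  have "((\<lambda>n. 2 * t * (real n)\<^sup>2 * (1 - cos (inverse (real n) * s))) \<longlonglongrightarrow> t * (s * s))" by real_asymp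
  then show ?thesis by (simp add: power2_eq_square)
 qed
 from this[of "y \<bullet> w"] show "(\<lambda>n. cr (exp (- (2 * t * (real n)\<^sup>2 * (1 - cos ((inverse (real n) *\<^sub>R y) \<bullet> w)))))) \<longlonglongrightarrow> of_real (exp (- (t * (y \<bullet> w)\<^sup>2)))"
  unfolding inner_scaleR_left by (intro tendsto_of_real tendsto_exp tendsto_minus)
qed

text \<open>Completing the square along a basis vector \<open>e\<close> with
  \<open>b e e > 0\<close> splits off the square of a linear form and leaves a positive semidefinite
  form with \<open>e\<close> in its kernel; induction on the number of basis vectors outside the
  kernel.\<close>

lemma submarkov_quadratic:
 fixes b :: "'a::euclidean_space => 'a => real"
 assumes "bilinear b" "\<And>x y. b x y = b y x" "\<And>x. 0 \<le> b x x" and t: "0 \<le> t"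
 shows "submarkov (\<lambda>w. of_real (exp (- (t * b w w))))"
 using assms(1-3)
proof (induction "card {e\<in>Basis. \<exists>y. b e y \<noteq> 0}" arbitrary: b rule: less_induct)
 case (less b)
 note bl = less.prems(1) and sym = less.prems(2) and psd = less.prems(3)
 have fin: "finite {e\<in>Basis. \<exists>y. b e y \<noteq> 0}" for b :: "'a => 'a => real" by simp
 note l = bilinear_ladd[OF bl] bilinear_radd[OF bl] bilinear_lmul[OF bl] bilinear_rmul[OF bl] bilinear_lsub[OF bl] bilinear_rsub[OF bl]
 show ?case
 proof (cases "{e\<in>Basis. \<exists>y. b e y \<noteq> 0} = {}")
  case True
  have "b w w = 0" for w
  proof -
   have lin: "linear (\<lambda>x. b x w)" using bl by (simp add: bilinear_def)
   have "b (\<Sum>i\<in>Basis. (w \<bullet> i) *\<^sub>R i) w = (\<Sum>i\<in>Basis. (w \<bullet> i) *\<^sub>R b i w)"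
    by (simp add: linear_sum[OF lin] linear_scale[OF lin])
   then show ?thesis using True by (auto simp: euclidean_representation)
  qed
  then show ?thesis using submarkov_const[of 1] by simp
 next
  case False
  then obtain e y where e: "e \<in> Basis" "b e y \<noteq> 0" by blast
  have qe: "b e e \<noteq> 0"
  proof
   assume z: "b e e = 0"
   have "0 \<le> b (s *\<^sub>R e + y) (s *\<^sub>R e + y)" for s by (rule psd)
   then have "0 \<le> 2 * (s * b e y) + b y y" for s using z sym[of y e] by (simp add: l)
   \<comment> \<open>With \<open>b e e = 0\<close> the form is affine in \<open>s\<close> with
     nonzero slope; this value makes it \<open>- b y y - 2\<close>.\<close>
   from this[of "- (b y y + 1) / b e y"] show False using e(2) psd[of y] by simp
  qed
  then have q: "0 < b e e" using psd[of e] by simp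
  define b' where "b' w k = b w k - b w e * b k e / b e e" for w k
  have bl': "bilinear b'" unfolding bilinear_def b'_def
   by (auto intro!: linearI simp: l algebra_simps add_divide_distrib)
  have sym': "b' x y = b' y x" for x y by (simp add: b'_def sym[of x y] mult.commute)
  have psd': "0 \<le> b' x x" for x
  proof -
   have "0 \<le> b (x - (b x e / b e e) *\<^sub>R e) (x - (b x e / b e e) *\<^sub>R e)" by (rule psd)
   also have "\<dots> = b' x x" using q sym[of e x] by (simp add: l b'_def field_simps)
   finally show ?thesis .
  qed
  have "{x\<in>Basis. \<exists>y. b' x y \<noteq> 0} \<subset> {e\<in>Basis. \<exists>y. b e y \<noteq> 0}"
  proof
   show "{x\<in>Basis. \<exists>y. b' x y \<noteq> 0} \<subseteq> {e\<in>Basis. \<exists>y. b e y \<noteq> 0}"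
   proof safe
    fix x y assume "b' x y \<noteq> 0"
    then show "\<exists>y. b x y \<noteq> 0" by (cases "b x e = 0") (auto simp: b'_def)
   qed
   have "b' e y = 0" for y using q sym[of e y] by (simp add: b'_def)
   then show "{x\<in>Basis. \<exists>y. b' x y \<noteq> 0} \<noteq> {e\<in>Basis. \<exists>y. b e y \<noteq> 0}" using e by blast
  qed
  then have "card {x\<in>Basis. \<exists>y. b' x y \<noteq> 0} < card {e\<in>Basis. \<exists>y. b e y \<noteq> 0}" by (intro psubset_card_mono fin)
  from less.hyps[OF this bl' sym' psd'] have 1: "submarkov (\<lambda>w. of_real (exp (- (t * b' w w))))" .
  define v where "v = (\<Sum>i\<in>Basis. b i e *\<^sub>R i)"
  have v: "b w e = v \<bullet> w" for w
  proof -
   have lin: "linear (\<lambda>x. b x e)" using bl by (simp add: bilinear_def)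
   have "b (\<Sum>i\<in>Basis. (w \<bullet> i) *\<^sub>R i) e = (\<Sum>i\<in>Basis. (w \<bullet> i) * b i e)"
    by (simp add: linear_sum[OF lin] linear_scale[OF lin])
   then show ?thesis unfolding euclidean_representation v_def inner_sum_left
    by (simp add: inner_commute[of w] mult.commute)
  qed
  have 2: "submarkov (\<lambda>w. of_real (exp (- (t / b e e * (v \<bullet> w)\<^sup>2))))" using t q by (intro submarkov_square) simp
  have "t * b w w = t * b' w w + t / b e e * (v \<bullet> w)\<^sup>2" for w
   using q by (simp add: b'_def v[symmetric] power2_eq_square field_simps)
  then show ?thesis using submarkov_mult[OF 1 2] by (simp add: exp_add[symmetric] flip: of_real_mult)
 qed
qed

text \<open>Put s = y \<bullet> w. For |y| at most 1, second-order expansion of the exponential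
  leaves s^2/2, and replacing s by s/(1 + |y|^2) costs at most |s| |y|^2. For larger y the terms are
  bounded one by one.\<close>

lemma levy_integrand_bound:
 fixes y w :: "'a::real_inner"
 shows "cmod (1 - en y w - \<i> * of_real (y \<bullet> w) / of_real (1 + (norm y)\<^sup>2))
  \<le> (2 + norm w + (norm w)\<^sup>2) * min 1 ((norm y)\<^sup>2)"
proof -
 define s r where "s = y \<bullet> w" and "r = norm y"
 have s: "\<bar>s\<bar> \<le> r * norm w" unfolding s_def r_def by (rule Cauchy_Schwarz_ineq2)
 have r: "0 \<le> r" by (simp add: r_def)
 have p: "0 < 1 + r\<^sup>2" by (simp add: add_pos_nonneg)
 show ?thesis
 proof (cases "r \<le> 1")
  case True
  have "cmod (iexp (- s) - (\<Sum>k\<le>1. (\<i> * of_real (- s)) ^ k / fact k)) \<le> \<bar>- s\<bar> ^ Suc 1 / fact (Suc 1)"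
   by (rule iexp_approx1)
  then have 1: "cmod (1 - exp (- (\<i> * of_real s)) - \<i> * of_real s) \<le> s\<^sup>2 / 2"
   by (simp add: norm_minus_commute algebra_simps power2_eq_square abs_mult)
  have "s\<^sup>2 \<le> (r * norm w)\<^sup>2" using s by (metis abs_ge_zero power2_abs power_mono)
  then have 2: "s\<^sup>2 / 2 \<le> (norm w)\<^sup>2 * r\<^sup>2"
   using zero_le_power2[of "r * norm w"] unfolding power_mult_distrib mult.commute[of "(norm w)\<^sup>2"] by linarith
  have "\<bar>s\<bar> * r\<^sup>2 / (1 + r\<^sup>2) \<le> \<bar>s\<bar> * r\<^sup>2" using p by (simp add: divide_le_eq) (simp add: algebra_simps)
  also have "\<dots> \<le> norm w * r\<^sup>2"
   using s True mult_left_le_one_le[of "norm w" r] r by (intro mult_right_mono) auto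
  finally have 3: "\<bar>s\<bar> * r\<^sup>2 / (1 + r\<^sup>2) \<le> norm w * r\<^sup>2" .
  have "1 - exp (- (\<i> * of_real s)) - \<i> * of_real s / of_real (1 + r\<^sup>2)
    = (1 - exp (- (\<i> * of_real s)) - \<i> * of_real s) + \<i> * of_real (s * r\<^sup>2 / (1 + r\<^sup>2))"
  proof -
   have "cr (1 + r\<^sup>2) \<noteq> 0" using p by (simp only: of_real_eq_0_iff)
   then show ?thesis by (simp add: field_simps)
  qed
  also have "cmod \<dots> \<le> s\<^sup>2 / 2 + \<bar>s\<bar> * r\<^sup>2 / (1 + r\<^sup>2)"
   by (rule norm_triangle_le, rule add_mono[OF 1]) (use p in \<open>simp add: norm_mult abs_mult del: of_real_divide of_real_mult\<close>)
  also have "\<dots> \<le> (2 + norm w + (norm w)\<^sup>2) * r\<^sup>2" using 2 3 zero_le_power2[of r] unfolding distrib_right by linarith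
  finally show ?thesis using True r by (simp add: power_le_one min_absorb2 flip: s_def r_def)
 next
  case False
  have "\<bar>s\<bar> / (1 + r\<^sup>2) \<le> norm w"
  proof -
   have "r * norm w \<le> (1 + r\<^sup>2) * norm w"
    using False self_le_power[of r 2] by (intro mult_right_mono) auto
   then have "\<bar>s\<bar> \<le> norm w * (1 + r\<^sup>2)" using s by (simp add: mult.commute)
   then show ?thesis using p by (simp add: divide_le_eq)
  qed
  moreover have "cmod (1 - exp (- (\<i> * of_real s)) - \<i> * of_real s / of_real (1 + r\<^sup>2)) \<le> (1 + 1) + \<bar>s\<bar> / (1 + r\<^sup>2)"
  proof (rule order_trans[OF norm_triangle_ineq4], rule add_mono)
   show "cmod (1 - exp (- (\<i> * of_real s))) \<le> 1 + 1"
    using norm_triangle_ineq4[of 1 "exp (- (\<i> * cr s))"] by (simp add: norm_exp_i_times)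
   show "cmod (\<i> * of_real s / of_real (1 + r\<^sup>2)) \<le> \<bar>s\<bar> / (1 + r\<^sup>2)"
    using p by (simp add: norm_divide norm_mult del: of_real_add of_real_power)
  qed
  ultimately have "cmod (1 - exp (- (\<i> * of_real s)) - \<i> * of_real s / of_real (1 + r\<^sup>2)) \<le> (2 + norm w + (norm w)\<^sup>2) * 1"
   using zero_le_power2[of "norm w"] unfolding mult_1_right by linarith
  then show ?thesis using False one_le_power[of r 2] by (simp add: min_absorb1 flip: s_def r_def)
 qed
qed

lemma levy_measurable:
 fixes f :: "real ^ 'n::finite => 'b::topological_space"
 assumes "levy_measure n" "f \<in> borel_measurable borel"
 shows "f \<in> borel_measurable n"
proof -
 have "sets n = sets (restrict_space borel (- {0}))" using assms(1) by (simp add: levy_measure_def)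
 from measurable_cong_sets[OF this refl] show ?thesis using measurable_restrict_space1[OF assms(2)] by blast
qed

lemma levy_integrable_min:
 assumes "levy_measure (n :: (real ^ 'n::finite) measure)"
 shows "integrable n (\<lambda>y. min 1 ((norm y)\<^sup>2))"
proof (rule integrableI_nonneg)
 show "(\<lambda>y. min 1 ((norm y)\<^sup>2)) \<in> borel_measurable n" by (rule levy_measurable[OF assms]) simp
 show "(\<integral>\<^sup>+ y. ennreal (min 1 ((norm y)\<^sup>2)) \<partial>n) < \<infinity>" using assms by (simp add: levy_measure_def)
qed simp

lemma levy_space: "levy_measure n \<Longrightarrow> space n = - {0}"
 using sets_eq_imp_space_eq[of n "restrict_space borel (- {0})"] by (simp add: levy_measure_def space_restrict_space)

lemma levy_cos_integrable:
 assumes n: "levy_measure (n :: (real ^ 'n::finite) measure)"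
 shows "integrable n (\<lambda>y. 1 - en y w - \<i> * of_real (y \<bullet> w) / of_real (1 + (norm y)\<^sup>2))" (is "integrable n ?f")
proof (rule Bochner_Integration.integrable_bound)
 show "integrable n (\<lambda>y. (2 + norm w + (norm w)\<^sup>2) * min 1 ((norm y)\<^sup>2))"
  by (intro integrable_mult_right levy_integrable_min n)
 have "continuous_on UNIV ?f"
 proof (intro continuous_intros ballI)
  show "cr (1 + (norm x)\<^sup>2) \<noteq> 0" for x :: "real ^ 'n"
   using add_pos_nonneg[OF zero_less_one zero_le_power2[of "norm x"]] by (simp only: of_real_eq_0_iff)
 qed
 then show "?f \<in> borel_measurable n" by (intro levy_measurable[OF n] borel_measurable_continuous_onI)
 show "AE y in n. cmod (?f y) \<le> norm ((2 + norm w + (norm w)\<^sup>2) * min 1 ((norm y)\<^sup>2))"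
  using levy_integrand_bound[of _ w] unfolding real_norm_def by (intro AE_I2 order_trans[OF _ abs_ge_self])
qed

text \<open>Real parts remove the sine and its compensator; what remains is the symmetric integrand
  that real symbols see.\<close>

lemma levy_Re:
 assumes n: "levy_measure (n :: (real ^ 'n::finite) measure)"
 shows "integrable n (\<lambda>y. 1 - cos (y \<bullet> w))"
  and "Re (\<integral>y. 1 - en y w - \<i> * of_real (y \<bullet> w) / of_real (1 + (norm y)\<^sup>2) \<partial>n) = (\<integral>y. 1 - cos (y \<bullet> w) \<partial>n)"
proof -
 have e: "Re (1 - en y w - \<i> * of_real (y \<bullet> w) / of_real (1 + (norm y)\<^sup>2)) = 1 - cos (y \<bullet> w)" for y
  by (simp add: Re_exp Re_divide_of_real del: of_real_add of_real_power)
 show "integrable n (\<lambda>y. 1 - cos (y \<bullet> w))" using integrable_Re[OF levy_cos_integrable[OF n, of w]] by (simp only: e)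
 show "Re (\<integral>y. 1 - en y w - \<i> * of_real (y \<bullet> w) / of_real (1 + (norm y)\<^sup>2) \<partial>n) = (\<integral>y. 1 - cos (y \<bullet> w) \<partial>n)"
  using integral_Re[OF levy_cos_integrable[OF n, of w]] by (simp only: e)
qed

text \<open>The Levy measure is cut down to finite measures with densities \<open>w k\<close>; for
  these the exponential is compound Poisson over a mixture of cosines, and dominated convergence
  lets \<open>k\<close> tend to infinity.\<close>

lemma submarkov_levy:
 assumes n: "levy_measure (n :: (real ^ 'n::finite) measure)" and t: "0 \<le> t"
 shows "submarkov (\<lambda>v. of_real (exp (- (t * (\<integral>y. 1 - cos (y \<bullet> v) \<partial>n)))))"
proof (rule submarkov_limit)
 \<comment> \<open>At most 1, integrable against the Levy measure, and equal to 1 at each fixed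
   \<open>y \<noteq> 0\<close> once \<open>k\<close> is large.\<close>
 define w where "w k y = min 1 (real k * min 1 ((norm y)\<^sup>2))" for k and y :: "real ^ 'n"
 have w: "0 \<le> w k y" "w k y \<le> 1" "w k y \<le> real k * min 1 ((norm y)\<^sup>2)" for k y by (auto simp: w_def)
 have wm: "w k \<in> borel_measurable n" for k unfolding w_def[abs_def] by (rule levy_measurable[OF n]) simp
 have cm: "(\<lambda>y. cos (y \<bullet> v)) \<in> borel_measurable n" for v :: "real ^ 'n"
  by (intro levy_measurable[OF n] borel_measurable_continuous_onI continuous_intros)
 have wi: "integrable n (w k)" for k
 proof (rule Bochner_Integration.integrable_bound)
  show "integrable n (\<lambda>y. real k * min 1 ((norm y)\<^sup>2))" by (intro integrable_mult_right levy_integrable_min n)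
 qed (use w wm in auto)
 have wci: "integrable n (\<lambda>y. w k y * cos (y \<bullet> v))" for k v
  by (rule Bochner_Integration.integrable_bound[OF wi[of k]]) (use wm cm w(1) in \<open>auto simp: abs_mult mult_left_le\<close>)
 have idm: "(\<lambda>y. y) \<in> measurable n borel" by (rule levy_measurable[OF n]) simp
 show "submarkov (\<lambda>v. of_real (exp (- (t * (\<integral>y. w k y * (1 - cos (y \<bullet> v)) \<partial>n)))))" for k
 proof (cases "(\<integral>y. w k y \<partial>n) = 0")
  case True
  then have "AE y in n. w k y = 0" using integral_nonneg_eq_0_iff_AE[OF wi] w by simp
  then have "(\<integral>y. w k y * (1 - cos (y \<bullet> v)) \<partial>n) = 0" for v by (intro integral_eq_zero_AE) auto
  then show ?thesis using submarkov_const[of 1] by simp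
 next
  case False
  \<comment> \<open>The mass goes into the time parameter \<open>t * a\<close>, so that
    \<open>N\<close> is a probability measure.\<close>
  define a where "a = (\<integral>y. w k y \<partial>n)"
  have a: "0 < a" using False integral_nonneg[of n "w k"] w(1) by (simp add: a_def less_le)
  define N where "N = density n (\<lambda>y. ennreal (w k y / a))"
  have wam: "(\<lambda>y. w k y / a) \<in> borel_measurable n" using wm by simp
  have sp: "emeasure N (space N) = 1"
  proof -
   have "emeasure N (space N) = (\<integral>\<^sup>+y. ennreal (w k y / a) \<partial>n)"
    unfolding N_def using wam by (simp add: emeasure_density cong: nn_integral_cong_simp)
   also have "\<dots> = ennreal (\<integral>y. w k y / a \<partial>n)" using wi w a by (intro nn_integral_eq_integral) auto
   also have "(\<integral>y. w k y / a \<partial>n) = 1" using a by (simp add: a_def)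
   finally show ?thesis by simp
  qed
  have fin: "finite_measure N" by (rule finite_measureI) (simp add: sp)
  have Nid: "(\<lambda>y. y) \<in> measurable N borel" using idm by (simp add: N_def)
  have s: "submarkov (\<lambda>v. \<integral>y. cr (cos (y \<bullet> v)) \<partial>N)"
  proof (rule submarkov_mixture[OF fin])
   show "measure N (space N) \<le> 1" by (simp add: measure_def sp)
   show "submarkov (\<lambda>v. cr (cos (y \<bullet> v)))" for y :: "real ^ 'n" by (rule submarkov_cos)
   have "(\<lambda>z. fst z \<bullet> snd z) \<in> borel_measurable (N \<Otimes>\<^sub>M (lborel :: (real ^ 'n) measure))"
    by (intro borel_measurable_inner measurable_compose[OF measurable_fst Nid] measurable_compose[OF measurable_snd]) simp
   then show "(\<lambda>(y, v). cr (cos (y \<bullet> v))) \<in> borel_measurable (N \<Otimes>\<^sub>M (lborel :: (real ^ 'n) measure))"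
    by (simp add: case_prod_beta)
  qed
  have e: "(\<integral>y. cr (cos (y \<bullet> v)) \<partial>N) = of_real ((\<integral>y. w k y * cos (y \<bullet> v) \<partial>n) / a)" for v
  proof -
   have "(\<integral>y. cos (y \<bullet> v) \<partial>N) = (\<integral>y. (w k y / a) *\<^sub>R cos (y \<bullet> v) \<partial>n)"
    unfolding N_def using wam cm w a by (intro integral_density) auto
   then show ?thesis by simp
  qed
  have "submarkov (\<lambda>v. exp (- (cr (t * a) * (1 - of_real ((\<integral>y. w k y * cos (y \<bullet> v) \<partial>n) / a)))))"
   using submarkov_exp[OF s, of "t * a"] t a unfolding e by simp
  moreover have "exp (- (cr (t * a) * (1 - of_real ((\<integral>y. w k y * cos (y \<bullet> v) \<partial>n) / a))))
    = of_real (exp (- (t * (\<integral>y. w k y * (1 - cos (y \<bullet> v)) \<partial>n))))" for v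
  proof -
   have "(\<integral>y. w k y * (1 - cos (y \<bullet> v)) \<partial>n) = a - (\<integral>y. w k y * cos (y \<bullet> v) \<partial>n)"
    using wi wci by (simp add: a_def right_diff_distrib)
   then have "t * (\<integral>y. w k y * (1 - cos (y \<bullet> v)) \<partial>n) = t * a * (1 - (\<integral>y. w k y * cos (y \<bullet> v) \<partial>n) / a)"
    using a by (simp only:) (simp add: right_diff_distrib)
   then show ?thesis by (simp only: exp_of_real[symmetric] of_real_mult of_real_minus of_real_diff of_real_1)
  qed
  ultimately show ?thesis by simp
 qed
 fix v
 have "(\<lambda>k. \<integral>y. w k y * (1 - cos (y \<bullet> v)) \<partial>n) \<longlonglongrightarrow> (\<integral>y. 1 - cos (y \<bullet> v) \<partial>n)"
 proof (rule integral_dominated_convergence[OF _ _ levy_Re(1)[OF n, of v]])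
  show "AE y in n. (\<lambda>k. w k y * (1 - cos (y \<bullet> v))) \<longlonglongrightarrow> 1 - cos (y \<bullet> v)"
  proof (rule AE_I2)
   fix y assume "y \<in> space n"
   then have p: "0 < min 1 ((norm y)\<^sup>2)" using levy_space[OF n] by auto
   obtain K where K: "1 < real K * min 1 ((norm y)\<^sup>2)" using reals_Archimedean3[OF p] by blast
   have "w k y = 1" if "K \<le> k" for k
   proof -
    have "real K * min 1 ((norm y)\<^sup>2) \<le> real k * min 1 ((norm y)\<^sup>2)" using that p by (intro mult_right_mono) auto
    then show ?thesis using K by (simp add: w_def)
   qed
   then have "\<forall>\<^sub>F k in sequentially. w k y * (1 - cos (y \<bullet> v)) = 1 - cos (y \<bullet> v)"
    by (auto simp: eventually_sequentially)
   then show "(\<lambda>k. w k y * (1 - cos (y \<bullet> v))) \<longlonglongrightarrow> 1 - cos (y \<bullet> v)" by (rule tendsto_eventually)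
  qed
  show "AE y in n. norm (w k y * (1 - cos (y \<bullet> v))) \<le> 1 - cos (y \<bullet> v)" for k
   using w by (auto simp: abs_mult mult_left_le_one_le)
 qed (use wm cm in auto)
 then show "(\<lambda>k. cr (exp (- (t * (\<integral>y. w k y * (1 - cos (y \<bullet> v)) \<partial>n))))) \<longlonglongrightarrow> of_real (exp (- (t * (\<integral>y. 1 - cos (y \<bullet> v) \<partial>n))))"
  by (intro tendsto_of_real tendsto_exp tendsto_minus tendsto_mult_left)
qed

text \<open>As \<open>Q\<close> is real, it is the real part of the Levy-Khinchin formula: a
  constant, a quadratic form and an integral of 1 - cos, whose exponentials are multiplied.\<close>

lemma submarkov_negative_definite:
 fixes Q :: "real ^ 'n::finite => real"
 assumes Q: "negative_definite (\<lambda>w. cr (Q w))" and t: "0 \<le> t"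
 shows "submarkov (\<lambda>w. of_real (exp (- (t * Q w))))"
proof -
 from Q obtain c :: real and d :: "real ^ 'n" and a :: "real ^ 'n ^ 'n" and n where
  c: "0 \<le> c" and a: "transpose a = a" "\<And>w. 0 \<le> w \<bullet> (a *v w)" and n: "levy_measure n"
  and q: "\<And>w. cr (Q w) = cr c + \<i> * cr (d \<bullet> w)
      + cr (\<Sum>k\<in>UNIV. \<Sum>l\<in>UNIV. a $ k $ l * w $ k * w $ l)
      + (\<integral>y. 1 - en y w
          - \<i> * cr (y \<bullet> w) / cr (1 + (norm y)\<^sup>2) \<partial>n)"
  unfolding negative_definite_def by blast
 have quad: "(\<Sum>k\<in>UNIV. \<Sum>l\<in>UNIV. a $ k $ l * w $ k * w $ l) = w \<bullet> (a *v w)" for w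
  by (simp add: inner_vec_def matrix_vector_mult_def sum_distrib_left mult_ac)
 have Qe: "Q w = c + w \<bullet> (a *v w) + (\<integral>y. 1 - cos (y \<bullet> w) \<partial>n)" for w
 proof -
  have "Q w = Re (cr (Q w))" by simp
  also have "\<dots> = c + w \<bullet> (a *v w) + (\<integral>y. 1 - cos (y \<bullet> w) \<partial>n)"
   unfolding q quad plus_complex.sel levy_Re(2)[OF n] by simp
  finally show ?thesis .
 qed
 have 1: "submarkov (\<lambda>w :: real ^ 'n. cr (exp (- (t * c))))" using t c by (intro submarkov_const) auto
 have 2: "submarkov (\<lambda>w. cr (exp (- (t * (w \<bullet> (a *v w))))))"
 proof (rule submarkov_quadratic[of "\<lambda>w z. w \<bullet> (a *v z)", OF _ _ a(2) t])
  show "bilinear (\<lambda>w z. w \<bullet> (a *v z))" unfolding bilinear_def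
   by (auto intro!: linearI simp: inner_add_left inner_add_right matrix_vector_right_distrib matrix_vector_mult_scaleR)
  show "w \<bullet> (a *v z) = z \<bullet> (a *v w)" for w z
   using dot_lmul_matrix[of w a z] a(1) by (metis inner_commute transpose_matrix_vector)
 qed
 have 3: "submarkov (\<lambda>w. cr (exp (- (t * (\<integral>y. 1 - cos (y \<bullet> w) \<partial>n)))))" by (rule submarkov_levy[OF n t])
 have "cr (exp (- (t * Q w))) = cr (exp (- (t * c))) * cr (exp (- (t * (w \<bullet> (a *v w))))) * cr (exp (- (t * (\<integral>y. 1 - cos (y \<bullet> w) \<partial>n))))" for w
  unfolding Qe of_real_mult[symmetric] exp_add[symmetric] by (simp add: algebra_simps)
 then show ?thesis using submarkov_mult[OF submarkov_mult[OF 1 2] 3] by simp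
qed

section \<open>Bernstein functions of negative definite functions\<close>

text \<open>Needed because the derivative within the open half-line and \<open>deriv\<close> agree
  only on the half-line.\<close>

lemma times_differentiable_on_cong:
 assumes S: "open S"
 shows "times_differentiable_on k S f \<Longrightarrow> (\<And>x. x \<in> S \<Longrightarrow> f x = h x) \<Longrightarrow> times_differentiable_on k S h"
proof (induction k arbitrary: f h)
 case 0
 have "continuous_on S h \<longleftrightarrow> continuous_on S f" by (rule continuous_on_cong) (simp_all add: 0(2))
 then show ?case using 0(1) by simp
next
 case (Suc k)
 have d: "(h has_derivative frechet_derivative f (at x within S)) (at x within S)" if x: "x \<in> S" for x
 proof (rule has_derivative_transform[OF x])
  show "(f has_derivative frechet_derivative f (at x within S)) (at x within S)"
   using Suc.prems(1) x by (intro frechet_derivative_works[THEN iffD1]) simp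
 qed (use Suc.prems(2) in simp)
 have fr: "frechet_derivative h (at x within S) = frechet_derivative f (at x within S)" if x: "x \<in> S" for x
 proof -
  have "(h has_derivative frechet_derivative f (at x)) (at x)" using d[OF x] by (simp only: at_within_open[OF x S])
  from frechet_derivative_at[OF this] show ?thesis by (simp only: at_within_open[OF x S])
 qed
 have "times_differentiable_on k S (\<lambda>x. frechet_derivative h (at x within S) v)" for v
 proof (rule Suc.IH)
  show "times_differentiable_on k S (\<lambda>x. frechet_derivative f (at x within S) v)" using Suc.prems(1) by simp
  show "frechet_derivative f (at x within S) v = frechet_derivative h (at x within S) v" if "x \<in> S" for x
   by (simp only: fr[OF that])
 qed
 moreover have "\<forall>x\<in>S. h differentiable (at x within S)" using differentiableI[OF d] by blast
 ultimately show ?case by simp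
qed

lemma smooth_on_has_deriv:
 fixes f :: "real => real"
 assumes "smooth_on S f" "open S" "x \<in> S"
 shows "(f has_real_derivative deriv f x) (at x)"
proof -
 have "times_differentiable_on (Suc 0) S f" using assms(1) by (simp only: smooth_on_def)
 then have "f differentiable (at x)" using assms(3) at_within_open[OF assms(3,2)] by auto
 then show ?thesis using DERIV_deriv_iff_real_differentiable by blast
qed

lemma smooth_on_deriv:
 fixes f :: "real => real"
 assumes f: "smooth_on S f" and S: "open S"
 shows "smooth_on S (deriv f)"
 unfolding smooth_on_def
proof
 fix k
 have "times_differentiable_on (Suc k) S f" using f by (simp only: smooth_on_def)
 then have "times_differentiable_on k S (\<lambda>x. frechet_derivative f (at x within S) 1)" by simp
 then show "times_differentiable_on k S (deriv f)"
 proof (rule times_differentiable_on_cong[OF S])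
  fix x assume x: "x \<in> S"
  have "(f has_derivative (*) (deriv f x)) (at x)"
   using smooth_on_has_deriv[OF f S x] by (simp add: has_field_derivative_def)
  from frechet_derivative_at[OF this] show "frechet_derivative f (at x within S) 1 = deriv f x"
   unfolding at_within_open[OF x S] by (metis mult.right_neutral)
 qed
qed

lemma smooth_on_iterated_deriv:
 fixes f :: "real => real"
 assumes "smooth_on S f" "open S" "x \<in> S"
 shows "((deriv ^^ k) f has_real_derivative (deriv ^^ Suc k) f x) (at x)"
proof -
 have "smooth_on S ((deriv ^^ k) f)" using assms(1,2) by (induction k) (simp_all add: smooth_on_deriv)
 then show ?thesis using smooth_on_has_deriv assms(2,3) by simp
qed

lemma bernstein_deriv:
 assumes "bernstein g" "0 < r"
 shows "((deriv ^^ k) g has_real_derivative (deriv ^^ Suc k) g r) (at r)"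
proof (rule smooth_on_iterated_deriv[OF _ open_greaterThan])
 show "smooth_on {0<..} g" using assms(1) unfolding bernstein_def by blast
qed (use assms(2) in simp)

lemma bernstein_nonneg: "bernstein g \<Longrightarrow> 0 \<le> s \<Longrightarrow> 0 \<le> g s"
 by (simp add: bernstein_def)

lemma bernstein_sign:
 assumes "bernstein g" "0 < r"
 shows "0 \<le> (- 1) ^ K * (deriv ^^ Suc K) g r"
proof -
 have "\<forall>k\<ge>1. \<forall>s>0. (- 1) ^ k * (deriv ^^ k) g s \<le> 0" using assms(1) by (simp add: bernstein_def)
 then have "(- 1) ^ Suc K * (deriv ^^ Suc K) g r \<le> 0" using assms(2) by (simp del: funpow.simps power_Suc)
 then show ?thesis by (simp del: funpow.simps)
qed

text \<open>The Taylor polynomial at \<open>s\<close> as a function of its centre \<open>r\<close>;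
  in this variable the derivative telescopes to a single term.\<close>

definition tay :: "(real => real) => real => nat => real => real" where
 "tay g s K r = (\<Sum>k<K. (deriv ^^ k) g r / fact k * (s - r) ^ k)"

lemma tay_has_deriv:
 assumes g: "bernstein g" and r: "0 < r"
 shows "(tay g s (Suc K) has_real_derivative (deriv ^^ Suc K) g r / fact K * (s - r) ^ K) (at r)"
proof (induction K)
 case 0
 have "tay g s (Suc 0) = g" by (rule ext) (simp add: tay_def)
 then show ?case using bernstein_deriv[OF g r, of 0] by simp
next
 case (Suc K)
 have e: "tay g s (Suc (Suc K)) = (\<lambda>r. tay g s (Suc K) r + (deriv ^^ Suc K) g r / fact (Suc K) * (s - r) ^ Suc K)"
  by (rule ext) (simp add: tay_def)
 have "((\<lambda>r. (deriv ^^ Suc K) g r / fact (Suc K) * (s - r) ^ Suc K) has_real_derivative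
   (deriv ^^ Suc (Suc K)) g r / fact (Suc K) * (s - r) ^ Suc K - (deriv ^^ Suc K) g r / fact (Suc K) * (real (Suc K) * (s - r) ^ K)) (at r)"
 proof -
  have 1: "((\<lambda>r. (s - r) ^ Suc K) has_real_derivative - (real (Suc K) * (s - r) ^ K)) (at r)"
  proof -
   have "((\<lambda>r. s - r) has_real_derivative - 1) (at r)" by (auto intro!: derivative_eq_intros)
   from DERIV_power[OF this, of "Suc K"] show ?thesis by (simp del: of_nat_Suc power_Suc)
  qed
  show ?thesis using DERIV_mult[OF DERIV_cdivide[OF bernstein_deriv[OF g r, of "Suc K"], of "fact (Suc K)"] 1]
   by (simp add: algebra_simps del: funpow.simps fact_Suc of_nat_Suc power_Suc)
 qed
 moreover have "(deriv ^^ Suc K) g r / fact (Suc K) * (real (Suc K) * (s - r) ^ K) = (deriv ^^ Suc K) g r / fact K * (s - r) ^ K"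
  by (simp add: divide_simps del: funpow.simps of_nat_Suc)
 ultimately have "((\<lambda>r. (deriv ^^ Suc K) g r / fact (Suc K) * (s - r) ^ Suc K) has_real_derivative
   (deriv ^^ Suc (Suc K)) g r / fact (Suc K) * (s - r) ^ Suc K - (deriv ^^ Suc K) g r / fact K * (s - r) ^ K) (at r)" by simp
 from DERIV_add[OF Suc this] show ?case unfolding e by simp
qed

lemma tay_self: "tay g s (Suc K) s = g s"
 unfolding tay_def lessThan_Suc_eq_insert_0 by (simp add: sum.reindex)

text \<open>The mean value theorem in the centre, between \<open>s\<close>, where the polynomial
  equals \<open>g s\<close>, and \<open>R\<close>. This is Cauchy's form of the remainder, with the
  sign of (s - c)^K pulled out.\<close>

lemma tay_remainder:
 assumes g: "bernstein g" and s: "0 < s" "s < R"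
 obtains c where "s < c" "c < R" "tay g s (Suc K) R - g s = (R - s) * ((- 1) ^ K * (deriv ^^ Suc K) g c / fact K * (c - s) ^ K)"
proof -
 have "\<exists>c. s < c \<and> c < R \<and> tay g s (Suc K) R - tay g s (Suc K) s = (R - s) * ((deriv ^^ Suc K) g c / fact K * (s - c) ^ K)"
  using s by (intro MVT2 tay_has_deriv g) auto
 then obtain c where c: "s < c" "c < R" "tay g s (Suc K) R - g s = (R - s) * ((deriv ^^ Suc K) g c / fact K * (s - c) ^ K)"
  unfolding tay_self by blast
 have "(s - c) ^ K = (- 1) ^ K * (c - s) ^ K" by (metis minus_diff_eq mult_minus1 power_mult_distrib)
 then show ?thesis using c by (intro that[of c]) (simp_all add: mult_ac del: funpow.simps)
qed

text \<open>The alternating signs of the derivatives give the remainders of all orders the same sign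
  to the left of the centre.\<close>

lemma tay_upper:
 assumes g: "bernstein g" and s: "0 < s" "s < R"
 shows "g s \<le> tay g s (Suc K) R"
proof -
 obtain c where c: "s < c" "c < R" "tay g s (Suc K) R - g s = (R - s) * ((- 1) ^ K * (deriv ^^ Suc K) g c / fact K * (c - s) ^ K)"
  using tay_remainder[OF g s] by blast
 have "0 \<le> ((- 1) ^ K * (deriv ^^ Suc K) g c) / fact K"
  using bernstein_sign[OF g, of c K] c(1) s by (intro divide_nonneg_pos) auto
 then have "0 \<le> (R - s) * ((- 1) ^ K * (deriv ^^ Suc K) g c / fact K * (c - s) ^ K)"
  using c(1,2) by (intro mult_nonneg_nonneg[OF _ mult_nonneg_nonneg]) auto
 then show ?thesis using c(3) by linarith
qed

lemma bernstein_mono: "bernstein g \<Longrightarrow> 0 < s \<Longrightarrow> s \<le> R \<Longrightarrow> g s \<le> g R"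
 using tay_upper[of g s R 0] by (cases "s = R") (auto simp: tay_def)

text \<open>The coefficient of \<open>m ^ k\<close> in the Taylor expansion of
  \<open>g (R * (1 - m))\<close> at \<open>m = 0\<close>.\<close>

definition bcoeff :: "(real => real) => real => nat => real" where
 "bcoeff g R k = (deriv ^^ k) g R / fact k * (- R) ^ k"

lemma bcoeff_0: "bcoeff g R 0 = g R"
 by (simp add: bcoeff_def)

lemma bcoeff_Suc:
 assumes "bernstein g" "0 < R"
 shows "bcoeff g R (Suc k) = - (R ^ Suc k * ((- 1) ^ k * (deriv ^^ Suc k) g R) / fact (Suc k))"
 unfolding bcoeff_def power_minus[of R] by (simp del: funpow.simps fact_Suc)

lemma bcoeff_nonpos:
 assumes "bernstein g" "0 < R"
 shows "bcoeff g R (Suc k) \<le> 0"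
 unfolding bcoeff_Suc[OF assms] using bernstein_sign[OF assms, of k] assms(2)
 by (simp del: funpow.simps fact_Suc power_Suc)

lemma tay_bcoeff: "R \<noteq> 0 \<Longrightarrow> tay g s K R = (\<Sum>k<K. bcoeff g R k * ((R - s) / R) ^ k)"
proof -
 assume R: "R \<noteq> 0"
 have "(s - R) ^ k = (- R) ^ k * ((R - s) / R) ^ k" for k
  unfolding power_mult_distrib[symmetric] using R by simp
 then show ?thesis by (simp add: tay_def bcoeff_def mult.assoc)
qed

text \<open>This is the Taylor polynomial at m = 1, that is at s = 0, where \<open>g\<close> is
  merely continuous; it is reached from s > 0, where the polynomial lies above the nonnegative
  \<open>g\<close>.\<close>

lemma bcoeff_sum_nonneg:
 assumes g: "bernstein g" and R: "0 < R"
 shows "0 \<le> (\<Sum>k<Suc K. bcoeff g R k)"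
proof -
 have "((\<lambda>s. \<Sum>k<Suc K. bcoeff g R k * ((R - s) / R) ^ k) \<longlongrightarrow> (\<Sum>k<Suc K. bcoeff g R k * ((R - 0) / R) ^ k)) (at_right 0)"
  using R by (intro tendsto_sum tendsto_mult tendsto_power tendsto_divide tendsto_diff tendsto_const tendsto_ident_at) simp
 moreover have "\<forall>\<^sub>F s in at_right 0. 0 \<le> (\<Sum>k<Suc K. bcoeff g R k * ((R - s) / R) ^ k)"
  unfolding eventually_at_right_field
 proof (intro exI[of _ R] conjI allI impI R)
  fix s assume s: "0 < s" "s < R"
  have "0 \<le> g s" using bernstein_nonneg[OF g, of s] s by simp
  also have "\<dots> \<le> tay g s (Suc K) R" by (rule tay_upper[OF g s])
  finally show "0 \<le> (\<Sum>k<Suc K. bcoeff g R k * ((R - s) / R) ^ k)" using tay_bcoeff[of R g s "Suc K"] R by (simp del: sum.lessThan_Suc)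
 qed
 ultimately have "0 \<le> (\<Sum>k<Suc K. bcoeff g R k * ((R - 0) / R) ^ k)"
  by (rule tendsto_lowerbound) simp
 then show ?thesis using R by (simp del: sum.lessThan_Suc)
qed

text \<open>The leading coefficient is \<open>g R\<close>, all others are nonpositive and the
  partial sums stay nonnegative, so no other coefficient can exceed \<open>g R\<close> in
  modulus.\<close>

lemma bcoeff_bound:
 assumes g: "bernstein g" and R: "0 < R"
 shows "R ^ Suc k * ((- 1) ^ k * (deriv ^^ Suc k) g R) / fact (Suc k) \<le> g R"
proof -
 have "(\<Sum>j<Suc k. bcoeff g R j) \<le> g R" for k
 proof (induction k)
  case (Suc k) then show ?case using bcoeff_nonpos[OF g R, of k] by (simp only: sum.lessThan_Suc)
 qed (simp add: bcoeff_0)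
 from this[of k] have "(\<Sum>j<Suc (Suc k). bcoeff g R j) \<le> g R + bcoeff g R (Suc k)" by simp
 then show ?thesis using bcoeff_sum_nonneg[OF g R, of "Suc k"] unfolding bcoeff_Suc[OF g R] by linarith
qed

text \<open>\<open>bcoeff_bound\<close> at the intermediate centre \<open>c\<close> controls the
  derivative in Cauchy's remainder, and (c - s)/c is at most (R - s)/R = m; the remainder is of size
  (K + 1) m^K.\<close>

lemma bcoeff_series:
 assumes g: "bernstein g" and R: "0 < R" and m: "0 < m" "m < 1"
 shows "(\<lambda>K. \<Sum>k<Suc K. bcoeff g R k * m ^ k) \<longlonglongrightarrow> g (R * (1 - m))"
  and "0 \<le> (\<Sum>k<Suc K. bcoeff g R k * m ^ k)" and "(\<Sum>k<Suc K. bcoeff g R k * m ^ k) \<le> g R"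
proof -
 define s where "s = R * (1 - m)"
 have s: "0 < s" "s < R" using R m by (simp_all add: s_def)
 have me: "(R - s) / R = m" using R by (simp add: s_def field_simps)
 have e: "(\<Sum>k<K. bcoeff g R k * m ^ k) = tay g s K R" for K using tay_bcoeff[of R g s K] R me by simp
 have bnd: "tay g s (Suc K) R - g s \<le> (R - s) * (real (Suc K) * g R / s * m ^ K)" for K
 proof -
  obtain c where c: "s < c" "c < R" "tay g s (Suc K) R - g s = (R - s) * ((- 1) ^ K * (deriv ^^ Suc K) g c / fact K * (c - s) ^ K)"
   using tay_remainder[OF g s] by blast
  have c0: "0 < c" using c s by simp
  define D where "D = (- 1) ^ K * (deriv ^^ Suc K) g c"
  have "c ^ Suc K * D / fact (Suc K) \<le> g c" using bcoeff_bound[OF g c0, of K] by (simp only: D_def)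
  also have "\<dots> \<le> g R" using bernstein_mono[OF g c0, of R] c by simp
  finally have "D / fact K \<le> real (Suc K) * g R / c ^ Suc K"
   using c0 by (simp add: field_simps del: of_nat_Suc power_Suc)
  then have "D / fact K * (c - s) ^ K \<le> real (Suc K) * g R / c ^ Suc K * (c - s) ^ K"
   using c by (intro mult_right_mono) auto
  also have "\<dots> = real (Suc K) * g R * (1 / c) * ((c - s) / c) ^ K" by (simp add: power_divide)
  also have "\<dots> \<le> real (Suc K) * g R * (1 / s) * ((R - s) / R) ^ K"
  proof (intro mult_mono power_mono mult_nonneg_nonneg)
   show "1 / c \<le> 1 / s" using c s by (simp add: frac_le)
   show "(c - s) / c \<le> (R - s) / R" using c s c0 R by (simp add: field_simps)
  qed (use c s c0 R bernstein_nonneg[OF g, of R] in auto)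
  finally have "D / fact K * (c - s) ^ K \<le> real (Suc K) * g R / s * m ^ K" unfolding me by simp
  then show ?thesis unfolding c(3) D_def[symmetric] using s by (intro mult_left_mono) auto
 qed
 have "(\<lambda>K. tay g s (Suc K) R - g s) \<longlonglongrightarrow> 0"
 proof (rule tendsto_sandwich)
  show "\<forall>\<^sub>F K in sequentially. 0 \<le> tay g s (Suc K) R - g s" using tay_upper[OF g s] by simp
  show "\<forall>\<^sub>F K in sequentially. tay g s (Suc K) R - g s \<le> (R - s) * (real (Suc K) * g R / s * m ^ K)" using bnd by simp
  have "(\<lambda>K. real K * m ^ K) \<longlonglongrightarrow> 0" using powser_times_n_limit_0[of m] m by simp
  moreover have "(\<lambda>K. m ^ K) \<longlonglongrightarrow> 0" using m by (intro LIMSEQ_realpow_zero) auto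
  ultimately have "(\<lambda>K. real K * m ^ K + m ^ K) \<longlonglongrightarrow> 0 + 0" by (rule tendsto_add)
  then have "(\<lambda>K. ((R - s) * g R / s) * (real K * m ^ K + m ^ K)) \<longlonglongrightarrow> ((R - s) * g R / s) * (0 + 0)" by (rule tendsto_mult_left)
  moreover have "(R - s) * (real (Suc K) * g R / s * m ^ K) = ((R - s) * g R / s) * (real K * m ^ K + m ^ K)" for K
   by (simp add: distrib_right distrib_left mult_ac add_divide_distrib)
  ultimately show "(\<lambda>K. (R - s) * (real (Suc K) * g R / s * m ^ K)) \<longlonglongrightarrow> 0"
   by (simp only: add_0 mult_zero_right)
 qed simp
 then show "(\<lambda>K. \<Sum>k<Suc K. bcoeff g R k * m ^ k) \<longlonglongrightarrow> g (R * (1 - m))"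
  unfolding e s_def[symmetric] by (rule LIM_zero_cancel)
 show "0 \<le> (\<Sum>k<Suc K. bcoeff g R k * m ^ k)"
  unfolding e using order_trans[OF bernstein_nonneg[OF g] tay_upper[OF g s]] s by simp
 show "(\<Sum>k<Suc K. bcoeff g R k * m ^ k) \<le> g R"
 proof (induction K)
  case (Suc K)
  have "bcoeff g R (Suc K) * m ^ Suc K \<le> 0" using bcoeff_nonpos[OF g R] m by (intro mult_nonpos_nonneg) auto
  then show ?case using Suc by simp
 qed (simp add: bcoeff_0)
qed

text \<open>At the maximum point every power of \<open>m\<close> yields at most \<open>M\<close>,
  and a nonpositive coefficient reverses this; the constant term gives equality.\<close>

lemma submarkov_polynomial_pmp:
 assumes s: "submarkov m" and h: "L1 h" and M: "0 \<le> M" "\<And>x. Re (syn h x) \<le> M" "Re (syn h x0) = M"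
  and b: "\<And>k. b (Suc k) \<le> 0"
 shows "(\<Sum>k<Suc K. b k) * M \<le> Re (syn (\<lambda>w. (\<Sum>k<Suc K. of_real (b k) * m w ^ k) * h w) x0)"
proof -
 have i: "L1 (\<lambda>w. of_real (b k) * (m w ^ k * h w))" for k
  by (intro integrable_mult_right submarkov_integrable[OF submarkov_power[OF s] h])
 have "L1 (\<lambda>w. (\<Sum>k<Suc K. of_real (b k) * m w ^ k) * h w) \<and>
  (\<Sum>k<Suc K. b k) * M \<le> Re (syn (\<lambda>w. (\<Sum>k<Suc K. of_real (b k) * m w ^ k) * h w) x0)" for K
 proof (induction K)
  case 0 show ?case using M(3) h by (simp add: syn_cmult)
 next
  case (Suc K)
  have "Re (syn (\<lambda>w. m w ^ Suc K * h w) x0) \<le> M" by (rule submarkovD[OF submarkov_power[OF s] h M(1,2)])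
  then have "b (Suc K) * M \<le> b (Suc K) * Re (syn (\<lambda>w. m w ^ Suc K * h w) x0)" using b by (intro mult_left_mono_neg)
  then have n: "b (Suc K) * M \<le> Re (syn (\<lambda>w. of_real (b (Suc K)) * (m w ^ Suc K * h w)) x0)" by (simp add: syn_cmult del: power_Suc)
  have e: "(\<lambda>w. (\<Sum>k<Suc (Suc K). of_real (b k) * m w ^ k) * h w)
    = (\<lambda>w. (\<Sum>k<Suc K. of_real (b k) * m w ^ k) * h w + of_real (b (Suc K)) * (m w ^ Suc K * h w))"
   by (simp add: distrib_right mult.assoc)
  have e2: "(\<Sum>k<Suc (Suc K). b k) * M = (\<Sum>k<Suc K. b k) * M + b (Suc K) * M" by (simp add: distrib_right)
  show ?case unfolding e e2
   using Suc n i[of "Suc K"] by (simp only: syn_add plus_complex.sel integrable_add add_mono)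
 qed
 then show ?thesis by blast
qed

text \<open>\<open>Q\<close> is replaced by (n + 1)(1 - exp(-Q/(n + 1))), for which
  \<open>bcoeff_series\<close> with R = n + 1 makes the Bernstein function a limit of polynomials in
  a sub-Markovian multiplier. The replacement lies below \<open>Q\<close>, so by monotonicity of
  \<open>g\<close> the function in \<open>gh\<close> dominates as n grows.\<close>

lemma bernstein_pmp:
 fixes Q :: "real ^ 'n::finite => real"
 assumes g: "bernstein g" and Q: "negative_definite (\<lambda>w. cr (Q w))" and Qpos: "\<And>w. 0 < Q w"
  and h: "L1 h" and gh: "L1 (\<lambda>w. of_real (g (Q w)) * h w)"
  and M: "0 \<le> M" "\<And>x. Re (syn h x) \<le> M" "Re (syn h x0) = M"
 shows "0 \<le> Re (syn (\<lambda>w. of_real (g (Q w)) * h w) x0)"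
proof -
 have hm: "h \<in> borel_measurable borel" using borel_measurable_integrable[OF h] by simp
 define m where "m n w = exp (- (inverse (real (Suc n)) * Q w))" for n w
 have m: "0 < m n w" "m n w < 1" for n w using Qpos[of w] by (simp_all add: m_def)
 have s: "submarkov (\<lambda>w. cr (m n w))" for n
  unfolding m_def by (rule submarkov_negative_definite[OF Q]) simp
 define r where "r n w = real (Suc n) * (1 - m n w)" for n w
 have R: "0 < real (Suc n)" for n by simp
 have r: "0 < r n w" "r n w \<le> Q w" for n w
 proof -
  show "0 < r n w" using m by (simp add: r_def)
  have "1 - m n w \<le> inverse (real (Suc n)) * Q w"
   using exp_ge_add_one_self[of "- (inverse (real (Suc n)) * Q w)"] by (simp only: m_def)
  then have "r n w \<le> real (Suc n) * (inverse (real (Suc n)) * Q w)" unfolding r_def by (intro mult_left_mono) auto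
  then show "r n w \<le> Q w" by (simp add: mult.assoc[symmetric] del: of_nat_Suc)
 qed
 define P where "P n K w = (\<Sum>k<Suc K. cr (bcoeff g (real (Suc n)) k) * cr (m n w) ^ k)" for n K w
 have P: "P n K w = cr (\<Sum>k<Suc K. bcoeff g (real (Suc n)) k * m n w ^ k)" for n K w
  by (simp add: P_def)
 have Pm: "P n K \<in> borel_measurable borel" for n K
  unfolding P_def[abs_def] using submarkov_measurable[OF s] by (intro borel_measurable_sum borel_measurable_times borel_measurable_power) auto
 have Pl: "(\<lambda>K. P n K w) \<longlonglongrightarrow> of_real (g (r n w))" for n w
  unfolding P r_def by (intro tendsto_of_real bcoeff_series g R m)
 have gm: "(\<lambda>w. cr (g (r n w))) \<in> borel_measurable borel" for n
  by (rule borel_measurable_LIMSEQ_metric[OF Pm Pl])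
 have step: "0 \<le> Re (syn (\<lambda>w. of_real (g (r n w)) * h w) x0)" for n
 proof -
  have "(\<lambda>K. syn (\<lambda>w. P n K w * h w) x0) \<longlonglongrightarrow> syn (\<lambda>w. of_real (g (r n w)) * h w) x0"
  proof (rule syn_tendsto)
   show "L1 (\<lambda>w. g (real (Suc n)) * cmod (h w))" using h by simp
   show "(\<lambda>w. P n K w * h w) \<in> borel_measurable borel" for K using Pm hm by simp
   show "(\<lambda>w. cr (g (r n w)) * h w) \<in> borel_measurable borel" using gm hm by simp
   show "(\<lambda>K. P n K w * h w) \<longlonglongrightarrow> of_real (g (r n w)) * h w" for w by (intro tendsto_mult_right Pl)
   show "cmod (P n K w * h w) \<le> g (real (Suc n)) * cmod (h w)" for K w
    unfolding norm_mult P norm_of_real using bcoeff_series(2,3)[OF g R m, of n n w K]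
    by (intro mult_right_mono) auto
  qed
  from tendsto_Re[OF this] show ?thesis
  proof (rule LIMSEQ_le_const, intro exI allI impI)
   fix K
   have "0 \<le> (\<Sum>k<Suc K. bcoeff g (real (Suc n)) k) * M" by (intro mult_nonneg_nonneg bcoeff_sum_nonneg g R M)
   also have "\<dots> \<le> Re (syn (\<lambda>w. P n K w * h w) x0)"
    unfolding P_def by (intro submarkov_polynomial_pmp[OF s h M] bcoeff_nonpos g R)
   finally show "0 \<le> Re (syn (\<lambda>w. P n K w * h w) x0)" .
  qed
 qed
 have rl: "(\<lambda>n. r n w) \<longlonglongrightarrow> Q w" for w
 proof -
  have "(\<lambda>n. real (Suc n) * (1 - exp (- (inverse (real (Suc n)) * c)))) \<longlonglongrightarrow> c" for c :: real by real_asymp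
  then show ?thesis unfolding r_def m_def .
 qed
 have gl: "(\<lambda>n. cr (g (r n w))) \<longlonglongrightarrow> of_real (g (Q w))" for w
 proof (intro tendsto_of_real continuous_on_tendsto_compose[OF _ rl])
  show "continuous_on {0..} g" using g by (simp add: bernstein_def)
  show "Q w \<in> {0..}" using Qpos[of w] by simp
  show "\<forall>\<^sub>F n in sequentially. r n w \<in> {0..}" using less_imp_le[OF r(1)] by simp
 qed
 have "(\<lambda>n. syn (\<lambda>w. of_real (g (r n w)) * h w) x0) \<longlonglongrightarrow> syn (\<lambda>w. of_real (g (Q w)) * h w) x0"
 proof (rule syn_tendsto[OF integrable_norm[OF gh]])
  show "(\<lambda>w. cr (g (r n w)) * h w) \<in> borel_measurable borel" for n using gm hm by simp
  show "(\<lambda>w. cr (g (Q w)) * h w) \<in> borel_measurable borel" using borel_measurable_integrable[OF gh] by simp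
  show "(\<lambda>n. cr (g (r n w)) * h w) \<longlonglongrightarrow> of_real (g (Q w)) * h w" for w by (intro tendsto_mult_right gl)
  show "cmod (cr (g (r n w)) * h w) \<le> cmod (cr (g (Q w)) * h w)" for n w
   using bernstein_mono[OF g r(1,2), of n w] bernstein_nonneg[OF g, of "r n w"] bernstein_nonneg[OF g, of "Q w"] r(1)[of n w] Qpos[of w]
   by (simp add: norm_mult mult_right_mono)
 qed
 from tendsto_Re[OF this] show ?thesis by (rule LIMSEQ_le_const) (use step in blast)
qed

section \<open>Tempered distributions and weighted spaces\<close>

lemma norm_integral_mult_le:
 fixes D :: "'a::euclidean_space => complex"
 assumes D: "L1 D" and v: "v \<in> borel_measurable borel" "\<And>x. cmod (v x) \<le> e"
 shows "cmod (\<integral>x. D x * v x) \<le> e * (\<integral>x. cmod (D x))"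
proof -
 have i: "L1 (\<lambda>x. D x * v x)" using integrable_bounded_mult[OF D v] by (simp add: mult.commute)
 have "cmod (\<integral>x. D x * v x) \<le> (\<integral>x. e * cmod (D x))"
  by (rule integral_norm_bound_integral[OF i])
   (use D v(2) in \<open>auto simp: norm_mult mult.commute[of "cmod (D _)"] intro!: mult_right_mono\<close>)
 then show ?thesis by simp
qed

lemma annihilates_vanishing:
 fixes D :: "'a::euclidean_space => complex"
 assumes D: "L1 D" and z: "\<And>h. sch h \<Longrightarrow> (\<integral>x. D x * h x) = 0" and g: "vanishing g"
 shows "(\<integral>x. D x * g x) = 0"
proof -
 define I where "I = (\<integral>x. cmod (D x))"
 have I: "0 \<le> I" by (simp add: I_def)
 have gm: "g \<in> borel_measurable borel" using g by (auto simp: vanishing_def intro: borel_measurable_continuous_onI)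
 obtain M where M: "\<And>x. cmod (g x) \<le> M" using vanishing_bounded[OF g] by blast
 have "cmod (\<integral>x. D x * g x) \<le> 0 + e" if e: "0 < e" for e
 proof -
  have d: "0 < e / (I + 1)" using e I by simp
  obtain u where u: "sch u" "norm (c0mk u - c0mk g) < e / (I + 1)" using sch_dense[OF d] by blast
  have b: "cmod (g x - u x) \<le> e / (I + 1)" for x
   using norm_c0app[of "c0mk u - c0mk g" x] u(2) by (simp add: c0app_c0mk sch_vanishing u(1) g norm_minus_commute)
  obtain C where C: "\<And>x. cmod (u x) \<le> C" using vanishing_bounded[OF sch_vanishing[OF u(1)]] by blast
  have "L1 (\<lambda>x. D x * g x)" "L1 (\<lambda>x. D x * u x)"
   using integrable_bounded_mult[OF D gm M] integrable_bounded_mult[OF D sch_measurable[OF u(1)] C] by (simp_all add: mult.commute)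
  then have "(\<integral>x. D x * g x) = (\<integral>x. D x * (g x - u x))"
   using z[OF u(1)] by (simp add: right_diff_distrib)
  also have "cmod \<dots> \<le> e / (I + 1) * I"
   unfolding I_def by (rule norm_integral_mult_le[OF D]) (use gm sch_measurable[OF u(1)] b I_def in auto)
  also have "\<dots> \<le> e" using e I by (simp add: field_simps)
  finally show ?thesis by simp
 qed
 then have "cmod (\<integral>x. D x * g x) \<le> 0" by (rule field_le_epsilon)
 then show ?thesis by simp
qed

text \<open>The indicator is a bounded pointwise limit of functions vanishing at infinity:
  \<open>k\<close> rises with the distance to the complement, \<open>c\<close> cuts off at radius n
  + 1.\<close>

lemma annihilates_open:
 fixes D :: "'a::euclidean_space => complex"
 assumes D: "L1 D" and z: "\<And>h. sch h \<Longrightarrow> (\<integral>x. D x * h x) = 0" and U: "open U"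
 shows "(\<integral>x. indicator U x *\<^sub>R D x) = 0"
proof -
 \<comment> \<open>The distance to the empty set is 0 by convention, so the whole space is a case of
   its own.\<close>
 define k where "k n x = (if U = UNIV then 1 else min 1 (real n * infdist x (- U)))" for n x
 define c where "c n x = max 0 (1 - norm x / real (Suc n))" for n and x :: 'a
 have k: "0 \<le> k n x" "k n x \<le> 1" for n x by (auto simp: k_def infdist_nonneg)
 have c: "0 \<le> c n x" "c n x \<le> 1" for n x by (auto simp: c_def)
 have kc: "continuous_on UNIV (k n)" for n unfolding k_def[abs_def] by (cases "U = UNIV") (auto intro!: continuous_intros)
 have cc: "continuous_on UNIV (c n)" for n unfolding c_def[abs_def] by (auto intro!: continuous_intros)
 define g where "g n x = cr (k n x * c n x)" for n x
 have gc: "continuous_on UNIV (g n)" for n unfolding g_def[abs_def] by (intro continuous_intros kc cc)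
 have gb: "cmod (g n x) \<le> 1" for n x using k[of n x] c[of n x] by (simp add: g_def norm_mult mult_le_one)
 have gv: "vanishing (g n)" for n unfolding vanishing_def
 proof
  have "\<forall>\<^sub>F x in at_infinity. g n x = 0"
   unfolding eventually_at_infinity by (intro exI[of _ "real (Suc n)"]) (auto simp: g_def c_def field_simps)
  then show "(g n \<longlongrightarrow> 0) at_infinity" by (rule tendsto_eventually)
 qed (rule gc)
 have lim: "(\<lambda>n. g n x) \<longlonglongrightarrow> indicator U x" for x
 proof -
  have "(\<lambda>n. c n x) \<longlonglongrightarrow> max 0 (1 - 0)"
   unfolding c_def by (intro tendsto_intros) real_asymp
  moreover have "(\<lambda>n. k n x) \<longlonglongrightarrow> indicator U x"
  proof (cases "x \<in> U")
   case False
   then have "k n x = 0" for n by (auto simp: k_def)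
   then show ?thesis using False by simp
  next
   case True
   have "\<forall>\<^sub>F n in sequentially. k n x = 1"
   proof (cases "U = UNIV")
    case False
    have "0 < infdist x (- U)"
     using True False U infdist_pos_not_in_closed[of "- U" x] by auto
    then obtain N where N: "1 < real N * infdist x (- U)" using reals_Archimedean3 by blast
    have "k n x = 1" if "N \<le> n" for n
    proof -
     have "real N * infdist x (- U) \<le> real n * infdist x (- U)" using that by (intro mult_right_mono infdist_nonneg) simp
     then show ?thesis using N by (simp add: k_def)
    qed
    then show ?thesis by (auto simp: eventually_sequentially)
   qed (simp add: k_def)
   then show ?thesis using True by (simp add: tendsto_eventually)
  qed
  ultimately have "(\<lambda>n. k n x * c n x) \<longlonglongrightarrow> indicator U x * max 0 (1 - 0)" by (intro tendsto_mult)
  from tendsto_of_real[OF this, where 'a = complex] show ?thesis unfolding g_def by (cases "x \<in> U") simp_all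
 qed
 have "(\<lambda>n. \<integral>x. D x * g n x \<partial>lborel) \<longlonglongrightarrow> (\<integral>x. D x * indicator U x)"
 proof (rule integral_dominated_convergence[OF _ _ integrable_norm[OF D]])
  show "(\<lambda>x. D x * indicator U x) \<in> borel_measurable lborel" using D U by auto
  show "(\<lambda>x. D x * g n x) \<in> borel_measurable lborel" for n
   using borel_measurable_integrable[OF D] borel_measurable_continuous_onI[OF gc] by simp
  show "AE x in lborel. (\<lambda>n. D x * g n x) \<longlonglongrightarrow> D x * indicator U x" by (intro AE_I2 tendsto_mult_left lim)
  show "AE x in lborel. cmod (D x * g n x) \<le> cmod (D x)" for n using gb by (simp add: norm_mult mult_left_le)
 qed
 moreover have "(\<integral>x. D x * g n x) = 0" for n by (rule annihilates_vanishing[OF D z gv])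
 ultimately have "(\<integral>x. D x * indicator U x) = 0" using LIMSEQ_unique[OF tendsto_const] by fastforce
 moreover have "D x * indicator U x = indicator U x *\<^sub>R D x" for x by (simp add: indicator_def)
 ultimately show ?thesis by simp
qed

text \<open>Open sets are stable under intersection and generate the Borel sets, so a Dynkin
  argument extends \<open>annihilates_open\<close> to all of them.\<close>

lemma annihilates_AE:
 fixes D :: "'a::euclidean_space => complex"
 assumes D: "L1 D" and z: "\<And>h. sch h \<Longrightarrow> (\<integral>x. D x * h x) = 0"
 shows "AE x in lborel. D x = 0"
proof (rule sigma_finite_measure.density_zero[OF sigma_finite_lborel D])
 fix A :: "'a set" assume "A \<in> sets lborel"
 then have A: "A \<in> sigma_sets UNIV {U. open U}" by (simp add: borel_def)
 have si: "L1 (\<lambda>x. indicator B x *\<^sub>R D x)" if "B \<in> sigma_sets UNIV {U. open U}" for B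
  using integrable_mult_indicator[of B lborel D] that D by (simp add: borel_def)
 have st: "Int_stable {U :: 'a set. open U}" by (auto simp: Int_stable_def)
 have pw: "{U :: 'a set. open U} \<subseteq> Pow UNIV" by simp
 from st pw A have "(\<integral>x. indicator A x *\<^sub>R D x) = 0"
 proof (induction rule: sigma_sets_induct_disjoint)
  case (basic U) then show ?case by (simp add: annihilates_open[OF D z])
 next
  case (compl B)
  have "(\<integral>x. indicator (UNIV - B) x *\<^sub>R D x) = (\<integral>x. indicator UNIV x *\<^sub>R D x - indicator B x *\<^sub>R D x)"
   by (intro integral_cong) (auto simp: indicator_def)
  also have "\<dots> = 0"
   using si[OF compl(1)] D compl(2) annihilates_open[OF D z open_UNIV] by (simp add: integral_diff)
  finally show ?case .
 next
  case (union B)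
  have "set_integrable lborel (\<Union>i. B i) D" unfolding set_integrable_def using union(2) by (intro si sigma_sets.Union) auto
  moreover have "B i \<in> sets lborel" for i using union(2) by (auto simp: borel_def)
  ultimately have "(LINT x:(\<Union>i. B i)|lborel. D x) = (\<Sum>i. (LINT x:(B i)|lborel. D x))"
   using union(1) by (intro lebesgue_integral_countable_add) (auto simp: disjoint_family_on_def)
  then show ?case using union(3) by (simp add: set_lebesgue_integral_def)
 qed simp_all
 then show "set_lebesgue_integral lborel A D = 0" by (simp add: set_lebesgue_integral_def)
qed

section \<open>The spaces and norms of the statement in terms of Schwartz functions\<close>

lemma smooth_on_add_const: "smooth_on UNIV f \<Longrightarrow> smooth_on UNIV (\<lambda>x. c + f x)"
proof -
 assume f: "smooth_on UNIV f"
 have d: "((\<lambda>x. c + f x) has_derivative (\<lambda>v. dd v f x)) (at x)" for x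
  using has_derivative_add[OF has_derivative_const[of c] has_derivative_dd[OF smooth_on_UNIV_D(1)[OF f]]] by simp
 have "times_differentiable_on k UNIV (\<lambda>x. c + f x)" for k
 proof (cases k)
  case 0 then show ?thesis using smooth_on_UNIV_D(3)[OF f] by (auto intro: continuous_intros)
 next
  case (Suc j)
  have "frechet_derivative (\<lambda>x. c + f x) (at x) v = dd v f x" for x v using frechet_derivative_at[OF d[of x]] by metis
  then show ?thesis using Suc smooth_on_UNIV_D(2)[OF f] differentiableI[OF d] by (simp add: smooth_on_def)
 qed
 then show ?thesis by (simp add: smooth_on_def)
qed

lemma multi_order_0: "multi_order (\<lambda>_. 0) = 0"
 by (simp add: multi_order_def)

lemma multi_deriv_0: "multi_deriv (\<lambda>_. 0) f = f"
proof -
 have "foldr (\<lambda>i. partial_deriv i ^^ 0) js f = f" for js :: "'a list" by (induction js) auto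
 then show ?thesis by (simp add: multi_deriv_def)
qed

lemma schwartz_iff: "u \<in> schwartz \<longleftrightarrow> sch u"
proof
 assume u: "u \<in> schwartz"
 show "sch u" unfolding sch_def
 proof
  fix N
  show "sm (dec N) u"
  proof (rule sm_from_multi_deriv)
   show "smooth_on UNIV u" using u by (simp add: schwartz_def)
   fix a
   have "bdd_above (range (\<lambda>x. (1 + norm x) ^ N * cmod (multi_deriv a u x)))" using u by (simp add: schwartz_def)
   then obtain C where "\<And>x. (1 + norm x) ^ N * cmod (multi_deriv a u x) \<le> C" by (auto simp: bdd_above_def)
   then have "dec N x * ((1 + norm x) ^ N * cmod (multi_deriv a u x)) \<le> dec N x * C" for x by (intro mult_left_mono) auto
   moreover have "dec N x * ((1 + norm x) ^ N * t) = t" for x :: "real ^ 'a" and t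
    using power_dec[of x N] by (simp add: mult.assoc[symmetric] mult.commute)
   ultimately show "\<exists>C. \<forall>x. norm (multi_deriv a u x) \<le> C * dec N x" by (metis mult.commute)
  qed simp
 qed
next
 assume u: "sch u"
 have sm: "smooth_on UNIV u" by (rule sm_imp_smooth_on[OF schD[OF u, of 0]])
 show "u \<in> schwartz" unfolding schwartz_def mem_Collect_eq
 proof (intro conjI allI sm)
  fix k a
  obtain C where C: "0 < C" "\<And>x. norm (dds (map (\<lambda>i. axis i 1) (index_list a)) u x) \<le> C * dec k x"
   using sm_boundE[OF sm_dds[OF schD[OF u, of k]]] dec_nonneg by metis
  show "bdd_above (range (\<lambda>x. (1 + norm x) ^ k * cmod (multi_deriv a u x)))"
  proof (rule bdd_aboveI2)
   fix x
   have "(1 + norm x) ^ k * cmod (multi_deriv a u x) \<le> (1 + norm x) ^ k * (C * dec k x)"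
    unfolding multi_deriv_eq_dds[OF sm] by (intro mult_left_mono C) auto
   also have "\<dots> = C" using power_dec[of x k] by (simp add: mult.left_commute)
   finally show "(1 + norm x) ^ k * cmod (multi_deriv a u x) \<le> C" .
  qed
 qed
qed

lemma represents_unique:
 assumes "represents g T" "represents h T"
 shows "AE x in lborel. g x = h x"
proof -
 \<comment> \<open>The Gaussian factor makes the difference integrable and has no zeros.\<close>
 define D where "D x = (g x - h x) * gauss x" for x
 have i: "L1 (\<lambda>x. g x * f x)" "L1 (\<lambda>x. h x * f x)"
   "(\<integral>x. g x * f x) = (\<integral>x. h x * f x)" if "sch f" for f
  using assms that by (auto simp: represents_def schwartz_iff)
 have D: "L1 D" unfolding D_def left_diff_distrib by (intro integrable_diff i sch_gauss)
 have "AE x in lborel. D x = 0"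
 proof (rule annihilates_AE[OF D])
  fix f :: "real ^ 'a => complex" assume f: "sch f"
  have "sm (\<lambda>x. dec 0 x) (gauss :: real ^ 'a => complex)" by (rule schD[OF sch_gauss])
  then have "sch (\<lambda>x. gauss x * f x)" using f by (intro sch_mult_1) simp_all
  from i[OF this] show "(\<integral>x. D x * f x) = 0" by (simp add: D_def left_diff_distrib mult.assoc)
 qed
 then show ?thesis by eventually_elim (simp add: D_def gauss_def)
qed

text \<open>Makes the choice in \<open>density_of\<close> harmless: under an integral any
  representing function may replace it.\<close>

lemma density_of_AE:
 assumes "represents g T"
 shows "AE x in lborel. density_of T x = g x"
 by (rule represents_unique[OF _ assms]) (unfold density_of_def, rule someI[of "\<lambda>g. represents g T", OF assms])

lemma represents_distr_of:
 fixes u :: "real ^ 'n::finite => complex"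
 shows "sch u \<Longrightarrow> represents u (distr_of u)"
 unfolding represents_def
proof (intro conjI ballI)
 assume u: "sch u"
 show "u \<in> borel_measurable lborel" using sch_measurable[OF u] by simp
 fix h :: "real ^ 'n => complex" assume h: "h \<in> schwartz"
 show "L1 (\<lambda>x. u x * h x)"
  using h sch_integrable[OF sch_mult_1[of u h]] schD[OF u, of 0] by (simp add: schwartz_iff dec_def[abs_def])
 show "distr_of u h = (\<integral>x. u x * h x)" using h by (simp add: distr_of_def)
qed

lemma represents_fourier_distr:
 fixes u :: "real ^ 'n::finite => complex"
 shows "sch u \<Longrightarrow> represents (four u) (fourier_distr (distr_of u))"
 unfolding represents_def
proof (intro conjI ballI)
 assume u: "sch u"
 show "four u \<in> borel_measurable lborel" using sch_measurable[OF sch_four[OF u]] by simp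
 fix h :: "real ^ 'n => complex" assume h: "h \<in> schwartz"
 have s: "sch h" using h by (simp add: schwartz_iff)
 show "L1 (\<lambda>x. four u x * h x)"
  using represents_distr_of[OF sch_four[OF u]] h by (simp add: represents_def)
 have "fourier_distr (distr_of u) h = (\<integral>x. u x * four h x)"
  using h sch_four[OF s] by (simp add: fourier_distr_def fourier_eq distr_of_def schwartz_iff)
 also have "\<dots> = (\<integral>x. four u x * h x)"
  using fm_parseval[OF sch_integrable[OF u] sch_integrable[OF s]] by (simp add: four_def mult.left_commute mult.assoc)
 finally show "fourier_distr (distr_of u) h = (\<integral>x. four u x * h x)" .
qed

lemma distr_of_tempered:
 fixes u :: "real ^ 'n::finite => complex"
 assumes u: "sch u"
 shows "distr_of u \<in> tempered"
 unfolding tempered_def mem_Collect_eq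
proof (intro conjI ballI allI impI)
 fix h :: "real ^ 'n => complex" assume "h \<notin> schwartz"
 then show "distr_of u h = 0" by (simp add: distr_of_def)
next
 fix h c :: "real ^ 'n => complex" assume h: "h \<in> schwartz" and c: "c \<in> schwartz"
 have i: "L1 (\<lambda>x. u x * h x)" "L1 (\<lambda>x. u x * c x)"
  using represents_distr_of[OF u] h c by (auto simp: represents_def)
 show "distr_of u (\<lambda>x. h x + c x) = distr_of u h + distr_of u c"
  using h c i by (simp add: distr_of_def schwartz_iff sch_add distrib_left)
next
 fix a and h :: "real ^ 'n => complex" assume h: "h \<in> schwartz"
 show "distr_of u (\<lambda>x. a * h x) = a * distr_of u h"
  using h by (simp add: distr_of_def schwartz_iff sch_cmult mult.left_commute)
next
 show "\<exists>C N. \<forall>h\<in>schwartz. cmod (distr_of u h) \<le> C * (\<Sum>\<alpha> | multi_order \<alpha> \<le> N. schwartz_seminorm N \<alpha> h)"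
 proof (intro exI[of _ "\<integral>x. cmod (u x) \<partial>lborel"] exI[of _ "0 :: nat"] ballI)
  fix h :: "real ^ 'n => complex" assume h: "h \<in> schwartz"
  have e: "{\<alpha> :: 'n => nat. multi_order \<alpha> \<le> 0} = {\<lambda>_. 0}" by (auto simp: multi_order_def)
  have "\<forall>k \<alpha>. bdd_above (range (\<lambda>x. (1 + norm x) ^ k * cmod (multi_deriv \<alpha> h x)))"
   using h unfolding schwartz_def by simp
  from this[rule_format, of 0 "\<lambda>_. 0"] have "cmod (h x) \<le> schwartz_seminorm 0 (\<lambda>_. 0) h" for x
   unfolding schwartz_seminorm_def multi_deriv_0 by (auto intro: cSUP_upper)
  then have "cmod (\<integral>x. u x * h x) \<le> schwartz_seminorm 0 (\<lambda>_. 0) h * (\<integral>x. cmod (u x))"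
   using h by (intro norm_integral_mult_le sch_integrable u sch_measurable) (auto simp: schwartz_iff)
  then show "cmod (distr_of u h) \<le> (\<integral>x. cmod (u x)) * (\<Sum>\<alpha> | multi_order \<alpha> \<le> 0. schwartz_seminorm 0 \<alpha> h)"
   using h unfolding e by (simp add: distr_of_def mult.commute)
 qed
qed

lemma H_norm_sq_distr_of:
 assumes u: "sch u"
 shows "H_norm_sq g s (distr_of u) = (\<integral>\<^sup>+ w. ennreal ((1 + g w) powr s * (cmod (four u w))\<^sup>2) \<partial>lborel)"
 unfolding H_norm_sq_def
 by (rule nn_integral_cong_AE, rule AE_mp[OF density_of_AE[OF represents_fourier_distr[OF u]]]) (auto intro!: AE_I2)

lemma H_norm_distr_of:
 assumes u: "sch u" and i: "L1 (\<lambda>w. (1 + g w) powr s * (cmod (four u w))\<^sup>2)"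
 shows "(H_norm g s (distr_of u))\<^sup>2 = (\<integral>w. (1 + g w) powr s * (cmod (four u w))\<^sup>2)"
  and "distr_of u \<in> H_space g s"
proof -
 have e: "H_norm_sq g s (distr_of u) = ennreal (\<integral>w. (1 + g w) powr s * (cmod (four u w))\<^sup>2)"
  unfolding H_norm_sq_distr_of[OF u] by (rule nn_integral_eq_integral[OF i]) simp
 show "(H_norm g s (distr_of u))\<^sup>2 = (\<integral>w. (1 + g w) powr s * (cmod (four u w))\<^sup>2)"
  unfolding H_norm_def e by (simp add: integral_nonneg)
 show "distr_of u \<in> H_space g s"
  unfolding H_space_def using distr_of_tempered[OF u] represents_fourier_distr[OF u] e by auto
qed

lemma L2_norm_density_of:
 assumes u: "sch u"
 shows "(L2_norm (density_of (distr_of u)))\<^sup>2 = (\<integral>w. (cmod (four u w))\<^sup>2)"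
proof -
 have r: "represents (density_of (distr_of u)) (distr_of u)"
  unfolding density_of_def by (rule someI[of "\<lambda>g. represents g (distr_of u)", OF represents_distr_of[OF u]])
 have "(\<integral>x. (cmod (density_of (distr_of u) x))\<^sup>2) = (\<integral>x. (cmod (u x))\<^sup>2)"
 proof (rule integral_cong_AE)
  have "density_of (distr_of u) \<in> borel_measurable lborel" using r unfolding represents_def by (rule conjunct1)
  then show "(\<lambda>x. (cmod (density_of (distr_of u) x))\<^sup>2) \<in> borel_measurable lborel" by simp
  show "(\<lambda>x. (cmod (u x))\<^sup>2) \<in> borel_measurable lborel" using sch_measurable[OF u] by simp
  show "AE x in lborel. (cmod (density_of (distr_of u) x))\<^sup>2 = (cmod (u x))\<^sup>2"
   using density_of_AE[OF represents_distr_of[OF u]] by eventually_elim simp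
 qed
 also have "\<dots> = (\<integral>x. (cmod (four u x))\<^sup>2)"
 proof -
  have "cr (\<integral>x. (cmod (u x))\<^sup>2) = cr (\<integral>x. (cmod (four u x))\<^sup>2)"
   using plancherel[OF u u] by (simp add: complex_norm_square[symmetric] flip: of_real_power integral_complex_of_real)
  then show ?thesis by (simp only: of_real_eq_iff)
 qed
 finally show ?thesis unfolding L2_norm_def by (simp add: integral_nonneg)
qed

lemma C_infty_iff: "u \<in> C_infty \<longleftrightarrow> vanishing u"
 by (simp add: C_infty_def vanishing_def)

lemma sup_norm_c0app: "sup_norm (c0app f) = norm f"
 by (simp add: sup_norm_def norm_c0_Sup)

lemma feller_pdo_feller:
 fixes L :: "real ^ 'n::finite => real"
 assumes F: "feller_pdo L p k0 \<gamma> lam0 m"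
 shows "\<exists>T :: 'n operator_family. feller_semigroup T \<and>
  (\<forall>u. sch u \<longrightarrow> u \<in> generator_domain T \<and> generator T u = (\<lambda>x. - pdo.Pop p u x))"
proof -
 interpret F: feller_pdo L p k0 \<gamma> lam0 m by (rule F)
 obtain T :: "real => (real ^ 'n) c0fun => (real ^ 'n) c0fun" where
    T_add: "\<And>t f g. 0 \<le> t \<Longrightarrow> T t (f + g) = T t f + T t g"
  and T_scale: "\<And>t a f. 0 \<le> t \<Longrightarrow> T t (F.cscale a f) = F.cscale a (T t f)"
  and T_0: "\<And>f. T 0 f = f"
  and T_semi: "\<And>s t f. 0 \<le> s \<Longrightarrow> 0 \<le> t \<Longrightarrow> T (s + t) f = T s (T t f)"
  and T_cont: "\<And>f. ((\<lambda>t. norm (T t f - f)) \<longlongrightarrow> 0) (at_right 0)"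
  and T_norm: "\<And>t f. 0 \<le> t \<Longrightarrow> norm (T t f) \<le> norm f"
  and T_pos: "\<And>t c f. 0 \<le> t \<Longrightarrow> cmod c = 1 \<Longrightarrow> pos_part_norm c (T t f) \<le> pos_part_norm c f"
  and T_gen: "\<And>f. f \<in> F.dom \<Longrightarrow> ((\<lambda>t. norm ((1 / t) *\<^sub>R (T t f - f) - F.Aop f)) \<longlongrightarrow> 0) (at_right 0)"
  by (rule F.semigroup) (rule that; assumption)
 \<comment> \<open>Outside \<open>C_infty\<close> the values are arbitrary; every clause of
   \<open>feller_semigroup\<close> quantifies over \<open>C_infty\<close>.\<close>
 define S :: "'n operator_family" where "S t u = c0app (T t (c0mk u))" for t u
 have mk_add: "c0mk (\<lambda>x. u x + v x) = c0mk u + c0mk v" if "vanishing u" "vanishing v" for u v :: "real ^ 'n => complex"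
 proof (rule c0fun_eqI)
  have "vanishing (\<lambda>x. u x + v x)" using that by (auto simp: vanishing_def intro!: continuous_intros tendsto_add_zero)
  then show "c0app (c0mk (\<lambda>x. u x + v x)) x = c0app (c0mk u + c0mk v) x" for x using that by (simp add: c0app_c0mk)
 qed
 have mk_scale: "c0mk (\<lambda>x. a * u x) = F.cscale a (c0mk u)" if "vanishing u" for a and u :: "real ^ 'n => complex"
  using that by (simp add: F.cscale_def c0app_c0mk)
 have nonpos: "Re (c * S t u x) \<le> 0" if t: "0 \<le> t" and c: "cmod c = 1" and u: "vanishing u" "\<And>x. Re (c * u x) \<le> 0" for t c u x
 proof -
  have "pos_part_norm c (T t (c0mk u)) \<le> pos_part_norm c (c0mk u)" by (rule T_pos[OF t c])
  also have "\<dots> \<le> 0" using u by (intro pos_part_norm_least) (simp_all add: c0app_c0mk)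
  finally show ?thesis using pos_part_norm_upper[OF c, of "T t (c0mk u)" x] by (simp add: S_def)
 qed
 have gen_iff: "has_generator_value S u w \<longleftrightarrow> ((\<lambda>t. (1 / t) *\<^sub>R (T t (c0mk u) - c0mk u)) \<longlongrightarrow> c0mk w) (at_right 0)"
  if u: "vanishing u" and w: "vanishing w" for u w
 proof -
  have "(\<lambda>x. (S t u x - u x) / cr t - w x) = c0app ((1 / t) *\<^sub>R (T t (c0mk u) - c0mk u) - c0mk w)" for t
   using u w by (auto simp: S_def c0app_c0mk)
  then have "has_generator_value S u w \<longleftrightarrow> ((\<lambda>t. norm ((1 / t) *\<^sub>R (T t (c0mk u) - c0mk u) - c0mk w)) \<longlongrightarrow> 0) (at_right 0)"
   using u w by (simp add: has_generator_value_def C_infty_iff sup_norm_c0app)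
  then show ?thesis by (simp add: tendsto_norm_zero_iff LIM_zero_iff)
 qed
 have "feller_semigroup S" unfolding feller_semigroup_def C_infty_iff
 proof (intro conjI allI ballI impI)
  fix t :: real and u :: "real ^ 'n => complex"
  show "vanishing (S t u)" by (simp add: S_def vanishing_c0app)
 next
  fix t :: real and u v :: "real ^ 'n => complex" assume t: "0 \<le> t" and u: "u \<in> C_infty" "v \<in> C_infty"
  show "S t (\<lambda>x. u x + v x) = (\<lambda>x. S t u x + S t v x)"
   using u by (auto simp: S_def mk_add C_infty_iff T_add[OF t])
 next
  fix t :: real and a and u :: "real ^ 'n => complex" assume t: "0 \<le> t" and u: "u \<in> C_infty"
  show "S t (\<lambda>x. a * u x) = (\<lambda>x. a * S t u x)"
   using u by (simp add: S_def mk_scale C_infty_iff T_scale[OF t] F.c0app_cscale)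
 next
  fix u :: "real ^ 'n => complex" assume u: "u \<in> C_infty"
  show "S 0 u = u" using u by (simp add: S_def T_0 c0app_c0mk C_infty_iff)
 next
  fix s t :: real and u :: "real ^ 'n => complex" assume "0 \<le> s" "0 \<le> t"
  then show "S (s + t) u = S s (S t u)" by (simp add: S_def T_semi c0mk_c0app)
 next
  fix u :: "real ^ 'n => complex" assume u: "u \<in> C_infty"
  have "(\<lambda>x. S t u x - u x) = c0app (T t (c0mk u) - c0mk u)" for t
   using u by (auto simp: S_def c0app_c0mk C_infty_iff)
  then show "((\<lambda>t. sup_norm (\<lambda>x. S t u x - u x)) \<longlongrightarrow> 0) (at_right 0)" using T_cont by (simp add: sup_norm_c0app)
 next
  fix t :: real and u :: "real ^ 'n => complex" and x assume t: "0 \<le> t" and u: "u \<in> C_infty" "\<forall>x. u x \<in> \<real>\<^sub>\<ge>\<^sub>0"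
  \<comment> \<open>The half norm for -1 controls the real part of the image from below; those for
    \<i> and -\<i> force its imaginary part to vanish.\<close>
  have u': "vanishing u" "\<And>x. 0 \<le> Re (u x)" "\<And>x. Im (u x) = 0" using u by (auto simp: C_infty_iff complex_nonneg_Reals_iff)
  have "Re (- 1 * S t u x) \<le> 0" by (rule nonpos[OF t _ u'(1)]) (simp_all add: u')
  moreover have "Re (\<i> * S t u x) \<le> 0" by (rule nonpos[OF t _ u'(1)]) (simp_all add: u')
  moreover have "Re (- \<i> * S t u x) \<le> 0" by (rule nonpos[OF t _ u'(1)]) (simp_all add: u')
  ultimately show "S t u x \<in> \<real>\<^sub>\<ge>\<^sub>0" by (simp add: complex_nonneg_Reals_iff)
 next
  fix t :: real and u :: "real ^ 'n => complex" assume t: "0 \<le> t" and u: "u \<in> C_infty"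
  show "sup_norm (S t u) \<le> sup_norm u"
   using T_norm[OF t, of "c0mk u"] u by (simp add: S_def sup_norm_c0app[symmetric] C_infty_iff c0app_c0mk)
 qed
 moreover have "u \<in> generator_domain S \<and> generator S u = (\<lambda>x. - pdo.Pop p u x)" if u: "sch u" for u
 proof -
  have v: "vanishing u" and w: "vanishing (\<lambda>x. - pdo.Pop p u x)"
   using sch_vanishing[OF u] sch_vanishing[OF sch_cmult[OF F.sch_Pop[OF u], of "-1"]] by simp_all
  have d: "c0mk u \<in> F.dom" by (simp add: F.dom_def c0app_c0mk v u)
  have A: "F.Aop (c0mk u) = c0mk (\<lambda>x. - pdo.Pop p u x)" by (simp add: F.Aop_def c0app_c0mk v)
  have g: "has_generator_value S u (\<lambda>x. - pdo.Pop p u x)"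
   using T_gen[OF d] unfolding gen_iff[OF v w] A by (simp add: tendsto_norm_zero_iff LIM_zero_iff)
  \<comment> \<open>\<open>generator\<close> is a definite description, so uniqueness of the limit
    has to be shown as well.\<close>
  have un: "w' = (\<lambda>x. - pdo.Pop p u x)" if w': "has_generator_value S u w'" for w' :: "real ^ 'n => complex"
  proof -
   have vw: "vanishing w'" using w' by (simp add: has_generator_value_def C_infty_iff)
   have "c0mk w' = c0mk (\<lambda>x. - pdo.Pop p u x)"
    by (rule tendsto_unique[OF trivial_limit_at_right_real gen_iff[OF v vw, THEN iffD1, OF w'] gen_iff[OF v w, THEN iffD1, OF g]])
   from arg_cong[OF this, of c0app] show ?thesis by (simp only: c0app_c0mk[OF vw] c0app_c0mk[OF w])
  qed
  have "generator S u = (\<lambda>x. - pdo.Pop p u x)" unfolding generator_def by (rule the_equality[of "has_generator_value S u", OF g un])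
  then show ?thesis using g unfolding generator_domain_def by blast
 qed
 ultimately show ?thesis by blast
qed

section \<open>From the classes of symbols to the abstract assumptions\<close>

lemma negative_definite_nonneg:
 assumes "negative_definite (\<lambda>w. cr (Q w))"
 shows "0 \<le> Q w"
proof -
 have "cmod (cr (exp (- (1 * Q w)))) \<le> 1"
  by (rule submarkov_norm[OF submarkov_negative_definite[OF assms]]) simp
 then show ?thesis by simp
qed

lemma Lambda_nonneg: "g \<in> Lambda_class \<Longrightarrow> 0 \<le> g w"
 by (rule negative_definite_nonneg) (simp add: Lambda_class_def)

text \<open>A derivative of \<open>dd (axis i 1) L\<close> is one of L whose multi-index has order
  at least 1, and from order 1 on the bounds in \<Lambda> are at most the square root of L.\<close>

lemma Lambda_weight:
 assumes g: "g \<in> Lambda_class"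
 shows "weight (\<lambda>w. 1 + g w)"
proof -
 define L where "L w = 1 + g w" for w
 have L1: "1 \<le> L w" for w using Lambda_nonneg[OF g] by (simp add: L_def)
 have sL: "smooth_on UNIV L" unfolding L_def[abs_def] using g by (intro smooth_on_add_const) (simp add: Lambda_class_def)
 obtain c where c: "\<And>a w. \<bar>multi_deriv a L w\<bar> \<le> c (multi_order a) * L w powr ((2 - real (rho (multi_order a))) / 2)"
  using g unfolding Lambda_class_def L_def[abs_def] by blast
 have cb: "\<bar>multi_deriv a L w\<bar> \<le> \<bar>c (multi_order a)\<bar> * L w powr r" if "(2 - real (rho (multi_order a))) / 2 \<le> r" for a w r
 proof -
  have "c (multi_order a) * L w powr ((2 - real (rho (multi_order a))) / 2) \<le> \<bar>c (multi_order a)\<bar> * L w powr r"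
   using that L1[of w] by (intro mult_mono powr_mono) auto
  then show ?thesis using c[of a w] by linarith
 qed
 have "sm L L"
 proof (rule sm_from_multi_deriv[OF sL])
  show "0 \<le> L x" for x using L1[of x] by simp
  have "\<bar>multi_deriv a L x\<bar> \<le> \<bar>c (multi_order a)\<bar> * L x" for a x using cb[of a 1 x] L1[of x] by simp
  then show "\<exists>C. \<forall>x. norm (multi_deriv a L x) \<le> C * L x" for a by auto
 qed
 moreover have "sm (\<lambda>w. L w powr (1/2)) (dd v L)" for v
 proof -
  have b: "sm (\<lambda>w. L w powr (1/2)) (dd (axis i 1) L)" for i
  proof (rule sm_from_multi_deriv)
   show s: "smooth_on UNIV (dd (axis i 1) L)" by (rule smooth_on_UNIV_D(2)[OF sL])
   fix a
   define \<beta> where "\<beta> = count (mset (index_list a @ [i]))"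
   have "multi_deriv a (dd (axis i 1) L) = dds (map (\<lambda>i. axis i 1) (index_list a @ [i])) L"
    unfolding multi_deriv_eq_dds[OF s] by simp
   also have "\<dots> = dds (map (\<lambda>i. axis i 1) (index_list \<beta>)) L"
    by (rule dds_mset[OF sL]) (simp only: mset_map \<beta>_def mset_index_list)
   also have "\<dots> = multi_deriv \<beta> L" by (rule multi_deriv_eq_dds[OF sL, symmetric])
   finally have e: "multi_deriv a (dd (axis i 1) L) = multi_deriv \<beta> L" .
   have "multi_order \<beta> = size (mset (index_list \<beta>))" by (simp add: length_index_list)
   also have "\<dots> = Suc (multi_order a)" unfolding \<beta>_def mset_index_list by (simp add: length_index_list)
   finally have "(2 - real (rho (multi_order \<beta>))) / 2 \<le> 1 / 2" by (simp add: rho_def)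
   from cb[OF this] show "\<exists>C. \<forall>x. norm (multi_deriv a (dd (axis i 1) L) x) \<le> C * L x powr (1/2)"
    unfolding e real_norm_def by blast
  qed simp
  have "dd v L = (\<lambda>x. \<Sum>i\<in>UNIV. v $ i *\<^sub>R dd (axis i 1) L x)"
  proof
   fix x
   have lin: "linear (\<lambda>v. dd v L x)"
    by (rule bounded_linear.linear[OF has_derivative_bounded_linear[OF has_derivative_dd[OF smooth_on_UNIV_D(1)[OF sL]]]])
   have ve: "v = (\<Sum>i\<in>UNIV. v $ i *\<^sub>R axis i 1)"
    using basis_expansion[of v] by (simp add: scalar_mult_eq_scaleR)
   have "dd v L x = dd (\<Sum>i\<in>UNIV. v $ i *\<^sub>R axis i 1) L x" by (rule arg_cong[OF ve])
   also have "\<dots> = (\<Sum>i\<in>UNIV. v $ i *\<^sub>R dd (axis i 1) L x)" by (simp only: linear_sum[OF lin] linear_scale[OF lin])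
   finally show "dd v L x = (\<Sum>i\<in>UNIV. v $ i *\<^sub>R dd (axis i 1) L x)" .
  qed
  then show ?thesis using b by (simp only:) (intro sm_sum sm_scaleR, auto)
 qed
 ultimately show ?thesis using L1 unfolding L_def[abs_def] by (intro weight.intro)
qed

text \<open>Since \<open>1 + g w\<close> is at least 1, the bound without \<xi>-derivatives is the
  weakest and can serve as the single weight for all orders.\<close>

lemma symbol_class_sm:
 assumes p: "p \<in> symbol_class m g" and g: "\<And>w. 0 \<le> g w"
 shows "sm (\<lambda>(x, w). (1 + g w) powr (m / 2)) (\<lambda>(x, w). p x w)"
proof (rule sm_from_symbol)
 show "smooth_on UNIV (\<lambda>(x, w). p x w)" using p by (simp add: symbol_class_def)
 fix a b
 obtain c where c: "0 \<le> c" "\<And>x w. cmod (multi_deriv b (\<lambda>y. multi_deriv a (p y) w) x) \<le> c * (1 + g w) powr ((m - real (rho (multi_order a))) / 2)"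
  using p unfolding symbol_class_def by blast
 have "cmod (multi_deriv b (\<lambda>y. multi_deriv a (p y) w) x) \<le> c * (1 + g w) powr (m / 2)" for x w
  by (rule order_trans[OF c(2)]) (use c(1) g[of w] in \<open>auto intro!: mult_left_mono powr_mono\<close>)
 then show "\<exists>C. \<forall>x w. cmod (multi_deriv b (\<lambda>y. multi_deriv a (p y) w) x) \<le> C * (1 + g w) powr (m / 2)" by blast
qed simp

lemma symbol_class_bound:
 assumes "p \<in> symbol_class m g"
 obtains c where "0 \<le> c" "\<And>x w. cmod (p x w) \<le> c * (1 + g w) powr (m / 2)"
proof -
 have "\<forall>a b. \<exists>c\<ge>0. \<forall>x w. cmod (multi_deriv b (\<lambda>y. multi_deriv a (p y) w) x) \<le> c * (1 + g w) powr ((m - real (rho (multi_order a))) / 2)"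
  using assms unfolding symbol_class_def by blast
 from this[rule_format, of "\<lambda>_. 0" "\<lambda>_. 0"] show ?thesis
  using that by (auto simp: multi_deriv_0 multi_order_0 rho_def)
qed

text \<open>Growth near infinity becomes the bound
  \<open>d * (1 + norm w) powr s \<le> 1 + \<psi> w\<close> everywhere, and \<open>m\<close> is the
  power that turns its left side into a multiple of \<open>dec (2 * DIM('a))\<close>.\<close>

lemma growth_integrable:
 fixes \<psi> :: "'a::euclidean_space => real"
 assumes \<psi>: "\<And>w. 0 \<le> \<psi> w" "continuous_on UNIV \<psi>" and c: "0 < c" "0 < s"
  and g: "\<forall>\<^sub>F w in at_infinity. c * norm w powr s \<le> \<psi> w"
 obtains m where "L1 (\<lambda>w. (1 + \<psi> w) powr (- m))"
proof -
 obtain r0 where r0: "\<And>w. r0 \<le> norm w \<Longrightarrow> c * norm w powr s \<le> \<psi> w" using g by (auto simp: eventually_at_infinity)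
 define r where "r = max r0 1"
 define d where "d = min (c / 2 powr s) (1 / (1 + r) powr s)"
 have r: "1 \<le> r" by (simp add: r_def)
 have d: "0 < d" using c r by (simp add: d_def)
 have low: "d * (1 + norm w) powr s \<le> 1 + \<psi> w" for w
 proof (cases "r \<le> norm w")
  case True
  have "(1 + norm w) powr s \<le> (2 * norm w) powr s" using True r c by (intro powr_mono2) auto
  also have "\<dots> = 2 powr s * norm w powr s" by (simp add: powr_mult)
  finally have "d * (1 + norm w) powr s \<le> c / 2 powr s * (2 powr s * norm w powr s)"
   using d c by (intro mult_mono) (auto simp: d_def)
  also have "\<dots> = c * norm w powr s" by simp
  also have "\<dots> \<le> \<psi> w" using True by (intro r0) (simp add: r_def)
  finally show ?thesis by simp
 next
  case False
  have "(1 + norm w) powr s \<le> (1 + r) powr s" using False c by (intro powr_mono2) auto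
  then have "d * (1 + norm w) powr s \<le> 1 / (1 + r) powr s * (1 + r) powr s"
   using d by (intro mult_mono) (auto simp: d_def)
  also have "\<dots> = 1" using r by simp
  finally show ?thesis using \<psi>(1)[of w] by simp
 qed
 define m where "m = real (2 * DIM('a)) / s"
 have m: "0 < m" using c by (simp add: m_def)
 have "L1 (\<lambda>w. (1 + \<psi> w) powr (- m))"
 proof (rule Bochner_Integration.integrable_bound)
  show "L1 (\<lambda>w::'a. d powr (- m) * dec (2 * DIM('a)) w)" by (intro integrable_mult_right integrable_dec) simp
  have "continuous_on UNIV (\<lambda>w. (1 + \<psi> w) powr (- m))"
   using \<psi>(1) by (intro continuous_intros \<psi>(2)) (simp add: add_nonneg_eq_0_iff)
  then show "(\<lambda>w. (1 + \<psi> w) powr (- m)) \<in> borel_measurable lborel" using borel_measurable_continuous_onI by auto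
  show "AE w in lborel. norm ((1 + \<psi> w) powr (- m)) \<le> norm (d powr (- m) * dec (2 * DIM('a)) w)"
  proof (rule AE_I2)
   fix w :: 'a
   have p: "0 < 1 + norm w" by (simp add: add_pos_nonneg)
   have "(1 + \<psi> w) powr (- m) \<le> (d * (1 + norm w) powr s) powr (- m)"
    using low[of w] d m p by (intro powr_mono2') auto
   also have "\<dots> = d powr (- m) * (1 + norm w) powr (- real (2 * DIM('a)))"
    using c p by (simp add: powr_mult powr_powr m_def)
   also have "(1 + norm w) powr (- real (2 * DIM('a))) = dec (2 * DIM('a)) w"
    unfolding powr_minus powr_realpow[OF p] dec_def ..
   finally show "norm ((1 + \<psi> w) powr (- m)) \<le> norm (d powr (- m) * dec (2 * DIM('a)) w)" by simp
  qed
 qed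
 then show ?thesis by (rule that)
qed

theorem theorem3p4:
  fixes f :: "real ^ 'n::finite \<Rightarrow> real \<Rightarrow> real"
    and f0 f1 :: "real \<Rightarrow> real"
    and \<psi> \<psi>0 \<psi>1 :: "real ^ 'n \<Rightarrow> real"
    and q p :: "real ^ 'n \<Rightarrow> real ^ 'n \<Rightarrow> real"
    and B :: "'n functional \<Rightarrow> 'n functional \<Rightarrow> complex"
    and ct0 ct1 \<rho>0 \<rho>1 c0 c1 c0' \<sigma> \<tau>0 \<tau>1 lambda0 \<kappa> \<gamma> :: real
  assumes f_smooth: "smooth_on (UNIV \<times> {0..}) (\<lambda>(y, s). f y s)"
    and f_bernstein: "\<And>y. bernstein (f y)"
    and f0_bernstein: "bernstein f0"
    and f1_bernstein: "bernstein f1"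
    and f_lower: "\<And>s. 0 \<le> s \<Longrightarrow> ereal (f0 s) \<le> (INF y. ereal (f y s))"
    and f_upper: "\<And>s. 0 \<le> s \<Longrightarrow> (SUP y. ereal (f y s)) \<le> ereal (f1 s)"
    and f0_growth_const: "0 < ct0" "0 < \<rho>0"
    and f0_growth: "\<forall>\<^sub>F s in at_top. ct0 * s powr \<rho>0 \<le> f0 s"
    and \<psi>_Lambda: "\<psi> \<in> Lambda_class"
    and \<psi>_growth_const: "0 < ct1" "0 < \<rho>1"
    and \<psi>_growth: "\<forall>\<^sub>F \<xi> in at_infinity. ct1 * norm \<xi> powr \<rho>1 \<le> \<psi> \<xi>"
    and q_symbol: "(\<lambda>x \<xi>. complex_of_real (q x \<xi>)) \<in> symbol_class 2 \<psi>"
    and q_negdef: "negative_definite_symbol (\<lambda>x \<xi>. complex_of_real (q x \<xi>))"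
    and q_elliptic: "elliptic \<psi> q"
    and c0_pos: "0 < c0"
    and c1_ge: "1 \<le> c1"
    and q_comparable: "\<And>x \<xi>. c0 \<le> q x \<xi> / \<psi> \<xi> \<and> q x \<xi> / \<psi> \<xi> \<le> c1"
    and p_def: "p = (\<lambda>x \<xi>. f x (q x \<xi>))"
    and \<psi>1_def: "\<psi>1 = (\<lambda>\<xi>. c1 * f1 (\<psi> \<xi>))"
    and c0'_pos: "0 < c0'"
    and c0'_bound: "\<And>x \<xi>. c0' * f0 (\<psi> \<xi>) \<le> f0 (q x \<xi>)"
    and \<psi>0_def: "\<psi>0 = (\<lambda>\<xi>. c0' * f0 (\<psi> \<xi>))"
    and \<psi>0_Lambda: "\<psi>0 \<in> Lambda_class"
    and \<psi>1_Lambda: "\<psi>1 \<in> Lambda_class"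
    and \<sigma>: "0 < \<sigma>" "\<sigma> < 1 / 2"
    and \<tau>1: "0 \<le> \<tau>1"
    and \<tau>0: "0 < \<tau>0"
    and lambda0: "0 \<le> lambda0"
    and i_symbol:
      "(\<lambda>x \<xi>. complex_of_real ((1 + \<psi>1 \<xi>) powr (1 / 2))) \<in> symbol_class (1 + \<sigma>) \<psi>0"
    and i_embedding: "\<And>m. 0 \<le> m \<Longrightarrow> H_continuously_embedded \<psi>0 (m * (1 + \<sigma>)) \<psi>1 m"
    and ii_p: "(\<lambda>x \<xi>. complex_of_real (p x \<xi>)) \<in> symbol_class (2 + \<tau>1) \<psi>1"
    and ii_resolvent:
      "\<And>\<mu>. lambda0 \<le> \<mu> \<Longrightarrow>
        (\<lambda>x \<xi>. complex_of_real (1 / (p x \<xi> + \<mu>))) \<in> symbol_class (- 2 + \<tau>0) \<psi>0"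
    and \<kappa>: "0 \<le> \<kappa>"
    and iii_bounded:
      "\<And>u v. u \<in> schwartz \<Longrightarrow> v \<in> schwartz \<Longrightarrow>
        cmod (L2_inner (pseudo_diff (\<lambda>x \<xi>. complex_of_real (p x \<xi>)) u) v)
          \<le> \<kappa> * H_norm \<psi>1 1 (distr_of u) * H_norm \<psi>1 1 (distr_of v)"
    and iii_extension:
      "continuous_form_extension \<psi>1 1
        (\<lambda>u v. L2_inner (pseudo_diff (\<lambda>x \<xi>. complex_of_real (p x \<xi>)) u) v) B"
    and \<gamma>: "0 < \<gamma>"
    and iii_garding:
      "\<And>u. u \<in> H_space \<psi>1 1 \<Longrightarrow>
        \<gamma> * (H_norm \<psi>0 1 u)\<^sup>2 - lambda0 * (L2_norm (density_of u))\<^sup>2 \<le> Re (B u u)"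
    and small: "\<tau>1 + \<tau>0 + \<sigma> * (2 + \<tau>1) < 1"
  shows "\<exists>T :: 'n operator_family.
    feller_semigroup T \<and>
    schwartz \<subseteq> generator_domain T \<and>
    (\<forall>u\<in>schwartz. generator T u = (\<lambda>x. - pseudo_diff (\<lambda>x \<xi>. complex_of_real (p x \<xi>)) u x))"
proof -
 define L where "L w = 1 + \<psi>0 w" for w
 define P where "P z = cr (p (fst z) (snd z))" for z
 \<comment> \<open>The order of the symbol in terms of \<open>\<psi>0\<close>: it has order 2 +
   \<tau>1 with respect to \<open>\<psi>1\<close>, and \<open>i_symbol\<close> bounds 1 +
   \<open>\<psi>1\<close> by a multiple of the power 1 + \<sigma> of 1 +
   \<open>\<psi>0\<close>.\<close>
 define k0 where "k0 = (1 + \<sigma>) * (2 + \<tau>1)"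
 have \<psi>nn: "0 \<le> \<psi> w" "0 \<le> \<psi>0 w" "0 \<le> \<psi>1 w" for w
  using \<psi>_Lambda \<psi>0_Lambda \<psi>1_Lambda by (simp_all add: Lambda_nonneg)
 have cont: "continuous_on UNIV \<psi>0" "continuous_on UNIV \<psi>1"
  using \<psi>0_Lambda \<psi>1_Lambda smooth_on_UNIV_D(3) by (auto simp: Lambda_class_def)
 interpret W: weight L unfolding L_def[abs_def] by (rule Lambda_weight[OF \<psi>0_Lambda])
 obtain C where C: "0 \<le> C" "\<And>x w. cmod (cr ((1 + \<psi>1 w) powr (1 / 2))) \<le> C * (1 + \<psi>0 w) powr ((1 + \<sigma>) / 2)"
  using symbol_class_bound[OF i_symbol] by metis
 have half: "(1 + \<psi>1 w) powr (1 / 2) \<le> C * L w powr ((1 + \<sigma>) / 2)" for w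
  using C(2)[of w] by (simp add: L_def)
 have pow: "(1 + \<psi>1 w) powr (r / 2) \<le> C powr r * L w powr ((1 + \<sigma>) * r / 2)" if r: "0 \<le> r" for r w
 proof -
  have "((1 + \<psi>1 w) powr (1 / 2)) powr r \<le> (C * L w powr ((1 + \<sigma>) / 2)) powr r"
   using half[of w] r by (intro powr_mono2) auto
  then show ?thesis using C(1) by (simp add: powr_powr powr_mult)
 qed
 have psm: "sm (\<lambda>(x, w). L w powr (k0 / 2)) P"
 proof -
  have 1: "sm (\<lambda>(x, w). (1 + \<psi>1 w) powr ((2 + \<tau>1) / 2)) (\<lambda>(x, w). cr (p x w))"
   by (rule symbol_class_sm[OF ii_p \<psi>nn(3)])
  have "sm (\<lambda>(x, w). L w powr (k0 / 2)) (\<lambda>(x, w). cr (p x w))"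
  proof (rule sm_mono[OF 1, where c = "C powr (2 + \<tau>1)"])
   fix z :: "(real ^ 'n) \<times> (real ^ 'n)"
   show "0 \<le> (case z of (x, w) => (1 + \<psi>1 w) powr ((2 + \<tau>1) / 2))" by (cases z) simp
   show "(case z of (x, w) => (1 + \<psi>1 w) powr ((2 + \<tau>1) / 2)) \<le> C powr (2 + \<tau>1) * (case z of (x, w) => L w powr (k0 / 2))"
    using pow[of "2 + \<tau>1" "snd z"] \<tau>1 by (cases z) (simp add: k0_def)
  qed
  moreover have "P = (\<lambda>(x, w). cr (p x w))" by (auto simp: P_def)
  ultimately show ?thesis by simp
 qed
 have Pc: "continuous_on UNIV P" using smD(3)[OF psm] .
 obtain CP where CP: "\<And>z. cmod (P z) \<le> CP * (case z of (x, w) => L w powr (k0 / 2))"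
  using smD(4)[OF psm] by blast
 have op: "kap TYPE(real ^ 'n) * osc (\<lambda>z. P z * four u (snd z)) x x = pseudo_diff (\<lambda>x w. cr (p x w)) u x" for u x
  by (simp add: pseudo_diff_def osc_def P_def kap_def fourier_eq mult.assoc)
 \<comment> \<open>Far out \<psi> exceeds the threshold in \<open>f0_growth\<close>, so the two
   growth conditions combine: \<open>\<psi>0\<close> grows at least like |w| to the power \<rho>0
   \<rho>1, and a negative power of L is integrable.\<close>
 obtain m where m: "L1 (\<lambda>w. L w powr (- m))"
 proof -
  have "filterlim \<psi> at_top at_infinity"
  proof (rule filterlim_at_top_mono[OF _ \<psi>_growth])
   have "filterlim (\<lambda>t :: real. t powr \<rho>1) at_top at_top" using \<psi>_growth_const(2) by real_asymp
   then have "filterlim (\<lambda>w :: real ^ 'n. norm w powr \<rho>1) at_top at_infinity"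
    by (rule filterlim_compose[OF _ filterlim_norm_at_top])
   then show "filterlim (\<lambda>w :: real ^ 'n. ct1 * norm w powr \<rho>1) at_top at_infinity"
    by (intro filterlim_tendsto_pos_mult_at_top[OF tendsto_const \<psi>_growth_const(1)])
  qed
  then have "\<forall>\<^sub>F w in at_infinity. ct0 * \<psi> w powr \<rho>0 \<le> f0 (\<psi> w)"
   using f0_growth by (rule eventually_compose_filterlim[rotated])
  with \<psi>_growth have "\<forall>\<^sub>F w in at_infinity. (c0' * ct0 * ct1 powr \<rho>0) * norm w powr (\<rho>1 * \<rho>0) \<le> \<psi>0 w"
  proof eventually_elim
   case (elim w)
   have "(ct1 * norm w powr \<rho>1) powr \<rho>0 \<le> \<psi> w powr \<rho>0"
    using elim(1) \<psi>_growth_const f0_growth_const by (intro powr_mono2) auto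
   then have "ct0 * (ct1 powr \<rho>0 * norm w powr (\<rho>1 * \<rho>0)) \<le> ct0 * \<psi> w powr \<rho>0"
    using \<psi>_growth_const f0_growth_const by (intro mult_left_mono) (simp_all add: powr_mult powr_powr)
   then have "c0' * (ct0 * (ct1 powr \<rho>0 * norm w powr (\<rho>1 * \<rho>0))) \<le> c0' * f0 (\<psi> w)"
    using elim(2) c0'_pos by (intro mult_left_mono) auto
   then show ?case by (simp add: \<psi>0_def mult.assoc)
  qed
  from growth_integrable[OF \<psi>nn(2) cont(1) _ _ this] show ?thesis
   using that c0'_pos f0_growth_const \<psi>_growth_const unfolding L_def by auto
 qed
 \<comment> \<open>For Schwartz functions the norms in \<open>iii_garding\<close> become integrals
   over the transform, and \<open>B\<close> is the given form. Membership in
   \<open>H_space \<psi>1 1\<close> follows from \<open>pow\<close> with exponent 2.\<close>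
 have garding: "\<gamma> * W.wn 1 (four u) - lambda0 * W.wn 0 (four u)
    \<le> Re (\<integral>x. (kap TYPE(real ^ 'n) * osc (\<lambda>z. P z * four u (snd z)) x x) * cnj (u x))" if u: "sch u" for u
 proof -
  have i0: "L1 (\<lambda>w. (1 + \<psi>0 w) powr 1 * (cmod (four u w))\<^sup>2)"
   using W.wn_integrable[OF sch_four[OF u], of 1] by (simp only: L_def)
  have i1: "L1 (\<lambda>w. (1 + \<psi>1 w) powr 1 * (cmod (four u w))\<^sup>2)"
  proof (rule Bochner_Integration.integrable_bound)
   show "L1 (\<lambda>w. C powr 2 * (L w powr (1 + \<sigma>) * (cmod (four u w))\<^sup>2))"
    by (intro integrable_mult_right W.wn_integrable sch_four u)
   show "(\<lambda>w. (1 + \<psi>1 w) powr 1 * (cmod (four u w))\<^sup>2) \<in> borel_measurable lborel"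
    using borel_measurable_continuous_onI[OF cont(2)] sch_measurable[OF sch_four[OF u]] by simp
   have "(1 + \<psi>1 w) powr 1 * (cmod (four u w))\<^sup>2 \<le> C powr 2 * (L w powr (1 + \<sigma>) * (cmod (four u w))\<^sup>2)" for w
   proof -
    have "(1 + \<psi>1 w) powr 1 \<le> C powr 2 * L w powr (1 + \<sigma>)"
     using pow[of 2 w] nonzero_mult_div_cancel_right[of "2 :: real" "1 + \<sigma>"] by (simp only: div_self zero_neq_numeral simp_thms zero_le_numeral)
    then show ?thesis using mult_right_mono[of _ _ "(cmod (four u w))\<^sup>2"] by (simp only: mult.assoc[symmetric]) simp
   qed
   then show "AE w in lborel. norm ((1 + \<psi>1 w) powr 1 * (cmod (four u w))\<^sup>2) \<le> norm (C powr 2 * (L w powr (1 + \<sigma>) * (cmod (four u w))\<^sup>2))"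
    by (intro AE_I2) (simp only: real_norm_def abs_of_nonneg mult_nonneg_nonneg powr_ge_zero zero_le_power2)
  qed
  have "\<gamma> * (H_norm \<psi>0 1 (distr_of u))\<^sup>2 - lambda0 * (L2_norm (density_of (distr_of u)))\<^sup>2 \<le> Re (B (distr_of u) (distr_of u))"
   by (rule iii_garding[OF H_norm_distr_of(2)[OF u i1]])
  also have "B (distr_of u) (distr_of u) = L2_inner (pseudo_diff (\<lambda>x w. cr (p x w)) u) u"
   using iii_extension u unfolding continuous_form_extension_def by (simp add: schwartz_iff)
  finally show ?thesis
   unfolding H_norm_distr_of(1)[OF u i0] L2_norm_density_of[OF u] L2_inner_def op W.wn_def by (simp add: L_def W.Lneq0[unfolded L_def])
 qed
 \<comment> \<open>Here k0 = 2 + \<tau>1 + \<sigma> (2 + \<tau>1), and \<open>small\<close> with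
   \<tau>0 > 0 keeps it below 3.\<close>
 have k0: "1 \<le> k0" "k0 < 3"
 proof -
  have "k0 = 2 + \<tau>1 + \<sigma> * (2 + \<tau>1)" by (simp add: k0_def algebra_simps)
  moreover have "0 \<le> \<sigma> * (2 + \<tau>1)" using \<sigma> \<tau>1 by simp
  ultimately show "1 \<le> k0" "k0 < 3" using small \<tau>0 \<tau>1 by auto
 qed
 interpret E: pdo L P k0 \<gamma> lambda0 m
  by (intro pdo.intro pdo_axioms.intro W.weight_axioms k0 psm \<gamma> garding m)
 have Pop: "E.Pop u x = pseudo_diff (\<lambda>x w. cr (p x w)) u x" for u x
  unfolding E.Pop_def by (rule op)
 have pmp: "0 \<le> Re (E.Pop u x0)" if u: "sch u" and x0: "0 \<le> Re (u x0)" "\<And>x. Re (u x) \<le> Re (u x0)" for u x0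
 proof -
  define \<kappa>' where "\<kappa>' = (2 * pi) powr (- real DIM(real ^ 'n) / 2)"
  have \<kappa>': "0 < \<kappa>'" "kap TYPE(real ^ 'n) = of_real \<kappa>'" by (simp_all add: \<kappa>'_def kap_def)
  have us: "u x = of_real \<kappa>' * syn (four u) x" for x
  proof -
   have "u x = ifour (four u) x" by (simp only: ifour_four[OF u])
   then show ?thesis by (simp only: ifour_eq syn_def \<kappa>'(2))
  qed
  have ps: "E.Pop u x0 = of_real \<kappa>' * syn (\<lambda>w. of_real (f x0 (q x0 w)) * four u w) x0"
   by (simp add: E.Pop_def osc_def syn_def P_def p_def \<kappa>'(2))
  \<comment> \<open>The value at the maximum point involves only the symbol frozen at
    \<open>x0\<close>, which is the Bernstein function \<open>f x0\<close> of the negative definite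
    function \<open>q x0\<close>; ellipticity makes the latter strictly positive, as
    \<open>bernstein_pmp\<close> requires.\<close>
  have "0 \<le> Re (syn (\<lambda>w. of_real (f x0 (q x0 w)) * four u w) x0)"
  proof (rule bernstein_pmp[OF f_bernstein])
   show "negative_definite (\<lambda>w. cr (q x0 w))" using q_negdef by (simp add: negative_definite_symbol_def)
   obtain d where d: "0 < d" "\<And>x w. d * (1 + \<psi> w) \<le> q x w" using q_elliptic by (auto simp: elliptic_def)
   show "0 < q x0 w" for w
   proof -
    have "0 < d * (1 + \<psi> w)" using d(1) \<psi>nn(1)[of w] by simp
    then show ?thesis using d(2)[of w x0] by linarith
   qed
   show "L1 (four u)" by (rule sch_integrable[OF sch_four[OF u]])
   obtain A M where A: "0 \<le> A" "\<And>w. L w powr (k0 / 2) \<le> A * (1 + norm w) ^ M" using W.Lpowr_poly[of "k0 / 2"] by blast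
   show "L1 (\<lambda>w. of_real (f x0 (q x0 w)) * four u w)"
   proof (rule sch_integrable_poly[OF sch_four[OF u]])
    have "continuous_on UNIV (\<lambda>w. P (x0, w))" by (intro continuous_on_compose2[OF Pc] continuous_intros) auto
    then show "(\<lambda>w. cr (f x0 (q x0 w))) \<in> borel_measurable borel"
     by (intro borel_measurable_continuous_onI) (simp add: P_def p_def)
    show "cmod (cr (f x0 (q x0 w))) \<le> (\<bar>CP\<bar> * A) * (1 + norm w) ^ M" for w
    proof -
     have "cmod (cr (f x0 (q x0 w))) \<le> CP * L w powr (k0 / 2)" using CP[of "(x0, w)"] by (simp add: P_def p_def)
     also have "\<dots> \<le> \<bar>CP\<bar> * (A * (1 + norm w) ^ M)" by (intro mult_mono A) auto
     finally show ?thesis by (simp add: mult.assoc)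
    qed
   qed
   show "0 \<le> Re (u x0) / \<kappa>'" using x0(1) \<kappa>'(1) by simp
   show "Re (syn (four u) x) \<le> Re (u x0) / \<kappa>'" for x using x0(2)[of x] \<kappa>'(1) us[of x] by (simp add: field_simps)
   show "Re (syn (four u) x0) = Re (u x0) / \<kappa>'" using \<kappa>'(1) us[of x0] by simp
  qed
  then show ?thesis unfolding ps using \<kappa>'(1) by simp
 qed
 have "feller_pdo L P k0 \<gamma> lambda0 m"
  by (rule feller_pdo.intro[OF E.pdo_axioms feller_pdo_axioms.intro]) (rule pmp)
 from feller_pdo_feller[OF this] show ?thesis by (auto simp: schwartz_iff Pop subset_iff)
qed

end
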